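(* The twisted virtual braid group $TVB_n$ has a presentation with generators $\sigma_1,\gamma_1,v_1,\dots,v_{n-1}$ and the following defining relations, where $e$ is the identity element: \begin{align*} v_i^2&=e && i=1,\dots,n-1;\\ v_iv_j&=v_jv_i && |i-j|>1;\\ v_iv_{i+1}v_i&=v_{i+1}v_iv_{i+1} && i=1,\dots,n-2;\\ \sigma_1(v_2v_3v_1v_2\sigma_1v_2v_1v_3v_2)&=(v_2v_3v_1v_2\sigma_1v_2v_1v_3v_2)\sigma_1;\\ (v_1\sigma_1v_1)(v_2\sigma_1v_2)(v_1\sigma_1v_1)&=(v_2\sigma_1v_2)(v_1\sigma_1v_1)(v_2\sigma_1v_2);\\ \sigma_1v_j&=v_j\sigma_1 && j=3,\dots,n-1;\\ \gamma_1^2&=e;\\ \gamma_1v_j&=v_j\gamma_1 && j=2,\dots,n-1;\\ \gamma_1v_1\gamma_1v_1&=v_1\gamma_1v_1\gamma_1;\\ \gamma_1v_1v_2\sigma_1v_2v_1&=v_1v_2\sigma_1v_2v_1\gamma_1;\\ \gamma_1v_1\gamma_1\sigma_1\gamma_1v_1\gamma_1&=\sigma_1. \end{align*}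
   Context: **Convention for small $n$.** Generators $\sigma_1$, $v_j$ exist only when $1\le n-1$, $j\le n-1$ respectively; generators and relations involving symbols with index out of range are omitted. **Twisted virtual braid diagrams.** Let $n\ge1$ and $E=[0,n+1]\times[0,1]$ with second projection $p_2:E\to[0,1]$. A twisted virtual braid diagram of degree $n$ is an immersed 1-manifold $b=a_1\cup\dots\cup a_n$ in $E$, where the $a_i$ are embedded arcs (strands), possibly with bars (short arcs intersecting the strands transversely), such that: (1) $\partial b=\{1,\dots,n\}\times\{0,1\}$; (2) each $p_2|_{a_i}:a_i\to[0,1]$ is a homeomorphism; (3) the multiple points of the strands are transverse double points, called crossings; (4) each crossing is equipped with the information of being a positive (real), negative (real) or virtual crossing; (5) bars avoid the crossings. Strands are oriented from height $1$ to height $0$. **Extended Reidemeister moves** (local moves): the Reidemeister moves R1 (create/delete a kink with one real crossing), R2 (create/delete a bigon with two real crossings, one strand over at both), R3 (usual triangle move on three real crossings); the virtual moves V1, V2, V3 (the analogues of R1, R2, R3 with all crossings virtual) and V4 (an arc meeting two other strands only in virtual crossings is moved across a real crossing of these two strands); the twisted moves T1 (a bar slides along its strand through a virtual crossing), T2 (two adjacent bars on the same arc are created/deleted), T3 (a real crossing with one bar on each of its four incident edges is replaced by the same real crossing without bars but with one virtual crossing of the two strands inserted just above and one just below it, or conversely; in braid form $\gamma_{i+1}\gamma_i\sigma_i^{\pm1}\gamma_i\gamma_{i+1}\leftrightarrow v_i\sigma_i^{\pm1}v_i$). **The group.** Two twisted virtual braid diagrams of degree $n$ are equivalent if they are related by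 a finite sequence of twisted virtual braid diagrams of degree $n$ in which each one is obtained from the preceding one by an isotopy of $E$ keeping (1)–(5), or by an extended Reidemeister move. $TVB_n$ is the group of equivalence classes (twisted virtual braids); the product $bb'$ is given by placing $b$ on top of $b'$. **Generators.** $\sigma_i$ (resp. $\sigma_i^{-1}$, $v_i$), $1\le i\le n-1$, is represented by the diagram without bars having exactly one crossing, between the strands in positions $i$ and $i+1$, which is positive (resp. negative, virtual), all other strands being vertical. $\gamma_i$, $1\le i\le n$, is represented by $n$ vertical strands with exactly one bar, on the $i$-th strand. *)

theory Defs
  imports "HOL-Analysis.Analysis" "HOL-Algebra.Group"
begin

section \<open>Twisted virtual braid diagrams\<close>

text \<open>
  Diagrams are taken in the topological category. A point of the plane is a pair
  (horizontal coordinate, height). A bar is recorded by the point where it meets its strand.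
  Crossings and bars are recorded as sets of points of the plane, so that a map of the plane acts
  on a whole diagram by taking images. The sign of a crossing refers to strands oriented downwards;
  it is unchanged by any map isotopic to the identity.
\<close>

type_synonym point = "real \<times> real"

datatype kind = Pos | Neg | Virt

record diagram =
  strands :: "point set set"
  crossings :: "kind \<Rightarrow> point set"
  bars :: "point set"

definition E :: "nat \<Rightarrow> point set" where
  "E n = {0..real n + 1} \<times> {0..1}"

text \<open>
  Two arcs that project homeomorphically to the height axis cross transversely at \<open>p\<close> if \<open>p\<close> is an
  isolated common point at which they pass to the other side of each other.
\<close>

definition transverse_at :: "point set \<Rightarrow> point set \<Rightarrow> point \<Rightarrow> bool" where
  "transverse_at a a' p \<longleftrightarrow> p \<in> a \<inter> a' \<and>
     (\<exists>e>0. \<forall>s. 0 < s \<and> s < e \<longrightarrow>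
        (\<forall>x x' y y'. (x, snd p - s) \<in> a \<and> (x', snd p - s) \<in> a' \<and>
                     (y, snd p + s) \<in> a \<and> (y', snd p + s) \<in> a'
            \<longrightarrow> (x - x') * (y - y') < 0))"

definition multiple_points :: "diagram \<Rightarrow> point set" where
  "multiple_points b = {p. \<exists>a\<in>strands b. \<exists>a'\<in>strands b. a \<noteq> a' \<and> p \<in> a \<and> p \<in> a'}"

text \<open>
  The diagram is properly immersed: besides having its \<open>2n\<close> end points at the prescribed places, it
  does not touch the boundary of the rectangle anywhere else. Since each of the \<open>n\<close> strands has
  exactly one point at height \<open>0\<close> and one at height \<open>1\<close>, the third condition below says both things.
\<close>

definition is_diagram :: "nat \<Rightarrow> diagram \<Rightarrow> bool" where
  "is_diagram n b \<longleftrightarrow>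
     finite (strands b) \<and> card (strands b) = n \<and>
     (\<forall>a\<in>strands b. a \<subseteq> E n \<and> (\<exists>g. homeomorphism a {0..1} snd g)) \<and>
     \<Union>(strands b) \<inter> frontier (E n) = (real ` {1..n}) \<times> {0, 1} \<and>
     (\<forall>p. card {a \<in> strands b. p \<in> a} \<le> 2) \<and>
     (\<forall>a\<in>strands b. \<forall>a'\<in>strands b. \<forall>p. a \<noteq> a' \<and> p \<in> a \<and> p \<in> a' \<longrightarrow> transverse_at a a' p) \<and>
     (\<Union>k. crossings b k) = multiple_points b \<and>
     (\<forall>k k'. k \<noteq> k' \<longrightarrow> crossings b k \<inter> crossings b k' = {}) \<and>
     finite (bars b) \<and>
     bars b \<subseteq> \<Union>(strands b) - multiple_points b - frontier (E n)"

definition map_diagram :: "(point \<Rightarrow> point) \<Rightarrow> diagram \<Rightarrow> diagram" where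
  "map_diagram f b =
     \<lparr>strands = (\<lambda>a. f ` a) ` strands b,
      crossings = (\<lambda>k. f ` crossings b k),
      bars = f ` bars b\<rparr>"

definition isotopic :: "nat \<Rightarrow> diagram \<Rightarrow> diagram \<Rightarrow> bool" where
  "isotopic n b b' \<longleftrightarrow> is_diagram n b \<and>
     (\<exists>h. homotopic_with_canon
            (\<lambda>f. (\<exists>g. homeomorphism (E n) (E n) f g) \<and> is_diagram n (map_diagram f b))
            (E n) (E n) id h \<and>
          b' = map_diagram h b)"


section \<open>Elementary diagrams and stacking\<close>

definition vertical_strand :: "nat \<Rightarrow> point set" where
  "vertical_strand j = closed_segment (real j, 0) (real j, 1)"

definition id_diagram :: "nat \<Rightarrow> diagram" where
  "id_diagram n =
     \<lparr>strands = vertical_strand ` {1..n}, crossings = (\<lambda>_. {}), bars = {}\<rparr>"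

definition crossing_diagram :: "nat \<Rightarrow> kind \<Rightarrow> nat \<Rightarrow> diagram" where
  "crossing_diagram n k i =
     \<lparr>strands = vertical_strand ` ({1..n} - {i, i + 1})
                \<union> {closed_segment (real i, 1) (real i + 1, 0),
                   closed_segment (real i + 1, 1) (real i, 0)},
      crossings = (\<lambda>k'. if k' = k then {(real i + 1/2, 1/2)} else {}),
      bars = {}\<rparr>"

definition bar_diagram :: "nat \<Rightarrow> nat \<Rightarrow> diagram" where
  "bar_diagram n i = (id_diagram n)\<lparr>bars := {(real i, 1/2)}\<rparr>"

definition upper :: "point \<Rightarrow> point" where
  "upper p = (fst p, (1 + snd p) / 2)"

definition lower :: "point \<Rightarrow> point" where
  "lower p = (fst p, snd p / 2)"

text \<open>\<open>stack b b'\<close> is \<open>b\<close> placed on top of \<open>b'\<close>.\<close>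

definition stack :: "diagram \<Rightarrow> diagram \<Rightarrow> diagram" where
  "stack b b' =
     \<lparr>strands = {upper ` a \<union> lower ` a' | a a'.
                   a \<in> strands b \<and> a' \<in> strands b' \<and> upper ` a \<inter> lower ` a' \<noteq> {}},
      crossings = (\<lambda>k. upper ` crossings b k \<union> lower ` crossings b' k),
      bars = upper ` bars b \<union> lower ` bars b'\<rparr>"

datatype letter = Cr kind nat | Bar nat

fun letter_diagram :: "nat \<Rightarrow> letter \<Rightarrow> diagram" where
  "letter_diagram n (Cr k i) = crossing_diagram n k i"
| "letter_diagram n (Bar i) = bar_diagram n i"

definition word_diagram :: "nat \<Rightarrow> letter list \<Rightarrow> diagram" where
  "word_diagram n w = foldr (\<lambda>l b. stack (letter_diagram n l) b) w (id_diagram n)"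


section \<open>Extended Reidemeister moves\<close>

text \<open>
  \<open>local_picture m l r\<close> lists the two sides of each move as pictures on \<open>m\<close> strands, read from top to
  bottom. The moves R1 and V1 do not occur: a kink is a strand crossing itself, and no diagram in
  which all strands are embedded and monotone contains one.

  In the triangle moves, \<open>a\<close>, \<open>b\<close>, \<open>c\<close> are the kinds of the crossings of strands 1 and 2, 1 and 3,
  2 and 3, numbered at the top. For R3 the two sign patterns with \<open>a = c \<noteq> b\<close> are excluded: in these
  each strand is over one of the other two and under the other one, so no strand can be
  moved across. In V4 the two virtual crossings lie on a common strand, which may be any
  of the three.
\<close>

inductive local_picture :: "nat \<Rightarrow> letter list \<Rightarrow> letter list \<Rightarrow> bool" where
  R2_pos_neg: "local_picture 2 [Cr Pos 1, Cr Neg 1] []"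
| R2_neg_pos: "local_picture 2 [Cr Neg 1, Cr Pos 1] []"
| R3: "\<lbrakk>a \<noteq> Virt; b \<noteq> Virt; c \<noteq> Virt; \<not> (a = c \<and> a \<noteq> b)\<rbrakk>
       \<Longrightarrow> local_picture 3 [Cr a 1, Cr b 2, Cr c 1] [Cr c 2, Cr b 1, Cr a 2]"
| V2: "local_picture 2 [Cr Virt 1, Cr Virt 1] []"
| V3: "local_picture 3 [Cr Virt 1, Cr Virt 2, Cr Virt 1] [Cr Virt 2, Cr Virt 1, Cr Virt 2]"
| V4_strand3: "a \<noteq> Virt \<Longrightarrow>
       local_picture 3 [Cr a 1, Cr Virt 2, Cr Virt 1] [Cr Virt 2, Cr Virt 1, Cr a 2]"
| V4_strand2: "b \<noteq> Virt \<Longrightarrow>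
       local_picture 3 [Cr Virt 1, Cr b 2, Cr Virt 1] [Cr Virt 2, Cr b 1, Cr Virt 2]"
| V4_strand1: "c \<noteq> Virt \<Longrightarrow>
       local_picture 3 [Cr Virt 1, Cr Virt 2, Cr c 1] [Cr c 2, Cr Virt 1, Cr Virt 2]"
| T1_left: "local_picture 2 [Bar 1, Cr Virt 1] [Cr Virt 1, Bar 2]"
| T1_right: "local_picture 2 [Bar 2, Cr Virt 1] [Cr Virt 1, Bar 1]"
| T2: "local_picture 1 [Bar 1, Bar 1] []"
| T3: "k \<noteq> Virt \<Longrightarrow>
       local_picture 2 [Bar 2, Bar 1, Cr k 1, Bar 1, Bar 2] [Cr Virt 1, Cr k 1, Cr Virt 1]"

definition restrict_diagram :: "point set \<Rightarrow> diagram \<Rightarrow> diagram" where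
  "restrict_diagram D b =
     \<lparr>strands = (\<lambda>a. a \<inter> D) ` strands b - {{}},
      crossings = (\<lambda>k. crossings b k \<inter> D),
      bars = bars b \<inter> D\<rparr>"

text \<open>
  A move replaces the picture in a rectangular box, parallel to the axes, leaving the
  exterior unchanged. Both pictures are allowed up to isotopy inside the box; as
  isotopies of the whole diagram are available too, differently shaped disks give nothing new.
\<close>

definition reidemeister_move :: "nat \<Rightarrow> diagram \<Rightarrow> diagram \<Rightarrow> bool" where
  "reidemeister_move n b b' \<longleftrightarrow> is_diagram n b \<and> is_diagram n b' \<and>
     (\<exists>m l r L R c d \<alpha> \<beta>.
        local_picture m l r \<and>
        isotopic m (word_diagram m l) L \<and> isotopic m (word_diagram m r) R \<and>
        \<alpha> > 0 \<and> \<beta> > 0 \<and>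
        (let \<phi> = (\<lambda>p. (c + \<alpha> * fst p, d + \<beta> * snd p)); D = \<phi> ` E m in
           D \<subseteq> E n \<and>
           restrict_diagram D b = map_diagram \<phi> L \<and>
           restrict_diagram D b' = map_diagram \<phi> R \<and>
           restrict_diagram (- D) b = restrict_diagram (- D) b'))"


section \<open>The twisted virtual braid group\<close>

definition diagram_step :: "nat \<Rightarrow> diagram \<Rightarrow> diagram \<Rightarrow> bool" where
  "diagram_step n b b' \<longleftrightarrow>
     isotopic n b b' \<or> reidemeister_move n b b' \<or> reidemeister_move n b' b"

definition diagram_equiv :: "nat \<Rightarrow> (diagram \<times> diagram) set" where
  "diagram_equiv n =
     {(b, b'). is_diagram n b \<and> is_diagram n b' \<and> (diagram_step n)\<^sup>*\<^sup>* b b'}"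

definition TVB :: "nat \<Rightarrow> diagram set monoid" where
  "TVB n =
     \<lparr>carrier = {b. is_diagram n b} // diagram_equiv n,
      mult = (\<lambda>A B. \<Union>b\<in>A. \<Union>b'\<in>B. diagram_equiv n `` {stack b b'}),
      one = diagram_equiv n `` {id_diagram n}\<rparr>"


section \<open>Group presentations\<close>

text \<open>
  Words in the symbols \<open>X\<close> and their inverses; the letter \<open>(x, True)\<close> stands for \<open>x\<close> and
  \<open>(x, False)\<close> for its inverse. A relation \<open>u = v\<close> is the pair \<open>(u, v)\<close>.
\<close>

type_synonym 'x word = "('x \<times> bool) list"

definition words :: "'x set \<Rightarrow> 'x word set" where
  "words X = lists (X \<times> UNIV)"

inductive_set word_cong :: "'x set \<Rightarrow> ('x word \<times> 'x word) set \<Rightarrow> ('x word \<times> 'x word) set"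
  for X R where
  refl: "w \<in> words X \<Longrightarrow> (w, w) \<in> word_cong X R"
| sym: "(u, v) \<in> word_cong X R \<Longrightarrow> (v, u) \<in> word_cong X R"
| trans: "\<lbrakk>(u, v) \<in> word_cong X R; (v, w) \<in> word_cong X R\<rbrakk> \<Longrightarrow> (u, w) \<in> word_cong X R"
| cancel: "\<lbrakk>p \<in> words X; q \<in> words X; x \<in> X\<rbrakk>
           \<Longrightarrow> (p @ [(x, e), (x, \<not> e)] @ q, p @ q) \<in> word_cong X R"
| relation: "\<lbrakk>p \<in> words X; q \<in> words X; u \<in> words X; v \<in> words X; (u, v) \<in> R\<rbrakk>
             \<Longrightarrow> (p @ u @ q, p @ v @ q) \<in> word_cong X R"

definition presented_group :: "'x set \<Rightarrow> ('x word \<times> 'x word) set \<Rightarrow> 'x word set monoid" where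
  "presented_group X R =
     \<lparr>carrier = words X // word_cong X R,
      mult = (\<lambda>A B. \<Union>u\<in>A. \<Union>v\<in>B. word_cong X R `` {u @ v}),
      one = word_cong X R `` {[]}\<rparr>"

definition has_presentation ::
  "('a, 'm) monoid_scheme \<Rightarrow> 'x set \<Rightarrow> ('x word \<times> 'x word) set \<Rightarrow> ('x \<Rightarrow> 'a) \<Rightarrow> bool" where
  "has_presentation G X R \<iota> \<longleftrightarrow> group G \<and> \<iota> ` X \<subseteq> carrier G \<and>
     (\<exists>h \<in> iso (presented_group X R) G. \<forall>x\<in>X. h (word_cong X R `` {[(x, True)]}) = \<iota> x)"


section \<open>Reduced generators and relations\<close>

datatype gen = Sigma1 | Gamma1 | V nat

definition tvb_generators :: "nat \<Rightarrow> gen set" where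
  "tvb_generators n = {Gamma1} \<union> (if n \<ge> 2 then {Sigma1} else {}) \<union> V ` {1..n - 1}"

fun gen_diagram :: "nat \<Rightarrow> gen \<Rightarrow> diagram" where
  "gen_diagram n Sigma1 = crossing_diagram n Pos 1"
| "gen_diagram n Gamma1 = bar_diagram n 1"
| "gen_diagram n (V i) = crossing_diagram n Virt i"

definition gen_class :: "nat \<Rightarrow> gen \<Rightarrow> diagram set" where
  "gen_class n x = diagram_equiv n `` {gen_diagram n x}"

abbreviation \<sigma>1 :: "gen \<times> bool" where "\<sigma>1 \<equiv> (Sigma1, True)"
abbreviation \<gamma>1 :: "gen \<times> bool" where "\<gamma>1 \<equiv> (Gamma1, True)"
abbreviation \<nu> :: "nat \<Rightarrow> gen \<times> bool" where "\<nu> i \<equiv> (V i, True)"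

text \<open>
  The relations for all indices, without upper bound; those involving a symbol that
  does not exist in degree \<open>n\<close> are then omitted.
\<close>

definition all_relations :: "(gen word \<times> gen word) set" where
  "all_relations =
     {([\<nu> i, \<nu> i], []) | i. True}
   \<union> {([\<nu> i, \<nu> j], [\<nu> j, \<nu> i]) | i j. \<bar>int i - int j\<bar> > 1}
   \<union> {([\<nu> i, \<nu> (i + 1), \<nu> i], [\<nu> (i + 1), \<nu> i, \<nu> (i + 1)]) | i. True}
   \<union> {([\<sigma>1] @ [\<nu> 2, \<nu> 3, \<nu> 1, \<nu> 2, \<sigma>1, \<nu> 2, \<nu> 1, \<nu> 3, \<nu> 2],
       [\<nu> 2, \<nu> 3, \<nu> 1, \<nu> 2, \<sigma>1, \<nu> 2, \<nu> 1, \<nu> 3, \<nu> 2] @ [\<sigma>1])}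
   \<union> {([\<nu> 1, \<sigma>1, \<nu> 1] @ [\<nu> 2, \<sigma>1, \<nu> 2] @ [\<nu> 1, \<sigma>1, \<nu> 1],
       [\<nu> 2, \<sigma>1, \<nu> 2] @ [\<nu> 1, \<sigma>1, \<nu> 1] @ [\<nu> 2, \<sigma>1, \<nu> 2])}
   \<union> {([\<sigma>1, \<nu> j], [\<nu> j, \<sigma>1]) | j. j \<ge> 3}
   \<union> {([\<gamma>1, \<gamma>1], [])}
   \<union> {([\<gamma>1, \<nu> j], [\<nu> j, \<gamma>1]) | j. j \<ge> 2}
   \<union> {([\<gamma>1, \<nu> 1, \<gamma>1, \<nu> 1], [\<nu> 1, \<gamma>1, \<nu> 1, \<gamma>1])}
   \<union> {([\<gamma>1, \<nu> 1, \<nu> 2, \<sigma>1, \<nu> 2, \<nu> 1], [\<nu> 1, \<nu> 2, \<sigma>1, \<nu> 2, \<nu> 1, \<gamma>1])}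
   \<union> {([\<gamma>1, \<nu> 1, \<gamma>1, \<sigma>1, \<gamma>1, \<nu> 1, \<gamma>1], [\<sigma>1])}"

definition tvb_relations :: "nat \<Rightarrow> (gen word \<times> gen word) set" where
  "tvb_relations n =
     all_relations \<inter> (words (tvb_generators n) \<times> words (tvb_generators n))"

end

theory Submission
  imports Defs
begin

text \<open>A diagram is determined up to isotopy by very little: list its crossings and bars from top to
bottom, and for each of them record its kind and its position, that is, one plus the number of strands
to its left. The proof turns this remark into an algebraic description of \<open>TVB n\<close> and
then solves the remaining, purely algebraic, problem.

\<^bold>\<open>From diagrams to words.\<close> The strand that starts at the top in position \<open>i\<close> is the graph of a function
\<open>f i\<close> of the height, so a diagram becomes a family of functions (\<open>dg\<close>). The set \<open>data b\<close> of pairs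
(letter, height) of the events of \<open>b\<close> determines \<open>b\<close> up to an isotopy that moves points
horizontally (\<open>isotopic_if_same_data\<close>): the data determine at each height in which order the strands
occur, and two families of functions with the same order can be interpolated. Isotopies that move points
vertically allow one to separate simultaneous events, in either order, and to change the heights. Hence each
diagram that reads \<open>w\<close> from top to bottom is isotopic to \<open>word_diagram n w\<close> (\<open>isotopic_word_diagram\<close>).

\<^bold>\<open>The congruence.\<close> Let \<open>lcong n\<close> be the congruence on words in all the letters \<open>Cr k i\<close>, \<open>Bar i\<close> that is generated
by the exchange of letters acting on disjoint sets of positions and by the local pictures, shifted to the
right. Two diagrams are equivalent exactly when the words that they read are congruent:

\<^item> An isotopy between two word diagrams carries the \<open>i\<close>-th strand to the \<open>i\<close>-th strand and preserves the order of
the events along it. By the usual normal form argument for partially commutative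
monoids, two words with the same sequence of events on every strand differ by exchanges
(\<open>lcong_if_isotopic\<close>).

\<^item> A Reidemeister move replaces a factor of the word: events beside the box at the height of the box act on other
positions than the box, so they can be moved past it (\<open>reidemeister_words\<close>).

\<^item> Conversely, an exchange is an isotopy through a diagram with two simultaneous events, and a local picture
becomes a genuine move after the strands that take part in it have been squeezed together, so that a
rectangular box contains these strands and no others (\<open>lcong_equiv\<close>).

\<^bold>\<open>The algebra.\<close> It remains to compare \<open>lcong n\<close> with the reduced presentation. The local pictures express
\<open>Cr k (i + 1)\<close> and \<open>Bar (i + 1)\<close> through \<open>Cr k i\<close>, \<open>Bar i\<close> and virtual crossings, so the reduced generators
suffice, and each reduced relation says that two letters commute, or is a local picture in disguise
(\<open>reduced_relation\<close>). In the other direction, in any monoid with elements satisfying the reduced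
relations the remaining letters are defined by these recursions, and conjugation by virtual crossings carries each
of the reduced relations to all positions (\<open>evs_lcong\<close>). Both comparisons are made in monoids of
self-maps, in which a word stands for left multiplication by it, so that one can compute with equations instead of congruences.\<close>

section \<open>Diagrams as families of functions\<close>

definition curve :: "(real => real) => point set" where
 "curve g = (%t. (g t, t)) ` {0..1}"

definition passes :: "(real => real) => (real => real) => real => bool" where
 "passes g g' t \<longleftrightarrow> (\<exists>e>0. e <= t & e <= 1 - t &
   (\<forall>s. 0 < s & s < e --> (g (t - s) - g' (t - s)) * (g (t + s) - g' (t + s)) < 0))"

text \<open>The functions \<open>f i\<close>, \<open>i = 1..n\<close>, of the height whose graphs are the strands of a diagram; the label of a strand
is its top position.\<close>

definition config :: "nat => (nat => real => real) => bool" where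
 "config n f \<longleftrightarrow>
   (\<forall>i\<in>{1..n}. continuous_on {0..1} (f i) & f i 1 = real i & f i 0 \<in> real ` {1..n} &
    (\<forall>t\<in>{0..1}. 0 < f i t & f i t < real n + 1)) &
   inj_on (%i. f i 0) {1..n} &
   (\<forall>i\<in>{1..n}. \<forall>j\<in>{1..n}. \<forall>k\<in>{1..n}. \<forall>t\<in>{0..1}.
    f i t = f j t & f j t = f k t --> i = j \<or> j = k \<or> i = k) &
   (\<forall>i\<in>{1..n}. \<forall>j\<in>{1..n}. \<forall>t\<in>{0<..<1}. i ~= j & f i t = f j t --> passes (f i) (f j) t)"

definition meets :: "nat => (nat => real => real) => point set" where
 "meets n f = {(f i t, t) | i j t. i \<in> {1..n} & j \<in> {1..n} & i ~= j & t \<in> {0..1} & f i t = f j t}"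

text \<open>\<open>dg n b f\<close> says that \<open>b\<close> is a diagram whose strands are the graphs of the \<open>f i\<close>. All later arguments use this
description instead of \<open>is_diagram\<close>.\<close>

definition dg :: "nat => diagram => (nat => real => real) => bool" where
 "dg n b f \<longleftrightarrow> config n f & strands b = (%i. curve (f i)) ` {1..n} &
   (\<Union>k. crossings b k) = meets n f &
   (\<forall>k k'. k ~= k' --> crossings b k \<inter> crossings b k' = {}) &
   finite (bars b) &
   bars b \<subseteq> (\<Union>i\<in>{1..n}. curve (f i)) - meets n f - UNIV \<times> {0, 1}"

lemma mem_curve: "(x, t) \<in> curve g \<longleftrightarrow> t \<in> {0..1} & x = g t"
 by (auto simp: curve_def)

lemma configD:
 assumes "config n f" "i \<in> {1..n}"
 shows "continuous_on {0..1} (f i)" "f i 1 = real i" "f i 0 \<in> real ` {1..n}"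
  "t \<in> {0..1} ==> 0 < f i t" "t \<in> {0..1} ==> f i t < real n + 1"
 using assms by (auto simp: config_def)

lemma config_two:
 assumes "config n f" "i \<in> {1..n}" "j \<in> {1..n}" "k \<in> {1..n}" "t \<in> {0..1}"
  "f i t = f j t" "f j t = f k t"
 shows "i = j \<or> j = k \<or> i = k"
 using assms unfolding config_def by blast

lemma config_passes:
 assumes "config n f" "i \<in> {1..n}" "j \<in> {1..n}" "i ~= j" "t \<in> {0<..<1}" "f i t = f j t"
 shows "passes (f i) (f j) t"
 using assms unfolding config_def by blast

lemma config_bottom_inj:
 assumes "config n f" "i \<in> {1..n}" "j \<in> {1..n}" "f i 0 = f j 0"
 shows "i = j"
 using assms unfolding config_def inj_on_def by blast

lemma config_meet_height:
 assumes "config n f" "i \<in> {1..n}" "j \<in> {1..n}" "i ~= j" "t \<in> {0..1}" "f i t = f j t"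
 shows "t \<in> {0<..<1}"
proof -
 have "t ~= 0" using config_bottom_inj[OF assms(1-3)] assms by auto
 moreover have "t ~= 1" using configD(2)[OF assms(1)] assms by auto
 ultimately show ?thesis using assms(5) by auto
qed

lemma frontier_E: "frontier (E n) = {p \<in> E n. fst p = 0 \<or> fst p = real n + 1 \<or> snd p = 0 \<or> snd p = 1}"
proof -
 have c: "closed (E n)" unfolding E_def by (intro closed_Times closed_real_atLeastAtMost)
 have i: "interior (E n) = {0<..<real n + 1} \<times> {0<..<1}"
  unfolding E_def interior_Times interior_atLeastAtMost_real ..
 have "frontier (E n) = closure (E n) - interior (E n)" by (rule frontier_def)
 hence f: "frontier (E n) = E n - {0<..<real n + 1} \<times> {0<..<1}"
  using i closure_closed[OF c] by metis
 show ?thesis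
 proof (intro equalityI subsetI)
  fix p assume "p \<in> frontier (E n)"
  thus "p \<in> {p \<in> E n. fst p = 0 \<or> fst p = real n + 1 \<or> snd p = 0 \<or> snd p = 1}"
   unfolding f by (cases p) (simp add: E_def, argo)
 next
  fix p assume "p \<in> {p \<in> E n. fst p = 0 \<or> fst p = real n + 1 \<or> snd p = 0 \<or> snd p = 1}"
  thus "p \<in> frontier (E n)" unfolding f by (cases p) auto
 qed
qed

text \<open>For graphs, an isolated transverse intersection is a change of sign of the difference.\<close>

lemma transverse_at_curve:
 assumes t: "t \<in> {0<..<1}" and eq: "g t = g' t"
 shows "transverse_at (curve g) (curve g') (g t, t) \<longleftrightarrow> passes g g' t"
proof
 assume "transverse_at (curve g) (curve g') (g t, t)"
 then obtain e where e: "e > 0" and *: "\<And>s x x' y y'. 0 < s ==> s < e ==>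
   (x, t - s) \<in> curve g ==> (x', t - s) \<in> curve g' ==> (y, t + s) \<in> curve g ==>
   (y', t + s) \<in> curve g' ==> (x - x') * (y - y') < 0"
  unfolding transverse_at_def by fastforce
 show "passes g g' t"
  unfolding passes_def
 proof (intro exI conjI allI impI)
  show "0 < min e (min t (1 - t))" using e t by auto
  fix s assume s: "0 < s & s < min e (min t (1 - t))"
  show "(g (t - s) - g' (t - s)) * (g (t + s) - g' (t + s)) < 0"
   by (rule *[of s]) (use s in \<open>auto simp: mem_curve\<close>)
 qed auto
next
 assume "passes g g' t"
 then obtain e where e: "e > 0" "e <= t" "e <= 1 - t" and
  *: "\<And>s. 0 < s ==> s < e ==> (g (t - s) - g' (t - s)) * (g (t + s) - g' (t + s)) < 0"
  unfolding passes_def by blast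
 show "transverse_at (curve g) (curve g') (g t, t)"
  unfolding transverse_at_def
 proof (intro conjI exI[of _ e] allI impI)
  show "(g t, t) \<in> curve g \<inter> curve g'" using t eq by (auto simp: mem_curve)
  show "0 < e" by fact
  fix s x x' y y'
  assume s: "0 < s & s < e"
   and m: "(x, snd (g t, t) - s) \<in> curve g & (x', snd (g t, t) - s) \<in> curve g' &
     (y, snd (g t, t) + s) \<in> curve g & (y', snd (g t, t) + s) \<in> curve g'"
  hence "x = g (t - s)" "x' = g' (t - s)" "y = g (t + s)" "y' = g' (t + s)"
   by (auto simp: mem_curve)
  thus "(x - x') * (y - y') < 0" using *[of s] s by simp
 qed
qed

lemma curve_inj:
 assumes "curve g = curve g'" "t \<in> {0..1}" shows "g t = g' t"
proof -
 have "(g t, t) \<in> curve g'" using assms mem_curve[of "g t" t g] by simp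
 thus ?thesis by (simp add: mem_curve)
qed

lemma config_curve_inj: "config n f ==> inj_on (%i. curve (f i)) {1..n}"
proof (rule inj_onI)
 fix i j assume c: "config n f" and ij: "i \<in> {1..n}" "j \<in> {1..n}" and eq: "curve (f i) = curve (f j)"
 have "f i 1 = f j 1" using curve_inj[OF eq, of 1] by simp
 thus "i = j" using configD(2)[OF c ij(1)] configD(2)[OF c ij(2)] by simp
qed

lemma homeomorphism_curve:
 assumes "continuous_on {0..1} g"
 shows "homeomorphism (curve g) {0..1} snd (%t. (g t, t))"
 using assms by (auto simp: homeomorphism_def curve_def image_image intro!: continuous_intros)

text \<open>The bottom end points are \<open>n\<close> different elements of a set with \<open>n\<close> elements.\<close>

lemma config_bottom_surj:
 assumes "config n f" shows "(%i. f i 0) ` {1..n} = real ` {1..n}"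
proof (rule card_subset_eq)
 show "(%i. f i 0) ` {1..n} \<subseteq> real ` {1..n}" using configD(3)[OF assms] by blast
 show "card ((%i. f i 0) ` {1..n}) = card (real ` {1..n})"
 proof -
  have "inj_on (%i. f i 0) {1..n}" using assms unfolding config_def by blast
  hence "card ((%i. f i 0) ` {1..n}) = n" by (simp add: card_image)
  moreover have "card (real ` {1..n}) = n" by (simp add: card_image)
  ultimately show ?thesis by (simp only:)
 qed
qed auto

lemma multiple_points_curves:
 assumes c: "config n f" and s: "strands b = (%i. curve (f i)) ` {1..n}"
 shows "multiple_points b = meets n f"
proof (intro equalityI subsetI)
 fix p assume "p \<in> multiple_points b"
 then obtain i j where ij: "i \<in> {1..n}" "j \<in> {1..n}" "curve (f i) ~= curve (f j)"
  and p: "p \<in> curve (f i)" "p \<in> curve (f j)"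
  unfolding multiple_points_def s by blast
 from p obtain t where "p = (f i t, t)" "t \<in> {0..1}" "f i t = f j t" by (auto simp: curve_def)
 thus "p \<in> meets n f" using ij unfolding meets_def by blast
next
 fix p assume "p \<in> meets n f"
 then obtain i j t where ij: "i \<in> {1..n}" "j \<in> {1..n}" "i ~= j"
  and p: "p = (f i t, t)" "t \<in> {0..1}" "f i t = f j t" unfolding meets_def by blast
 have "curve (f i) ~= curve (f j)" using config_curve_inj[OF c] ij by (meson inj_on_def)
 moreover have "p \<in> curve (f i)" "p \<in> curve (f j)" using p by (simp_all add: mem_curve)
 ultimately show "p \<in> multiple_points b" unfolding multiple_points_def s using ij by blast
qed

lemma dg_is_diagram:
 assumes "dg n b f" shows "is_diagram n b"
proof -
 have c: "config n f" and s: "strands b = (%i. curve (f i)) ` {1..n}"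
  and cr: "(\<Union>k. crossings b k) = meets n f"
  and br: "bars b \<subseteq> (\<Union>i\<in>{1..n}. curve (f i)) - meets n f - UNIV \<times> {0, 1}"
  using assms by (auto simp: dg_def)
 have mm: "multiple_points b = meets n f" by (rule multiple_points_curves[OF c s])
 have inside: "fst p \<in> {0<..<real n + 1} & snd p \<in> {0..1}" if "p \<in> curve (f i)" "i \<in> {1..n}" for p i
  using that configD(4,5)[OF c that(2)] by (auto simp: curve_def)
 have fr: "\<Union>(strands b) \<inter> frontier (E n) = (real ` {1..n}) \<times> {0, 1}"
 proof (intro equalityI subsetI)
  fix p assume "p \<in> \<Union>(strands b) \<inter> frontier (E n)"
  then obtain i where i: "i \<in> {1..n}" "p \<in> curve (f i)" and fp: "p \<in> frontier (E n)" by (auto simp: s)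
  obtain t where t: "p = (f i t, t)" "t \<in> {0..1}" using i by (auto simp: curve_def)
  have "t = 0 \<or> t = 1" using inside[OF i(2,1)] fp t by (auto simp: frontier_E)
  thus "p \<in> (real ` {1..n}) \<times> {0, 1}" using t configD(2,3)[OF c i(1)] i(1) by auto
 next
  fix p assume p: "p \<in> (real ` {1..n}) \<times> {0, 1::real}"
  then obtain i where i: "i \<in> {1..n}" "fst p = real i" by auto
  have "real i \<in> (%i. f i 0) ` {1..n}" unfolding config_bottom_surj[OF c] using i by blast
  then obtain j where j: "j \<in> {1..n}" "f j 0 = real i" by (metis imageE)
  have "p \<in> E n" using p i by (cases p) (auto simp: E_def)
  hence "p \<in> frontier (E n)" using p by (auto simp: frontier_E)
  moreover have "p \<in> \<Union>(strands b)"
  proof (cases "snd p = 0")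
   case True
   hence "p \<in> curve (f j)" using i j by (cases p) (auto simp: mem_curve)
   thus ?thesis using j by (auto simp: s)
  next
   case False
   hence "p \<in> curve (f i)" using i p configD(2)[OF c i(1)] by (cases p) (auto simp: mem_curve)
   thus ?thesis using i by (auto simp: s)
  qed
  ultimately show "p \<in> \<Union>(strands b) \<inter> frontier (E n)" by blast
 qed
 show ?thesis unfolding is_diagram_def mm cr
 proof (intro conjI ballI allI impI)
  show "finite (strands b)" by (simp add: s)
  show "card (strands b) = n" unfolding s using card_image[OF config_curve_inj[OF c]] by simp
  show "finite (bars b)" using assms by (simp add: dg_def)
  show "crossings b k \<inter> crossings b k' = {}" if "k ~= k'" for k k'
   using assms that unfolding dg_def by blast
  show "bars b \<subseteq> \<Union> (strands b) - meets n f - frontier (E n)"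
  proof
   fix p assume p: "p \<in> bars b"
   then obtain i where i: "i \<in> {1..n}" "p \<in> curve (f i)" using br by blast
   have "p \<notin> UNIV \<times> {0, 1}" "p \<notin> meets n f" using br p by blast+
   hence "snd p ~= 0" "snd p ~= 1" "p \<notin> meets n f" by (cases p, simp)+
   thus "p \<in> \<Union> (strands b) - meets n f - frontier (E n)"
    using inside[OF i(2,1)] i by (auto simp: frontier_E s)
  qed
  fix a assume a: "a \<in> strands b"
  then obtain i where i: "i \<in> {1..n}" "a = curve (f i)" by (auto simp: s)
  show "a \<subseteq> E n"
  proof
   fix p assume "p \<in> a"
   thus "p \<in> E n" using inside[of p i] i by (cases p) (auto simp: E_def)
  qed
  show "\<exists>g. homeomorphism a {0..1} snd g"
   using homeomorphism_curve configD(1)[OF c i(1)] i(2) by blast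
  fix a' p assume a': "a' \<in> strands b" and ap: "a ~= a' & p \<in> a & p \<in> a'"
  then obtain j where j: "j \<in> {1..n}" "a' = curve (f j)" unfolding s by blast
  obtain t where t: "p = (f i t, t)" "t \<in> {0..1}" "f i t = f j t"
   using ap i j by (auto simp: curve_def)
  have "i ~= j" using ap i j by auto
  hence "t \<in> {0<..<1}" using config_meet_height[OF c i(1) j(1)] t by auto
  thus "transverse_at a a' p"
   using transverse_at_curve config_passes[OF c i(1) j(1) \<open>i ~= j\<close>] t i j by auto
 next
  fix p
  show "card {a \<in> strands b. p \<in> a} <= 2"
  proof (rule ccontr)
   assume "\<not> card {a \<in> strands b. p \<in> a} <= 2"
   hence "3 <= card {a \<in> strands b. p \<in> a}" by simp
   then obtain T where "T \<subseteq> {a \<in> strands b. p \<in> a}" "card T = 3"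
    by (meson obtain_subset_with_card_n)
   then obtain a1 a2 a3 where T: "T = {a1, a2, a3}" and d: "a1 ~= a2" "a2 ~= a3" "a1 ~= a3"
    unfolding card_3_iff by blast
   hence "a1 \<in> strands b" "a2 \<in> strands b" "a3 \<in> strands b"
    and "p \<in> a1" "p \<in> a2" "p \<in> a3"
    using \<open>T \<subseteq> {a \<in> strands b. p \<in> a}\<close> by blast+
   then obtain i j k where ijk: "i \<in> {1..n}" "j \<in> {1..n}" "k \<in> {1..n}"
    "a1 = curve (f i)" "a2 = curve (f j)" "a3 = curve (f k)" unfolding s by blast
   obtain x t where p: "p = (x, t)" by force
   have "t \<in> {0..1}" "f i t = f j t" "f j t = f k t"
    using \<open>p \<in> a1\<close> \<open>p \<in> a2\<close> \<open>p \<in> a3\<close> ijk p by (auto simp: mem_curve)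
   hence "i = j \<or> j = k \<or> i = k" using config_two[OF c ijk(1-3)] by blast
   thus False using d ijk by auto
  qed
 qed (rule fr HOL.refl)+
qed

lemma is_diagramD:
 assumes "is_diagram n b"
 shows "finite (strands b)" "card (strands b) = n"
  "\<forall>a\<in>strands b. a \<subseteq> E n & (\<exists>g. homeomorphism a {0..1} snd g)"
  "\<Union>(strands b) \<inter> frontier (E n) = (real ` {1..n}) \<times> {0, 1}"
  "\<forall>p. card {a \<in> strands b. p \<in> a} <= 2"
  "\<forall>a\<in>strands b. \<forall>a'\<in>strands b. \<forall>p. a ~= a' & p \<in> a & p \<in> a' --> transverse_at a a' p"
  "(\<Union>k. crossings b k) = multiple_points b"
  "\<forall>k k'. k ~= k' --> crossings b k \<inter> crossings b k' = {}"
  "finite (bars b)"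
  "bars b \<subseteq> \<Union>(strands b) - multiple_points b - frontier (E n)"
 using assms unfolding is_diagram_def by - (elim conjE, assumption)+

text \<open>A strand projects homeomorphically to the height axis, so it is the graph of a continuous function.
The boundary condition forces exactly one strand to start in each top position, which gives the labels, and keeps
the strands away from the vertical sides.\<close>

lemma is_diagram_dg:
 assumes "is_diagram n b" shows "\<exists>f. dg n b f"
proof -
 note d = is_diagramD[OF assms]
 note fin = d(1,2)
 note fr = d(4)
 have "\<exists>g. a = curve g & continuous_on {0..1} g" if a: "a \<in> strands b" for a
 proof -
  obtain g where g: "homeomorphism a {0..1} snd g" using d(3) a by blast
  have "a = curve (fst \<circ> g)"
  proof (intro equalityI subsetI)
   fix p assume "p \<in> a"
   hence "snd p \<in> {0..1}" "g (snd p) = p" using g by (auto simp: homeomorphism_def)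
   thus "p \<in> curve (fst \<circ> g)" by (cases p) (auto simp: mem_curve)
  next
   fix p assume "p \<in> curve (fst \<circ> g)"
   then obtain t where t: "p = (fst (g t), t)" "t \<in> {0..1}" by (auto simp: curve_def)
   hence "snd (g t) = t" "g t \<in> a" using g by (auto simp: homeomorphism_def)
   thus "p \<in> a" using t by (metis prod.collapse)
  qed
  moreover have "continuous_on {0..1} (fst \<circ> g)"
   using g by (auto simp: homeomorphism_def comp_def intro!: continuous_intros)
  ultimately show ?thesis by blast
 qed
 then obtain F where F: "\<And>a. a \<in> strands b ==> a = curve (F a) & continuous_on {0..1} (F a)" by metis
 have sub: "a \<subseteq> E n" if "a \<in> strands b" for a using d(3) that by blast
 have pt: "(F a t, t) \<in> a" if "a \<in> strands b" "t \<in> {0..1}" for a t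
  using F[OF that(1)] that(2) mem_curve by blast
 have ends: "F a t \<in> real ` {1..n}" if "a \<in> strands b" "t \<in> {0, 1}" for a t
 proof -
  have "(F a t, t) \<in> \<Union>(strands b) \<inter> frontier (E n)"
   using pt[of a t] sub[OF that(1)] that by (auto simp: frontier_E)
  thus ?thesis using fr by auto
 qed
 have onto: "(%a. F a t) ` strands b = real ` {1..n}" if t: "t \<in> {0, 1}" for t
 proof (intro equalityI subsetI)
  fix x assume "x \<in> real ` {1..n}"
  hence "(x, t) \<in> \<Union>(strands b) \<inter> frontier (E n)" using fr t by auto
  then obtain a where "a \<in> strands b" "(x, t) \<in> a" by blast
  thus "x \<in> (%a. F a t) ` strands b" using F mem_curve by blast
 qed (use ends t in auto)
 have injt: "inj_on (%a. F a t) (strands b)" if "t \<in> {0, 1}" for t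
 proof (rule eq_card_imp_inj_on)
  have "card (real ` {1..n}) = n" by (simp add: card_image)
  thus "card ((%a. F a t) ` strands b) = card (strands b)" using onto[OF that] fin by metis
 qed (rule fin)
 have ex: "\<exists>a\<in>strands b. F a 1 = real i" if "i \<in> {1..n}" for i
 proof -
  have "(%a. F a 1) ` strands b = real ` {1..n}" by (rule onto) simp
  hence "real i \<in> (%a. F a 1) ` strands b" using that by simp
  thus ?thesis by (metis imageE)
 qed
 then obtain A where A: "\<And>i. i \<in> {1..n} ==> A i \<in> strands b & F (A i) 1 = real i" by metis
 have Ainj: "A i = A j \<longleftrightarrow> i = j" if "i \<in> {1..n}" "j \<in> {1..n}" for i j
  using A[OF that(1)] A[OF that(2)] by (metis of_nat_eq_iff)
 have Aim: "A ` {1..n} = strands b"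
 proof (rule card_subset_eq)
  have "inj_on A {1..n}" using Ainj by (meson inj_onI)
  thus "card (A ` {1..n}) = card (strands b)" using card_image fin by fastforce
  show "A ` {1..n} \<subseteq> strands b" using A by blast
 qed (rule fin)
 define f where "f = (%i. F (A i))"
 have cA: "curve (f i) = A i" if "i \<in> {1..n}" for i using F A that unfolding f_def by metis
 have "config n f"
  unfolding config_def
 proof (intro conjI ballI impI)
  fix i assume i: "i \<in> {1..n}"
  show "continuous_on {0..1} (f i)" using F A i unfolding f_def by blast
  show "f i 1 = real i" using A i by (simp add: f_def)
  show "f i 0 \<in> real ` {1..n}" using ends A i by (simp add: f_def)
  fix t :: real assume t: "t \<in> {0..1}"
  have in_E: "(f i t, t) \<in> E n" using pt sub A i t unfolding f_def by blast
  have "f i t ~= 0 & f i t ~= real n + 1"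
  proof (rule ccontr)
   assume "\<not> (f i t ~= 0 & f i t ~= real n + 1)"
   hence "(f i t, t) \<in> \<Union>(strands b) \<inter> frontier (E n)"
    using pt A i t in_E unfolding f_def by (auto simp: frontier_E)
   hence "f i t \<in> real ` {1..n}" using fr by auto
   thus False using \<open>\<not> (f i t ~= 0 & f i t ~= real n + 1)\<close> by auto
  qed
  thus "0 < f i t" "f i t < real n + 1" using in_E by (auto simp: E_def)
 next
  show "inj_on (%i. f i 0) {1..n}"
  proof (rule inj_onI)
   fix i j assume ij: "i \<in> {1..n}" "j \<in> {1..n}" and "f i 0 = f j 0"
   hence "A i = A j" using injt[of 0] A unfolding f_def inj_on_def by blast
   thus "i = j" using Ainj ij by blast
  qed
 next
  fix i j k t assume ijk: "i \<in> {1..n}" "j \<in> {1..n}" "k \<in> {1..n}" and t: "t \<in> {0..1::real}"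
   and eq: "f i t = f j t & f j t = f k t"
  show "i = j \<or> j = k \<or> i = k"
  proof (rule ccontr)
   assume "\<not> ?thesis"
   hence "A i ~= A j" "A j ~= A k" "A i ~= A k" using Ainj ijk by blast+
   hence "card {A i, A j, A k} = 3" by simp
   moreover have "{A i, A j, A k} \<subseteq> {a \<in> strands b. (f i t, t) \<in> a}"
    using A[OF ijk(1)] A[OF ijk(2)] A[OF ijk(3)] pt[of "A i" t] pt[of "A j" t] pt[of "A k" t] t eq
    by (simp add: f_def)
   hence "card {A i, A j, A k} <= card {a \<in> strands b. (f i t, t) \<in> a}"
    by (rule card_mono[rotated]) (use fin in auto)
   moreover have "card {a \<in> strands b. (f i t, t) \<in> a} <= 2" using d(5) by blast
   ultimately show False by simp
  qed
 next
  fix i j t assume ij: "i \<in> {1..n}" "j \<in> {1..n}" and t: "t \<in> {0<..<1::real}"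
   and eq: "i ~= j & f i t = f j t"
  have "transverse_at (curve (f i)) (curve (f j)) (f i t, t)"
  proof -
   have "A i \<in> strands b" "A j \<in> strands b" "A i ~= A j" using A Ainj ij eq by blast+
   moreover have "(f i t, t) \<in> A i" "(f i t, t) \<in> A j"
    using pt[of "A i" t] pt[of "A j" t] t eq A[OF ij(1)] A[OF ij(2)] by (simp_all add: f_def)
   ultimately show ?thesis using d(6) cA ij by metis
  qed
  thus "passes (f i) (f j) t" using transverse_at_curve t eq by blast
 qed
 moreover have st: "strands b = (%i. curve (f i)) ` {1..n}" using Aim cA by force
 moreover have mm: "multiple_points b = meets n f" by (rule multiple_points_curves) fact+
 moreover have "bars b \<subseteq> (\<Union>i\<in>{1..n}. curve (f i)) - meets n f - UNIV \<times> {0, 1}"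
 proof -
  have "bars b \<subseteq> \<Union>(strands b) - meets n f - frontier (E n)" using d(10) mm by simp
  moreover have "\<Union>(strands b) - frontier (E n) \<subseteq> \<Union>(strands b) - UNIV \<times> {0, 1}"
  proof
   fix p assume p: "p \<in> \<Union>(strands b) - frontier (E n)"
   hence "p \<in> E n" using sub by blast
   thus "p \<in> \<Union>(strands b) - UNIV \<times> {0, 1}" using p by (cases p) (auto simp: frontier_E)
  qed
  moreover have "\<Union>(strands b) = (\<Union>i\<in>{1..n}. curve (f i))" using st by simp
  ultimately show ?thesis by blast
 qed
 moreover have "(\<Union>k. crossings b k) = meets n f" using d(7) mm by simp
 ultimately have "dg n b f" unfolding dg_def using d(8,9) by - (intro conjI; assumption)
 thus ?thesis by blast
qed

section \<open>Isotopies\<close>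

lemma diagram_in_E:
 assumes "is_diagram n b"
 shows "a \<in> strands b ==> a \<subseteq> E n" "crossings b k \<subseteq> E n" "bars b \<subseteq> E n"
proof -
 note d = is_diagramD[OF assms]
 show 1: "a \<subseteq> E n" if "a \<in> strands b" for a using d(3) that by blast
 have "crossings b k \<subseteq> multiple_points b" using d(7) by blast
 thus "crossings b k \<subseteq> E n" using 1 unfolding multiple_points_def by blast
 show "bars b \<subseteq> E n" using d(10) 1 by blast
qed

lemma map_diagram_cong:
 assumes "is_diagram n b" "\<And>p. p \<in> E n ==> f p = g p"
 shows "map_diagram f b = map_diagram g b"
proof -
 note d = diagram_in_E[OF assms(1)]
 have eq: "f ` A = g ` A" if "A \<subseteq> E n" for A using assms(2) that by (auto intro!: image_cong)
 have "(%a. f ` a) ` strands b = (%a. g ` a) ` strands b"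
  by (rule image_cong) (use d(1) eq in blast)+
 moreover have "f ` crossings b k = g ` crossings b k" for k using eq d(2) by blast
 moreover have "f ` bars b = g ` bars b" using eq d(3) by blast
 ultimately show ?thesis by (simp add: map_diagram_def)
qed

lemma map_diagram_comp: "map_diagram f (map_diagram g b) = map_diagram (f \<circ> g) b"
 by (simp add: map_diagram_def image_image comp_def)

lemma map_diagram_id: "map_diagram id b = b"
 by (simp add: map_diagram_def)

lemma diagram_homeo_cong:
 assumes "is_diagram n b" "\<And>p. p \<in> E n ==> f p = g p"
 shows "((\<exists>k. homeomorphism (E n) (E n) f k) & is_diagram n (map_diagram f b)) \<longleftrightarrow>
     ((\<exists>k. homeomorphism (E n) (E n) g k) & is_diagram n (map_diagram g b))"
proof -
 have "homeomorphism (E n) (E n) f k \<longleftrightarrow> homeomorphism (E n) (E n) g k" for k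
  using assms(2) by (intro iffI; elim homeomorphism_cong) auto
 moreover have "map_diagram f b = map_diagram g b" by (rule map_diagram_cong) (use assms in auto)
 ultimately show ?thesis by simp
qed

lemma compact_E: "compact (E n)"
 unfolding E_def by (intro compact_Times compact_Icc)

text \<open>By compactness of the rectangle it suffices that the stages of the homotopy are bijective.\<close>

lemma isotopicI:
 fixes H :: "real => point => point"
 assumes b: "is_diagram n b"
  and cont: "continuous_on ({0..1} \<times> E n) (%q. H (fst q) (snd q))"
  and onto: "\<And>s. s \<in> {0..1} ==> H s ` E n = E n"
  and inj: "\<And>s. s \<in> {0..1} ==> inj_on (H s) (E n)"
  and H0: "\<And>p. p \<in> E n ==> H 0 p = p"
  and d: "\<And>s. s \<in> {0..1} ==> is_diagram n (map_diagram (H s) b)"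
 shows "isotopic n b (map_diagram (H 1) b)"
proof -
 let ?P = "%f. (\<exists>g. homeomorphism (E n) (E n) f g) & is_diagram n (map_diagram f b)"
 have P: "?P (H s)" if s: "s \<in> {0..1}" for s :: real
 proof
  have "continuous_on (E n) (%p. (%q. H (fst q) (snd q)) (s, p))"
   by (rule continuous_on_compose2[OF cont]) (use s in \<open>auto intro!: continuous_intros\<close>)
  hence "continuous_on (E n) (H s)" by simp
  thus "\<exists>g. homeomorphism (E n) (E n) (H s) g"
   using homeomorphism_compact[OF compact_E] onto[OF s] inj[OF s] by blast
 qed (rule d[OF s])
 have "homotopic_with_canon ?P (E n) (E n) id (H 1)"
 proof (subst homotopic_with, goal_cases)
  case (1 h k)
  show ?case by (rule diagram_homeo_cong[OF b]) (use 1 in simp)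
 next
  case 2
  show ?case
  proof (rule exI[of _ "%q. H (fst q) (snd q)"], intro conjI ballI)
   show "continuous_map (prod_topology (top_of_set {0..1}) (top_of_set (E n)))
       (top_of_set (E n)) (%q. H (fst q) (snd q))"
    unfolding prod_topology_subtopology_eu[symmetric]
   proof -
    have "H s p \<in> E n" if "s \<in> {0..1}" "p \<in> E n" for s p using onto[OF that(1)] that(2) by blast
    hence "(%q. H (fst q) (snd q)) \<in> {0..1} \<times> E n \<rightarrow> E n" by (auto simp: mem_Times_iff)
    thus ?thesis using cont by (simp add: continuous_map_in_subtopology prod_topology_subtopology_eu image_subset_iff_funcset)
   qed
   show "H (fst (0, p)) (snd (0, p)) = id p" if "p \<in> topspace (top_of_set (E n))" for p
    using H0 that by simp
   show "\<exists>g. homeomorphism (E n) (E n) (%x. H (fst (s, x)) (snd (s, x))) g"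
    "is_diagram n (map_diagram (%x. H (fst (s, x)) (snd (s, x))) b)" if "s \<in> {0..1}" for s
    using P[OF that] by simp_all
  qed simp
 qed
 thus ?thesis unfolding isotopic_def using b by blast
qed

lemma isotopicE:
 assumes "isotopic n b b'"
 obtains H :: "real => point => point" where "continuous_on ({0..1} \<times> E n) (%q. H (fst q) (snd q))"
  "\<And>p. H 0 p = p" "b' = map_diagram (H 1) b"
  "\<And>s. s \<in> {0..1} ==> H s ` E n = E n" "\<And>s. s \<in> {0..1} ==> inj_on (H s) (E n)"
  "\<And>s. s \<in> {0..1} ==> is_diagram n (map_diagram (H s) b)"
proof -
 let ?P = "%f. (\<exists>g. homeomorphism (E n) (E n) f g) & is_diagram n (map_diagram f b)"
 obtain h where h: "homotopic_with_canon ?P (E n) (E n) id h" "b' = map_diagram h b"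
  using assms unfolding isotopic_def by blast
 obtain K :: "real \<times> point => point" where
  KK: "continuous_map (prod_topology (top_of_set {0..1}) (top_of_set (E n))) (top_of_set (E n)) K &
   (\<forall>x. K (0, x) = id x) & (\<forall>x. K (1, x) = h x) & (\<forall>t\<in>{0..1}. ?P (%x. K (t, x)))"
  using h(1) unfolding homotopic_with_def by (elim exE)
 have K1: "continuous_map (prod_topology (top_of_set {0..1}) (top_of_set (E n))) (top_of_set (E n)) K"
  using KK by (rule conjunct1)
 have K2: "K (0, x) = x" for x
  using KK[THEN conjunct2, THEN conjunct1, THEN spec, of x] by (simp only: id_apply)
 have K3: "K (1, x) = h x" for x
  using KK[THEN conjunct2, THEN conjunct2, THEN conjunct1] by (rule spec)
 have K4: "?P (%x. K (t, x))" if "t \<in> {0..1}" for t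
  using KK[THEN conjunct2, THEN conjunct2, THEN conjunct2] that by (rule bspec)
 show ?thesis
 proof (rule that[of "%s p. K (s, p)"])
  show "continuous_on ({0..1} \<times> E n) (%q. K (fst q, snd q))"
   using K1 unfolding continuous_map_in_subtopology prod_topology_subtopology_eu by simp
  show "b' = map_diagram (%p. K (1, p)) b" using h(2) K3 by simp
  fix s :: real assume s: "s \<in> {0..1}"
  obtain g where g: "homeomorphism (E n) (E n) (%x. K (s, x)) g" using K4[OF s] by blast
  show "(%p. K (s, p)) ` E n = E n" by (rule homeomorphism_image1[OF g])
  show "inj_on (%p. K (s, p)) (E n)"
   by (rule inj_on_inverseI[of _ g]) (rule homeomorphism_apply1[OF g])
  show "is_diagram n (map_diagram (%p. K (s, p)) b)" using K4[OF s] by blast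
 qed (rule K2)
qed

lemma isotopic_diagrams:
 assumes "isotopic n b b'" shows "is_diagram n b" "is_diagram n b'"
proof -
 show "is_diagram n b" using assms by (simp add: isotopic_def)
 show "is_diagram n b'"
 proof (rule isotopicE[OF assms])
  fix H :: "real => point => point"
  assume b': "b' = map_diagram (H 1) b"
   and d: "\<And>s. s \<in> {0..1} ==> is_diagram n (map_diagram (H s) b)"
  show "is_diagram n b'" unfolding b' by (rule d) simp
 qed
qed

lemma isotopic_refl:
 assumes "is_diagram n b" shows "isotopic n b b"
proof -
 have "isotopic n b (map_diagram id b)"
  by (rule isotopicI[OF assms, where H = "%s. id"]) (use assms in \<open>auto simp: map_diagram_id intro!: continuous_intros\<close>)
 thus ?thesis by (simp add: map_diagram_id)
qed

text \<open>If \<open>H s\<close> is an isotopy from \<open>b\<close> to \<open>b'\<close> with final map \<open>h\<close>, then \<open>H (1 - s) \<circ> h\<^bsup>-1\<^esup>\<close> is one from \<open>b'\<close> to \<open>b\<close>.\<close>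

lemma isotopic_sym:
 assumes "isotopic n b b'" shows "isotopic n b' b"
proof -
 obtain H :: "real => point => point" where H: "continuous_on ({0..1} \<times> E n) (%q. H (fst q) (snd q))"
  "\<And>p. H 0 p = p" "b' = map_diagram (H 1) b"
  "\<And>s. s \<in> {0..1} ==> H s ` E n = E n" "\<And>s. s \<in> {0..1} ==> inj_on (H s) (E n)"
  "\<And>s. s \<in> {0..1} ==> is_diagram n (map_diagram (H s) b)"
  by (rule isotopicE[OF assms]) blast
 have db: "is_diagram n b" "is_diagram n b'" using isotopic_diagrams[OF assms] by blast+
 have "continuous_on (E n) (%p. (%q. H (fst q) (snd q)) (1, p))"
 proof (rule continuous_on_compose2[OF H(1)])
  show "(%p. (1, p)) ` E n \<subseteq> {0..1::real} \<times> E n" by (rule image_subsetI, rule SigmaI) simp_all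
 qed (intro continuous_intros)
 hence c1: "continuous_on (E n) (H 1)" by simp
 have one: "H 1 ` E n = E n" "inj_on (H 1) (E n)" by (rule H(4), simp, rule H(5), simp)
 obtain g where g: "homeomorphism (E n) (E n) (H 1) g"
  using homeomorphism_compact[OF compact_E c1 one] by blast
 have gE: "g ` E n = E n" by (rule homeomorphism_image2[OF g])
 have gc: "continuous_on (E n) g" by (rule homeomorphism_cont2[OF g])
 have gi: "inj_on g (E n)" by (rule inj_on_inverseI[of _ "H 1"]) (rule homeomorphism_apply2[OF g])
 have gH: "g (H 1 p) = p" if "p \<in> E n" for p using g that unfolding homeomorphism_def by blast
 have Hg: "H 1 (g p) = p" if "p \<in> E n" for p using g that unfolding homeomorphism_def by blast
 have key: "map_diagram (%p. H (1 - s) (g p)) b' = map_diagram (H (1 - s)) b" for s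
  unfolding H(3) map_diagram_comp by (rule map_diagram_cong[OF db(1)]) (simp add: gH)
 have "isotopic n b' (map_diagram (%p. H (1 - 1) (g p)) b')"
 proof (rule isotopicI[OF db(2), where H = "%s p. H (1 - s) (g p)"])
  show "continuous_on ({0..1} \<times> E n) (%q. H (1 - fst q) (g (snd q)))"
  proof -
   have "continuous_on ({0..1::real} \<times> E n) (%r. (%q. H (fst q) (snd q)) (1 - fst r, g (snd r)))"
   proof (rule continuous_on_compose2[OF H(1)])
    have "continuous_on ({0..1::real} \<times> E n) (%r. 1 - fst r)" by (intro continuous_intros)
    moreover have "continuous_on ({0..1::real} \<times> E n) (%r. g (snd r))"
     by (rule continuous_on_compose2[OF gc]) (auto intro: continuous_intros)
    ultimately show "continuous_on ({0..1::real} \<times> E n) (%r. (1 - fst r, g (snd r)))"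
     by (rule continuous_on_Pair)
    show "(%r. (1 - fst r, g (snd r))) ` ({0..1::real} \<times> E n) \<subseteq> {0..1} \<times> E n"
     using gE by (auto simp: image_subset_iff)
   qed
   thus ?thesis by simp
  qed
  fix s :: real assume s: "s \<in> {0..1}"
  have s': "1 - s \<in> {0..1}" using s by auto
  show "(%p. H (1 - s) (g p)) ` E n = E n"
   using H(4)[OF s'] gE by (metis image_image)
  show "inj_on (%p. H (1 - s) (g p)) (E n)"
   using comp_inj_on[OF gi] H(5)[OF s'] gE by (simp add: comp_def)
  show "is_diagram n (map_diagram (%p. H (1 - s) (g p)) b')"
   unfolding key by (rule H(6)[OF s'])
 qed (simp add: Hg)
 moreover have "map_diagram (%p. H (1 - 1) (g p)) b' = b"
  unfolding key using H(2) map_diagram_id[of b] by (simp add: id_def[symmetric] cong: map_diagram_cong[OF db(1)])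
 ultimately show ?thesis by simp
qed

lemma isotopic_trans:
 assumes "isotopic n b b'" "isotopic n b' b''" shows "isotopic n b b''"
proof -
 let ?P = "%b f. (\<exists>g. homeomorphism (E n) (E n) f g) & is_diagram n (map_diagram f b)"
 obtain h where h: "homotopic_with_canon (?P b) (E n) (E n) id h" "b' = map_diagram h b" and b: "is_diagram n b"
  using assms(1) unfolding isotopic_def by blast
 obtain h' where h': "homotopic_with_canon (?P b') (E n) (E n) id h'" "b'' = map_diagram h' b'"
  using assms(2) unfolding isotopic_def by blast
 have Ph: "?P b h" using homotopic_with_imp_property[OF h(1)] by blast
 then obtain g where g: "homeomorphism (E n) (E n) h g" by blast
 have "homotopic_with_canon (?P b) (E n) (E n) (id \<circ> h) (h' \<circ> h)"
 proof (rule homotopic_with_compose_continuous_map_right[OF h'(1)])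
  show "continuous_map (top_of_set (E n)) (top_of_set (E n)) h"
   using g unfolding homeomorphism_def by auto
  fix j assume "?P b' j"
  thus "?P b (j \<circ> h)" using homeomorphism_compose[OF g] h(2) map_diagram_comp by metis
 qed
 hence "homotopic_with_canon (?P b) (E n) (E n) id (h' \<circ> h)"
  using homotopic_with_trans[OF h(1)] by simp
 moreover have "b'' = map_diagram (h' \<circ> h) b" using h(2) h'(2) map_diagram_comp by metis
 ultimately show ?thesis unfolding isotopic_def using b by blast
qed

lemma meets_eq: "meets n f = (\<Union>i\<in>{1..n}. \<Union>j\<in>{1..n} - {i}. curve (f i) \<inter> curve (f j))"
proof (intro equalityI subsetI)
 fix p assume "p \<in> meets n f"
 then obtain i j t where ij: "i \<in> {1..n}" "j \<in> {1..n} - {i}" and p: "p = (f i t, t)" "t \<in> {0..1}" "f i t = f j t"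
  unfolding meets_def by blast
 have "p \<in> curve (f i) \<inter> curve (f j)" using p by (simp add: mem_curve)
 thus "p \<in> (\<Union>i\<in>{1..n}. \<Union>j\<in>{1..n} - {i}. curve (f i) \<inter> curve (f j))" using ij by blast
next
 fix p assume "p \<in> (\<Union>i\<in>{1..n}. \<Union>j\<in>{1..n} - {i}. curve (f i) \<inter> curve (f j))"
 then obtain i j where ij: "i \<in> {1..n}" "j \<in> {1..n}" "i ~= j" and p: "p \<in> curve (f i)" "p \<in> curve (f j)"
  by blast
 from p obtain t where "p = (f i t, t)" "t \<in> {0..1}" "f i t = f j t" by (auto simp: curve_def)
 thus "p \<in> meets n f" using ij unfolding meets_def by blast
qed

lemma curve_sub_E:
 assumes "config n f" "i \<in> {1..n}" shows "curve (f i) \<subseteq> E n"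
 using configD(4,5)[OF assms] unfolding curve_def E_def by (auto simp: less_imp_le)

text \<open>The image of a diagram under an injective map that keeps the boundary heights apart is a diagram as soon as the images of
the strands are again the graphs of an admissible family.\<close>

lemma dg_map:
 assumes b: "dg n b f" and g: "config n g" and inj: "inj_on \<phi> (E n)"
  and int: "\<And>p. p \<in> E n ==> snd p ~= 0 ==> snd p ~= 1 ==> snd (\<phi> p) ~= 0 & snd (\<phi> p) ~= 1"
  and cur: "\<And>i. i \<in> {1..n} ==> \<phi> ` curve (f i) = curve (g i)"
 shows "dg n (map_diagram \<phi> b) g"
proof -
 have c: "config n f" and st: "strands b = (%i. curve (f i)) ` {1..n}"
  and cr: "(\<Union>k. crossings b k) = meets n f"
  and dj: "\<And>k k'. k ~= k' ==> crossings b k \<inter> crossings b k' = {}"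
  and fb: "finite (bars b)"
  and br: "bars b \<subseteq> (\<Union>i\<in>{1..n}. curve (f i)) - meets n f - UNIV \<times> {0, 1}"
  using b by (auto simp: dg_def)
 note sub = curve_sub_E[OF c]
 have mm: "\<phi> ` meets n f = meets n g"
 proof -
  have "\<phi> ` (curve (f i) \<inter> curve (f j)) = curve (g i) \<inter> curve (g j)"
   if "i \<in> {1..n}" "j \<in> {1..n}" for i j
   using inj_on_image_Int[OF inj sub[OF that(1)] sub[OF that(2)]] cur that by simp
  hence "(\<Union>i\<in>{1..n}. \<Union>j\<in>{1..n} - {i}. \<phi> ` (curve (f i) \<inter> curve (f j))) = meets n g"
   unfolding meets_eq by (intro SUP_cong HOL.refl) blast
  thus ?thesis unfolding meets_eq image_UN by simp
 qed
 have meE: "meets n f \<subseteq> E n" unfolding meets_eq using sub by blast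
 have brE: "bars b \<subseteq> E n" using br sub by blast
 show ?thesis
  unfolding dg_def
 proof (intro conjI allI impI)
  show "strands (map_diagram \<phi> b) = (%i. curve (g i)) ` {1..n}"
   using cur by (simp add: map_diagram_def st image_image)
  show "(\<Union>k. crossings (map_diagram \<phi> b) k) = meets n g"
   unfolding mm[symmetric] cr[symmetric] by (simp add: map_diagram_def image_UN)
  show "finite (bars (map_diagram \<phi> b))" using fb by (simp add: map_diagram_def)
  fix k k' :: kind assume k: "k ~= k'"
  have "crossings b k \<subseteq> E n" "crossings b k' \<subseteq> E n" using cr meE by blast+
  hence "\<phi> ` crossings b k \<inter> \<phi> ` crossings b k' = \<phi> ` (crossings b k \<inter> crossings b k')"
   using inj_on_image_Int[OF inj] by metis
  thus "crossings (map_diagram \<phi> b) k \<inter> crossings (map_diagram \<phi> b) k' = {}"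
   using dj[OF k] by (simp add: map_diagram_def)
 next
  show "bars (map_diagram \<phi> b) \<subseteq> (\<Union>i\<in>{1..n}. curve (g i)) - meets n g - UNIV \<times> {0, 1}"
  proof
   fix q assume "q \<in> bars (map_diagram \<phi> b)"
   then obtain p where p: "p \<in> bars b" "q = \<phi> p" by (auto simp: map_diagram_def)
   then obtain i where i: "i \<in> {1..n}" "p \<in> curve (f i)" using br by blast
   have "q \<in> curve (g i)" using cur[OF i(1)] i(2) p(2) by blast
   moreover have "q \<notin> meets n g"
   proof
    assume "q \<in> meets n g"
    hence "\<phi> p \<in> \<phi> ` meets n f" using mm p(2) by simp
    then obtain p' where "p' \<in> meets n f" "\<phi> p' = \<phi> p" by (metis imageE)
    hence "p' = p" using inj meE brE p(1) by (meson inj_onD subsetD)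
    thus False using \<open>p' \<in> meets n f\<close> br p(1) by blast
   qed
   moreover have "q \<notin> UNIV \<times> {0, 1}"
   proof -
    have "p \<notin> UNIV \<times> {0, 1}" using br p(1) by blast
    hence "snd p ~= 0" "snd p ~= 1" by (cases p, simp)+
    hence "snd q ~= 0 & snd q ~= 1" using int brE p by blast
    thus ?thesis by (cases q) simp
   qed
   ultimately show "q \<in> (\<Union>i\<in>{1..n}. curve (g i)) - meets n g - UNIV \<times> {0, 1}" using i(1) by blast
  qed
 qed (rule g)
qed

section \<open>Piecewise linear maps and order statistics\<close>

text \<open>The increasing piecewise linear function with nodes \<open>y k\<close> and values \<open>z k\<close>. A segment of length \<open>0\<close> contributes nothing,
as division by \<open>0\<close> gives \<open>0\<close>; so strands may cross while the formula stays the same.\<close>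

definition plmap :: "nat => (nat => real) => (nat => real) => real => real" where
 "plmap N y z x = z 0 + (\<Sum>k<N. (z (Suc k) - z k) * ((min x (y (Suc k)) - min x (y k)) / (y (Suc k) - y k)))"

definition nodes :: "nat => (nat => real) => (nat => real) => bool" where
 "nodes N y z \<longleftrightarrow> (\<forall>k<N. y k <= y (Suc k) & z k <= z (Suc k) & (y k = y (Suc k) \<longleftrightarrow> z k = z (Suc k)))"

lemma nodes_mono:
 assumes "nodes N y z" "i <= j" "j <= N" shows "y i <= y j"
 using assms(2,3)
proof (induction j rule: dec_induct)
 case (step m)
 hence "y m <= y (Suc m)" using assms(1) by (simp add: nodes_def)
 thus ?case using step by simp
qed simp

lemma plmap_node:
 assumes "nodes N y z" "j <= N" shows "plmap N y z (y j) = z j"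
proof -
 have "(z (Suc k) - z k) * ((min (y j) (y (Suc k)) - min (y j) (y k)) / (y (Suc k) - y k))
   = (if k < j then z (Suc k) - z k else 0)" if k: "k < N" for k
 proof (cases "k < j")
  case True
  hence "y k <= y j" "y (Suc k) <= y j" using nodes_mono[OF assms(1)] assms(2) by simp_all
  moreover have "y k = y (Suc k) \<longleftrightarrow> z k = z (Suc k)" using assms(1) k unfolding nodes_def by blast
  ultimately show ?thesis using True by (cases "y (Suc k) = y k") (auto simp: min_absorb2)
 next
  case False
  hence "y j <= y k" "y j <= y (Suc k)" using nodes_mono[OF assms(1)] k by simp_all
  thus ?thesis using False by (simp add: min_absorb1)
 qed
 hence "plmap N y z (y j) = z 0 + (\<Sum>k<N. if k < j then z (Suc k) - z k else 0)"
  by (simp add: plmap_def)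
 also have "(\<Sum>k<N. if k < j then z (Suc k) - z k else 0) = (\<Sum>k<j. z (Suc k) - z k)"
  using assms(2) by (intro sum.mono_neutral_cong_right) auto
 also have "... = z j - z 0" by (rule sum_lessThan_telescope)
 finally show ?thesis by simp
qed

lemma plmap_strict:
 assumes n: "nodes N y z" and x: "y 0 <= x" "x < x'" "x' <= y N"
 shows "plmap N y z x < plmap N y z x'"
proof -
 let ?T = "%x k. (z (Suc k) - z k) * ((min x (y (Suc k)) - min x (y k)) / (y (Suc k) - y k))"
 have le: "?T x k <= ?T x' k" if k: "k < N" for k
 proof -
  have *: "y k <= y (Suc k)" "z k <= z (Suc k)" using n k by (auto simp: nodes_def)
  have "min x (y (Suc k)) - min x (y k) <= min x' (y (Suc k)) - min x' (y k)"
   using * x(2) by (simp add: min_def)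
  thus ?thesis using * by (intro mult_left_mono divide_right_mono) auto
 qed
 define k where "k = (LEAST j. x < y j)"
 have ex: "x < y N" using x by simp
 have k1: "x < y k" "k <= N" unfolding k_def using ex by (rule LeastI, rule Least_le)
 have "k ~= 0" using k1 x(1) by (metis not_le)
 then obtain m where m: "k = Suc m" by (cases k) auto
 have k2: "y m <= x" using not_less_Least[of m "%j. x < y j"] m unfolding k_def[symmetric] by simp
 have mN: "m < N" using k1 m by simp
 have pos: "y m < y (Suc m)" using k1 k2 m by simp
 hence zpos: "z m < z (Suc m)" using n mN by (metis nodes_def order_le_less less_irrefl)
 have "min x (y (Suc m)) - min x (y m) < min x' (y (Suc m)) - min x' (y m)"
  using k1 k2 m x(2) by (simp add: min_def)
 hence lt: "?T x m < ?T x' m"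
  using pos zpos by (intro mult_strict_left_mono divide_strict_right_mono) auto
 have "(\<Sum>k<N. ?T x k) < (\<Sum>k<N. ?T x' k)"
  by (rule sum_strict_mono_ex1) (use le lt mN in auto)
 thus ?thesis by (simp add: plmap_def)
qed

lemma plmap_id:
 assumes n: "nodes N y y" and x: "y 0 <= x" "x <= y N"
 shows "plmap N y y x = x"
proof -
 have "(y (Suc k) - y k) * ((min x (y (Suc k)) - min x (y k)) / (y (Suc k) - y k))
   = min x (y (Suc k)) - min x (y k)" for k
  by (cases "y (Suc k) = y k") auto
 hence "plmap N y y x = y 0 + (\<Sum>k<N. min x (y (Suc k)) - min x (y k))"
  by (simp add: plmap_def)
 also have "... = y 0 + (min x (y N) - min x (y 0))" using sum_lessThan_telescope[of "%k. min x (y k)" N] by simp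
 finally show ?thesis using x by (simp add: min_def)
qed

text \<open>Continuity in the nodes is delicate where two nodes collide. There the ratio in the definition may have no limit, but it stays between
\<open>0\<close> and \<open>1\<close>, and its coefficient \<open>z (k+1) - z k\<close> tends to \<open>0\<close>, since the values collide together with the nodes.\<close>

lemma plmap_continuous:
 fixes y z :: "nat => 'a::metric_space => real"
 assumes n: "\<And>p. p \<in> S ==> nodes N (%k. y k p) (%k. z k p)"
  and y: "\<And>k. k <= N ==> continuous_on S (y k)" and z: "\<And>k. k <= N ==> continuous_on S (z k)"
  and x: "continuous_on S x"
 shows "continuous_on S (%p. plmap N (%k. y k p) (%k. z k p) (x p))"
 unfolding plmap_def
proof (intro continuous_on_add continuous_on_sum)
 show "continuous_on S (z 0)" by (rule z) simp
 fix k assume "k \<in> {..<N}"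
 hence k: "k < N" "k <= N" "Suc k <= N" by auto
 let ?T = "%p. (z (Suc k) p - z k p) * ((min (x p) (y (Suc k) p) - min (x p) (y k p)) / (y (Suc k) p - y k p))"
 have nn: "y k p <= y (Suc k) p" "z k p <= z (Suc k) p" "y k p = y (Suc k) p \<longleftrightarrow> z k p = z (Suc k) p"
  if "p \<in> S" for p using n[OF that] k(1) by (auto simp: nodes_def)
 show "continuous_on S ?T"
  unfolding continuous_on_eq_continuous_within
 proof
  fix p assume p: "p \<in> S"
  have c: "continuous (at p within S) (y k)" "continuous (at p within S) (y (Suc k))"
   "continuous (at p within S) (z k)" "continuous (at p within S) (z (Suc k))"
   "continuous (at p within S) x"
   using y[OF k(2)] y[OF k(3)] z[OF k(2)] z[OF k(3)] x p
   unfolding continuous_on_eq_continuous_within by blast+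
  show "continuous (at p within S) ?T"
  proof (cases "y k p = y (Suc k) p")
   case False
   thus ?thesis using c by (intro continuous_intros) auto
  next
   case True
   have "((%q. z (Suc k) q - z k q) \<longlongrightarrow> z (Suc k) p - z k p) (at p within S)"
    using c by (auto simp: continuous_within intro!: tendsto_intros)
   hence lim: "((%q. z (Suc k) q - z k q) \<longlongrightarrow> 0) (at p within S)"
    using True nn(3)[OF p] by simp
   have bound: "norm (?T q) <= z (Suc k) q - z k q" if "q \<in> S" for q
   proof (cases "y k q = y (Suc k) q")
    case True
    thus ?thesis using nn(2)[OF that] by simp
   next
    case False
    hence d: "0 < y (Suc k) q - y k q" using nn(1)[OF that] by simp
    have "0 <= min (x q) (y (Suc k) q) - min (x q) (y k q)"
     "min (x q) (y (Suc k) q) - min (x q) (y k q) <= y (Suc k) q - y k q"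
     using nn(1)[OF that] by (auto simp: min_def)
    hence "0 <= (min (x q) (y (Suc k) q) - min (x q) (y k q)) / (y (Suc k) q - y k q)"
     "(min (x q) (y (Suc k) q) - min (x q) (y k q)) / (y (Suc k) q - y k q) <= 1"
     using d by (simp_all add: divide_le_eq_1)
    moreover have "0 <= z (Suc k) q - z k q" using nn(2)[OF that] by simp
    ultimately have "0 <= ?T q" "?T q <= z (Suc k) q - z k q"
     by (blast intro: mult_nonneg_nonneg mult_left_le)+
    thus ?thesis by (simp only: real_norm_def abs_of_nonneg)
   qed
   have T0: "(?T \<longlongrightarrow> 0) (at p within S)"
    by (rule Lim_null_comparison[OF _ lim])
     (use bound in \<open>auto simp: eventually_at_filter\<close>)
   have Tp: "?T p = 0" using True by simp
   show ?thesis unfolding continuous_within Tp by (rule T0)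
  qed
 qed
qed

text \<open>The \<open>k\<close>-th smallest of the values \<open>v 1, ..., v n\<close>, completed by the sides \<open>0\<close> and \<open>n + 1\<close> of the rectangle. Unlike the values
themselves, which belong to labelled strands, these are ordered in the same way at every height.\<close>

definition ostat :: "nat => (nat => real) => nat => real" where
 "ostat n v k = (if k = 0 then 0 else if n < k then real n + 1
   else Min (v ` {i \<in> {1..n}. k <= card {j \<in> {1..n}. v j <= v i}}))"

lemma ostat_le_iff:
 assumes k: "1 <= k" "k <= n"
 shows "ostat n v k <= c \<longleftrightarrow> k <= card {i \<in> {1..n}. v i <= c}"
proof -
 let ?I = "{i \<in> {1..n}. k <= card {j \<in> {1..n}. v j <= v i}}"
 have key: "\<exists>i\<in>?I. v i <= c" if c: "k <= card {i \<in> {1..n}. v i <= c}" for c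
 proof -
  let ?C = "{i \<in> {1..n}. v i <= c}"
  have "?C ~= {}" using c k(1) by (metis card.empty not_one_le_zero le_trans)
  hence "Max (v ` ?C) \<in> v ` ?C" by (intro Max_in) auto
  then obtain i where i: "i \<in> ?C" "v i = Max (v ` ?C)"
   by - (erule imageE, rule that, assumption, erule HOL.sym)
  have "v j <= v i" if "j \<in> ?C" for j
  proof -
   have "finite (v ` ?C)" by simp
   thus ?thesis unfolding i(2) by (rule Max_ge) (rule imageI[OF that])
  qed
  hence "?C = {j \<in> {1..n}. v j <= v i}"
  proof (intro equalityI subsetI)
   fix j assume "j \<in> {j \<in> {1..n}. v j <= v i}"
   hence "j \<in> {1..n}" "v j <= v i" by blast+
   moreover have "v i <= c" using i(1) by blast
   ultimately show "j \<in> ?C" by (simp only: mem_Collect_eq) (meson order_trans)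
  qed blast
  hence "i \<in> ?I" using c i(1) by simp
  thus ?thesis using i(1) by blast
 qed
 have "\<exists>i\<in>?I. v i <= Max (v ` {1..n})"
 proof (rule key)
  have "{i \<in> {1..n}. v i <= Max (v ` {1..n})} = {1..n}" by auto
  thus "k <= card {i \<in> {1..n}. v i <= Max (v ` {1..n})}" using k by simp
 qed
 hence ne: "?I ~= {}" by blast
 have o: "ostat n v k = Min (v ` ?I)" using k by (simp add: ostat_def)
 show ?thesis
 proof
  assume "ostat n v k <= c"
  moreover have "Min (v ` ?I) \<in> v ` ?I" using ne by (intro Min_in) auto
  ultimately obtain i where i: "i \<in> ?I" "v i <= c" unfolding o by auto
  have "k <= card {j \<in> {1..n}. v j <= v i}" using i(1) by simp
  also have "... <= card {i \<in> {1..n}. v i <= c}"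
   by (rule card_mono) (use i(2) in auto)
  finally show "k <= card {i \<in> {1..n}. v i <= c}" .
 next
  assume "k <= card {i \<in> {1..n}. v i <= c}"
  then obtain i where i: "i \<in> ?I" "v i <= c" using key by blast
  hence "Min (v ` ?I) <= v i" by (intro Min_le) auto
  thus "ostat n v k <= c" unfolding o using i(2) by simp
 qed
qed

lemma ostat_witness:
 assumes k: "1 <= k" "k <= n"
  and ord: "\<And>i j. i \<in> {1..n} ==> j \<in> {1..n} ==> v i < v j \<longleftrightarrow> w i < w j"
 shows "\<exists>i\<in>{1..n}. ostat n v k = v i & ostat n w k = w i"
proof -
 let ?I = "%v. {i \<in> {1..n}. k <= card {j \<in> {1..n}. v j <= v i}}"
 have le: "v i <= v j \<longleftrightarrow> w i <= w j" if "i \<in> {1..n}" "j \<in> {1..n}" for i j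
  using ord[OF that(2,1)] by (simp add: not_less[symmetric])
 have "{j \<in> {1..n}. v j <= v i} = {j \<in> {1..n}. w j <= w i}" if "i \<in> {1..n}" for i using le that by blast
 hence I: "?I v = ?I w" by auto
 have o: "ostat n v k = Min (v ` ?I v)" "ostat n w k = Min (w ` ?I w)" using k by (simp_all add: ostat_def)
 have ne: "?I v ~= {}"
 proof
  assume e: "?I v = {}"
  have "{i \<in> {1..n}. v i <= Max (v ` {1..n})} = {1..n}" by auto
  moreover have "Max (v ` {1..n}) \<in> v ` {1..n}" using k by (intro Max_in) auto
  then obtain m where m: "m \<in> {1..n}" "v m = Max (v ` {1..n})" by (metis imageE)
  ultimately have "m \<in> ?I v" using k by simp
  thus False using e by blast
 qed
 have "Min (v ` ?I v) \<in> v ` ?I v" using ne by (intro Min_in) auto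
 then obtain i where i: "i \<in> ?I v" "v i = Min (v ` ?I v)"
  by - (erule imageE, rule that, assumption, erule HOL.sym)
 have min: "v i <= v j" if "j \<in> ?I v" for j unfolding i(2) by (rule Min_le) (use that in auto)
 have wi: "Min (w ` ?I w) = w i"
 proof (rule Min_eqI)
  show "w i \<in> w ` ?I w" using i(1) I by blast
  fix y assume "y \<in> w ` ?I w"
  then obtain j where j: "j \<in> ?I w" "y = w j"
   by - (erule imageE, rule that, assumption+)
  hence "j \<in> ?I v" unfolding I by simp
  hence "v i <= v j" "i \<in> {1..n}" "j \<in> {1..n}" using min i(1) by blast+
  hence "w i <= w j" using le by blast
  thus "w i <= y" unfolding j(2) .
 qed simp
 show ?thesis
 proof (intro bexI conjI)
  show "ostat n v k = v i" unfolding o(1) by (rule i(2)[symmetric])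
  show "ostat n w k = w i" unfolding o(2) by (rule wi)
  show "i \<in> {1..n}" using i(1) by blast
 qed
qed

lemma ostat_rank:
 assumes i: "i \<in> {1..n}"
 shows "ostat n v (card {j \<in> {1..n}. v j <= v i}) = v i"
  and "1 <= card {j \<in> {1..n}. v j <= v i}" "card {j \<in> {1..n}. v j <= v i} <= n"
proof -
 let ?k = "card {j \<in> {1..n}. v j <= v i}"
 have "card {i} <= ?k" by (rule card_mono) (use i in auto)
 thus k1: "1 <= ?k" by simp
 have "?k <= card {1..n}" by (rule card_mono) auto
 thus k2: "?k <= n" by simp
 have "ostat n v ?k <= v i" using ostat_le_iff[OF k1 k2] by simp
 moreover have "\<not> ostat n v ?k < v i"
 proof
  assume lt: "ostat n v ?k < v i"
  have "?k <= card {j \<in> {1..n}. v j <= ostat n v ?k}" using ostat_le_iff[OF k1 k2] by blast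
  also have "... < ?k"
  proof (rule psubset_card_mono, simp, rule psubsetI)
   show "{j \<in> {1..n}. v j <= ostat n v ?k} \<subseteq> {j \<in> {1..n}. v j <= v i}"
    using lt by (blast intro: order_trans less_imp_le)
   have "i \<notin> {j \<in> {1..n}. v j <= ostat n v ?k}" using lt by (simp add: not_le)
   moreover have "i \<in> {j \<in> {1..n}. v j <= v i}" using i by blast
   ultimately show "{j \<in> {1..n}. v j <= ostat n v ?k} ~= {j \<in> {1..n}. v j <= v i}" by blast
  qed
  finally show False by simp
 qed
 ultimately show "ostat n v ?k = v i" by simp
qed

lemma ostat_perturb:
 assumes "\<And>i. i \<in> {1..n} ==> \<bar>v i - w i\<bar> <= e" "0 <= e"
 shows "\<bar>ostat n v k - ostat n w k\<bar> <= e"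
proof (cases "1 <= k & k <= n")
 case True
 have *: "ostat n w k <= ostat n v k + e" if d: "\<And>i. i \<in> {1..n} ==> \<bar>v i - w i\<bar> <= e" for v w
 proof -
  have "k <= card {i \<in> {1..n}. v i <= ostat n v k}" using ostat_le_iff True by blast
  also have "... <= card {i \<in> {1..n}. w i <= ostat n v k + e}"
   by (rule card_mono) (use d in \<open>fastforce+\<close>)
  finally show ?thesis using ostat_le_iff True by blast
 qed
 have "ostat n v k <= ostat n w k + e" by (rule *) (use assms(1) in \<open>simp add: abs_minus_commute\<close>)
 moreover have "ostat n w k <= ostat n v k + e" by (rule *) (use assms(1) in simp)
 ultimately show ?thesis by linarith
qed (use assms(2) in \<open>auto simp: ostat_def\<close>)

lemma ostat_continuous:
 assumes "\<And>i. i \<in> {1..n} ==> continuous_on S (f i)"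
 shows "continuous_on S (%t::real. ostat n (%i. f i t) k)"
 unfolding continuous_on_iff
proof (intro ballI allI impI)
 fix t e assume t: "t \<in> S" and e: "(0::real) < e"
 have "\<exists>d>0. \<forall>t'\<in>S. dist t' t < d --> dist (f i t') (f i t) < e / 2" if "i \<in> {1..n}" for i
  using assms[OF that] t e unfolding continuous_on_iff by (meson half_gt_zero)
 then obtain d where d: "\<And>i. i \<in> {1..n} ==> d i > 0 & (\<forall>t'\<in>S. dist t' t < d i --> dist (f i t') (f i t) < e / 2)"
  by metis
 let ?d = "Min (insert 1 (d ` {1..n}))"
 show "\<exists>d>0. \<forall>t'\<in>S. dist t' t < d --> dist (ostat n (%i. f i t') k) (ostat n (%i. f i t) k) < e"
 proof (intro exI[of _ ?d] conjI ballI impI)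
  show "0 < ?d" using d by (subst Min_gr_iff) auto
  fix t' assume t': "t' \<in> S" "dist t' t < ?d"
  have "\<bar>ostat n (%i. f i t') k - ostat n (%i. f i t) k\<bar> <= e / 2"
  proof (rule ostat_perturb)
   fix i assume i: "i \<in> {1..n}"
   have "?d <= d i" using i by (intro Min_le) auto
   hence "dist (f i t') (f i t) < e / 2" using d[OF i] t' by (meson order_less_le_trans)
   thus "\<bar>f i t' - f i t\<bar> <= e / 2" by (simp add: dist_real_def)
  qed (use e in simp)
  thus "dist (ostat n (%i. f i t') k) (ostat n (%i. f i t) k) < e"
   using e by (simp add: dist_real_def)
 qed
qed

section \<open>Horizontal isotopies\<close>

lemma conv_less:
 fixes a b s :: real
 assumes "a < a'" "b < b'" "0 <= s" "s <= 1"
 shows "(1 - s) * a + s * b < (1 - s) * a' + s * b'"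
proof (cases "s = 0")
 case False
 hence "s * b < s * b'" using assms by simp
 moreover have "(1 - s) * a <= (1 - s) * a'" using assms by (simp add: mult_left_mono)
 ultimately show ?thesis by simp
qed (use assms in simp)

text \<open>Whether two strands cross at a height depends only on their order nearby.\<close>

lemma passes_cong:
 assumes p: "passes g g' t"
  and ord: "\<And>u. u \<in> {0..1} ==> (g u < g' u \<longleftrightarrow> h u < h' u)" "\<And>u. u \<in> {0..1} ==> (g' u < g u \<longleftrightarrow> h' u < h u)"
 shows "passes h h' t"
proof -
 obtain e where e: "e > 0" "e <= t" "e <= 1 - t" and
  *: "\<And>s. 0 < s ==> s < e ==> (g (t - s) - g' (t - s)) * (g (t + s) - g' (t + s)) < 0"
  using p unfolding passes_def by blast
 show ?thesis
  unfolding passes_def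
 proof (intro exI[of _ e] conjI allI impI)
  fix s assume s: "0 < s & s < e"
  hence u: "t - s \<in> {0..1}" "t + s \<in> {0..1}" using e by auto
  show "(h (t - s) - h' (t - s)) * (h (t + s) - h' (t + s)) < 0"
   using *[of s] s ord(1)[OF u(1)] ord(1)[OF u(2)] ord(2)[OF u(1)] ord(2)[OF u(2)]
   by (simp add: mult_less_0_iff)
 qed (use e in auto)
qed

definition same_order :: "nat => (nat => real => real) => (nat => real => real) => real => bool" where
 "same_order n f f' t \<longleftrightarrow> (\<forall>i\<in>{1..n}. \<forall>j\<in>{1..n}. f i t < f j t \<longleftrightarrow> f' i t < f' j t)"

lemma same_orderD:
 assumes "same_order n f f' t" "i \<in> {1..n}" "j \<in> {1..n}"
 shows "f i t < f j t \<longleftrightarrow> f' i t < f' j t" "f i t <= f j t \<longleftrightarrow> f' i t <= f' j t" "f i t = f j t \<longleftrightarrow> f' i t = f' j t"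
proof -
 have 1: "f i t < f j t \<longleftrightarrow> f' i t < f' j t" and 2: "f j t < f i t \<longleftrightarrow> f' j t < f' i t"
  using assms unfolding same_order_def by blast+
 show "f i t < f j t \<longleftrightarrow> f' i t < f' j t" by (rule 1)
 show "f i t <= f j t \<longleftrightarrow> f' i t <= f' j t" using 2 by linarith
 show "f i t = f j t \<longleftrightarrow> f' i t = f' j t" using 1 2 by linarith
qed

text \<open>The bottom position of a strand is the number of strands ending at or to the left of it. So it is determined by
the order of the strands at height \<open>0\<close>.\<close>

lemma config_bottom_rank:
 assumes c: "config n f" and i: "i \<in> {1..n}"
 shows "f i 0 = real (card {j \<in> {1..n}. f j 0 <= f i 0})"
proof -
 obtain m where m: "m \<in> {1..n}" "f i 0 = real m" using configD(3)[OF c i] by blast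
 have inj: "inj_on (%j. f j 0) {j \<in> {1..n}. f j 0 <= f i 0}"
  by (rule inj_onI) (use config_bottom_inj[OF c] in blast)
 have "(%j. f j 0) ` {j \<in> {1..n}. f j 0 <= f i 0} = real ` {1..m}"
 proof (intro equalityI subsetI)
  fix x assume "x \<in> (%j. f j 0) ` {j \<in> {1..n}. f j 0 <= f i 0}"
  then obtain j where j: "j \<in> {1..n}" "f j 0 <= f i 0" "x = f j 0" by blast
  then obtain l where "l \<in> {1..n}" "f j 0 = real l" using configD(3)[OF c j(1)] by blast
  thus "x \<in> real ` {1..m}" using j m by auto
 next
  fix x assume "x \<in> real ` {1..m}"
  then obtain l where l: "l \<in> {1..m}" "x = real l" by blast
  hence "x \<in> (%i. f i 0) ` {1..n}" unfolding config_bottom_surj[OF c] using m(1) by auto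
  then obtain j where "j \<in> {1..n}" "x = f j 0" by blast
  thus "x \<in> (%j. f j 0) ` {j \<in> {1..n}. f j 0 <= f i 0}" using l m(2) by auto
 qed
 hence "card {j \<in> {1..n}. f j 0 <= f i 0} = card (real ` {1..m})"
  using card_image[OF inj] by simp
 also have "... = m" by (simp add: card_image)
 finally show ?thesis using m(2) by simp
qed

lemma same_order_card:
 assumes "same_order n f f' t" "i \<in> {1..n}"
 shows "card {j \<in> {1..n}. f j t <= f i t} = card {j \<in> {1..n}. f' j t <= f' i t}"
  "card {j \<in> {1..n}. f j t < f i t} = card {j \<in> {1..n}. f' j t < f' i t}"
 by (rule arg_cong[where f = card], use same_orderD[OF assms(1) _ assms(2)] in blast)+

text \<open>At each height the interpolated values are ordered like the given ones, so the interpolated strands meet and cross at the same heights.\<close>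

lemma config_convex:
 assumes c: "config n f" and c': "config n f'" and o: "\<And>t. t \<in> {0..1} ==> same_order n f f' t"
  and s: "0 <= s" "s <= 1"
 shows "config n (%i t. (1 - s) * f i t + s * f' i t)"
proof -
 let ?g = "%i t. (1 - s) * f i t + s * f' i t"
 have lt: "?g i t < ?g j t \<longleftrightarrow> f i t < f j t" if t: "t \<in> {0..1}" and ij: "i \<in> {1..n}" "j \<in> {1..n}" for i j t
 proof
  assume "f i t < f j t"
  thus "?g i t < ?g j t" using conv_less same_orderD(1)[OF o[OF t] ij] s by blast
 next
  assume a: "?g i t < ?g j t"
  show "f i t < f j t"
  proof (rule ccontr)
   assume "\<not> f i t < f j t"
   hence "f j t < f i t \<or> f j t = f i t" by linarith
   thus False
   proof
    assume "f j t < f i t"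
    hence "?g j t < ?g i t" using conv_less same_orderD(1)[OF o[OF t] ij(2,1)] s by blast
    thus False using a by linarith
   next
    assume e: "f j t = f i t"
    hence "f' j t = f' i t" using same_orderD(3)[OF o[OF t] ij(2,1)] by simp
    thus False using a e by simp
   qed
  qed
 qed
 have eq: "?g i t = ?g j t \<longleftrightarrow> f i t = f j t" if t: "t \<in> {0..1}" and ij: "i \<in> {1..n}" "j \<in> {1..n}" for i j t
  using lt[OF t ij] lt[OF t ij(2,1)] by linarith
 have zero: "?g i 0 = f i 0" if i: "i \<in> {1..n}" for i
 proof -
  have "f i 0 = f' i 0"
   using config_bottom_rank[OF c i] config_bottom_rank[OF c' i] same_order_card(1)[OF o i, of 0] by simp
  thus ?thesis by (simp add: algebra_simps)
 qed
 show ?thesis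
  unfolding config_def
 proof (intro conjI ballI impI)
  fix i assume i: "i \<in> {1..n}"
  show "continuous_on {0..1} (?g i)" by (intro continuous_intros configD(1)[OF c i] configD(1)[OF c' i])
  show "?g i 1 = real i" using configD(2)[OF c i] configD(2)[OF c' i] by (simp add: algebra_simps)
  show "?g i 0 \<in> real ` {1..n}" unfolding zero[OF i] by (rule configD(3)[OF c i])
  fix t :: real assume t: "t \<in> {0..1}"
  have "(1 - s) * 0 + s * 0 < ?g i t"
   by (rule conv_less) (use configD(4)[OF c i t] configD(4)[OF c' i t] s in auto)
  thus "0 < ?g i t" by simp
  have "?g i t < (1 - s) * (real n + 1) + s * (real n + 1)"
   by (rule conv_less) (use configD(5)[OF c i t] configD(5)[OF c' i t] s in auto)
  thus "?g i t < real n + 1" by (simp add: algebra_simps)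
 next
  show "inj_on (%i. ?g i 0) {1..n}"
  proof (rule inj_onI)
   fix i j assume "i \<in> {1..n}" "j \<in> {1..n}" "?g i 0 = ?g j 0"
   thus "i = j" using config_bottom_inj[OF c] zero by metis
  qed
 next
  fix i j k and t :: real assume "i \<in> {1..n}" "j \<in> {1..n}" "k \<in> {1..n}" "t \<in> {0..1}" "?g i t = ?g j t & ?g j t = ?g k t"
  thus "i = j \<or> j = k \<or> i = k" using config_two[OF c] eq by metis
 next
  fix i j and t :: real assume ij: "i \<in> {1..n}" "j \<in> {1..n}" and t: "t \<in> {0<..<1}" and ne: "i ~= j & ?g i t = ?g j t"
  have "t \<in> {0..1}" using t by auto
  hence "passes (f i) (f j) t" using config_passes[OF c ij] eq ij ne t by blast
  thus "passes (?g i) (?g j) t"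
   by (rule passes_cong) (rule lt[OF _ ij, symmetric], assumption, rule lt[OF _ ij(2,1), symmetric], assumption)
 qed
qed

lemma ostat_nodes:
 assumes v: "\<And>i. i \<in> {1..n} ==> 0 < v i & v i < real n + 1"
  and w: "\<And>i. i \<in> {1..n} ==> 0 < w i & w i < real n + 1"
  and ord: "\<And>i j. i \<in> {1..n} ==> j \<in> {1..n} ==> v i < v j \<longleftrightarrow> w i < w j"
 shows "nodes (Suc n) (ostat n v) (ostat n w)"
proof -
 have "ostat n v k <= ostat n v (Suc k) & ostat n w k <= ostat n w (Suc k) &
   (ostat n v k = ostat n v (Suc k) \<longleftrightarrow> ostat n w k = ostat n w (Suc k))" if k: "k < Suc n" for k
 proof -
  have wit: "\<exists>i\<in>{1..n}. ostat n v k = v i & ostat n w k = w i" if "1 <= k" "k <= n" for k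
   by (rule ostat_witness[OF that ord])
  have edge: "ostat n u 0 = 0" "ostat n u (Suc n) = real n + 1" for u by (simp_all add: ostat_def)
  show ?thesis
  proof (cases "k = 0")
   case True
   have "0 < ostat n v (Suc 0) & 0 < ostat n w (Suc 0)"
   proof (cases "n = 0")
    case True thus ?thesis by (simp add: ostat_def)
   next
    case False
    then obtain i where "i \<in> {1..n}" "ostat n v 1 = v i & ostat n w 1 = w i" using wit[of 1] by auto
    thus ?thesis using v w by simp
   qed
   thus ?thesis using True edge by simp
  next
   case k0: False
   then obtain i where i: "i \<in> {1..n}" "ostat n v k = v i" "ostat n w k = w i" using wit[of k] k by auto
   show ?thesis
   proof (cases "k = n")
    case True
    thus ?thesis using edge i v[OF i(1)] w[OF i(1)] by simp
   next
    case False
    have mono: "ostat n u k <= ostat n u (Suc k)" for u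
    proof -
     have "Suc k <= card {i \<in> {1..n}. u i <= ostat n u (Suc k)}"
      using ostat_le_iff[of "Suc k" n u "ostat n u (Suc k)"] False k by simp
     thus ?thesis using ostat_le_iff[of k n u "ostat n u (Suc k)"] k0 k by simp
    qed
    obtain j where j: "j \<in> {1..n}" "ostat n v (Suc k) = v j" "ostat n w (Suc k) = w j"
     using wit[of "Suc k"] k False by auto
    have "v i = v j \<longleftrightarrow> w i = w j" using ord[OF i(1) j(1)] ord[OF j(1) i(1)] by linarith
    thus ?thesis using mono[of v] mono[of w] i j by simp
   qed
  qed
 qed
 thus ?thesis unfolding nodes_def by blast
qed

lemma nodes_conv:
 assumes n: "nodes N y z" and s: "0 <= s" "s <= 1"
 shows "nodes N y (%k. (1 - s) * y k + s * z k)"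
 unfolding nodes_def
proof (intro allI impI)
 fix k assume k: "k < N"
 have *: "y k <= y (Suc k)" "z k <= z (Suc k)" "y k = y (Suc k) \<longleftrightarrow> z k = z (Suc k)"
  using n k unfolding nodes_def by blast+
 show "y k <= y (Suc k) & (1 - s) * y k + s * z k <= (1 - s) * y (Suc k) + s * z (Suc k) &
  (y k = y (Suc k)) = ((1 - s) * y k + s * z k = (1 - s) * y (Suc k) + s * z (Suc k))"
 proof (cases "y k = y (Suc k)")
  case True thus ?thesis using * by simp
 next
  case False
  hence "(1 - s) * y k + s * z k < (1 - s) * y (Suc k) + s * z (Suc k)"
   using conv_less[of "y k" "y (Suc k)" "z k" "z (Suc k)" s] * s by linarith
  thus ?thesis using False * by simp
 qed
qed

lemma plmap_onto:
 assumes n: "nodes N y z" and x: "z 0 <= x" "x <= z N"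
 shows "\<exists>x'. y 0 <= x' & x' <= y N & plmap N y z x' = x"
proof -
 have "continuous_on {y 0..y N} (%x. plmap N (%k. y k) (%k. z k) x)"
  by (rule plmap_continuous[where y = "%k _. y k" and z = "%k _. z k"])
    (use n in \<open>auto intro: continuous_intros\<close>)
 thus ?thesis
  using IVT'[of "plmap N y z" "y 0" x "y N"] plmap_node[OF n] nodes_mono[OF n, of 0 N] x by auto
qed

lemma plmap_range:
 assumes n: "nodes N y z" and x: "y 0 <= x" "x <= y N"
 shows "z 0 <= plmap N y z x" "plmap N y z x <= z N"
proof -
 have m: "plmap N y z a <= plmap N y z b" if "y 0 <= a" "a <= b" "b <= y N" for a b
  using plmap_strict[OF n, of a b] that by (cases "a = b") auto
 show "z 0 <= plmap N y z x" using m[of "y 0" x] plmap_node[OF n, of 0] x by simp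
 show "plmap N y z x <= z N" using m[of x "y N"] plmap_node[OF n, of N] x by simp
qed

text \<open>Two families with the same order at every height are isotopic: at height \<open>t\<close> apply the piecewise linear map
that moves the \<open>k\<close>-th smallest value of the first family towards the \<open>k\<close>-th smallest value of the second one.\<close>

lemma isotopic_reorder:
 assumes b: "dg n b f" and c': "config n f'" and o: "\<And>t. t \<in> {0..1} ==> same_order n f f' t"
 shows "\<exists>\<phi>. isotopic n b (map_diagram \<phi> b) & dg n (map_diagram \<phi> b) f' &
  (\<forall>i\<in>{1..n}. \<forall>t\<in>{0..1}. \<phi> (f i t, t) = (f' i t, t))"
proof -
 have c: "config n f" using b by (simp add: dg_def)
 define y where "y = (%k t. ostat n (%i. f i t) k)"
 define y' where "y' = (%k t. ostat n (%i. f' i t) k)"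
 define z where "z = (%s k t. (1 - s) * y k t + s * y' k t)"
 define H where "H = (%s p. (plmap (Suc n) (%k. y k (snd p)) (%k. z s k (snd p)) (fst p), snd p :: real))"
 have nd: "nodes (Suc n) (%k. y k t) (%k. z s k t)" if "t \<in> {0..1}" "s \<in> {0..1}" for s t
 proof -
  have "nodes (Suc n) (%k. y k t) (%k. y' k t)"
   unfolding y_def y'_def
  proof (rule ostat_nodes)
   fix i assume i: "i \<in> {1..n}"
   show "0 < f i t & f i t < real n + 1" "0 < f' i t & f' i t < real n + 1"
    using configD(4,5)[OF c i that(1)] configD(4,5)[OF c' i that(1)] by blast+
   fix j assume "j \<in> {1..n}"
   thus "f i t < f j t \<longleftrightarrow> f' i t < f' j t" by (rule same_orderD(1)[OF o[OF that(1)] i])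
  qed
  thus ?thesis unfolding z_def using that(2) by (intro nodes_conv) auto
 qed
 have edge: "y 0 t = 0" "y (Suc n) t = real n + 1" "z s 0 t = 0" "z s (Suc n) t = real n + 1" for s t
  by (simp_all add: y_def y'_def z_def ostat_def algebra_simps)
 have onto: "H s ` E n = E n" if s: "s \<in> {0..1}" for s
 proof (intro equalityI subsetI)
  fix q assume "q \<in> H s ` E n"
  then obtain x t where xt: "0 <= x" "x <= real n + 1" "t \<in> {0..1}" "q = H s (x, t)" by (auto simp: E_def)
  have "0 <= plmap (Suc n) (%k. y k t) (%k. z s k t) x" "plmap (Suc n) (%k. y k t) (%k. z s k t) x <= real n + 1"
   using plmap_range[OF nd[OF xt(3) s], of x] xt edge by simp_all
  thus "q \<in> E n" using xt by (simp add: H_def E_def)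
 next
  fix q assume "q \<in> E n"
  then obtain x t where xt: "0 <= x" "x <= real n + 1" "t \<in> {0..1}" "q = (x, t)" by (auto simp: E_def)
  obtain x' where "0 <= x'" "x' <= real n + 1" "plmap (Suc n) (%k. y k t) (%k. z s k t) x' = x"
   using plmap_onto[OF nd[OF xt(3) s], of x] xt edge by auto
  hence "q = H s (x', t)" "(x', t) \<in> E n" using xt by (auto simp: H_def E_def)
  thus "q \<in> H s ` E n" by blast
 qed
 have inj: "inj_on (H s) (E n)" if s: "s \<in> {0..1}" for s
 proof (rule inj_onI)
  fix p q assume p: "p \<in> E n" and q: "q \<in> E n" and eq: "H s p = H s q"
  obtain x t where xt: "0 <= x" "x <= real n + 1" "t \<in> {0..1}" "p = (x, t)" using p by (auto simp: E_def)
  obtain x' t' where xt': "0 <= x'" "x' <= real n + 1" "t' \<in> {0..1}" "q = (x', t')" using q by (auto simp: E_def)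
  have tt: "t' = t" using eq xt xt' by (simp add: H_def)
  have e: "plmap (Suc n) (%k. y k t) (%k. z s k t) x = plmap (Suc n) (%k. y k t) (%k. z s k t) x'"
   using eq xt xt' tt by (simp add: H_def)
  have "x = x'"
  proof (rule ccontr)
   assume "x ~= x'"
   then consider "x < x'" | "x' < x" by linarith
   thus False
    using plmap_strict[OF nd[OF xt(3) s], of x x'] plmap_strict[OF nd[OF xt(3) s], of x' x] edge xt xt' e
    by cases simp_all
  qed
  thus "p = q" using xt xt' tt by simp
 qed
 have cont: "continuous_on ({0..1} \<times> E n) (%q. H (fst q) (snd q))"
 proof -
  have sn: "continuous_on ({0..1} \<times> E n) (%q::real \<times> point. snd (snd q))" by (intro continuous_intros)
  have cy: "continuous_on ({0..1} \<times> E n) (%q::real \<times> point. y k (snd (snd q)))" for k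
   unfolding y_def
   by (rule continuous_on_compose2[OF ostat_continuous[OF configD(1)[OF c]] sn]) (auto simp: E_def)
  have cy': "continuous_on ({0..1} \<times> E n) (%q::real \<times> point. y' k (snd (snd q)))" for k
   unfolding y'_def
   by (rule continuous_on_compose2[OF ostat_continuous[OF configD(1)[OF c']] sn]) (auto simp: E_def)
  have "continuous_on ({0..1} \<times> E n) (%q::real \<times> point. plmap (Suc n) (%k. y k (snd (snd q))) (%k. z (fst q) k (snd (snd q))) (fst (snd q)))"
  proof (rule plmap_continuous)
   fix q :: "real \<times> point" assume "q \<in> {0..1} \<times> E n"
   thus "nodes (Suc n) (%k. y k (snd (snd q))) (%k. z (fst q) k (snd (snd q)))"
    by (intro nd) (auto simp: E_def)
  next
   fix k show "continuous_on ({0..1} \<times> E n) (%q::real \<times> point. z (fst q) k (snd (snd q)))"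
    unfolding z_def by (intro continuous_intros cy cy')
  qed (intro continuous_intros cy)+
  thus ?thesis unfolding H_def by (intro continuous_on_Pair sn)
 qed
 have Hf: "H s (f i t, t) = ((1 - s) * f i t + s * f' i t, t)" if "s \<in> {0..1}" "i \<in> {1..n}" "t \<in> {0..1}" for s i t
 proof -
  let ?k = "card {j \<in> {1..n}. f j t <= f i t}"
  have k: "?k <= n" "f i t = y ?k t" using ostat_rank[OF that(2), of "%i. f i t"] by (simp_all add: y_def)
  have k': "f' i t = y' ?k t"
   unfolding same_order_card(1)[OF o[OF that(3)] that(2)]
   using ostat_rank(1)[OF that(2), of "%i. f' i t"] by (simp add: y'_def)
  have "plmap (Suc n) (%k. y k t) (%k. z s k t) (y ?k t) = z s ?k t"
   using plmap_node[OF nd[OF that(3,1)], of ?k] k(1) by simp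
  thus ?thesis unfolding H_def using k(2) k' by (simp add: z_def)
 qed
 let ?g = "%s i t. (1 - s) * f i t + s * f' i t"
 have d: "dg n (map_diagram (H s) b) (?g s)" if s: "s \<in> {0..1}" for s
 proof (rule dg_map[OF b _ inj[OF s]])
  show "config n (?g s)" by (rule config_convex[OF c c' o]) (use s in auto)
  fix i assume i: "i \<in> {1..n}"
  show "H s ` curve (f i) = curve (?g s i)"
   unfolding curve_def image_image using Hf[OF s i] by (intro image_cong) auto
 qed (simp add: H_def)
 have H0: "H 0 p = p" if p: "p \<in> E n" for p
 proof -
  obtain x t where xt: "0 <= x" "x <= real n + 1" "t \<in> {0..1}" "p = (x, t)" using p by (auto simp: E_def)
  have z0: "(%k. z 0 k t) = (%k. y k t)" by (simp add: z_def)
  have "plmap (Suc n) (%k. y k t) (%k. y k t) x = x"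
   by (rule plmap_id) (use nd[OF xt(3), of 0] z0 edge xt in auto)
  thus ?thesis using xt z0 by (simp add: H_def)
 qed
 have "isotopic n b (map_diagram (H 1) b)"
  by (rule isotopicI[OF dg_is_diagram[OF b] cont onto inj H0 dg_is_diagram[OF d]])
 moreover have "dg n (map_diagram (H 1) b) f'" using d[of 1] by simp
 ultimately show ?thesis using Hf[of 1] by (intro exI[of _ "H 1"]) simp
qed

section \<open>The order of the strands is determined by the crossings\<close>

definition lt_count :: "nat => (nat => real => real) => real => real => nat" where
 "lt_count n f x t = card {j \<in> {1..n}. f j t < x}"

text \<open>The crossings, each given by the number of strands to its left and its height, without regard to the kind.\<close>

definition crs :: "nat => (nat => real => real) => (nat \<times> real) set" where
 "crs n f = (%p. (lt_count n f (fst p) (snd p), snd p)) ` meets n f"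

lemma eventually_lt_right:
 assumes "config n f" "i \<in> {1..n}" "j \<in> {1..n}" "0 <= u" "u < 1" "f i u < f j u"
 shows "eventually (%v. f i v < f j v) (at_right u)"
proof -
 have c: "continuous_on {0..1} (%v. f j v - f i v)"
  by (intro continuous_intros configD(1)[OF assms(1)] assms)
 have "((%v. f j v - f i v) \<longlongrightarrow> f j u - f i u) (at u within {0..1})"
  using c assms(4,5) unfolding continuous_on_def by simp
 hence "((%v. f j v - f i v) \<longlongrightarrow> f j u - f i u) (at u within {u..1})"
  by (rule tendsto_within_subset) (use assms(4) in auto)
 hence "((%v. f j v - f i v) \<longlongrightarrow> f j u - f i u) (at_right u)"
  by (simp add: at_within_Icc_at_right[OF assms(5)])
 hence "eventually (%v. 0 < f j v - f i v) (at_right u)"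
  by (rule order_tendstoD) (use assms(6) in simp)
 thus ?thesis by (rule eventually_mono) simp
qed

lemma eventually_lt_left:
 assumes "config n f" "i \<in> {1..n}" "j \<in> {1..n}" "0 < u" "u <= 1" "f i u < f j u"
 shows "eventually (%v. f i v < f j v) (at_left u)"
proof -
 have c: "continuous_on {0..1} (%v. f j v - f i v)"
  by (intro continuous_intros configD(1)[OF assms(1)] assms)
 have "((%v. f j v - f i v) \<longlongrightarrow> f j u - f i u) (at u within {0..1})"
  using c assms(4,5) unfolding continuous_on_def by simp
 hence "((%v. f j v - f i v) \<longlongrightarrow> f j u - f i u) (at u within {0..u})"
  by (rule tendsto_within_subset) (use assms(5) in auto)
 hence "((%v. f j v - f i v) \<longlongrightarrow> f j u - f i u) (at_left u)"
  by (simp add: at_within_Icc_at_left[OF assms(4)])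
 hence "eventually (%v. 0 < f j v - f i v) (at_left u)"
  by (rule order_tendstoD) (use assms(6) in simp)
 thus ?thesis by (rule eventually_mono) simp
qed

lemma order_limit:
 assumes c: "config n f" and c': "config n f'" and u: "0 <= u" "u < 1"
  and o: "\<And>v. u < v ==> v <= 1 ==> same_order n f f' v"
  and ij: "i \<in> {1..n}" "j \<in> {1..n}" and lt: "f i u < f j u"
 shows "f' i u <= f' j u"
proof (rule ccontr)
 assume "\<not> f' i u <= f' j u"
 hence "f' j u < f' i u" by simp
 hence "eventually (%v. f' j v < f' i v) (at_right u)" by (rule eventually_lt_right[OF c' ij(2,1) u])
 moreover have "eventually (%v. f i v < f j v) (at_right u)" by (rule eventually_lt_right[OF c ij u lt])
 moreover have "eventually (%v. v \<in> {u<..<1}) (at_right u)" by (rule eventually_at_right_real[OF u(2)])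
 ultimately have "eventually (%v. False) (at_right u)"
 proof eventually_elim
  case (elim v)
  hence "same_order n f f' v" using o by simp
  thus False using same_orderD(1)[OF _ ij] elim by fastforce
 qed
 thus False by simp
qed

lemma initial_segments_eq:
 assumes o: "same_order n f f' v" and L: "L \<subseteq> {1..n}" "L' \<subseteq> {1..n}" "card L = card L'"
  and i: "\<And>a b. a \<in> L ==> b \<in> {1..n} - L ==> f a v < f b v"
  and i': "\<And>a b. a \<in> L' ==> b \<in> {1..n} - L' ==> f' a v < f' b v"
 shows "L = L'"
proof (rule ccontr)
 assume ne: "L ~= L'"
 have fin: "finite L" "finite L'" using L finite_subset by blast+
 obtain a where a: "a \<in> L" "a \<notin> L'" using ne fin L(3) card_subset_eq[OF fin(2), of L] by blast
 obtain b where b: "b \<in> L'" "b \<notin> L" using ne fin L(3) card_subset_eq[OF fin(1), of L'] by auto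
 have ab: "a \<in> {1..n}" "b \<in> {1..n}" using a b L by blast+
 have "f a v < f b v" using i a b ab by blast
 moreover have "f' b v < f' a v" using i' a b ab by blast
 ultimately show False using same_orderD(1)[OF o ab] by simp
qed

lemma eventually_segments:
 assumes c: "config n f" and u: "0 <= u" "u < 1" and L: "L \<subseteq> {1..n}"
  and lt: "\<And>a b. a \<in> L ==> b \<in> {1..n} - L ==> f a u < f b u"
 shows "eventually (%v. \<forall>a\<in>L. \<forall>b\<in>{1..n} - L. f a v < f b v) (at_right u)"
proof (intro eventually_ball_finite ballI)
 show "finite L" using L finite_subset by blast
 show "finite ({1..n} - L)" by simp
 fix a b assume "a \<in> L" "b \<in> {1..n} - L"
 thus "eventually (%v. f a v < f b v) (at_right u)"
  using L by (intro eventually_lt_right[OF c _ _ u] lt) auto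
qed

text \<open>Two strands that meet at height \<open>u\<close> in the first family also do so in the second. By assumption there is a crossing in the second
family at height \<open>u\<close> with as many strands to its left. The strands on its left and those up to and including the
crossing are initial segments of the common order just above \<open>u\<close>, hence determined by their sizes.\<close>

lemma coincidence_transfer:
 assumes c: "config n f" and c': "config n f'" and crs: "crs n f = crs n f'" and u: "0 <= u" "u < 1"
  and o: "\<And>v. u < v ==> v <= 1 ==> same_order n f f' v"
  and ij: "i \<in> {1..n}" "j \<in> {1..n}" and eq: "f i u = f j u"
 shows "f' i u = f' j u"
proof (cases "i = j")
 case False
 have u1: "u \<in> {0..1}" using u by simp
 have "(f i u, u) \<in> meets n f" unfolding meets_def using ij eq u1 False by blast
 hence "(lt_count n f (f i u) u, u) \<in> crs n f" unfolding crs_def by force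
 hence "(lt_count n f (f i u) u, u) \<in> crs n f'" by (simp only: crs)
 then obtain q where qe: "(lt_count n f (f i u) u, u) = (lt_count n f' (fst q) (snd q), snd q)" and qm: "q \<in> meets n f'"
  unfolding crs_def by (rule imageE)
 have "lt_count n f (f i u) u = lt_count n f' (fst q) (snd q)" "u = snd q"
  using arg_cong[OF qe, of fst] arg_cong[OF qe, of snd] by (simp_all only: fst_conv snd_conv)
 note q = qm this[symmetric]
 then obtain i' j' where ij': "i' \<in> {1..n}" "j' \<in> {1..n}" "i' ~= j'" and eq': "f' i' u = f' j' u" and fq: "fst q = f' i' u"
  unfolding meets_def by auto
 define L where "L = {l \<in> {1..n}. f l u < f i u}"
 define L' where "L' = {l \<in> {1..n}. f' l u < f' i' u}"
 have card: "card L = card L'" using q fq by (simp add: lt_count_def L_def L'_def)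
 have seg: "f a u < f b u" if "a \<in> L" "b \<in> {1..n} - L" for a b using that by (auto simp: L_def)
 have seg': "f' a u < f' b u" if "a \<in> L'" "b \<in> {1..n} - L'" for a b using that by (auto simp: L'_def)
 have segm: "f a u < f b u" if "a \<in> L \<union> {i, j}" "b \<in> {1..n} - (L \<union> {i, j})" for a b
 proof -
  have "f b u ~= f i u" using config_two[OF c _ ij u1, of b] that eq False by blast
  hence "f i u < f b u" using that by (auto simp: L_def)
  thus ?thesis using that eq by (auto simp: L_def)
 qed
 have segm': "f' a u < f' b u" if "a \<in> L' \<union> {i', j'}" "b \<in> {1..n} - (L' \<union> {i', j'})" for a b
 proof -
  have "f' b u ~= f' i' u" using config_two[OF c' _ ij'(1,2) u1, of b] that eq' ij'(3) by blast
  hence "f' i' u < f' b u" using that by (auto simp: L'_def)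
  thus ?thesis using that eq' by (auto simp: L'_def)
 qed
 have sub: "L \<subseteq> {1..n}" "L' \<subseteq> {1..n}" by (auto simp: L_def L'_def)
 have sub2: "L \<union> {i, j} \<subseteq> {1..n}" "L' \<union> {i', j'} \<subseteq> {1..n}" using sub ij ij' by blast+
 have nin: "i \<notin> L" "j \<notin> L" "i' \<notin> L'" "j' \<notin> L'" using eq eq' by (auto simp: L_def L'_def)
 have fin: "finite L" "finite L'" using sub finite_subset by blast+
 have card2: "card (L \<union> {i, j}) = card (L' \<union> {i', j'})"
  using card nin fin False ij'(3) by (simp add: card_Un_disjoint)
 have e1: "eventually (%v. \<forall>a\<in>L. \<forall>b\<in>{1..n} - L. f a v < f b v) (at_right u)"
  by (rule eventually_segments[OF c u sub(1)]) (rule seg)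
 have e2: "eventually (%v. \<forall>a\<in>L'. \<forall>b\<in>{1..n} - L'. f' a v < f' b v) (at_right u)"
  by (rule eventually_segments[OF c' u sub(2)]) (rule seg')
 have e3: "eventually (%v. \<forall>a\<in>L \<union> {i, j}. \<forall>b\<in>{1..n} - (L \<union> {i, j}). f a v < f b v) (at_right u)"
  by (rule eventually_segments[OF c u sub2(1)]) (rule segm)
 have e4: "eventually (%v. \<forall>a\<in>L' \<union> {i', j'}. \<forall>b\<in>{1..n} - (L' \<union> {i', j'}). f' a v < f' b v) (at_right u)"
  by (rule eventually_segments[OF c' u sub2(2)]) (rule segm')
 have "eventually (%v. L = L' & L \<union> {i, j} = L' \<union> {i', j'}) (at_right u)"
  using e1 e2 e3 e4 eventually_at_right_real[OF u(2)]
 proof eventually_elim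
  case (elim v)
  hence ov: "same_order n f f' v" using o by simp
  have "L = L'" by (rule initial_segments_eq[OF ov sub card]) (use elim in blast)+
  moreover have "L \<union> {i, j} = L' \<union> {i', j'}"
   by (rule initial_segments_eq[OF ov sub2 card2]) (use elim in blast)+
  ultimately show ?case by blast
 qed
 from eventually_happens'[OF trivial_limit_at_right_real this]
 have "L = L'" "L \<union> {i, j} = L' \<union> {i', j'}" by blast+
 hence "{i, j} = {i', j'}" using nin by blast
 thus ?thesis using eq' by (auto simp: doubleton_eq_iff)
qed simp

lemma same_order_limit:
 assumes c: "config n f" and c': "config n f'" and crs: "crs n f = crs n f'" and u: "0 <= u" "u < 1"
  and o: "\<And>v. u < v ==> v <= 1 ==> same_order n f f' v"
 shows "same_order n f f' u"
proof -
 have o': "same_order n f' f v" if "u < v" "v <= 1" for v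
  using o[OF that] unfolding same_order_def by blast
 show ?thesis
  unfolding same_order_def
 proof (intro ballI iffI)
  fix i j assume ij: "i \<in> {1..n}" "j \<in> {1..n}"
  show "f' i u < f' j u" if "f i u < f j u"
   using order_limit[OF c c' u o ij that] coincidence_transfer[OF c' c crs[symmetric] u o' ij] that by linarith
  show "f i u < f j u" if "f' i u < f' j u"
   using order_limit[OF c' c u o' ij that] coincidence_transfer[OF c c' crs u o ij] that by linarith
 qed
qed

text \<open>The common order at heights \<open>>= u\<close> persists slightly below: two strands that differ at \<open>u\<close> keep their order, and
those that meet at \<open>u\<close> change sides in both families.\<close>

lemma same_order_below:
 assumes c: "config n f" and c': "config n f'" and u: "0 < u" "u <= 1"
  and o: "\<And>v. u <= v ==> v <= 1 ==> same_order n f f' v"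
 shows "eventually (same_order n f f') (at_left u)"
proof -
 have "eventually (%v. \<forall>i\<in>{1..n}. \<forall>j\<in>{1..n}. f i v < f j v \<longleftrightarrow> f' i v < f' j v) (at_left u)"
 proof (intro eventually_ball_finite ballI)
  fix i j assume ij: "i \<in> {1..n}" "j \<in> {1..n}"
  have ou: "same_order n f f' u" using o u by simp
  consider "f i u < f j u" | "f j u < f i u" | "f i u = f j u" by linarith
  thus "eventually (%v. f i v < f j v \<longleftrightarrow> f' i v < f' j v) (at_left u)"
  proof cases
   case 1
   hence "f' i u < f' j u" using same_orderD(1)[OF ou ij] by simp
   thus ?thesis
    using eventually_lt_left[OF c ij u 1] eventually_lt_left[OF c' ij u] by (auto elim: eventually_elim2)
  next
   case 2
   hence "f' j u < f' i u" using same_orderD(1)[OF ou ij(2,1)] by simp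
   from eventually_lt_left[OF c ij(2,1) u 2] eventually_lt_left[OF c' ij(2,1) u this]
   show ?thesis by (rule eventually_elim2) simp
  next
   case 3
   show ?thesis
   proof (cases "i = j")
    case False
    have e': "f' i u = f' j u" using same_orderD(3)[OF ou ij] 3 by simp
    have ui: "u \<in> {0<..<1}" using config_meet_height[OF c ij False _ 3] u by simp
    obtain e where e: "e > 0" "e <= u" "e <= 1 - u"
     "\<And>s. 0 < s ==> s < e ==> (f i (u - s) - f j (u - s)) * (f i (u + s) - f j (u + s)) < 0"
     using config_passes[OF c ij False ui 3] unfolding passes_def by blast
    obtain d where d: "d > 0" "d <= u" "d <= 1 - u"
     "\<And>s. 0 < s ==> s < d ==> (f' i (u - s) - f' j (u - s)) * (f' i (u + s) - f' j (u + s)) < 0"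
     using config_passes[OF c' ij False ui e'] unfolding passes_def by blast
    \<comment> \<open>Reflection at \<open>u\<close> reverses the order of the two strands in both families, and above \<open>u\<close> the orders agree.\<close>
    have "u - min e d < u" using e d by simp
    hence "eventually (%v. v \<in> {u - min e d<..<u}) (at_left u)" by (rule eventually_at_left_real)
    thus ?thesis
    proof (rule eventually_mono)
     fix v assume v: "v \<in> {u - min e d<..<u}"
     define s where "s = u - v"
     have s: "0 < s" "s < e" "s < d" and vs: "v = u - s" using v by (auto simp: s_def)
     have os: "same_order n f f' (u + s)" using o[of "u + s"] s e by simp
     show "f i v < f j v \<longleftrightarrow> f' i v < f' j v"
      using e(4)[OF s(1,2)] d(4)[OF s(1,3)] same_orderD(1)[OF os ij] same_orderD(1)[OF os ij(2,1)]
      unfolding vs by (simp add: mult_less_0_iff) argo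
    qed
   qed simp
  qed
 qed simp_all
 thus ?thesis unfolding same_order_def .
qed

text \<open>Going downwards from height \<open>1\<close>, where the strand \<open>i\<close> is in position \<open>i\<close> in both families, the two previous lemmas show
that the set of heights down to which the orders agree is closed and open.\<close>

lemma same_order_if_crs:
 assumes c: "config n f" and c': "config n f'" and crs: "crs n f = crs n f'" and t: "t \<in> {0..1}"
 shows "same_order n f f' t"
proof (rule ccontr)
 assume neg: "\<not> same_order n f f' t"
 define S where "S = {v \<in> {0..1}. \<not> same_order n f f' v}"
 define u where "u = Sup S"
 have tS: "t \<in> S" using t neg by (simp add: S_def)
 have bdd: "bdd_above S" by (rule bdd_aboveI[of _ 1]) (simp add: S_def)
 have u: "0 <= u" "u <= 1"
 proof -
  have "t <= u" unfolding u_def by (rule cSup_upper[OF tS bdd])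
  thus "0 <= u" using t by simp
  show "u <= 1" unfolding u_def by (rule cSup_least) (use tS in \<open>auto simp: S_def\<close>)
 qed
 have above: "same_order n f f' v" if "u < v" "v <= 1" for v
 proof (rule ccontr)
  assume "\<not> same_order n f f' v"
  hence "v \<in> S" using that u by (simp add: S_def)
  hence "v <= u" unfolding u_def by (rule cSup_upper[OF _ bdd])
  thus False using that by simp
 qed
 have at_u: "same_order n f f' u"
 proof (cases "u = 1")
  case True
  thus ?thesis unfolding same_order_def using configD(2)[OF c] configD(2)[OF c'] by simp
 next
  case False
  thus ?thesis using same_order_limit[OF c c' crs u(1) _ above] u by simp
 qed
 have upto: "same_order n f f' v" if "u <= v" "v <= 1" for v
  using at_u above that by (cases "v = u") auto
 have "u ~= 0"
 proof
  assume "u = 0"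
  have "t <= u" unfolding u_def by (rule cSup_upper[OF tS bdd])
  hence "t = u" using t \<open>u = 0\<close> by simp
  thus False using at_u neg by simp
 qed
 hence u0: "0 < u" using u by simp
 have "eventually (same_order n f f') (at_left u)" by (rule same_order_below[OF c c' u0 u(2) upto])
 then obtain b where b: "b < u" "\<And>y. b < y ==> y < u ==> same_order n f f' y"
  unfolding eventually_at_left[OF u0] by blast
 obtain s where s: "s \<in> S" "b < s"
  using less_cSupE[of b S] b(1) tS unfolding u_def by blast
 have "s <= u" unfolding u_def by (rule cSup_upper[OF s(1) bdd])
 hence "same_order n f f' s" using b(2)[OF s(2)] at_u by (cases "s = u") auto
 thus False using s(1) by (simp add: S_def)
qed

definition rank :: "diagram => point => nat" where
 "rank b p = card {a \<in> strands b. \<exists>x<fst p. (x, snd p) \<in> a}"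

text \<open>The invariant that determines a diagram up to horizontal isotopy: for each crossing or bar the corresponding letter, with its position
among the strands, and its height.\<close>

definition data :: "diagram => (letter \<times> real) set" where
 "data b = {(Cr k (Suc (rank b p)), snd p) | k p. p \<in> crossings b k} \<union>
      {(Bar (Suc (rank b p)), snd p) | p. p \<in> bars b}"

lemma rank_dg:
 assumes "dg n b f" "t \<in> {0..1}"
 shows "rank b (x, t) = lt_count n f x t"
proof -
 have c: "config n f" and s: "strands b = (%i. curve (f i)) ` {1..n}" using assms(1) by (auto simp: dg_def)
 have "{a \<in> strands b. \<exists>y<x. (y, t) \<in> a} = (%i. curve (f i)) ` {j \<in> {1..n}. f j t < x}"
  unfolding s using assms(2) by (auto simp: mem_curve)
 moreover have "inj_on (%i. curve (f i)) {j \<in> {1..n}. f j t < x}"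
  by (rule inj_on_subset[OF config_curve_inj[OF c]]) blast
 ultimately show ?thesis unfolding rank_def lt_count_def fst_conv snd_conv by (simp add: card_image)
qed

lemma dg_events:
 assumes "dg n b f"
 shows "p \<in> crossings b k ==> p \<in> meets n f"
  and "p \<in> meets n f ==> \<exists>k. p \<in> crossings b k"
  and "p \<in> bars b ==> \<exists>i\<in>{1..n}. \<exists>t\<in>{0<..<1}. p = (f i t, t)"
  and "p \<in> meets n f ==> \<exists>i\<in>{1..n}. \<exists>j\<in>{1..n}. \<exists>t\<in>{0<..<1}. i ~= j & p = (f i t, t) & f i t = f j t"
  and "p \<in> bars b ==> p \<notin> meets n f"
  and "p \<in> crossings b k ==> p \<in> crossings b k' ==> k = k'"
proof -
 have c: "config n f" and cr: "(\<Union>k. crossings b k) = meets n f"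
  and br: "bars b \<subseteq> (\<Union>i\<in>{1..n}. curve (f i)) - meets n f - UNIV \<times> {0, 1}"
  and dj: "\<And>k k'. k ~= k' ==> crossings b k \<inter> crossings b k' = {}"
  using assms by (auto simp: dg_def)
 show "p \<in> meets n f" if "p \<in> crossings b k" for p k using cr that by blast
 show "\<exists>k. p \<in> crossings b k" if "p \<in> meets n f" for p using cr that by blast
 show "p \<notin> meets n f" if "p \<in> bars b" for p using br that by blast
 show "k = k'" if "p \<in> crossings b k" "p \<in> crossings b k'" for p k k' using dj that by blast
 show "\<exists>i\<in>{1..n}. \<exists>t\<in>{0<..<1}. p = (f i t, t)" if pb: "p \<in> bars b" for p
 proof -
  obtain i where i: "i \<in> {1..n}" "p \<in> curve (f i)" using br pb by blast
  have "p \<notin> UNIV \<times> {0, 1}" using br pb by blast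
  thus ?thesis using i by (auto simp: curve_def)
 qed
 show "\<exists>i\<in>{1..n}. \<exists>j\<in>{1..n}. \<exists>t\<in>{0<..<1}. i ~= j & p = (f i t, t) & f i t = f j t" if "p \<in> meets n f" for p
 proof -
  obtain i j t where "i \<in> {1..n}" "j \<in> {1..n}" "i ~= j" "t \<in> {0..1}" "p = (f i t, t)" "f i t = f j t"
   using \<open>p \<in> meets n f\<close> unfolding meets_def by blast
  thus ?thesis using config_meet_height[OF c] by blast
 qed
qed

lemma rank_meets:
 assumes "dg n b f" "p \<in> meets n f"
 shows "rank b p = lt_count n f (fst p) (snd p)"
proof -
 obtain x t where p: "p = (x, t)" by force
 have "t \<in> {0..1}" using assms(2) unfolding p meets_def by blast
 thus ?thesis unfolding p using rank_dg[OF assms(1)] by simp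
qed

lemma data_crs:
 assumes "dg n b f"
 shows "crs n f = {(k, t). \<exists>\<kappa>. (Cr \<kappa> (Suc k), t) \<in> data b}"
proof (intro equalityI subsetI)
 fix q assume "q \<in> crs n f"
 then obtain p where p: "q = (lt_count n f (fst p) (snd p), snd p)" "p \<in> meets n f"
  unfolding crs_def by (rule imageE)
 obtain \<kappa> where "p \<in> crossings b \<kappa>" using dg_events(2)[OF assms p(2)] by blast
 hence "(Cr \<kappa> (Suc (rank b p)), snd p) \<in> data b" unfolding data_def by blast
 thus "q \<in> {(k, t). \<exists>\<kappa>. (Cr \<kappa> (Suc k), t) \<in> data b}"
  unfolding p(1) rank_meets[OF assms p(2)] by blast
next
 fix q assume "q \<in> {(k, t). \<exists>\<kappa>. (Cr \<kappa> (Suc k), t) \<in> data b}"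
 then obtain k t \<kappa> where q: "q = (k, t)" "(Cr \<kappa> (Suc k), t) \<in> data b" by blast
 then obtain p where p: "p \<in> crossings b \<kappa>" "k = rank b p" "t = snd p" unfolding data_def by auto
 have m: "p \<in> meets n f" by (rule dg_events(1)[OF assms p(1)])
 thus "q \<in> crs n f" unfolding crs_def q(1) p(2,3) rank_meets[OF assms m] by (rule imageI)
qed

lemma same_order_if_data:
 assumes "dg n b f" "dg n b' f'" "data b = data b'" "t \<in> {0..1}"
 shows "same_order n f f' t"
 using same_order_if_crs[of n f f' t] data_crs[OF assms(1)] data_crs[OF assms(2)] assms by (auto simp: dg_def)

lemma lt_count_inj:
 assumes "i \<in> {1..n}" "j \<in> {1..n}" "lt_count n f (f i t) t = lt_count n f (f j t) t"
 shows "f i t = f j t"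
proof (rule ccontr)
 have *: "lt_count n f (f i t) t < lt_count n f (f j t) t" if "f i t < f j t" "i \<in> {1..n}" for i j
  unfolding lt_count_def
 proof (rule psubset_card_mono, simp, rule psubsetI)
  show "{l \<in> {1..n}. f l t < f i t} \<subseteq> {l \<in> {1..n}. f l t < f j t}" using that by auto
  have "i \<in> {l \<in> {1..n}. f l t < f j t}" "i \<notin> {l \<in> {1..n}. f l t < f i t}" using that by auto
  thus "{l \<in> {1..n}. f l t < f i t} ~= {l \<in> {1..n}. f l t < f j t}" by blast
 qed
 assume "f i t ~= f j t"
 then consider "f i t < f j t" | "f j t < f i t" by linarith
 thus False using *[of i j] *[of j i] assms by cases auto
qed

section \<open>The data determine the diagram up to isotopy\<close>

lemma rank_same_order:
 assumes "dg n b f" "dg n b' f'" "t \<in> {0..1}" "same_order n f f' t" "i \<in> {1..n}"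
 shows "rank b (f i t, t) = rank b' (f' i t, t)"
 unfolding rank_dg[OF assms(1,3)] rank_dg[OF assms(2,3)] lt_count_def
 by (rule same_order_card(2)[OF assms(4,5)])

lemma rank_determines_point:
 assumes d: "dg n b f" and i: "i \<in> {1..n}" "j \<in> {1..n}" and t: "t \<in> {0..1}"
  and r: "rank b (f i t, t) = rank b (f j t, t)"
 shows "f i t = f j t"
 using r unfolding rank_dg[OF d t] by (rule lt_count_inj[OF i])

lemma event_point:
 assumes d: "dg n b f" and p: "p \<in> crossings b k \<or> p \<in> bars b"
 shows "\<exists>i\<in>{1..n}. \<exists>t\<in>{0<..<1}. p = (f i t, t)"
 using p dg_events(3)[OF d, of p] dg_events(4)[OF d dg_events(1)[OF d], of p k] by blast

lemma same_data_crossing: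
 assumes b: "dg n b f" and b': "dg n b' f'" and eq: "data b = data b'" and o: "same_order n f f' t"
  and t: "t \<in> {0..1}" and i: "i \<in> {1..n}" and p: "(f i t, t) \<in> crossings b k"
 shows "(f' i t, t) \<in> crossings b' k"
proof -
 have "(Cr k (Suc (rank b (f i t, t))), t) \<in> data b" using p unfolding data_def by force
 hence "(Cr k (Suc (rank b (f i t, t))), t) \<in> data b'" by (simp only: eq)
 then obtain q where q: "q \<in> crossings b' k" "rank b' q = rank b (f i t, t)" "snd q = t"
  unfolding data_def by auto
 obtain j u where j: "j \<in> {1..n}" "q = (f' j u, u)" using event_point[OF b', of q k] q(1) by blast
 have u: "u = t" using j q by simp
 have "rank b' (f' j t, t) = rank b' (f' i t, t)"
  using q(2) rank_same_order[OF b b' t o i] j u by simp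
 hence "f' j t = f' i t" by (rule rank_determines_point[OF b' j(1) i t])
 thus ?thesis using q(1) j u by simp
qed

lemma same_data_bar:
 assumes b: "dg n b f" and b': "dg n b' f'" and eq: "data b = data b'" and o: "same_order n f f' t"
  and t: "t \<in> {0..1}" and i: "i \<in> {1..n}" and p: "(f i t, t) \<in> bars b"
 shows "(f' i t, t) \<in> bars b'"
proof -
 have "(Bar (Suc (rank b (f i t, t))), t) \<in> data b" using p unfolding data_def by force
 hence "(Bar (Suc (rank b (f i t, t))), t) \<in> data b'" by (simp only: eq)
 then obtain q where q: "q \<in> bars b'" "rank b' q = rank b (f i t, t)" "snd q = t"
  unfolding data_def by auto
 obtain j u where j: "j \<in> {1..n}" "q = (f' j u, u)" using event_point[OF b', of q] q(1) by blast
 have u: "u = t" using j q by simp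
 have "rank b' (f' j t, t) = rank b' (f' i t, t)"
  using q(2) rank_same_order[OF b b' t o i] j u by simp
 hence "f' j t = f' i t" by (rule rank_determines_point[OF b' j(1) i t])
 thus ?thesis using q(1) j u by simp
qed

text \<open>The crossings determine the order of the strands at each height, so one diagram can be deformed such that its strands become those of the
other one. An event is then carried to the point with the same height and position, which by assumption carries the same letter.\<close>

theorem isotopic_if_same_data:
 assumes "is_diagram n b" "is_diagram n b'" and eq: "data b = data b'"
 shows "isotopic n b b'"
proof -
 obtain f f' where b: "dg n b f" and b': "dg n b' f'" using is_diagram_dg assms by metis
 have c': "config n f'" using b' by (simp add: dg_def)
 have o: "same_order n f f' t" if "t \<in> {0..1}" for t by (rule same_order_if_data[OF b b' eq that])
 have o': "same_order n f' f t" if "t \<in> {0..1}" for t using o[OF that] unfolding same_order_def by blast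
 obtain \<phi> where \<phi>: "isotopic n b (map_diagram \<phi> b)" "dg n (map_diagram \<phi> b) f'"
  "\<And>i t. i \<in> {1..n} ==> t \<in> {0..1} ==> \<phi> (f i t, t) = (f' i t, t)"
  using isotopic_reorder[OF b c' o] by blast
 have "map_diagram \<phi> b = b'"
 proof (rule diagram.equality)
  show "strands (map_diagram \<phi> b) = strands b'" using \<phi>(2) b' by (simp add: dg_def)
  show "crossings (map_diagram \<phi> b) = crossings b'"
  proof
   fix k
   have "\<phi> ` crossings b k = crossings b' k"
   proof (intro equalityI subsetI)
    fix q assume "q \<in> \<phi> ` crossings b k"
    then obtain p where p: "p \<in> crossings b k" "q = \<phi> p" by blast
    then obtain i t where it: "i \<in> {1..n}" "t \<in> {0<..<1}" "p = (f i t, t)" using event_point[OF b, of p k] by blast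
    have t: "t \<in> {0..1}" using it(2) by simp
    show "q \<in> crossings b' k" unfolding p(2) it(3) \<phi>(3)[OF it(1) t]
     by (rule same_data_crossing[OF b b' eq o[OF t] t it(1)]) (use p it in simp)
   next
    fix q assume q: "q \<in> crossings b' k"
    then obtain i t where it: "i \<in> {1..n}" "t \<in> {0<..<1}" "q = (f' i t, t)" using event_point[OF b', of q k] by blast
    have t: "t \<in> {0..1}" using it(2) by simp
    have "(f i t, t) \<in> crossings b k"
     by (rule same_data_crossing[OF b' b eq[symmetric] o'[OF t] t it(1)]) (use q it in simp)
    thus "q \<in> \<phi> ` crossings b k" using \<phi>(3)[OF it(1) t] it(3) by (metis imageI)
   qed
   thus "crossings (map_diagram \<phi> b) k = crossings b' k" by (simp add: map_diagram_def)
  qed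
  have "\<phi> ` bars b = bars b'"
  proof (intro equalityI subsetI)
   fix q assume "q \<in> \<phi> ` bars b"
   then obtain p where p: "p \<in> bars b" "q = \<phi> p" by blast
   then obtain i t where it: "i \<in> {1..n}" "t \<in> {0<..<1}" "p = (f i t, t)" using event_point[OF b, of p] by blast
   have t: "t \<in> {0..1}" using it(2) by simp
   show "q \<in> bars b'" unfolding p(2) it(3) \<phi>(3)[OF it(1) t]
    by (rule same_data_bar[OF b b' eq o[OF t] t it(1)]) (use p it in simp)
  next
   fix q assume q: "q \<in> bars b'"
   then obtain i t where it: "i \<in> {1..n}" "t \<in> {0<..<1}" "q = (f' i t, t)" using event_point[OF b', of q] by blast
   have t: "t \<in> {0..1}" using it(2) by simp
   have "(f i t, t) \<in> bars b"
    by (rule same_data_bar[OF b' b eq[symmetric] o'[OF t] t it(1)]) (use q it in simp)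
   thus "q \<in> \<phi> ` bars b" using \<phi>(3)[OF it(1) t] it(3) by (metis imageI)
  qed
  thus "bars (map_diagram \<phi> b) = bars b'" by (simp add: map_diagram_def)
 qed simp
 thus ?thesis using \<phi>(1) by simp
qed

section \<open>Vertical isotopies\<close>

text \<open>One-sided form of \<open>passes\<close>: for continuous functions the sign of the difference is constant on either side, so the
speeds at which the two sides are traversed do not matter. This makes crossings invariant under reparametrisation of the height.\<close>

lemma passes_sides:
 assumes c: "continuous_on {0..1} g" "continuous_on {0..1} g'" and t: "t \<in> {0<..<1}"
 shows "passes g g' t \<longleftrightarrow> (\<exists>e>0. e <= t & e <= 1 - t &
  ((\<forall>u. t - e < u & u < t --> g u < g' u) & (\<forall>u. t < u & u < t + e --> g' u < g u) \<or>
   (\<forall>u. t - e < u & u < t --> g' u < g u) & (\<forall>u. t < u & u < t + e --> g u < g' u)))"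
  (is "_ \<longleftrightarrow> (\<exists>e>0. ?Q e)")
proof
 assume "\<exists>e>0. ?Q e"
 then obtain e where e: "e > 0" and Q: "?Q e" by blast
 show "passes g g' t"
  unfolding passes_def
 proof (intro exI[of _ e] conjI allI impI)
  fix s assume s: "0 < s & s < e"
  hence "t - e < t - s" "t - s < t" "t < t + s" "t + s < t + e" by auto
  thus "(g (t - s) - g' (t - s)) * (g (t + s) - g' (t + s)) < 0"
   using Q by (auto simp: mult_less_0_iff)
 qed (use e Q in auto)
next
 assume "passes g g' t"
 then obtain e where e: "e > 0" "e <= t" "e <= 1 - t" and
  *: "\<And>s. 0 < s ==> s < e ==> (g (t - s) - g' (t - s)) * (g (t + s) - g' (t + s)) < 0"
  unfolding passes_def by blast
 define d where "d = (%u. g u - g' u)"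
 have cd: "continuous_on {0..1} d" unfolding d_def by (intro continuous_intros c)
 have nz: "d u ~= 0" if "t - e < u" "u < t + e" "u ~= t" for u
 proof (cases "u < t")
  case True
  hence "d u * d (t + (t - u)) < 0" using *[of "t - u"] that by (simp add: d_def)
  thus ?thesis by auto
 next
  case False
  hence "d (t - (u - t)) * d u < 0" using *[of "u - t"] that by (simp add: d_def)
  thus ?thesis by auto
 qed
 have const: "d u * d v > 0" if uv: "u \<in> I" "v \<in> I" and I: "I = {t - e<..<t} \<or> I = {t<..<t + e}" for u v I
 proof (rule ccontr)
  assume neg: "\<not> d u * d v > 0"
  have "is_interval (d ` I)"
   unfolding is_interval_connected_1
   by (rule connected_continuous_image[OF continuous_on_subset[OF cd]]) (use I e in auto)
  moreover have "d u \<in> d ` I" "d v \<in> d ` I" using uv by auto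
  moreover have "(d u <= 0 & 0 <= d v) \<or> (d v <= 0 & 0 <= d u)"
   using neg by (metis mult_neg_neg mult_pos_pos not_le less_imp_le)
  ultimately have "0 \<in> d ` I" unfolding is_interval_1 by blast
  thus False using nz I e(1) by auto
 qed
 define u0 where "u0 = t - e / 2"
 define v0 where "v0 = t + e / 2"
 have opp: "d u0 * d v0 < 0" using *[of "e/2"] e by (simp add: d_def u0_def v0_def)
 have L: "d u * d u0 > 0" if "t - e < u" "u < t" for u
  by (rule const[where I = "{t - e<..<t}"]) (use that e in \<open>auto simp: u0_def\<close>)
 have R: "d u * d v0 > 0" if "t < u" "u < t + e" for u
  by (rule const[where I = "{t<..<t + e}"]) (use that e in \<open>auto simp: v0_def\<close>)
 show "\<exists>e>0. ?Q e"
 proof (intro exI[of _ e] conjI)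
  show "(\<forall>u. t - e < u & u < t --> g u < g' u) & (\<forall>u. t < u & u < t + e --> g' u < g u) \<or>
   (\<forall>u. t - e < u & u < t --> g' u < g u) & (\<forall>u. t < u & u < t + e --> g u < g' u)"
  proof (cases "d u0 < 0")
   case True
   hence "d v0 > 0" using opp by (simp add: mult_less_0_iff)
   hence "d u < 0" if "t - e < u" "u < t" for u using L[OF that] True by (simp add: zero_less_mult_iff)
   moreover have "d u > 0" if "t < u" "u < t + e" for u using R[OF that] \<open>d v0 > 0\<close> by (simp add: zero_less_mult_iff)
   ultimately show ?thesis unfolding d_def by simp
  next
   case False
   hence "d u0 > 0" "d v0 < 0" using opp by (auto simp: mult_less_0_iff)
   hence "d u > 0" if "t - e < u" "u < t" for u using L[OF that] by (simp add: zero_less_mult_iff)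
   moreover have "d u < 0" if "t < u" "u < t + e" for u using R[OF that] \<open>d v0 < 0\<close> by (simp add: zero_less_mult_iff)
   ultimately show ?thesis unfolding d_def by simp
  qed
 qed (use e in auto)
qed

definition height_map :: "(real => real) => bool" where
 "height_map k \<longleftrightarrow> continuous_on {0..1} k & strict_mono_on {0..1} k & k 0 = 0 & k 1 = 1"

lemma height_map_less:
 assumes "height_map k" "u \<in> {0..1}" "v \<in> {0..1}" shows "k u < k v \<longleftrightarrow> u < v"
proof -
 have "strict_mono_on {0..1} k" using assms(1) by (simp add: height_map_def)
 thus ?thesis using assms(2,3) by (metis strict_mono_onD less_asym linorder_neqE_linordered_idom less_irrefl)
qed

lemma height_map_image:
 assumes "height_map k" shows "k ` {0..1} = {0..1}"
proof (intro equalityI subsetI)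
 fix v assume "v \<in> k ` {0..1}"
 then obtain u where u: "u \<in> {0..1}" "v = k u" by blast
 have k: "k 0 = 0" "k 1 = 1" using assms by (simp_all add: height_map_def)
 have "\<not> k u < k 0" "\<not> k 1 < k u"
  using height_map_less[OF assms u(1), of 0] height_map_less[OF assms _ u(1), of 1] u(1) by simp_all
 thus "v \<in> {0..1}" using k u by simp
next
 fix v :: real assume "v \<in> {0..1}"
 thus "v \<in> k ` {0..1}" using IVT'[of k 0 v 1] assms by (auto simp: height_map_def)
qed

definition hinv :: "(real => real) => real => real" where
 "hinv k = the_inv_into {0..1} k"

lemma hinv:
 assumes "height_map k"
 shows "u \<in> {0..1} ==> hinv k (k u) = u" "v \<in> {0..1} ==> k (hinv k v) = v"
  "v \<in> {0..1} ==> hinv k v \<in> {0..1}" "height_map (hinv k)"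
proof -
 have inj: "inj_on k {0..1}" using assms strict_mono_on_imp_inj_on by (auto simp: height_map_def)
 show 1: "hinv k (k u) = u" if "u \<in> {0..1}" for u
  unfolding hinv_def by (rule the_inv_into_f_f[OF inj that])
 show 2: "k (hinv k v) = v" if "v \<in> {0..1}" for v
  unfolding hinv_def by (rule f_the_inv_into_f[OF inj]) (use that height_map_image[OF assms] in simp)
 show 3: "hinv k v \<in> {0..1}" if "v \<in> {0..1}" for v
  unfolding hinv_def by (rule the_inv_into_into[OF inj]) (use that height_map_image[OF assms] in simp_all)
 have cont: "continuous_on (k ` {0..1}) (hinv k)"
  by (rule continuous_on_inv) (use assms 1 in \<open>auto simp: height_map_def\<close>)
 show "height_map (hinv k)"
  unfolding height_map_def
 proof (intro conjI)
  show "continuous_on {0..1} (hinv k)" using cont height_map_image[OF assms] by simp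
  show "strict_mono_on {0..1} (hinv k)"
  proof (rule strict_mono_onI)
   fix u v :: real assume uv: "u \<in> {0..1}" "v \<in> {0..1}" "u < v"
   hence "k (hinv k u) < k (hinv k v)" using 2 by simp
   thus "hinv k u < hinv k v" using height_map_less[OF assms 3[OF uv(1)] 3[OF uv(2)]] by simp
  qed
  have "k 0 = 0" "k 1 = 1" using assms by (simp_all add: height_map_def)
  thus "hinv k 0 = 0" "hinv k 1 = 1" using 1[of 0] 1[of 1] by simp_all
 qed
qed

lemma height_map_conv:
 assumes "height_map h" "0 <= c" "c <= 1"
 shows "height_map (%t. (1 - c) * t + c * h t)"
 unfolding height_map_def
proof (intro conjI)
 show "continuous_on {0..1} (%t. (1 - c) * t + c * h t)"
  using assms(1) by (intro continuous_intros) (simp add: height_map_def)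
 show "strict_mono_on {0..1} (%t. (1 - c) * t + c * h t)"
 proof (rule strict_mono_onI)
  fix u v :: real assume uv: "u \<in> {0..1}" "v \<in> {0..1}" "u < v"
  hence "h u < h v" using height_map_less[OF assms(1)] by blast
  thus "(1 - c) * u + c * h u < (1 - c) * v + c * h v" using conv_less uv(3) assms by blast
 qed
qed (use assms(1) in \<open>simp_all add: height_map_def\<close>)

lemma passes_reparam:
 assumes c: "continuous_on {0..1} g" "continuous_on {0..1} g'" and k: "height_map k" and t: "t \<in> {0<..<1}"
  and p: "passes g g' (k t)"
 shows "passes (%u. g (k u)) (%u. g' (k u)) t"
proof -
 have t1: "t \<in> {0..1}" and k01: "k 0 = 0" "k 1 = 1" using t k by (auto simp: height_map_def)
 have kt: "k t \<in> {0<..<1}"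
  using height_map_less[OF k, of 0 t] height_map_less[OF k, of t 1] t k01 by auto
 have kc: "continuous_on {0..1} k" using k by (simp add: height_map_def)
 have ki: "k ` {0..1} \<subseteq> {0..1}" using height_map_image[OF k] by simp
 have c': "continuous_on {0..1} (%u. g (k u))" "continuous_on {0..1} (%u. g' (k u))"
  by (rule continuous_on_compose2[OF c(1) kc ki], rule continuous_on_compose2[OF c(2) kc ki])
 obtain e where e: "e > 0" "e <= k t" "e <= 1 - k t" and
  Q: "(\<forall>u. k t - e < u & u < k t --> g u < g' u) & (\<forall>u. k t < u & u < k t + e --> g' u < g u) \<or>
   (\<forall>u. k t - e < u & u < k t --> g' u < g u) & (\<forall>u. k t < u & u < k t + e --> g u < g' u)"
  using p passes_sides[OF c kt] by blast
 define a where "a = hinv k (k t - e)"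
 define b where "b = hinv k (k t + e)"
 have kab: "k a = k t - e" "k b = k t + e" and ab: "a \<in> {0..1}" "b \<in> {0..1}"
  unfolding a_def b_def by (rule hinv[OF k], use e kt in force)+
 have at: "a < t" "t < b" using height_map_less[OF k ab(1) t1] height_map_less[OF k t1 ab(2)] kab e by simp_all
 define d where "d = min (t - a) (b - t)"
 have lo: "k t - e < k u & k u < k t" if "t - d < u" "u < t" for u
 proof -
  have u: "u \<in> {0..1}" "a < u" using that ab at t by (auto simp: d_def)
  show ?thesis using height_map_less[OF k ab(1) u(1)] height_map_less[OF k u(1) t1] that u kab by simp
 qed
 have hi: "k t < k u & k u < k t + e" if "t < u" "u < t + d" for u
 proof -
  have u: "u \<in> {0..1}" "u < b" using that ab at t by (auto simp: d_def)
  show ?thesis using height_map_less[OF k u(1) ab(2)] height_map_less[OF k t1 u(1)] that u kab by simp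
 qed
 show ?thesis
  unfolding passes_sides[OF c' t]
 proof (intro exI[of _ d] conjI)
  show "0 < d" "d <= t" "d <= 1 - t" using at ab by (auto simp: d_def)
  show "(\<forall>u. t - d < u & u < t --> g (k u) < g' (k u)) & (\<forall>u. t < u & u < t + d --> g' (k u) < g (k u)) \<or>
   (\<forall>u. t - d < u & u < t --> g' (k u) < g (k u)) & (\<forall>u. t < u & u < t + d --> g (k u) < g' (k u))"
   using Q lo hi by meson
 qed
qed

lemma passes_local:
 assumes p: "passes g g' t" and d: "d > 0" "\<And>u. u \<in> {0..1} ==> \<bar>u - t\<bar> < d ==> h u = g u & h' u = g' u"
 shows "passes h h' t"
proof -
 obtain e where e: "e > 0" "e <= t" "e <= 1 - t" and
  *: "\<And>s. 0 < s ==> s < e ==> (g (t - s) - g' (t - s)) * (g (t + s) - g' (t + s)) < 0"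
  using p unfolding passes_def by blast
 show ?thesis
  unfolding passes_def
 proof (intro exI[of _ "min e d"] conjI allI impI)
  fix s assume s: "0 < s & s < min e d"
  have "h (t - s) = g (t - s)" "h' (t - s) = g' (t - s)" "h (t + s) = g (t + s)" "h' (t + s) = g' (t + s)"
   using d(2)[of "t - s"] d(2)[of "t + s"] s e by auto
  thus "(h (t - s) - h' (t - s)) * (h (t + s) - h' (t + s)) < 0" using *[of s] s by simp
 qed (use e d(1) in auto)
qed

lemma binary_constant:
 fixes g :: "real => real"
 assumes c: "continuous_on {a..b} g" and g: "\<And>t. t \<in> {a..b} ==> g t = 0 \<or> g t = 1" and t: "t \<in> {a..b}"
 shows "g t = g a"
proof (rule ccontr)
 assume ne: "g t ~= g a"
 have a: "a \<in> {a..b}" using t by simp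
 have "is_interval (g ` {a..b})"
  unfolding is_interval_connected_1 by (rule connected_continuous_image[OF c]) simp
 hence "1/2 \<in> g ` {a..b}"
  using g[OF t] g[OF a] ne t a unfolding is_interval_1
  by (smt (verit, best) field_sum_of_halves imageI)
 thus False using g by fastforce
qed

text \<open>Move the points with \<open>l x = 1\<close> vertically by \<open>h\<close>, fix those with \<open>l x = 0\<close>, and interpolate in between. If no strand visits the
transition zone \<open>0 < l x < 1\<close> at heights where \<open>h\<close> is not the identity, the strands remain monotone: those in \<open>A\<close> are reparametrised and
the others stay.\<close>

lemma vertical_isotopy:
 fixes l h :: "real => real"
 assumes b: "dg n b f" and l: "continuous_on {0..real n + 1} l" "\<And>x. x \<in> {0..real n + 1} ==> 0 <= l x & l x <= 1"
  and h: "height_map h" and band: "0 <= t1" "t1 <= t2" "t2 <= 1" "\<And>t. t \<in> {0..1} ==> t \<notin> {t1<..<t2} ==> h t = t"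
  and free: "\<And>i t. i \<in> {1..n} ==> t \<in> {t1..t2} ==> l (f i t) = 0 \<or> l (f i t) = 1"
  and A: "A = {i \<in> {1..n}. l (f i t1) = 1}"
 shows "\<exists>\<phi>. isotopic n b (map_diagram \<phi> b) &
   dg n (map_diagram \<phi> b) (%i t. if i \<in> A then f i (hinv h t) else f i t) &
   (\<forall>i\<in>{1..n}. \<forall>t\<in>{0..1}. \<phi> (f i t, t) = (f i t, if i \<in> A then h t else t))"
proof -
 have c: "config n f" using b by (simp add: dg_def)
 define H where "H = (%s p. (fst p, (1 - s * l (fst p)) * snd p + s * l (fst p) * h (snd p)) :: point)"
 have fx: "f i t \<in> {0..real n + 1}" if "i \<in> {1..n}" "t \<in> {0..1}" for i t
  using configD(4,5)[OF c that] by simp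
 have lam: "l (f i t) = (if i \<in> A then 1 else 0)" if i: "i \<in> {1..n}" and t: "t \<in> {t1..t2}" for i t
 proof -
  have "continuous_on {t1..t2} (%t. l (f i t))"
   by (rule continuous_on_compose2[OF l(1)])
    (use fx[OF i] band in \<open>auto intro: continuous_on_subset[OF configD(1)[OF c i]]\<close>)
  hence "l (f i t) = l (f i t1)"
   by (rule binary_constant[where g = "%t. l (f i t)"]) (use free[OF i] t in auto)
  moreover have "l (f i t1) = 0 \<or> l (f i t1) = 1" using free[OF i] band by simp
  ultimately show ?thesis using i by (auto simp: A)
 qed
 define k where "k = (%s t. (1 - s) * t + s * h t)"
 have hm: "height_map (k s)" if "s \<in> {0..1}" for s
  unfolding k_def by (rule height_map_conv[OF h]) (use that in auto)
 have kout: "k s t = t" if "t \<in> {0..1}" "t \<notin> {t1<..<t2}" for s t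
  using band(4)[OF that] by (simp add: k_def algebra_simps)
 have kin: "k s t \<in> {t1..t2} \<longleftrightarrow> t \<in> {t1..t2}" if t: "t \<in> {0..1}" and s: "s \<in> {0..1}" for s t
 proof -
  have e: "t1 \<in> {0..1}" "t2 \<in> {0..1}" using band by auto
  have "k s t1 = t1" "k s t2 = t2" using kout e by auto
  thus ?thesis
   using height_map_less[OF hm[OF s] t e(1)] height_map_less[OF hm[OF s] e(2) t] by auto
 qed
 have Hf: "H s (f i t, t) = (f i t, if i \<in> A then k s t else t)" if i: "i \<in> {1..n}" and t: "t \<in> {0..1}" for s i t
 proof (cases "t \<in> {t1..t2}")
  case True
  thus ?thesis using lam[OF i True] by (simp add: H_def k_def)
 next
  case False
  hence "h t = t" "k s t = t" using band(4)[OF t] kout[OF t] by auto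
  thus ?thesis by (simp add: H_def algebra_simps)
 qed
 have hmx: "height_map (%t. (1 - s * l x) * t + s * l x * h t)" if "s \<in> {0..1}" "x \<in> {0..real n + 1}" for s x
  by (rule height_map_conv[OF h]) (use l(2)[OF that(2)] that(1) in \<open>auto intro: mult_le_one\<close>)
 have onto: "H s ` E n = E n" if s: "s \<in> {0..1}" for s
 proof (intro equalityI subsetI)
  fix q assume "q \<in> H s ` E n"
  then obtain x t where xt: "x \<in> {0..real n + 1}" "t \<in> {0..1}" "q = H s (x, t)" by (auto simp: E_def)
  have "(1 - s * l x) * t + s * l x * h t \<in> {0..1}"
   using height_map_image[OF hmx[OF s xt(1)]] xt(2) by blast
  thus "q \<in> E n" using xt by (simp add: H_def E_def)
 next
  fix q assume "q \<in> E n"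
  then obtain x t where xt: "x \<in> {0..real n + 1}" "t \<in> {0..1}" "q = (x, t)" by (auto simp: E_def)
  then obtain u where "u \<in> {0..1}" "t = (1 - s * l x) * u + s * l x * h u"
   using height_map_image[OF hmx[OF s xt(1)]] by (metis (no_types, lifting) imageE)
  hence "q = H s (x, u)" "(x, u) \<in> E n" using xt by (simp_all add: H_def E_def)
  thus "q \<in> H s ` E n" by blast
 qed
 have inj: "inj_on (H s) (E n)" if s: "s \<in> {0..1}" for s
 proof (rule inj_onI)
  fix p q assume p: "p \<in> E n" and q: "q \<in> E n" and eq: "H s p = H s q"
  obtain x t where xt: "x \<in> {0..real n + 1}" "t \<in> {0..1}" "p = (x, t)" using p by (auto simp: E_def)
  obtain x' u where xu: "u \<in> {0..1}" "q = (x', u)" using q by (auto simp: E_def)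
  have x': "x' = x" using eq xt xu by (simp add: H_def)
  have "(1 - s * l x) * t + s * l x * h t = (1 - s * l x) * u + s * l x * h u"
   using eq xt xu x' by (simp add: H_def)
  hence "t = u"
   using height_map_less[OF hmx[OF s xt(1)] xt(2) xu(1)] height_map_less[OF hmx[OF s xt(1)] xu(1) xt(2)] by linarith
  thus "p = q" using xt xu x' by simp
 qed
 have cont: "continuous_on ({0..1} \<times> E n) (%q. H (fst q) (snd q))"
 proof -
  have "continuous_on ({0..1} \<times> E n) (%q::real \<times> point. l (fst (snd q)))"
   by (rule continuous_on_compose2[OF l(1)]) (auto simp: E_def intro!: continuous_intros)
  moreover have "continuous_on ({0..1} \<times> E n) (%q::real \<times> point. h (snd (snd q)))"
   by (rule continuous_on_compose2[of "{0..1}" h]) (use h in \<open>auto simp: E_def height_map_def intro!: continuous_intros\<close>)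
  ultimately show ?thesis unfolding H_def by (intro continuous_intros)
 qed
 define g where "g = (%s i t. if i \<in> A then f i (hinv (k s) t) else f i t)"
 have gk: "g s i (if i \<in> A then k s t else t) = f i t" if "s \<in> {0..1}" "t \<in> {0..1}" for s i t
  using hinv(1)[OF hm[OF that(1)] that(2)] by (simp add: g_def)
 have cur: "H s ` curve (f i) = curve (g s i)" if s: "s \<in> {0..1}" and i: "i \<in> {1..n}" for s i
 proof (intro equalityI subsetI)
  fix q assume "q \<in> H s ` curve (f i)"
  then obtain t where t: "t \<in> {0..1}" "q = H s (f i t, t)" by (auto simp: curve_def)
  have "(if i \<in> A then k s t else t) \<in> {0..1}" using t(1) height_map_image[OF hm[OF s]] by auto
  thus "q \<in> curve (g s i)" unfolding t(2) Hf[OF i t(1)] mem_curve using gk[OF s t(1), of i] by simp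
 next
  fix q assume "q \<in> curve (g s i)"
  then obtain u where u: "u \<in> {0..1}" "q = (g s i u, u)" by (auto simp: curve_def)
  define t where "t = (if i \<in> A then hinv (k s) u else u)"
  have t: "t \<in> {0..1}" using hinv(3)[OF hm[OF s] u(1)] u(1) by (simp add: t_def)
  have "(if i \<in> A then k s t else t) = u" using hinv(2)[OF hm[OF s] u(1)] by (simp add: t_def)
  moreover have "g s i u = f i t" by (simp add: g_def t_def)
  ultimately have "q = H s (f i t, t)" using Hf[OF i t] u(2) by simp
  thus "q \<in> H s ` curve (f i)" using t by (auto simp: curve_def)
 qed
 have bk: "\<exists>t\<in>{0..1}. H s (f i t, t) = (g s i u, u)" if s: "s \<in> {0..1}" and i: "i \<in> {1..n}" and u: "u \<in> {0..1}" for s i u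
 proof -
  have "(g s i u, u) \<in> H s ` curve (f i)" unfolding cur[OF s i] mem_curve using u by simp
  thus ?thesis by (auto simp: curve_def)
 qed
 have common: "\<exists>t\<in>{0..1}. f i t = f j t & f i t = g s i u & (if i \<in> A then k s t else t) = u & (if j \<in> A then k s t else t) = u
   & (\<forall>m\<in>{1..n}. g s m u = g s i u --> f m t = f i t)"
  if s: "s \<in> {0..1}" and ij: "i \<in> {1..n}" "j \<in> {1..n}" and u: "u \<in> {0..1}" and eq: "g s i u = g s j u" for s i j u
 proof -
  obtain t where t: "t \<in> {0..1}" "H s (f i t, t) = (g s i u, u)" using bk[OF s ij(1) u] by blast
  have same: "f m t = f i t & H s (f m t, t) = (g s i u, u)" if m: "m \<in> {1..n}" "g s m u = g s i u" for m
  proof -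
   obtain t' where t': "t' \<in> {0..1}" "H s (f m t', t') = (g s m u, u)" using bk[OF s m(1) u] by blast
   have "(f m t', t') \<in> E n" "(f i t, t) \<in> E n"
    using curve_sub_E[OF c m(1)] curve_sub_E[OF c ij(1)] t t' by (auto simp: curve_def)
   hence "(f m t', t') = (f i t, t)" using inj_onD[OF inj[OF s]] t t' m(2) by metis
   thus ?thesis using t by auto
  qed
  have j: "f j t = f i t & H s (f j t, t) = (g s i u, u)" by (rule same[OF ij(2) eq[symmetric]])
  show ?thesis
   using t j same Hf[OF ij(1) t(1), of s] Hf[OF ij(2) t(1), of s] by (intro bexI[OF _ t(1)]) auto
 qed
 have k01: "k s 0 = 0" "k s 1 = 1" for s using h by (simp_all add: k_def height_map_def)
 have cg: "config n (g s)" if s: "s \<in> {0..1}" for s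
  unfolding config_def
 proof (intro conjI ballI impI)
  fix i assume i: "i \<in> {1..n}"
  have hc: "continuous_on {0..1} (hinv (k s))" using hinv(4)[OF hm[OF s]] by (simp add: height_map_def)
  have h01: "hinv (k s) 0 = 0" "hinv (k s) 1 = 1" using hinv(4)[OF hm[OF s]] by (simp_all add: height_map_def)
  have "continuous_on {0..1} (%t. f i (hinv (k s) t))"
   by (rule continuous_on_compose2[OF configD(1)[OF c i] hc]) (use hinv(3)[OF hm[OF s]] in blast)
  thus "continuous_on {0..1} (g s i)" using configD(1)[OF c i] by (cases "i \<in> A") (simp_all add: g_def)
  show "g s i 1 = real i" using configD(2)[OF c i] h01 by (simp add: g_def)
  show "g s i 0 \<in> real ` {1..n}" using configD(3)[OF c i] h01 by (simp add: g_def)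
  fix t :: real assume t: "t \<in> {0..1}"
  show "0 < g s i t" "g s i t < real n + 1"
   using configD(4,5)[OF c i t] configD(4,5)[OF c i hinv(3)[OF hm[OF s] t]] by (simp_all add: g_def)
 next
  have h0: "hinv (k s) 0 = 0" using hinv(4)[OF hm[OF s]] by (simp add: height_map_def)
  show "inj_on (%i. g s i 0) {1..n}"
  proof (rule inj_onI)
   have z: "g s i 0 = f i 0" for i by (simp add: g_def h0)
   fix i j assume "i \<in> {1..n}" "j \<in> {1..n}" "g s i 0 = g s j 0"
   thus "i = j" unfolding z by (rule config_bottom_inj[OF c])
  qed
 next
  fix i j m and u :: real assume ijm: "i \<in> {1..n}" "j \<in> {1..n}" "m \<in> {1..n}" and u: "u \<in> {0..1}" and eq: "g s i u = g s j u & g s j u = g s m u"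
  obtain t where "t \<in> {0..1}" "f i t = f j t" "f m t = f i t" using common[OF s ijm(1,2) u] ijm(3) eq by metis
  hence "f j t = f m t" by simp
  thus "i = j \<or> j = m \<or> i = m" by (rule config_two[OF c ijm \<open>t \<in> {0..1}\<close> \<open>f i t = f j t\<close>])
 next
  fix i j and u :: real assume ij: "i \<in> {1..n}" "j \<in> {1..n}" and u: "u \<in> {0<..<1}" and ne: "i ~= j & g s i u = g s j u"
  have u1: "u \<in> {0..1}" using u by simp
  obtain t where t: "t \<in> {0..1}" "f i t = f j t" "(if i \<in> A then k s t else t) = u" "(if j \<in> A then k s t else t) = u"
   using common[OF s ij u1] ne by blast
  have ti: "t \<in> {0<..<1}" using config_meet_height[OF c ij _ t(1,2)] ne by blast
  have p: "passes (f i) (f j) t" using config_passes[OF c ij _ ti t(2)] ne by blast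
  show "passes (g s i) (g s j) u"
  proof (cases "i \<in> A \<longleftrightarrow> j \<in> A")
   case True
   show ?thesis
   proof (cases "i \<in> A")
    case True
    have hu: "hinv (k s) u = t" using t True hinv(1)[OF hm[OF s] t(1)] by auto
    have "passes (%u. f i (hinv (k s) u)) (%u. f j (hinv (k s) u)) u"
     by (rule passes_reparam[OF configD(1)[OF c ij(1)] configD(1)[OF c ij(2)] hinv(4)[OF hm[OF s]] u]) (use p hu in simp)
    thus ?thesis using True \<open>i \<in> A \<longleftrightarrow> j \<in> A\<close> by (simp add: g_def)
   next
    case False
    thus ?thesis using p t(3,4) \<open>i \<in> A \<longleftrightarrow> j \<in> A\<close> by (simp add: g_def)
   qed
  next
   case False
   hence ktu: "k s t = t" "u = t" using t(3,4) by (auto split: if_splits)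
   have "t \<notin> {t1..t2}"
   proof
    assume "t \<in> {t1..t2}"
    hence "l (f i t) = (if i \<in> A then 1 else 0)" "l (f j t) = (if j \<in> A then 1 else 0)" using lam ij by blast+
    thus False using False t(2) by (auto split: if_splits)
   qed
   then obtain d where d: "d > 0" "\<And>v. \<bar>v - t\<bar> < d ==> v \<notin> {t1..t2}"
   proof -
    have "t < t1 \<or> t2 < t" using \<open>t \<notin> {t1..t2}\<close> by auto
    thus ?thesis
    proof
     assume "t < t1" thus ?thesis by (intro that[of "t1 - t"]) auto
    next
     assume "t2 < t" thus ?thesis by (intro that[of "t - t2"]) auto
    qed
   qed
   have out: "hinv (k s) v = v" if "v \<in> {0..1}" "\<bar>v - t\<bar> < d" for v
   proof -
    have "k s v = v" using kout[OF that(1)] d(2)[OF that(2)] by auto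
    thus ?thesis using hinv(1)[OF hm[OF s] that(1)] by simp
   qed
   show ?thesis unfolding ktu(2)
    by (rule passes_local[OF p d(1)]) (simp add: g_def out)
  qed
 qed
 have int: "snd (H s p) ~= 0 & snd (H s p) ~= 1" if s: "s \<in> {0..1}" and p: "p \<in> E n" "snd p ~= 0" "snd p ~= 1" for s p
 proof -
  obtain x t where xt: "x \<in> {0..real n + 1}" "t \<in> {0..1}" "p = (x, t)" using p(1) by (auto simp: E_def)
  define m where "m = (%t. (1 - s * l x) * t + s * l x * h t)"
  have m: "height_map m" unfolding m_def by (rule hmx[OF s xt(1)])
  hence e: "m 0 = 0" "m 1 = 1" by (simp_all add: height_map_def)
  have "0 < t" "t < 1" using xt p by auto
  hence "m 0 < m t" "m t < m 1"
   using height_map_less[OF m, of 0 t] height_map_less[OF m, of t 1] by auto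
  moreover have "snd (H s p) = m t" by (simp add: H_def m_def xt(3))
  ultimately show ?thesis using e by simp
 qed
 have d: "dg n (map_diagram (H s) b) (g s)" if s: "s \<in> {0..1}" for s
  by (rule dg_map[OF b cg[OF s] inj[OF s] int[OF s] cur[OF s]])
 have H0: "H 0 p = p" for p by (simp add: H_def)
 have "isotopic n b (map_diagram (H 1) b)"
  by (rule isotopicI[OF dg_is_diagram[OF b] cont onto inj H0 dg_is_diagram[OF d]])
 moreover have k1: "k 1 = h" by (simp add: k_def)
 have "dg n (map_diagram (H 1) b) (%i t. if i \<in> A then f i (hinv h t) else f i t)"
  using d[of 1] unfolding g_def k1 by simp
 moreover have "\<forall>i\<in>{1..n}. \<forall>t\<in>{0..1}. H 1 (f i t, t) = (f i t, if i \<in> A then h t else t)"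
  using Hf[of _ _ 1] unfolding k1 by blast
 ultimately show ?thesis by blast
qed

section \<open>Moving single events\<close>

text \<open>Crossings and bars in one set. A mark carries the constructor of its letter, to be applied to a position.\<close>

definition marks :: "diagram => ((nat => letter) \<times> point) set" where
 "marks b = {(Cr k, p) | k p. p \<in> crossings b k} \<union> {(Bar, p) | p. p \<in> bars b}"

lemma data_marks: "data b = (%(c, p). (c (Suc (rank b p)), snd p)) ` marks b"
 unfolding data_def marks_def image_Un by (intro arg_cong2[where f = "(\<union>)"]) force+

lemma marks_map: "marks (map_diagram \<phi> b) = (%(c, p). (c, \<phi> p)) ` marks b"
 unfolding marks_def image_Un map_diagram_def by (intro arg_cong2[where f = "(\<union>)"]) force+

lemma Cr_neq_Bar [simp]: "Cr k ~= Bar" "Bar ~= Cr k"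
 by (metis letter.distinct(1))+

lemma mark_point:
 assumes d: "dg n b f" and m: "(c, p) \<in> marks b"
 shows "\<exists>i\<in>{1..n}. \<exists>t\<in>{0<..<1}. p = (f i t, t)"
 using m event_point[OF d, of p] unfolding marks_def by blast

lemma Cr_fun_inj: "Cr k = Cr k' \<longleftrightarrow> k = k'"
 by (metis letter.inject(1))

lemma mark_unique:
 assumes d: "dg n b f" and m: "(c, p) \<in> marks b" "(c', p) \<in> marks b"
 shows "c = c'"
proof -
 have "(\<exists>k. c = Cr k & p \<in> crossings b k) \<or> (c = Bar & p \<in> bars b)"
  "(\<exists>k. c' = Cr k & p \<in> crossings b k) \<or> (c' = Bar & p \<in> bars b)"
  using m unfolding marks_def by blast+
 thus ?thesis using dg_events(1,5,6)[OF d] by blast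
qed

lemma mark_inj:
 assumes d: "dg n b f" and m: "(c, p) \<in> marks b" "(c', p') \<in> marks b"
  and e: "rank b p = rank b p'" "snd p = snd p'"
 shows "(c, p) = (c', p')"
proof -
 obtain i t where i: "i \<in> {1..n}" "t \<in> {0<..<1}" "p = (f i t, t)" using mark_point[OF d m(1)] by blast
 obtain j u where j: "j \<in> {1..n}" "u \<in> {0<..<1}" "p' = (f j u, u)" using mark_point[OF d m(2)] by blast
 have u: "u = t" using e(2) i j by simp
 have "f i t = f j t"
  by (rule rank_determines_point[OF d i(1) j(1)]) (use i j u e(1) in auto)
 hence "p = p'" using i j u by simp
 thus ?thesis using mark_unique[OF d m(1)] m(2) by simp
qed

text \<open>Meeting heights are isolated by \<open>passes\<close>, and they form a compact set.\<close>

lemma finite_meets: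
 assumes c: "config n f" shows "finite (meets n f)"
proof -
 have fin: "finite {t \<in> {0..1}. f i t = f j t}" if ij: "i \<in> {1..n}" "j \<in> {1..n}" "i ~= j" for i j
 proof -
  let ?Z = "{t \<in> {0..1}. f i t = f j t}"
  have cont: "continuous_on {0..1} (%t. f i t - f j t)"
   by (intro continuous_intros configD(1)[OF c] ij)
  have "closed ({0..1} \<inter> (%t. f i t - f j t) -` {0})"
   by (rule continuous_closed_preimage[OF cont]) auto
  moreover have "{0..1} \<inter> (%t. f i t - f j t) -` {0} = ?Z" by auto
  ultimately have cl: "closed ?Z" by simp
  have "finite ({0..1} \<inter> ?Z)"
  proof (rule finite_not_islimpt_in_compact)
   fix z :: real assume z: "z \<in> {0..1}"
   show "\<not> z islimpt ?Z"
   proof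
    assume lim: "z islimpt ?Z"
    hence "z \<in> ?Z" using cl lim unfolding closed_limpt by blast
    hence e: "f i z = f j z" by simp
    have zi: "z \<in> {0<..<1}" by (rule config_meet_height[OF c ij z e])
    obtain e where e: "e > 0" "e <= z" "e <= 1 - z" and
     *: "\<And>s. 0 < s ==> s < e ==> (f i (z - s) - f j (z - s)) * (f i (z + s) - f j (z + s)) < 0"
     using config_passes[OF c ij zi e] unfolding passes_def by blast
    obtain x where x: "x \<in> ?Z" "x ~= z" "dist x z < e"
     using lim e(1) unfolding islimpt_approachable by blast
    define s where "s = \<bar>x - z\<bar>"
    have s: "0 < s" "s < e" using x by (auto simp: s_def dist_real_def)
    have "x = z - s \<or> x = z + s" by (auto simp: s_def)
    thus False using *[OF s] x(1) by auto
   qed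
  qed simp
  thus ?thesis by (rule finite_subset[rotated]) auto
 qed
 have "meets n f \<subseteq> (\<Union>i\<in>{1..n}. \<Union>j\<in>{1..n} - {i}. (%t. (f i t, t)) ` {t \<in> {0..1}. f i t = f j t})"
  unfolding meets_def by blast
 moreover have "finite ..." by (intro finite_UN_I finite_imageI fin) auto
 ultimately show ?thesis by (rule finite_subset)
qed

lemma finite_data:
 assumes d: "dg n b f" shows "finite (data b)"
proof -
 have "marks b \<subseteq> (Cr ` UNIV \<times> meets n f) \<union> ({Bar} \<times> bars b)"
  unfolding marks_def using dg_events(1)[OF d] by blast
 moreover have "finite (meets n f)" "finite (bars b)" using d finite_meets by (auto simp: dg_def)
 moreover have "finite (UNIV :: kind set)"
 proof -
  have "(UNIV :: kind set) = {Pos, Neg, Virt}" by (auto intro: kind.exhaust)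
  thus ?thesis by (metis finite.simps)
 qed
 ultimately have "finite (marks b)" by (meson finite_SigmaI finite_UnI finite_imageI finite.simps finite_subset)
 thus ?thesis unfolding data_marks by (rule finite_imageI)
qed

lemma data_height:
 assumes d: "dg n b f" and m: "(l, t) \<in> data b" shows "t \<in> {0<..<1}"
proof -
 obtain c p where "(c, p) \<in> marks b" "t = snd p" using m unfolding data_marks by auto
 thus ?thesis using mark_point[OF d] by fastforce
qed

lemma tent_height_map:
 assumes d: "0 < \<delta>" "0 <= t - \<delta>" "t + \<delta> <= 1" and e: "\<bar>e\<bar> < \<delta>"
 shows "height_map (%u. u + e * max 0 (1 - \<bar>u - t\<bar> / \<delta>))"
 unfolding height_map_def
proof (intro conjI)
 show "strict_mono_on {0..1} (%u. u + e * max 0 (1 - \<bar>u - t\<bar> / \<delta>))"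
 proof (rule strict_mono_onI)
  fix u v :: real assume uv: "u < v"
  let ?T = "%u. max 0 (1 - \<bar>u - t\<bar> / \<delta>)"
  have "\<bar>\<bar>u - t\<bar> / \<delta> - \<bar>v - t\<bar> / \<delta>\<bar> = \<bar>\<bar>u - t\<bar> - \<bar>v - t\<bar>\<bar> / \<delta>"
   using d(1) by (simp add: diff_divide_distrib[symmetric])
  also have "... <= (v - u) / \<delta>" using d(1) uv by (intro divide_right_mono) auto
  finally have le: "\<bar>\<bar>u - t\<bar> / \<delta> - \<bar>v - t\<bar> / \<delta>\<bar> <= (v - u) / \<delta>" .
  have "\<bar>max 0 (1 - p) - max 0 (1 - q)\<bar> <= \<bar>p - q\<bar>" for p q :: real by (auto simp: max_def abs_if)
  hence "\<bar>?T u - ?T v\<bar> <= (v - u) / \<delta>" using le by (rule order_trans)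
  hence "\<bar>e\<bar> * \<bar>?T u - ?T v\<bar> <= \<bar>e\<bar> * ((v - u) / \<delta>)" by (rule mult_left_mono) simp
  also have "... < \<delta> * ((v - u) / \<delta>)" using e uv d(1) by (intro mult_strict_right_mono) auto
  also have "... = v - u" using d(1) by simp
  finally have "\<bar>e * ?T u - e * ?T v\<bar> < v - u" by (simp add: abs_mult[symmetric] algebra_simps)
  thus "u + e * ?T u < v + e * ?T v" by linarith
 qed
 have "1 <= \<bar>0 - t\<bar> / \<delta>" "1 <= \<bar>1 - t\<bar> / \<delta>" using d by (simp_all add: le_divide_eq)
 thus "0 + e * max 0 (1 - \<bar>0 - t\<bar> / \<delta>) = 0" "1 + e * max 0 (1 - \<bar>1 - t\<bar> / \<delta>) = 1" by simp_all
 show "continuous_on {0..1} (%u. u + e * max 0 (1 - \<bar>u - t\<bar> / \<delta>))"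
  using d(1) by (intro continuous_intros) auto
qed

text \<open>An event can be raised or lowered a little without changing the position of any event, even if there are other events at
the same height. Take a neighbourhood of the event that only the strands through it visit within a short
range of heights, and move it by a tent function.\<close>

lemma shift_event:
 assumes d: "dg n b f" and m: "(c0, p0) \<in> marks b" and p0: "p0 = (x0, t)"
 shows "\<exists>\<delta>>0. \<forall>t'. \<bar>t' - t\<bar> < \<delta> --> (\<exists>b'. isotopic n b b' &
   data b' = insert (c0 (Suc (rank b p0)), t') (data b - {(c0 (Suc (rank b p0)), t)}))"
proof -
 have c: "config n f" using d by (simp add: dg_def)
 have t: "t \<in> {0<..<1}" using mark_point[OF d m] p0 by auto
 hence t01: "t \<in> {0..1}" by simp
 define B where "B = (%i. \<bar>f i t - x0\<bar>) ` {i \<in> {1..n}. f i t ~= x0}"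
 \<comment> \<open>Strands not through the event keep distance \<open>3 * \<eta>\<close> from it at height \<open>t\<close>, hence \<open>2 * \<eta>\<close> at nearby heights.\<close>
 define \<eta> where "\<eta> = Min (insert 1 B) / 3"
 have fB: "finite B" by (simp add: B_def)
 have "0 < Min (insert 1 B)" using fB by (subst Min_gr_iff) (auto simp: B_def)
 hence eta: "0 < \<eta>" by (simp add: \<eta>_def)
 have far: "3 * \<eta> <= \<bar>f i t - x0\<bar>" if "i \<in> {1..n}" "f i t ~= x0" for i
 proof -
  have "Min (insert 1 B) <= \<bar>f i t - x0\<bar>" by (rule Min_le) (use fB that in \<open>auto simp: B_def\<close>)
  thus ?thesis by (simp add: \<eta>_def)
 qed
 have "\<exists>\<delta>>0. \<forall>u\<in>{0..1}. \<bar>u - t\<bar> < \<delta> --> \<bar>f i u - f i t\<bar> < \<eta>" if "i \<in> {1..n}" for i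
  using configD(1)[OF c that] t01 eta unfolding continuous_on_iff dist_real_def by blast
 then obtain D where D: "\<And>i. i \<in> {1..n} ==> D i > 0 & (\<forall>u\<in>{0..1}. \<bar>u - t\<bar> < D i --> \<bar>f i u - f i t\<bar> < \<eta>)" by metis
 \<comment> \<open>Within half of the minimum of this set there is no event at a height other than \<open>t\<close>, and the strands move by less than \<open>\<eta>\<close>.\<close>
 define G where "G = insert 1 (D ` {1..n}) \<union> (%q. \<bar>snd q - t\<bar>) ` {q \<in> data b. snd q ~= t} \<union> {t, 1 - t}"
 have fG: "finite G" using finite_data[OF d] by (simp add: G_def)
 define \<delta> where "\<delta> = Min G / 2"
 have "0 < Min G" using fG D t by (subst Min_gr_iff) (auto simp: G_def)
 hence del: "0 < \<delta>" "2 * \<delta> = Min G" by (simp_all add: \<delta>_def)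
 have G: "2 * \<delta> <= g" if "g \<in> G" for g unfolding del(2) by (rule Min_le[OF fG that])
 have G1: "2 * \<delta> <= t" "2 * \<delta> <= 1 - t" by (rule G, simp add: G_def)+
 have close: "\<bar>f i u - f i t\<bar> < \<eta>" if "i \<in> {1..n}" "u \<in> {t - \<delta>..t + \<delta>}" for i u
 proof -
  have "2 * \<delta> <= D i" by (rule G) (use that in \<open>auto simp: G_def\<close>)
  hence "\<bar>u - t\<bar> < D i" "u \<in> {0..1}" using that(2) del(1) G1 by auto
  thus ?thesis using D[OF that(1)] by blast
 qed
 have alone: "u = t" if "(l, u) \<in> data b" "u \<in> {t - \<delta>..t + \<delta>}" for l u
 proof (rule ccontr)
  assume "u ~= t"
  hence "2 * \<delta> <= \<bar>u - t\<bar>" using that(1) by (intro G) (force simp: G_def)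
  thus False using that(2) del(1) by auto
 qed
 show ?thesis
 proof (intro exI[of _ \<delta>] conjI allI impI del(1))
  fix t' assume t': "\<bar>t' - t\<bar> < \<delta>"
  define h where "h = (%u. u + (t' - t) * max 0 (1 - \<bar>u - t\<bar> / \<delta>))"
  have h: "height_map h" unfolding h_def by (rule tent_height_map) (use del(1) G1 t' in auto)
  have ht: "h t = t'" by (simp add: h_def)
  have hout: "h u = u" if "u \<notin> {t - \<delta><..<t + \<delta>}" for u
  proof -
   have "\<delta> <= \<bar>u - t\<bar>" using that by auto
   hence "1 <= \<bar>u - t\<bar> / \<delta>" using del(1) by (simp add: le_divide_eq)
   thus ?thesis by (simp add: h_def)
  qed
  have t'01: "t' \<in> {0..1}" using t' t G1 del(1) by auto
  define l where "l = (%x. max 0 (min 1 (2 - \<bar>x - x0\<bar> / \<eta>)))"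
  have lval: "l (f i u) = (if f i t = x0 then 1 else 0)" if "i \<in> {1..n}" "u \<in> {t - \<delta>..t + \<delta>}" for i u
  proof (cases "f i t = x0")
   case True
   hence "\<bar>f i u - x0\<bar> / \<eta> <= 1" using close[OF that] eta by (simp add: divide_le_eq)
   thus ?thesis using True by (simp add: l_def)
  next
   case False
   hence "2 * \<eta> <= \<bar>f i u - x0\<bar>" using far[OF that(1) False] close[OF that] by linarith
   hence "2 <= \<bar>f i u - x0\<bar> / \<eta>" using eta by (simp add: le_divide_eq)
   thus ?thesis using False by (simp add: l_def)
  qed
  define A where "A = {i \<in> {1..n}. f i t = x0}"
  have "l (f i (t - \<delta>)) = 1 \<longleftrightarrow> f i t = x0" if "i \<in> {1..n}" for i
   using lval[OF that, of "t - \<delta>"] del(1) by simp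
  hence A: "A = {i \<in> {1..n}. l (f i (t - \<delta>)) = 1}" unfolding A_def by blast
  have "\<exists>\<phi>. isotopic n b (map_diagram \<phi> b) &
    dg n (map_diagram \<phi> b) (%i t. if i \<in> A then f i (hinv h t) else f i t) &
    (\<forall>i\<in>{1..n}. \<forall>t\<in>{0..1}. \<phi> (f i t, t) = (f i t, if i \<in> A then h t else t))"
  proof (rule vertical_isotopy[OF d _ _ h _ _ _ _ _ A, where ?t2.0 = "t + \<delta>"])
   show "continuous_on {0..real n + 1} l" unfolding l_def using eta by (intro continuous_intros) auto
   show "l (f i u) = 0 \<or> l (f i u) = 1" if "i \<in> {1..n}" "u \<in> {t - \<delta>..t + \<delta>}" for i u
    using lval[OF that] by simp
  qed (use del(1) G1 hout in \<open>auto simp: l_def\<close>)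
  then obtain \<phi> where \<phi>: "isotopic n b (map_diagram \<phi> b)"
   "dg n (map_diagram \<phi> b) (%i t. if i \<in> A then f i (hinv h t) else f i t)"
   "\<And>i t. i \<in> {1..n} ==> t \<in> {0..1} ==> \<phi> (f i t, t) = (f i t, if i \<in> A then h t else t)"
   by blast
  define g where "g = (%i t. if i \<in> A then f i (hinv h t) else f i t)"
  define b' where "b' = map_diagram \<phi> b"
  have d': "dg n b' g" using \<phi>(2) by (simp add: b'_def g_def)
  have hi: "hinv h u = u" if "u \<in> {0..1}" "u \<notin> {t - \<delta><..<t + \<delta>}" for u
   using hinv(1)[OF h that(1)] hout[OF that(2)] by simp
  have hit: "hinv h t' = t" using hinv(1)[OF h t01] ht by simp
  have hin: "hinv h t \<in> {t - \<delta>..t + \<delta>}"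
  proof -
   have v: "hinv h t \<in> {0..1}" "h (hinv h t) = t" using hinv[OF h] t01 by blast+
   show ?thesis
   proof (rule ccontr)
    assume "hinv h t \<notin> {t - \<delta>..t + \<delta>}"
    hence "h (hinv h t) = hinv h t" by (intro hout) auto
    hence "hinv h t = t" using v by simp
    thus False using \<open>hinv h t \<notin> {t - \<delta>..t + \<delta>}\<close> del(1) by simp
   qed
  qed
  have p0x: "\<exists>i\<in>{1..n}. f i t = x0" using mark_point[OF d m] p0 by auto
  have phi0: "\<phi> p0 = (x0, t')"
  proof -
   obtain i where i: "i \<in> {1..n}" "f i t = x0" using p0x by blast
   hence "i \<in> A" by (simp add: A_def)
   thus ?thesis using \<phi>(3)[OF i(1) t01] i ht p0 by simp
  qed
  have rank0: "rank b' (\<phi> p0) = rank b p0"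
  proof -
   have side: "g i t' < x0 \<longleftrightarrow> f i t < x0" if i: "i \<in> {1..n}" for i
   proof (cases "i \<in> A")
    case True
    thus ?thesis by (simp add: g_def hit A_def)
   next
    case False
    hence "f i t ~= x0" using i by (simp add: A_def)
    hence "3 * \<eta> <= \<bar>f i t - x0\<bar>" by (rule far[OF i])
    moreover have "\<bar>f i t' - f i t\<bar> < \<eta>" by (rule close[OF i]) (use t' in auto)
    ultimately show ?thesis using False eta by (simp add: g_def) linarith
   qed
   have "rank b' (x0, t') = rank b (x0, t)" unfolding rank_dg[OF d t01] rank_dg[OF d' t'01] lt_count_def
    by (rule arg_cong[where f = card]) (use side in blast)
   thus ?thesis unfolding phi0 using p0 by simp
  qed
  have other: "\<phi> p = p & rank b' p = rank b p" if mp: "(c, p) \<in> marks b" and ne: "p ~= p0" for c p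
  proof -
   obtain j u where j: "j \<in> {1..n}" "u \<in> {0<..<1}" "p = (f j u, u)" using mark_point[OF d mp] by blast
   have u01: "u \<in> {0..1}" using j(2) by simp
   have "(c (Suc (rank b p)), u) \<in> data b" using mp j(3) unfolding data_marks by force
   hence cases: "u = t \<or> u \<notin> {t - \<delta><..<t + \<delta>}" using alone by auto
   have jA: "j \<notin> A" if "u = t" using that ne j(3) p0 by (auto simp: A_def)
   have ph: "\<phi> p = p"
    using \<phi>(3)[OF j(1) u01] cases jA hout j(3) by auto
   have side: "g i u < f j u \<longleftrightarrow> f i u < f j u" if i: "i \<in> {1..n}" for i
   proof (cases "i \<in> A & u \<in> {t - \<delta><..<t + \<delta>}")
    case False
    thus ?thesis using hi[OF u01] by (auto simp: g_def)
   next
    case True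
    hence ut: "u = t" using cases by blast
    have "f j t ~= x0" using jA[OF ut] j(1) by (simp add: A_def)
    hence "3 * \<eta> <= \<bar>f j t - x0\<bar>" by (rule far[OF j(1)])
    moreover have "f i t = x0" "\<bar>f i (hinv h t) - f i t\<bar> < \<eta>" using True close[OF i hin] by (simp_all add: A_def)
    ultimately show ?thesis using True ut eta by (simp add: g_def) linarith
   qed
   have "rank b' p = rank b p" unfolding j(3) rank_dg[OF d u01] rank_dg[OF d' u01] lt_count_def
    by (rule arg_cong[where f = card]) (use side in blast)
   thus ?thesis using ph by simp
  qed
  let ?F = "%(c, p). (c (Suc (rank b p)), snd p)"
  have "data b' = (%(c, p). (c (Suc (rank b' (\<phi> p))), snd (\<phi> p))) ` marks b"
   unfolding data_marks b'_def marks_map image_image by (rule image_cong) auto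
  also have "... = insert (c0 (Suc (rank b p0)), t') (?F ` (marks b - {(c0, p0)}))"
  proof -
   have "marks b = insert (c0, p0) (marks b - {(c0, p0)})" using m by blast
   hence "(%(c, p). (c (Suc (rank b' (\<phi> p))), snd (\<phi> p))) ` marks b =
    insert (c0 (Suc (rank b' (\<phi> p0))), snd (\<phi> p0))
     ((%(c, p). (c (Suc (rank b' (\<phi> p))), snd (\<phi> p))) ` (marks b - {(c0, p0)}))"
    by (metis (no_types, lifting) image_insert case_prod_conv)
   also have "(%(c, p). (c (Suc (rank b' (\<phi> p))), snd (\<phi> p))) ` (marks b - {(c0, p0)}) = ?F ` (marks b - {(c0, p0)})"
   proof (rule image_cong[OF HOL.refl])
    fix q assume q: "q \<in> marks b - {(c0, p0)}"
    obtain c p where cp: "q = (c, p)" by (cases q)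
    have mp: "(c, p) \<in> marks b" and ne: "(c, p) ~= (c0, p0)" using q cp by auto
    have "p ~= p0" using mark_unique[OF d mp] m ne by blast
    thus "(%(c, p). (c (Suc (rank b' (\<phi> p))), snd (\<phi> p))) q = ?F q"
     unfolding cp using other[OF mp] by simp
   qed
   finally show ?thesis using rank0 phi0 by simp
  qed
  also have "?F ` (marks b - {(c0, p0)}) = data b - {(c0 (Suc (rank b p0)), t)}"
  proof -
   have "inj_on ?F (marks b)"
   proof (rule inj_onI)
    fix q q' assume a: "q \<in> marks b" "q' \<in> marks b" and e: "?F q = ?F q'"
    obtain c p c' p' where q: "q = (c, p)" "q' = (c', p')" by (metis surj_pair)
    have e1: "c (Suc (rank b p)) = c' (Suc (rank b p'))" and e2: "snd p = snd p'" using e unfolding q by simp_all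
    have "(\<exists>k. c = Cr k) \<or> c = Bar" "(\<exists>k. c' = Cr k) \<or> c' = Bar" using a unfolding q marks_def by blast+
    hence "rank b p = rank b p'" using e1 by auto
    thus "q = q'" unfolding q by (rule mark_inj[OF d a[unfolded q] _ e2])
   qed
   hence "?F ` (marks b - {(c0, p0)}) = ?F ` marks b - ?F ` {(c0, p0)}"
    using m by (intro inj_on_image_set_diff[where C = "marks b"]) auto
   thus ?thesis unfolding data_marks using p0 by simp
  qed
  finally show "\<exists>b'. isotopic n b b' & data b' = insert (c0 (Suc (rank b p0)), t') (data b - {(c0 (Suc (rank b p0)), t)})"
   using \<phi>(1) unfolding b'_def by blast
 qed
qed

lemma reparametrize_heights:
 assumes d: "dg n b f" and h: "height_map h"
 shows "\<exists>b'. isotopic n b b' & data b' = (%(l, t). (l, h t)) ` data b"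
proof -
 define A where "A = {1..n}"
 have A: "A = {i \<in> {1..n}. (%_. 1::real) (f i 0) = 1}" by (auto simp: A_def)
 have h01: "h 0 = 0" "h 1 = 1" using h by (simp_all add: height_map_def)
 have "\<exists>\<phi>. isotopic n b (map_diagram \<phi> b) &
   dg n (map_diagram \<phi> b) (%i t. if i \<in> A then f i (hinv h t) else f i t) &
   (\<forall>i\<in>{1..n}. \<forall>t\<in>{0..1}. \<phi> (f i t, t) = (f i t, if i \<in> A then h t else t))"
 proof (rule vertical_isotopy[OF d _ _ h _ _ _ _ _ A, where ?t2.0 = 1])
  fix t :: real assume "t \<in> {0..1}" "t \<notin> {0<..<1}"
  hence "t = 0 \<or> t = 1" by auto
  thus "h t = t" using h01 by auto
 qed auto
 then obtain \<phi> where \<phi>: "isotopic n b (map_diagram \<phi> b)"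
  "dg n (map_diagram \<phi> b) (%i t. if i \<in> A then f i (hinv h t) else f i t)"
  "\<And>i t. i \<in> {1..n} ==> t \<in> {0..1} ==> \<phi> (f i t, t) = (f i t, if i \<in> A then h t else t)" by blast
 define g where "g = (%i t. if i \<in> A then f i (hinv h t) else f i t)"
 define b' where "b' = map_diagram \<phi> b"
 have d': "dg n b' g" using \<phi>(2) by (simp add: b'_def g_def)
 have key: "snd (\<phi> p) = h (snd p) & rank b' (\<phi> p) = rank b p" if mp: "(c, p) \<in> marks b" for c p
 proof -
  obtain j u where j: "j \<in> {1..n}" "u \<in> {0<..<1}" "p = (f j u, u)" using mark_point[OF d mp] by blast
  have u01: "u \<in> {0..1}" using j(2) by simp
  have hu: "h u \<in> {0..1}" using height_map_image[OF h] u01 by blast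
  have ph: "\<phi> p = (f j u, h u)" using \<phi>(3)[OF j(1) u01] j(1,3) by (simp add: A_def)
  have "g i (h u) = f i u" if "i \<in> {1..n}" for i using hinv(1)[OF h u01] that by (simp add: g_def A_def)
  hence "rank b' (\<phi> p) = rank b p"
   unfolding ph unfolding j(3) rank_dg[OF d u01] rank_dg[OF d' hu] lt_count_def
   by (intro arg_cong[where f = card]) auto
  thus ?thesis using ph j(3) by simp
 qed
 have "data b' = (%(c, p). (c (Suc (rank b' (\<phi> p))), snd (\<phi> p))) ` marks b"
  unfolding data_marks b'_def marks_map image_image by (rule image_cong) auto
 also have "... = (%(l, t). (l, h t)) ` data b"
  unfolding data_marks image_image by (rule image_cong) (use key in auto)
 finally show ?thesis using \<phi>(1) b'_def by blast
qed

text \<open>A piecewise linear function with the given heights as nodes, listed from the bottom.\<close>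

lemma interpolating_height_map:
 assumes ts: "sorted_wrt (>) ts" "\<And>t. t \<in> set ts ==> t \<in> {0<..<1}"
  and us: "sorted_wrt (>) us" "\<And>t. t \<in> set us ==> t \<in> {0<..<1}" and len: "length us = length ts"
 shows "\<exists>h. height_map h & (\<forall>j<length ts. h (ts ! j) = us ! j)"
proof -
 define r where "r = length ts"
 define node where "node = (%xs k. if k = 0 then 0 else if k <= r then xs ! (r - k) else (1::real))"
 have strict: "node xs k < node xs (Suc k)" if xs: "sorted_wrt (>) xs" "\<And>t. t \<in> set xs ==> t \<in> {0<..<1}"
  "length xs = r" and k: "k < Suc r" for xs k
 proof -
  have i1: "xs ! (r - Suc k) \<in> {0<..<1}" if "Suc k <= r" by (rule xs(2)) (use xs(3) that in auto)
  have i2: "xs ! (r - k) \<in> {0<..<1}" if "0 < k" by (rule xs(2)) (use xs(3) that k in auto)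
  have "xs ! (r - k) < xs ! (r - Suc k)" if "0 < k" "Suc k <= r"
   using sorted_wrt_nth_less[OF xs(1), of "r - Suc k" "r - k"] xs(3) that by simp
  thus ?thesis using i1 i2 k by (auto simp: node_def)
 qed
 have nd: "nodes (Suc r) (node ts) (node us)"
  unfolding nodes_def
 proof (intro allI impI)
  fix k assume "k < Suc r"
  thus "node ts k <= node ts (Suc k) & node us k <= node us (Suc k) & (node ts k = node ts (Suc k)) = (node us k = node us (Suc k))"
   using strict[OF ts, of k] strict[OF us, of k] len r_def by simp
 qed
 have e: "node xs 0 = 0" "node xs (Suc r) = 1" for xs by (simp_all add: node_def)
 define h where "h = plmap (Suc r) (node ts) (node us)"
 have "height_map h"
  unfolding height_map_def
 proof (intro conjI)
  have "continuous_on {0..1} (%x. plmap (Suc r) (%k. node ts k) (%k. node us k) x)"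
   by (rule plmap_continuous[where y = "%k _. node ts k" and z = "%k _. node us k"])
     (use nd in \<open>auto intro: continuous_intros\<close>)
  thus "continuous_on {0..1} h" by (simp add: h_def)
  show "strict_mono_on {0..1} h"
   by (rule strict_mono_onI) (use plmap_strict[OF nd] e in \<open>auto simp: h_def\<close>)
  show "h 0 = 0" "h 1 = 1" using plmap_node[OF nd, of 0] plmap_node[OF nd, of "Suc r"] e by (simp_all add: h_def)
 qed
 moreover have "h (ts ! j) = us ! j" if j: "j < length ts" for j
 proof -
  have "node xs (r - j) = xs ! j" for xs using j by (simp add: node_def r_def)
  thus ?thesis using plmap_node[OF nd, of "r - j"] by (simp add: h_def)
 qed
 ultimately show ?thesis by blast
qed

lemma marks_iff: "(c, p) \<in> marks b \<longleftrightarrow> (\<exists>\<kappa>. c = Cr \<kappa> & p \<in> crossings b \<kappa>) \<or> c = Bar & p \<in> bars b"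
 unfolding marks_def by blast

lemma marks_stack: "marks (stack b c) = apsnd upper ` marks b \<union> apsnd lower ` marks c"
proof (rule Set.set_eqI)
 fix m :: "(nat => letter) \<times> point"
 obtain a p where m: "m = (a, p)" by (cases m)
 have im: "(a, p) \<in> apsnd F ` M \<longleftrightarrow> (\<exists>q. p = F q & (a, q) \<in> M)" for F and M :: "((nat => letter) \<times> point) set"
  by force
 show "m \<in> marks (stack b c) \<longleftrightarrow> m \<in> apsnd upper ` marks b \<union> apsnd lower ` marks c"
  unfolding m Un_iff im marks_iff stack_def by auto
qed

section \<open>Words and their congruence\<close>

fun shift :: "nat => letter => letter" where
 "shift d (Cr k i) = Cr k (i + d)"
| "shift d (Bar i) = Bar (i + d)"

fun supp :: "letter => nat set" where
 "supp (Cr k i) = {i, i + 1}"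
| "supp (Bar i) = {i}"

fun valid :: "nat => letter => bool" where
 "valid n (Cr k i) \<longleftrightarrow> 1 <= i & i + 1 <= n"
| "valid n (Bar i) \<longleftrightarrow> 1 <= i & i <= n"

definition vwords :: "nat => letter list set" where
 "vwords n = {w. \<forall>l\<in>set w. valid n l}"

lemma vwords_simps [simp]:
 "[] \<in> vwords n"
 "l # w \<in> vwords n \<longleftrightarrow> valid n l & w \<in> vwords n"
 "u @ w \<in> vwords n \<longleftrightarrow> u \<in> vwords n & w \<in> vwords n"
 by (auto simp: vwords_def)

text \<open>The congruence on words in all letters generated by the exchange of distant letters and by the local pictures in all positions.
It will turn out to describe the equivalence of diagrams.\<close>

inductive_set lcong :: "nat => (letter list \<times> letter list) set" for n where
 lrefl: "w \<in> vwords n ==> (w, w) \<in> lcong n"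
| lsym: "(u, v) \<in> lcong n ==> (v, u) \<in> lcong n"
| ltrans: "(u, v) \<in> lcong n ==> (v, w) \<in> lcong n ==> (u, w) \<in> lcong n"
| far: "p \<in> vwords n ==> q \<in> vwords n ==> valid n l1 ==> valid n l2 ==> supp l1 \<inter> supp l2 = {} ==>
  (p @ [l1, l2] @ q, p @ [l2, l1] @ q) \<in> lcong n"
| local: "p \<in> vwords n ==> q \<in> vwords n ==> local_picture m l r ==> d + m <= n ==>
  (p @ map (shift d) l @ q, p @ map (shift d) r @ q) \<in> lcong n"

text \<open>The monoid of self-maps of a type under composition. A word acts on classes of words by left multiplication, and this action
is faithful. So congruences of words are equations in a monoid given as a type, for which rewriting is available.\<close>

typedef 'a endo = "UNIV :: ('a => 'a) set" morphisms run Endo ..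

instantiation endo :: (type) monoid_mult
begin
definition "1 = Endo id"
definition "f * g = Endo (run f \<circ> run g)"
instance by standard (simp_all add: one_endo_def times_endo_def Endo_inverse run_inverse comp_assoc)
end

locale word_congruence =
 fixes W :: "'b list set" and r :: "('b list \<times> 'b list) set"
 assumes Nil_in [simp]: "[] \<in> W"
  and append_in [simp]: "u @ v \<in> W \<longleftrightarrow> u \<in> W & v \<in> W"
  and eq: "equiv W r"
  and ctx: "(u, v) \<in> r ==> p \<in> W ==> q \<in> W ==> (p @ u @ q, p @ v @ q) \<in> r"
begin

lemma in_lists: "(u, v) \<in> r ==> u \<in> W & v \<in> W"
 using eq by (auto simp: equiv_def refl_on_def)

lemma left: "(u, v) \<in> r ==> p \<in> W ==> (p @ u, p @ v) \<in> r"
 using ctx[of u v p "[]"] by simp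

lemma right: "(u, v) \<in> r ==> q \<in> W ==> (u @ q, v @ q) \<in> r"
 using ctx[of u v "[]" q] by simp

lemma trans': "(u, v) \<in> r ==> (v, w) \<in> r ==> (u, w) \<in> r"
 using eq by (meson equivE transD)

lemma sym': "(u, v) \<in> r ==> (v, u) \<in> r"
 using eq by (meson equivE symD)

lemma append2: "(u, v) \<in> r ==> (u', v') \<in> r ==> (u @ u', v @ v') \<in> r"
 using left[of u' v' u] right[of u v v'] in_lists trans' by blast

definition cls :: "'b list => 'b list set" where
 "cls w = r `` {w}"

lemma cls_eq: "u \<in> W ==> v \<in> W ==> cls u = cls v \<longleftrightarrow> (u, v) \<in> r"
 unfolding cls_def using eq_equiv_class_iff[OF eq] by blast

definition act :: "'b list => ('b list set) endo" where
 "act w = Endo (%A. if A \<in> W // r then \<Union>u\<in>A. cls (w @ u) else A)"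

lemma act_cls:
 assumes "w \<in> W" "u \<in> W" shows "run (act w) (cls u) = cls (w @ u)"
proof -
 have q: "cls u \<in> W // r" unfolding cls_def by (rule quotientI[OF assms(2)])
 have "cls (w @ u') = cls (w @ u)" if "u' \<in> cls u" for u'
 proof -
  have "(u, u') \<in> r" using that by (simp add: cls_def)
  hence "(w @ u, w @ u') \<in> r" using left assms(1) by blast
  thus ?thesis using cls_eq in_lists by metis
 qed
 moreover have "u \<in> cls u" using assms(2) eq by (auto simp: cls_def equiv_def refl_on_def)
 ultimately have "(\<Union>u'\<in>cls u. cls (w @ u')) = cls (w @ u)" by blast
 thus ?thesis using q by (simp add: act_def Endo_inverse)
qed

lemma act_other: "A \<notin> W // r ==> run (act w) A = A"
 by (simp add: act_def Endo_inverse)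

lemma quotient_cls: "A \<in> W // r ==> \<exists>u\<in>W. A = cls u"
 unfolding cls_def by (rule quotientE) auto

lemma endo_eqI: "(\<And>A. run f A = run g A) ==> f = g"
 by (metis ext run_inverse)

lemma act_append:
 assumes "u \<in> W" "v \<in> W" shows "act (u @ v) = act u * act v"
proof (rule endo_eqI)
 fix A
 have m: "run (act u * act v) A = run (act u) (run (act v) A)" by (simp add: times_endo_def Endo_inverse)
 show "run (act (u @ v)) A = run (act u * act v) A"
 proof (cases "A \<in> W // r")
  case True
  then obtain w where w: "w \<in> W" "A = cls w" using quotient_cls by blast
  thus ?thesis unfolding m using assms by (simp add: act_cls)
 next
  case False
  thus ?thesis unfolding m by (simp add: act_other)
 qed
qed

lemma act_Nil: "act [] = 1"
proof (rule endo_eqI)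
 fix A
 show "run (act []) A = run 1 A"
 proof (cases "A \<in> W // r")
  case True
  then obtain w where w: "w \<in> W" "A = cls w" using quotient_cls by blast
  thus ?thesis by (simp add: act_cls one_endo_def Endo_inverse)
 next
  case False
  thus ?thesis by (simp add: act_other one_endo_def Endo_inverse)
 qed
qed

lemma act_eq_iff:
 assumes "u \<in> W" "v \<in> W" shows "act u = act v \<longleftrightarrow> (u, v) \<in> r"
proof
 assume "act u = act v"
 hence "run (act u) (cls []) = run (act v) (cls [])" by simp
 thus "(u, v) \<in> r" using act_cls assms cls_eq by simp
next
 assume uv: "(u, v) \<in> r"
 show "act u = act v"
 proof (rule endo_eqI)
  fix A
  show "run (act u) A = run (act v) A"
  proof (cases "A \<in> W // r")
   case True
   then obtain w where w: "w \<in> W" "A = cls w" using quotient_cls by blast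
   hence "(u @ w, v @ w) \<in> r" using uv right by blast
   thus ?thesis using w assms act_cls cls_eq in_lists by metis
  next
   case False
   thus ?thesis by (simp add: act_other)
  qed
 qed
qed

lemma act_prod:
 assumes "w \<in> W" shows "act w = prod_list (map (%x. act [x]) w)"
 using assms
proof (induction w)
 case Nil
 thus ?case by (simp add: act_Nil)
next
 case (Cons x w)
 have "[x] \<in> W & w \<in> W" using append_in[of "[x]" w] Cons.prems by simp
 thus ?case using act_append[of "[x]" w] Cons.IH by simp
qed

end

section \<open>From the reduced relations to all relations\<close>

definition commutes :: "'a::monoid_mult => 'a => bool" where
 "commutes x y \<longleftrightarrow> x * y = y * x"

lemma commutes_sym: "commutes x y ==> commutes y x"
 by (simp add: commutes_def)

lemma commutes_mult: "commutes x y ==> commutes x z ==> commutes x (y * z)"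
 unfolding commutes_def by (metis mult.assoc)

lemma commutes_conj:
 assumes "commutes x y" "d * e = 1" "e * d = 1" shows "commutes (d * x * e) (d * y * e)"
proof -
 have "(d * x * e) * (d * y * e) = d * x * (e * d) * y * e" by (simp only: mult.assoc)
 also have "... = d * (x * y) * e" by (simp only: assms(3) mult.assoc mult_1_right mult_1_left)
 also have "... = d * (y * x) * e" using assms(1) by (simp only: commutes_def)
 also have "... = d * y * (e * d) * x * e" by (simp only: assms(3) mult.assoc mult_1_right mult_1_left)
 also have "... = (d * y * e) * (d * x * e)" by (simp only: mult.assoc)
 finally show ?thesis unfolding commutes_def .
qed

lemma commutes_inverse:
 assumes "commutes x y" "x * x' = 1" "x' * x = 1" shows "commutes x' y"
proof -
 have "x' * y = x' * y * (x * x')" by (simp add: assms)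
 also have "... = x' * (y * x) * x'" by (simp only: mult.assoc)
 also have "... = x' * (x * y) * x'" using assms(1) by (simp only: commutes_def)
 also have "... = (x' * x) * y * x'" by (simp only: mult.assoc)
 also have "... = y * x'" by (simp add: assms)
 finally show ?thesis unfolding commutes_def .
qed

lemma inverse_unique':
 fixes x :: "'a::monoid_mult"
 assumes "x * y = 1" "z * x = 1" shows "y = z"
 by (metis assms mult.assoc mult_1_left mult_1_right)

text \<open>If \<open>a\<close>, \<open>b\<close>, \<open>c\<close> are the transpositions \<open>(1 2)\<close>, \<open>(2 3)\<close>, \<open>(3 4)\<close>, then conjugation by \<open>b c a b\<close> moves the pair \<open>{3, 4}\<close>
to the pair \<open>{1, 2}\<close>.\<close>

lemma long_conjugation:
 fixes a b c :: "'a::monoid_mult"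
 assumes aa: "a * a = 1" and bb: "b * b = 1" and cc: "c * c = 1" and ac: "a * c = c * a"
  and aba: "a * b * a = b * a * b" and bcb: "b * c * b = c * b * c"
 shows "(b * c * a * b) * c * (b * a * c * b) = a" "(b * c * a * b) * (b * a * c * b) = 1" "(b * a * c * b) * (b * c * a * b) = 1"
proof -
 have "(b * c * a * b) * c * (b * a * c * b) = b * c * a * (b * c * b) * a * c * b" by (simp only: mult.assoc)
 also have "... = b * c * a * (c * b * c) * a * c * b" by (simp only: bcb)
 also have "... = b * c * (a * c) * b * (c * a) * c * b" by (simp only: mult.assoc)
 also have "... = b * c * (c * a) * b * (a * c) * c * b" by (simp only: ac)
 also have "... = b * (c * c) * a * b * a * (c * c) * b" by (simp only: mult.assoc)
 also have "... = b * (a * b * a) * b" by (simp only: cc mult.assoc mult_1_left mult_1_right)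
 also have "... = b * (b * a * b) * b" by (simp only: aba)
 also have "... = (b * b) * a * (b * b)" by (simp only: mult.assoc)
 finally show "(b * c * a * b) * c * (b * a * c * b) = a" by (simp add: bb)
 have "(b * c * a * b) * (b * a * c * b) = b * c * a * (b * b) * a * c * b" by (simp only: mult.assoc)
 also have "... = b * c * (a * a) * c * b" by (simp only: bb mult.assoc mult_1_left)
 also have "... = b * (c * c) * b" by (simp only: aa mult.assoc mult_1_left)
 finally show "(b * c * a * b) * (b * a * c * b) = 1" by (simp add: bb cc)
 have "(b * a * c * b) * (b * c * a * b) = b * a * c * (b * b) * c * a * b" by (simp only: mult.assoc)
 also have "... = b * a * (c * c) * a * b" by (simp only: bb mult.assoc mult_1_left)
 also have "... = b * (a * a) * b" by (simp only: cc mult.assoc mult_1_left)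
 finally show "(b * a * c * b) * (b * c * a * b) = 1" by (simp add: bb aa)
qed

text \<open>Elements of a monoid satisfying the reduced relations, with \<open>s'\<close> inverse to \<open>s\<close>. Each relation is required only in those
degrees in which all of its generators exist.\<close>

locale reduced_relations =
 fixes n :: nat and v :: "nat => 'a::monoid_mult" and s s' g :: 'a
 assumes vv: "1 <= i ==> i < n ==> v i * v i = 1"
  and vfar: "1 <= i ==> i < n ==> 1 <= j ==> j < n ==> i + 1 < j ==> v i * v j = v j * v i"
  and vbraid: "1 <= i ==> i + 1 < n ==> v i * v (i + 1) * v i = v (i + 1) * v i * v (i + 1)"
  and ss': "2 <= n ==> s * s' = 1" and s's: "2 <= n ==> s' * s = 1"
  and sfar: "4 <= n ==> s * (v 2 * v 3 * v 1 * v 2 * s * v 2 * v 1 * v 3 * v 2) = (v 2 * v 3 * v 1 * v 2 * s * v 2 * v 1 * v 3 * v 2) * s"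
  and sbraid: "3 <= n ==> (v 1 * s * v 1) * (v 2 * s * v 2) * (v 1 * s * v 1) = (v 2 * s * v 2) * (v 1 * s * v 1) * (v 2 * s * v 2)"
  and sv: "3 <= j ==> j < n ==> s * v j = v j * s"
  and gg: "g * g = 1"
  and gv: "2 <= j ==> j < n ==> g * v j = v j * g"
  and gvgv: "2 <= n ==> g * v 1 * g * v 1 = v 1 * g * v 1 * g"
  and gs: "3 <= n ==> g * v 1 * v 2 * s * v 2 * v 1 = v 1 * v 2 * s * v 2 * v 1 * g"
  and gsg: "2 <= n ==> g * v 1 * g * s * g * v 1 * g = s"
begin

text \<open>The crossing in position \<open>i + 1\<close> is obtained from the one in position \<open>i\<close> by carrying it one step to the right with virtual crossings.\<close>

fun sig :: "nat => 'a" where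
 "sig (Suc (Suc i)) = v (Suc i) * v (Suc (Suc i)) * sig (Suc i) * v (Suc (Suc i)) * v (Suc i)"
| "sig i = s"

fun sig' :: "nat => 'a" where
 "sig' (Suc (Suc i)) = v (Suc i) * v (Suc (Suc i)) * sig' (Suc i) * v (Suc (Suc i)) * v (Suc i)"
| "sig' i = s'"

fun gam :: "nat => 'a" where
 "gam (Suc (Suc i)) = v (Suc i) * gam (Suc i) * v (Suc i)"
| "gam i = g"

lemma sig_step: "1 <= i ==> sig (i + 1) = v i * v (i + 1) * sig i * v (i + 1) * v i"
 and sig'_step: "1 <= i ==> sig' (i + 1) = v i * v (i + 1) * sig' i * v (i + 1) * v i"
 and gam_step: "1 <= i ==> gam (i + 1) = v i * gam i * v i"
 by (cases i; simp)+

lemma sig_1: "sig 1 = s" "sig' 1 = s'" "gam 1 = g"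
 by (simp_all add: numeral_eq_Suc)

lemma vvx: "1 <= i ==> i < n ==> v i * (v i * x) = x"
 by (simp add: mult.assoc[symmetric] vv)

lemma v_commutes:
 assumes "1 <= i" "i < n" "1 <= j" "j < n" "i + 1 < j \<or> j + 1 < i" shows "commutes (v i) (v j)"
 using assms vfar[of i j] vfar[of j i] unfolding commutes_def by auto

lemma pair_inverse:
 assumes "1 <= i" "i + 1 < n"
 shows "(v i * v (i + 1)) * (v (i + 1) * v i) = 1" "(v (i + 1) * v i) * (v i * v (i + 1)) = 1"
 using assms by (simp_all add: mult.assoc vv vvx)

lemma sig_inverse:
 assumes "1 <= i" "i < n" shows "sig i * sig' i = 1 & sig' i * sig i = 1"
 using assms
proof (induction i rule: nat_induct_at_least)
 case base
 thus ?case using ss' s's sig_1 by simp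
next
 case (Suc i)
 hence i: "1 <= i" "i + 1 < n" "i < n" by simp_all
 have IH: "sig i * sig' i = 1" "sig' i * sig i = 1" using Suc.IH i by simp_all
 have IHx: "sig i * (sig' i * x) = x" "sig' i * (sig i * x) = x" for x
  by (simp_all add: mult.assoc[symmetric] IH)
 show ?case using sig_step[OF i(1)] sig'_step[OF i(1)] i
  by (simp add: mult.assoc vv vvx IHx del: sig.simps sig'.simps)
qed

lemma sig_conj: "1 <= i ==> (v i * v (i + 1)) * sig i * (v (i + 1) * v i) = sig (i + 1)"
 using sig_step[of i] by (simp add: mult.assoc del: sig.simps)

text \<open>\<open>long_conjugation\<close> for three consecutive virtual crossings: the strands \<open>i - 1\<close>, \<open>i\<close> change places with the strands \<open>i + 1\<close>, \<open>i + 2\<close>.\<close>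

lemma double_shift:
 assumes i: "2 <= i" "i + 1 < n"
 shows "(v i * v (i + 1) * v (i - 1) * v i) * v (i + 1) * (v i * v (i - 1) * v (i + 1) * v i) = v (i - 1)"
  "(v i * v (i + 1) * v (i - 1) * v i) * (v i * v (i - 1) * v (i + 1) * v i) = 1"
  "(v i * v (i - 1) * v (i + 1) * v i) * (v i * v (i + 1) * v (i - 1) * v i) = 1"
  "(v i * v (i + 1) * v (i - 1) * v i) * sig (i - 1) * (v i * v (i - 1) * v (i + 1) * v i) = sig (i + 1)"
proof -
 have b: "v (i - 1) * v i * v (i - 1) = v i * v (i - 1) * v i" using vbraid[of "i - 1"] i by simp
 have b2: "v i * v (i + 1) * v i = v (i + 1) * v i * v (i + 1)" using vbraid[of i] i by simp
 have ac: "v (i - 1) * v (i + 1) = v (i + 1) * v (i - 1)" using vfar[of "i - 1" "i + 1"] i by simp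
 note l = long_conjugation[of "v (i - 1)" "v i" "v (i + 1)", OF vv vv vv ac b b2]
 show "(v i * v (i + 1) * v (i - 1) * v i) * v (i + 1) * (v i * v (i - 1) * v (i + 1) * v i) = v (i - 1)"
  "(v i * v (i + 1) * v (i - 1) * v i) * (v i * v (i - 1) * v (i + 1) * v i) = 1"
  "(v i * v (i - 1) * v (i + 1) * v i) * (v i * v (i + 1) * v (i - 1) * v i) = 1"
  using l i by auto
 have "sig i = v (i - 1) * v i * sig (i - 1) * v i * v (i - 1)" using sig_step[of "i - 1"] i by simp
 thus "(v i * v (i + 1) * v (i - 1) * v i) * sig (i - 1) * (v i * v (i - 1) * v (i + 1) * v i) = sig (i + 1)"
  using sig_step[of i] i by (simp add: mult.assoc del: sig.simps)
qed

text \<open>By the recursion this reduces to smaller \<open>i\<close>, except that the recursion for \<open>sig i\<close> uses a virtual crossing next to \<open>v j\<close> when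
\<open>j = i - 2\<close>. This case is the commutation of \<open>v (j + 2)\<close> with \<open>sig j\<close>, conjugated by a double shift.\<close>

lemma sig_v_commutes:
 assumes "1 <= i" "i < n" "1 <= j" "j < n" "i + 1 < j \<or> j + 1 < i"
 shows "commutes (v j) (sig i)"
 using assms
proof (induction i arbitrary: j rule: less_induct)
 case (less i)
 show ?case
 proof (cases "i = 1")
  case True
  thus ?thesis using sv[of j] less.prems sig_1 by (simp add: commutes_def)
 next
  case False
  define k where "k = i - 1"
  have k: "i = k + 1" "1 <= k" using False less.prems(1) by (auto simp: k_def)
  show ?thesis
  proof (cases "j + 1 = k")
   case True
   hence kk: "2 <= k" "k + 1 < n" using k less.prems by auto
   have j: "j = k - 1" using True by simp
   have "commutes (v (k + 1)) (sig (k - 1))"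
    by (rule less.IH) (use kk k in auto)
   thus ?thesis using commutes_conj[OF _ double_shift(2,3)[OF kk], of "v (k + 1)" "sig (k - 1)"]
    unfolding double_shift(1,4)[OF kk] j k(1) by blast
  next
   case False
   hence f: "k + 2 < j \<or> j + 1 < k" using less.prems k by auto
   have 1: "commutes (v j) (v k)" by (rule v_commutes) (use f less.prems k in auto)
   have 2: "commutes (v j) (v (k + 1))" by (rule v_commutes) (use f less.prems k in auto)
   have 3: "commutes (v j) (sig k)" by (rule less.IH) (use f less.prems k in auto)
   show ?thesis unfolding k(1) sig_step[OF k(2)] by (intro commutes_mult 1 2 3)
  qed
 qed
qed

lemma sig_3: "sig 3 = v 2 * v 3 * v 1 * v 2 * s * v 2 * v 1 * v 3 * v 2"
 by (simp add: numeral_eq_Suc mult.assoc)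

lemma sig_2: "sig 2 = v 1 * v 2 * s * v 2 * v 1"
 by (simp add: numeral_eq_Suc mult.assoc)

lemma s_sig_commutes:
 assumes "3 <= j" "j < n" shows "commutes s (sig j)"
 using assms
proof (induction j rule: nat_induct_at_least)
 case base
 thus ?case unfolding commutes_def sig_3 using sfar by simp
next
 case (Suc j)
 have 1: "commutes s (v j)" "commutes s (v (j + 1))" using sv[of j] sv[of "j + 1"] Suc by (simp_all add: commutes_def)
 have j: "1 <= j" using Suc by simp
 have "commutes s (sig j)" using Suc by simp
 hence "commutes s (sig (j + 1))" unfolding sig_step[OF j] by (intro commutes_mult 1)
 thus ?case by (simp del: sig.simps)
qed

lemma sig_sig_commutes:
 assumes "1 <= i" "i + 1 < j" "j < n" shows "commutes (sig j) (sig i)"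
 using assms
proof (induction i rule: nat_induct_at_least)
 case base
 thus ?case using s_sig_commutes[of j] sig_1 by (simp add: commutes_sym)
next
 case (Suc i)
 have 1: "commutes (sig j) (v i)" "commutes (sig j) (v (i + 1))"
  by (rule commutes_sym, rule sig_v_commutes, use Suc in auto)+
 have i: "1 <= i" using Suc by simp
 have "commutes (sig j) (sig i)" using Suc by simp
 hence "commutes (sig j) (sig (i + 1))" unfolding sig_step[OF i] by (intro commutes_mult 1)
 thus ?case by (simp del: sig.simps)
qed

lemma conj_mult3:
 fixes d e x y z :: 'a
 assumes "e * d = 1"
 shows "d * (x * y * z) * e = (d * x * e) * (d * y * e) * (d * z * e)"
proof -
 have "(d * x * e) * (d * y * e) * (d * z * e) = d * x * (e * d) * y * (e * d) * z * e" by (simp only: mult.assoc)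
 also have "... = d * (x * y * z) * e" by (simp only: assms mult.assoc mult_1_left)
 finally show ?thesis by simp
qed

lemma triple_shift:
 assumes i: "1 <= i" "i + 2 < n"
 shows "(v i * v (i + 1) * v (i + 2)) * (v (i + 2) * v (i + 1) * v i) = 1"
  "(v (i + 2) * v (i + 1) * v i) * (v i * v (i + 1) * v (i + 2)) = 1"
  "(v i * v (i + 1) * v (i + 2)) * sig i * (v (i + 2) * v (i + 1) * v i) = sig (i + 1)"
  "(v i * v (i + 1) * v (i + 2)) * sig (i + 1) * (v (i + 2) * v (i + 1) * v i) = sig (i + 2)"
proof -
 have n: "v i * v i = 1" "v (i + 1) * v (i + 1) = 1" "v (i + 2) * v (i + 2) = 1"
  "v i * (v i * x) = x" "v (i + 1) * (v (i + 1) * x) = x" "v (i + 2) * (v (i + 2) * x) = x" for x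
  using i vv vvx by auto
 show "(v i * v (i + 1) * v (i + 2)) * (v (i + 2) * v (i + 1) * v i) = 1"
  "(v (i + 2) * v (i + 1) * v i) * (v i * v (i + 1) * v (i + 2)) = 1"
  by (simp_all only: mult.assoc n mult_1_right)
 have c1: "v (i + 2) * sig i = sig i * v (i + 2)" using sig_v_commutes[of i "i + 2"] i by (simp add: commutes_def)
 have "(v i * v (i + 1) * v (i + 2)) * sig i * (v (i + 2) * v (i + 1) * v i)
   = v i * v (i + 1) * (v (i + 2) * sig i) * v (i + 2) * v (i + 1) * v i" by (simp only: mult.assoc)
 also have "... = v i * v (i + 1) * sig i * (v (i + 2) * v (i + 2)) * v (i + 1) * v i" by (simp only: c1 mult.assoc)
 also have "... = sig (i + 1)" by (simp only: n mult_1_right sig_step[OF i(1)])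
 finally show "(v i * v (i + 1) * v (i + 2)) * sig i * (v (i + 2) * v (i + 1) * v i) = sig (i + 1)" .
 have c2: "v i * sig (i + 2) = sig (i + 2) * v i" using sig_v_commutes[of "i + 2" i] i by (simp add: commutes_def del: sig.simps)
 have st: "sig (i + 2) = v (i + 1) * v (i + 2) * sig (i + 1) * v (i + 2) * v (i + 1)"
  using sig_step[of "i + 1"] by (simp add: numeral_eq_Suc del: sig.simps)
 have "(v i * v (i + 1) * v (i + 2)) * sig (i + 1) * (v (i + 2) * v (i + 1) * v i) = v i * sig (i + 2) * v i"
  by (simp only: mult.assoc st)
 also have "... = sig (i + 2)" by (simp only: c2 mult.assoc n mult_1_right)
 finally show "(v i * v (i + 1) * v (i + 2)) * sig (i + 1) * (v (i + 2) * v (i + 1) * v i) = sig (i + 2)" .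
qed

lemma v_sig_v:
 assumes "1 <= i" "i + 1 < n" shows "v i * sig (i + 1) * v i = v (i + 1) * sig i * v (i + 1)"
  "v i * sig' (i + 1) * v i = v (i + 1) * sig' i * v (i + 1)"
 using assms unfolding sig_step[OF assms(1)] sig'_step[OF assms(1)] by (simp_all add: mult.assoc vv vvx)

text \<open>For \<open>i = 1\<close> this is the long reduced relation conjugated by \<open>v 1\<close>. Conjugation by \<open>v i v (i + 1) v (i + 2)\<close> carries it from \<open>i\<close> to \<open>i + 1\<close>.\<close>

lemma sig_braid:
 assumes "1 <= i" "i + 1 < n" shows "sig i * sig (i + 1) * sig i = sig (i + 1) * sig i * sig (i + 1)"
 using assms
proof (induction i rule: nat_induct_at_least)
 case base
 hence n: "1 < n" "1 + 1 < n" by simp_all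
 have e: "v 2 * s * v 2 = v 1 * sig 2 * v 1" using v_sig_v(1)[of 1] n sig_1 by (simp add: numeral_eq_Suc del: sig.simps)
 have c: "v 1 * v 1 = 1" using vv n by simp
 have "(v 1 * s * v 1) * (v 1 * sig 2 * v 1) * (v 1 * s * v 1) = (v 1 * sig 2 * v 1) * (v 1 * s * v 1) * (v 1 * sig 2 * v 1)"
  using sbraid n unfolding e by simp
 hence "v 1 * (s * sig 2 * s) * v 1 = v 1 * (sig 2 * s * sig 2) * v 1" by (simp only: conj_mult3[OF c])
 hence "v 1 * (v 1 * (s * sig 2 * s) * v 1) * v 1 = v 1 * (v 1 * (sig 2 * s * sig 2) * v 1) * v 1" by (simp only:)
 hence "s * sig 2 * s = sig 2 * s * sig 2" using vvx[of 1] c n by (simp only: mult.assoc) (simp add: mult.assoc)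
 thus ?case unfolding sig_1 by (simp add: numeral_eq_Suc sig_1 del: sig.simps)
next
 case (Suc i)
 have i: "1 <= i" "i + 2 < n" using Suc by simp_all
 note t = triple_shift[OF i]
 have IH: "sig i * sig (i + 1) * sig i = sig (i + 1) * sig i * sig (i + 1)" using Suc by simp
 have "sig (i + 1) * sig (i + 2) * sig (i + 1) = sig (i + 2) * sig (i + 1) * sig (i + 2)"
  using arg_cong[OF IH, of "%x. (v i * v (i + 1) * v (i + 2)) * x * (v (i + 2) * v (i + 1) * v i)"]
  unfolding conj_mult3[OF t(2)] t(3,4) .
 thus ?case by (simp add: numeral_eq_Suc del: sig.simps)
qed

lemma gam_square: "1 <= i ==> i <= n ==> gam i * gam i = 1"
proof (induction i rule: nat_induct_at_least)
 case base
 thus ?case using gg sig_1 by simp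
next
 case (Suc i)
 have IH: "gam i * gam i = 1" "gam i * (gam i * x) = x" for x
  using Suc by (simp_all add: mult.assoc[symmetric])
 have "gam (i + 1) * gam (i + 1) = 1"
  using gam_step[of i] Suc by (simp add: mult.assoc vv vvx IH del: gam.simps)
 thus ?case by simp
qed

lemma gam_v_commutes:
 assumes "1 <= i" "i <= n" "1 <= j" "j < n" "j ~= i" "j + 1 ~= i"
 shows "commutes (v j) (gam i)"
 using assms
proof (induction i arbitrary: j rule: less_induct)
 case (less i)
 show ?case
 proof (cases "i = 1")
  case True
  thus ?thesis using gv[of j] less.prems sig_1 by (simp add: commutes_def)
 next
  case False
  define k where "k = i - 1"
  have k: "i = k + 1" "1 <= k" using False less.prems(1) by (auto simp: k_def)
  show ?thesis
  proof (cases "j + 1 = k")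
   case True
   hence j: "k = j + 1" "j + 1 < n" using k less.prems by auto
   have c: "commutes (v (j + 1)) (gam j)" by (rule less.IH) (use j k less.prems in auto)
   have b: "v j * v (j + 1) * v j = v (j + 1) * v j * v (j + 1)" using vbraid[of j] j less.prems by simp
   have g: "gam i = v (j + 1) * v j * gam j * v j * v (j + 1)"
    using gam_step[of "j + 1"] gam_step[of j] k j less.prems by (simp add: mult.assoc del: gam.simps)
   have "v j * gam i = (v j * v (j + 1) * v j) * gam j * v j * v (j + 1)" by (simp only: g mult.assoc)
   also have "... = (v (j + 1) * v j * v (j + 1)) * gam j * v j * v (j + 1)" by (simp only: b)
   also have "... = v (j + 1) * v j * (v (j + 1) * gam j) * v j * v (j + 1)" by (simp only: mult.assoc)
   also have "... = v (j + 1) * v j * (gam j * v (j + 1)) * v j * v (j + 1)" using c by (simp only: commutes_def)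
   also have "... = v (j + 1) * v j * gam j * (v (j + 1) * v j * v (j + 1))" by (simp only: mult.assoc)
   also have "... = v (j + 1) * v j * gam j * (v j * v (j + 1) * v j)" by (simp only: b)
   also have "... = gam i * v j" by (simp only: g mult.assoc)
   finally show ?thesis by (simp only: commutes_def)
  next
   case False
   have 1: "commutes (v j) (v k)" by (rule v_commutes) (use False less.prems k in auto)
   have 2: "commutes (v j) (gam k)" by (rule less.IH) (use False less.prems k in auto)
   show ?thesis unfolding k(1) gam_step[OF k(2)] by (intro commutes_mult 1 2)
  qed
 qed
qed

lemma g_gam_commutes: "2 <= j ==> j <= n ==> commutes g (gam j)"
proof (induction j rule: nat_induct_at_least)
 case base
 hence "gam 2 = v 1 * g * v 1" by (simp add: numeral_eq_Suc)
 thus ?case using gvgv base by (simp add: commutes_def mult.assoc)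
next
 case (Suc j)
 have "commutes g (v j)" using gv[of j] Suc by (simp add: commutes_def)
 moreover have "commutes g (gam j)" using Suc by simp
 ultimately have "commutes g (gam (j + 1))" using gam_step[of j] Suc by (simp add: commutes_mult del: gam.simps)
 thus ?case by simp
qed

lemma gam_gam_commutes: "1 <= i ==> i < j ==> j <= n ==> commutes (gam j) (gam i)"
proof (induction i rule: nat_induct_at_least)
 case base
 thus ?case using g_gam_commutes[of j] sig_1 by (simp add: commutes_sym)
next
 case (Suc i)
 have "commutes (gam j) (v i)" by (rule commutes_sym, rule gam_v_commutes) (use Suc in auto)
 moreover have "commutes (gam j) (gam i)" using Suc by simp
 ultimately have "commutes (gam j) (gam (i + 1))" using gam_step[of i] Suc by (simp add: commutes_mult del: gam.simps)
 thus ?case by simp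
qed

lemma g_sig_commutes: "2 <= j ==> j < n ==> commutes g (sig j)"
proof (induction j rule: nat_induct_at_least)
 case base
 thus ?case unfolding sig_2 commutes_def using gs by (simp add: mult.assoc)
next
 case (Suc j)
 have "commutes g (v j)" "commutes g (v (j + 1))" using gv[of j] gv[of "j + 1"] Suc by (simp_all add: commutes_def)
 moreover have "commutes g (sig j)" using Suc by simp
 ultimately have "commutes g (sig (j + 1))" using sig_step[of j] Suc by (simp add: commutes_mult del: sig.simps)
 thus ?case by simp
qed

lemma gam_sig_commutes_left: "1 <= i ==> i < j ==> j < n ==> commutes (sig j) (gam i)"
proof (induction i rule: nat_induct_at_least)
 case base
 thus ?case using g_sig_commutes[of j] sig_1 by (simp add: commutes_sym)
next
 case (Suc i)
 have "commutes (sig j) (v i)" by (rule commutes_sym, rule sig_v_commutes) (use Suc in auto)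
 moreover have "commutes (sig j) (gam i)" using Suc by simp
 ultimately have "commutes (sig j) (gam (i + 1))" using gam_step[of i] Suc by (simp add: commutes_mult del: gam.simps)
 thus ?case by simp
qed

lemma gam_sig_commutes_right: "j + 2 <= i ==> 1 <= j ==> i <= n ==> commutes (sig j) (gam i)"
proof (induction i rule: nat_induct_at_least)
 case base
 hence j: "1 <= j" "j + 1 < n" by simp_all
 have c: "commutes (sig (j + 1)) (gam j)" by (rule gam_sig_commutes_left) (use j in auto)
 have s: "(v (j + 1) * v j) * sig (j + 1) * (v j * v (j + 1)) = sig j"
  unfolding sig_step[OF j(1)] using j by (simp add: mult.assoc vv vvx)
 have g: "(v (j + 1) * v j) * gam j * (v j * v (j + 1)) = gam (j + 2)"
  using gam_step[of "j + 1"] gam_step[of j] j by (simp add: mult.assoc numeral_eq_Suc del: gam.simps)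
 show ?case using commutes_conj[OF c pair_inverse(2,1)[OF j]] unfolding s g .
next
 case (Suc i)
 have "commutes (sig j) (v i)" by (rule commutes_sym, rule sig_v_commutes) (use Suc in auto)
 moreover have "commutes (sig j) (gam i)" using Suc by simp
 ultimately have "commutes (sig j) (gam (i + 1))" using gam_step[of i] Suc by (simp add: commutes_mult del: gam.simps)
 thus ?case by simp
qed

text \<open>For \<open>i = 1\<close> this is the last reduced relation, conjugated by \<open>v 1\<close>. Conjugation by \<open>v i v (i + 1)\<close> moves position
\<open>i\<close> to \<open>i + 1\<close> in every factor.\<close>

lemma bars_through_crossing:
 assumes "1 <= i" "i < n"
 shows "gam (i + 1) * gam i * sig i * gam i * gam (i + 1) = v i * sig i * v i"
 using assms
proof (induction i rule: nat_induct_at_least)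
 case base
 hence n: "2 <= n" "1 < n" by simp_all
 have g2: "gam 2 = v 1 * g * v 1" by (simp add: numeral_eq_Suc)
 have "gam 2 * g * s * g * gam 2 = v 1 * (g * v 1 * g * s * g * v 1 * g) * v 1" unfolding g2 by (simp only: mult.assoc)
 also have "... = v 1 * s * v 1" unfolding gsg[OF n(1)] ..
 finally show ?case by (simp add: numeral_eq_Suc del: gam.simps sig.simps) (simp add: numeral_eq_Suc)
next
 case (Suc i)
 have i: "1 <= i" "i + 1 < n" "i < n" using Suc by simp_all
 have IH: "gam (i + 1) * gam i * sig i * gam i * gam (i + 1) = v i * sig i * v i" using Suc by simp
 \<comment> \<open>Conjugation by \<open>v i * v (i + 1)\<close> carries position \<open>i\<close> to \<open>i + 1\<close> and \<open>i + 1\<close> to \<open>i + 2\<close>.\<close>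
 let ?d = "v i * v (i + 1)" and ?e = "v (i + 1) * v i"
 have ed: "?e * ?d = 1" by (rule pair_inverse(2)[OF i(1,2)])
 have cj: "?d * (x * y) * ?e = (?d * x * ?e) * (?d * y * ?e)" for x y
 proof -
  have "?d * (x * y) * ?e = ?d * x * 1 * y * ?e" by (simp only: mult_1_right mult.assoc)
  also have "... = ?d * x * (?e * ?d) * y * ?e" by (simp only: ed)
  finally show ?thesis by (simp only: mult.assoc)
 qed
 have g1: "?d * gam i * ?e = gam (i + 1)"
 proof -
  have "v (i + 1) * gam i = gam i * v (i + 1)" using gam_v_commutes[of i "i + 1"] i by (simp add: commutes_def)
  hence "v i * (v (i + 1) * gam i) * v (i + 1) * v i = v i * (gam i * v (i + 1)) * v (i + 1) * v i" by (simp only:)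
  hence "?d * gam i * ?e = v i * gam i * (v (i + 1) * v (i + 1)) * v i" by (simp only: mult.assoc)
  thus ?thesis using vv[of "i + 1"] i gam_step[OF i(1)] by (simp del: gam.simps)
 qed
 have st: "gam (i + 2) = v (i + 1) * gam (i + 1) * v (i + 1)"
  using gam_step[of "i + 1"] by (simp add: numeral_eq_Suc del: gam.simps)
 have g2: "?d * gam (i + 1) * ?e = gam (i + 2)"
 proof -
  have c: "v i * gam (i + 2) = gam (i + 2) * v i" using gam_v_commutes[of "i + 2" i] i by (simp add: commutes_def del: gam.simps)
  have "?d * gam (i + 1) * ?e = v i * gam (i + 2) * v i" unfolding st by (simp only: mult.assoc)
  also have "... = gam (i + 2)" using vv[of i] i unfolding c by (simp add: mult.assoc del: gam.simps)
  finally show ?thesis .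
 qed
 have v1: "?d * v i * ?e = v (i + 1)"
 proof -
  have "?d * v i * ?e = (v i * v (i + 1) * v i) * (v (i + 1) * v i)" by (simp only: mult.assoc)
  hence "?d * v i * ?e = (v (i + 1) * v i * v (i + 1)) * (v (i + 1) * v i)" using vbraid[OF i(1,2)] by simp
  thus ?thesis using i by (simp add: vv vvx mult.assoc)
 qed
 have "gam (i + 2) * gam (i + 1) * sig (i + 1) * gam (i + 1) * gam (i + 2) = v (i + 1) * sig (i + 1) * v (i + 1)"
  using arg_cong[OF IH, of "%x. ?d * x * ?e"] unfolding cj g1 g2 v1 sig_conj[OF i(1)] .
 thus ?case by (simp add: numeral_eq_Suc del: gam.simps sig.simps)
qed

lemma bars_through_inverse_crossing:
 assumes i: "1 <= i" "i < n"
 shows "gam (i + 1) * gam i * sig' i * gam i * gam (i + 1) = v i * sig' i * v i"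
proof (rule inverse_unique'[of "v i * sig i * v i"])
 have g: "gam i * gam i = 1" "gam (i + 1) * gam (i + 1) = 1" using gam_square i by simp_all
 have gx: "gam i * (gam i * x) = x" "gam (i + 1) * (gam (i + 1) * x) = x" for x
  by (simp_all only: mult.assoc[symmetric] g mult_1_left)
 have s: "sig i * sig' i = 1" "sig' i * sig i = 1" using sig_inverse[OF i] by simp_all
 have sx: "sig i * (sig' i * x) = x" "sig' i * (sig i * x) = x" for x
  by (simp_all only: mult.assoc[symmetric] s mult_1_left)
 show "v i * sig i * v i * (gam (i + 1) * gam i * sig' i * gam i * gam (i + 1)) = 1"
  unfolding bars_through_crossing[OF i, symmetric] by (simp only: mult.assoc gx sx g)
 show "v i * sig' i * v i * (v i * sig i * v i) = 1"
  using i by (simp add: mult.assoc vv vvx sx)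
qed

fun ev :: "letter => 'a" where
 "ev (Cr Pos i) = sig i" | "ev (Cr Neg i) = sig' i" | "ev (Cr Virt i) = v i" | "ev (Bar i) = gam i"

lemma ev_far:
 assumes "valid n l1" "valid n l2" "supp l1 \<inter> supp l2 = {}"
 shows "commutes (ev l1) (ev l2)"
proof -
 have inv: "commutes (sig' i) y" if "commutes (sig i) y" "1 <= i" "i < n" for i y
  using commutes_inverse[OF that(1)] sig_inverse[OF that(2,3)] by blast
 have vs: "commutes (v j) (sig i)" "commutes (v j) (sig' i)" if "1 <= i" "i < n" "1 <= j" "j < n" "i + 1 < j \<or> j + 1 < i" for i j
  using sig_v_commutes[OF that] inv commutes_sym that by blast+
 have ss: "commutes (sig i) (sig j)" if "1 <= i" "i < n" "1 <= j" "j < n" "i + 1 < j \<or> j + 1 < i" for i j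
  using sig_sig_commutes[of i j] sig_sig_commutes[of j i] commutes_sym that by blast
 have ss': "commutes (sig i) (sig' j)" if "1 <= i" "i < n" "1 <= j" "j < n" "i + 1 < j \<or> j + 1 < i" for i j
  using ss[of j i] inv[of j "sig i"] commutes_sym that by blast
 have s's': "commutes (sig' i) (sig' j)" if "1 <= i" "i < n" "1 <= j" "j < n" "i + 1 < j \<or> j + 1 < i" for i j
  using ss'[OF that] inv[of i] that by blast
 have gs: "commutes (gam i) (sig j)" if "1 <= i" "i <= n" "1 <= j" "j < n" "i ~= j" "i ~= j + 1" for i j
 proof -
  have "i < j \<or> j + 2 <= i" using that by linarith
  thus ?thesis using gam_sig_commutes_left[of i j] gam_sig_commutes_right[of j i] that commutes_sym by blast
 qed
 have gs': "commutes (gam i) (sig' j)" if "1 <= i" "i <= n" "1 <= j" "j < n" "i ~= j" "i ~= j + 1" for i j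
  using gs[OF that] inv[of j "gam i"] commutes_sym that by blast
 have ggc: "commutes (gam i) (gam j)" if "1 <= i" "i <= n" "1 <= j" "j <= n" "i ~= j" for i j
  using gam_gam_commutes[of i j] gam_gam_commutes[of j i] that commutes_sym by (metis linorder_neqE_nat)
 have gvc: "commutes (v j) (gam i)" if "1 <= i" "i <= n" "1 <= j" "j < n" "i ~= j" "i ~= j + 1" for i j
  using gam_v_commutes[of i j] that by auto
 have cr: "commutes (ev (Cr k i)) (ev (Cr k' j))" if "1 <= i" "i < n" "1 <= j" "j < n" "i + 1 < j \<or> j + 1 < i" for i j k k'
  using v_commutes[OF that] vs[of i j] vs[of j i] ss[OF that] ss'[OF that] ss'[of j i] s's'[OF that] that commutes_sym
  by (cases k; cases k') auto
 have br: "commutes (ev (Bar i)) (ev (Cr k j))" if "1 <= i" "i <= n" "1 <= j" "j < n" "i ~= j" "i ~= j + 1" for i j k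
  using gvc[OF that] gs[OF that] gs'[OF that] commutes_sym by (cases k) auto
 show ?thesis
 proof (cases l1)
  case l1: (Cr k i)
  show ?thesis
  proof (cases l2)
   case l2: (Cr k' j)
   have "i + 1 < j \<or> j + 1 < i" using assms(3) unfolding l1 l2 by auto
   thus ?thesis using cr[of i j k k'] assms(1,2) unfolding l1 l2 by simp
  next
   case l2: (Bar j)
   have "j ~= i" "j ~= i + 1" using assms(3) unfolding l1 l2 by auto
   thus ?thesis using br[of j i k] assms(1,2) commutes_sym unfolding l1 l2 by simp
  qed
 next
  case l1: (Bar i)
  show ?thesis
  proof (cases l2)
   case l2: (Cr k' j)
   have "i ~= j" "i ~= j + 1" using assms(3) unfolding l1 l2 by auto
   thus ?thesis using br[of i j k'] assms(1,2) unfolding l1 l2 by simp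
  next
   case l2: (Bar j)
   thus ?thesis using ggc[of i j] assms unfolding l1 l2 by auto
  qed
 qed
qed

definition evs :: "letter list => 'a" where
 "evs w = prod_list (map ev w)"

lemma evs_append: "evs (u @ w) = evs u * evs w"
 by (simp add: evs_def)

text \<open>The braid relation for positive crossings implies those for the other admissible choices of signs, by
multiplication with inverses.\<close>

lemma braid_signs:
 assumes i: "1 <= i" "i + 1 < n" and k: "a ~= Virt" "b ~= Virt" "c ~= Virt" "\<not> (a = c & a ~= b)"
 shows "ev (Cr a i) * ev (Cr b (i + 1)) * ev (Cr c i) = ev (Cr c (i + 1)) * ev (Cr b i) * ev (Cr a (i + 1))"
proof -
 let ?x = "sig i" and ?y = "sig (i + 1)" and ?x' = "sig' i" and ?y' = "sig' (i + 1)"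
 have B: "?x * ?y * ?x = ?y * ?x * ?y" by (rule sig_braid[OF i])
 have s: "?x * ?x' = 1" "?x' * ?x = 1" "?y * ?y' = 1" "?y' * ?y = 1" using sig_inverse[of i] sig_inverse[of "i + 1"] i by auto
 have sx: "?x * (?x' * z) = z" "?x' * (?x * z) = z" "?y * (?y' * z) = z" "?y' * (?y * z) = z" for z
  by (simp_all only: mult.assoc[symmetric] s mult_1_left)
 have 1: "?x * ?y * ?x' = ?y' * ?x * ?y"
 proof -
  have "?y' * (?x * ?y * ?x) * ?x' = ?y' * (?y * ?x * ?y) * ?x'" by (simp only: B)
  thus ?thesis by (simp only: mult.assoc s sx mult_1_right)
 qed
 have 2: "?x' * ?y * ?x = ?y * ?x * ?y'"
 proof -
  have "?x' * (?x * ?y * ?x) * ?y' = ?x' * (?y * ?x * ?y) * ?y'" by (simp only: B)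
  thus ?thesis by (simp only: mult.assoc s sx mult_1_right)
 qed
 have 3: "?x * ?y' * ?x' = ?y' * ?x' * ?y"
 proof (rule inverse_unique'[of "?x * ?y * ?x'"])
  show "?x * ?y * ?x' * (?x * ?y' * ?x') = 1" by (simp only: mult.assoc s sx)
  show "?y' * ?x' * ?y * (?x * ?y * ?x') = 1" unfolding 1 by (simp only: mult.assoc s sx)
 qed
 have 4: "?x' * ?y' * ?x = ?y * ?x' * ?y'"
 proof (rule inverse_unique'[of "?x' * ?y * ?x"])
  show "?x' * ?y * ?x * (?x' * ?y' * ?x) = 1" by (simp only: mult.assoc s sx)
  show "?y * ?x' * ?y' * (?x' * ?y * ?x) = 1" unfolding 2 by (simp only: mult.assoc s sx)
 qed
 have 5: "?x' * ?y' * ?x' = ?y' * ?x' * ?y'"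
 proof (rule inverse_unique'[of "?x * ?y * ?x"])
  show "?x * ?y * ?x * (?x' * ?y' * ?x') = 1" by (simp only: mult.assoc s sx)
  show "?y' * ?x' * ?y' * (?x * ?y * ?x) = 1" unfolding B by (simp only: mult.assoc s sx)
 qed
 show ?thesis using k B 1 2 3 4 5 by (cases a; cases b; cases c) (simp_all del: sig.simps sig'.simps)
qed

text \<open>The three forms of the mixed triangle move are equivalent to the recursion that defines the crossings.\<close>

lemma virtual_shift:
 assumes i: "1 <= i" "i + 1 < n" and k: "k ~= Virt"
 shows "ev (Cr k i) * v (i + 1) * v i = v (i + 1) * v i * ev (Cr k (i + 1))"
  "v i * ev (Cr k (i + 1)) * v i = v (i + 1) * ev (Cr k i) * v (i + 1)"
  "v i * v (i + 1) * ev (Cr k i) = ev (Cr k (i + 1)) * v i * v (i + 1)"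
proof -
 have e: "ev (Cr k (i + 1)) = v i * v (i + 1) * ev (Cr k i) * v (i + 1) * v i"
  using sig_step[OF i(1)] sig'_step[OF i(1)] k by (cases k) (simp_all del: sig.simps sig'.simps)
 show "ev (Cr k i) * v (i + 1) * v i = v (i + 1) * v i * ev (Cr k (i + 1))"
  "v i * ev (Cr k (i + 1)) * v i = v (i + 1) * ev (Cr k i) * v (i + 1)"
  "v i * v (i + 1) * ev (Cr k i) = ev (Cr k (i + 1)) * v i * v (i + 1)"
  unfolding e using i by (simp_all add: mult.assoc vv vvx)
qed

lemma evs_local:
 assumes "local_picture m l r" "d + m <= n"
 shows "evs (map (shift d) l) = evs (map (shift d) r)"
 using assms
proof (cases rule: local_picture.cases)
 case R2_pos_neg
 thus ?thesis using sig_inverse[of "d + 1"] assms(2) by (simp add: evs_def del: sig.simps sig'.simps)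
next
 case R2_neg_pos
 thus ?thesis using sig_inverse[of "d + 1"] assms(2) by (simp add: evs_def del: sig.simps sig'.simps)
next
 case (R3 a b c)
 thus ?thesis using braid_signs[of "d + 1" a b c] assms(2) by (simp add: evs_def mult.assoc del: ev.simps)
next
 case V2
 thus ?thesis using vv[of "d + 1"] assms(2) by (simp add: evs_def)
next
 case V3
 thus ?thesis using vbraid[of "d + 1"] assms(2) by (simp add: evs_def mult.assoc)
next
 case (V4_strand3 a)
 thus ?thesis using virtual_shift(1)[of "d + 1" a] assms(2) by (simp add: evs_def mult.assoc del: sig.simps sig'.simps)
next
 case (V4_strand2 a)
 thus ?thesis using virtual_shift(2)[of "d + 1" a] assms(2) by (simp add: evs_def mult.assoc del: sig.simps sig'.simps)
next
 case (V4_strand1 a)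
 thus ?thesis using virtual_shift(3)[of "d + 1" a] assms(2) by (simp add: evs_def mult.assoc del: sig.simps sig'.simps)
next
 case T1_left
 thus ?thesis using gam_step[of "d + 1"] vvx[of "d + 1"] assms(2) by (simp add: evs_def mult.assoc del: gam.simps)
next
 case T1_right
 thus ?thesis using gam_step[of "d + 1"] vv[of "d + 1"] assms(2) by (simp add: evs_def mult.assoc del: gam.simps)
next
 case T2
 thus ?thesis using gam_square[of "d + 1"] assms(2) by (simp add: evs_def del: gam.simps)
next
 case (T3 k)
 thus ?thesis using bars_through_crossing[of "d + 1"] bars_through_inverse_crossing[of "d + 1"] assms(2)
  by (cases k) (simp_all add: evs_def mult.assoc del: gam.simps sig.simps sig'.simps)
qed

lemma evs_lcong: "(u, w) \<in> lcong n ==> evs u = evs w"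
proof (induction rule: lcong.induct)
 case (far p q l1 l2)
 hence "ev l1 * ev l2 = ev l2 * ev l1" using ev_far unfolding commutes_def by blast
 hence "evs [l1, l2] = evs [l2, l1]" by (simp add: evs_def)
 thus ?case by (simp only: evs_append)
next
 case (local p q m l r d)
 thus ?case using evs_local by (simp only: evs_append)
qed simp_all

end

section \<open>Stacking and word diagrams\<close>

text \<open>The bottom position of the strand \<open>i\<close>; for an admissible family, \<open>f i 0\<close> is a natural number.\<close>

definition endp :: "(nat => real => real) => nat => nat" where
 "endp f i = nat \<lfloor>f i 0\<rfloor>"

text \<open>The lower half of the strand \<open>i\<close> is the strand of the lower diagram that starts where the strand \<open>i\<close> of the upper one ends.\<close>

definition stackf :: "(nat => real => real) => (nat => real => real) => nat => real => real" where
 "stackf f g i t = (if t < 1/2 then g (endp f i) (2 * t) else f i (2 * t - 1))"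

lemma endp:
 assumes c: "config n f" and i: "i \<in> {1..n}"
 shows "f i 0 = real (endp f i)" "endp f i \<in> {1..n}"
proof -
 obtain m where m: "f i 0 = real m" "m \<in> {1..n}" using configD(3)[OF c i] by (rule imageE)
 have "endp f i = m" unfolding endp_def m(1) by simp
 thus "f i 0 = real (endp f i)" "endp f i \<in> {1..n}" using m by simp_all
qed

lemma endp_bij:
 assumes c: "config n f" shows "bij_betw (endp f) {1..n} {1..n}"
proof -
 have inj: "inj_on (endp f) {1..n}"
 proof (rule inj_onI)
  fix i j assume ij: "i \<in> {1..n}" "j \<in> {1..n}" "endp f i = endp f j"
  hence "f i 0 = f j 0" using endp(1)[OF c] by simp
  thus "i = j" by (rule config_bottom_inj[OF c ij(1,2)])
 qed
 have "endp f ` {1..n} \<subseteq> {1..n}" using endp(2)[OF c] by blast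
 hence "endp f ` {1..n} = {1..n}" using inj by (simp add: endo_inj_surj)
 thus ?thesis using inj by (simp add: bij_betw_def)
qed

lemma endp_inj:
 assumes "config n f" "i \<in> {1..n}" "j \<in> {1..n}" "endp f i = endp f j" shows "i = j"
 by (rule inj_onD[OF bij_betw_imp_inj_on[OF endp_bij[OF assms(1)]] assms(4,2,3)])

lemma stackf_upper: "t \<in> {0..1} ==> stackf f g i ((1 + t) / 2) = f i t"
proof -
 assume "t \<in> {0..1}"
 hence "2 * ((1 + t) / 2) - 1 = t" "\<not> (1 + t) / 2 < 1/2" by (simp_all add: field_simps)
 thus ?thesis by (simp only: stackf_def if_False)
qed

lemma stackf_lower: "t \<in> {0..<1} ==> stackf f g i (t / 2) = g (endp f i) t"
 by (simp add: stackf_def)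

lemma passes_affine:
 assumes p: "passes g g' (2 * t - c)" and c: "0 <= c" "c <= 1"
  and h: "\<And>u. 2 * u - c \<in> {0<..<1} ==> h u = g (2 * u - c) & h' u = g' (2 * u - c)"
 shows "passes h h' t"
proof -
 obtain e where e: "e > 0" "e <= 2 * t - c" "e <= 1 - (2 * t - c)" and
  *: "\<And>s. 0 < s ==> s < e ==> (g (2 * t - c - s) - g' (2 * t - c - s)) * (g (2 * t - c + s) - g' (2 * t - c + s)) < 0"
  using p unfolding passes_def by blast
 show ?thesis
  unfolding passes_def
 proof (intro exI[of _ "e/2"] conjI allI impI)
  fix s assume s: "0 < s & s < e / 2"
  have "h (t - s) = g (2 * t - c - 2 * s)" "h' (t - s) = g' (2 * t - c - 2 * s)"
   "h (t + s) = g (2 * t - c + 2 * s)" "h' (t + s) = g' (2 * t - c + 2 * s)"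
   using h[of "t - s"] h[of "t + s"] s e by (simp_all add: algebra_simps)
  thus "(h (t - s) - h' (t - s)) * (h (t + s) - h' (t + s)) < 0" using *[of "2 * s"] s by simp
 qed (use e c in auto)
qed

lemma stackf_glue:
 assumes "config n f" "config n g" "i \<in> {1..n}"
 shows "g (endp f i) 1 = f i 0"
 using configD(2)[OF assms(2) endp(2)[OF assms(1,3)]] endp(1)[OF assms(1,3)] by simp

lemma config_stack:
 assumes f: "config n f" and g: "config n g" shows "config n (stackf f g)"
 unfolding config_def
proof (intro conjI ballI impI)
 fix i assume i: "i \<in> {1..n}"
 note e = endp(2)[OF f i]
 have "continuous_on ({1/2..1} \<union> {0..1/2}) (%t. if t < 1/2 then g (endp f i) (2 * t) else f i (2 * t - 1))"
 proof (subst Un_commute, rule continuous_on_If)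
  show "continuous_on {0..1/2} (%t. g (endp f i) (2 * t))"
   by (rule continuous_on_compose2[OF configD(1)[OF g e]]) (auto intro!: continuous_intros)
  show "continuous_on {1/2..1} (%t. f i (2 * t - 1))"
   by (rule continuous_on_compose2[OF configD(1)[OF f i]]) (auto intro!: continuous_intros)
  fix x :: real assume "x \<in> {0..1/2}" "\<not> x < 1/2"
  hence x: "2 * x = 1" "2 * x - 1 = 0" by simp_all
  show "g (endp f i) (2 * x) = f i (2 * x - 1)" unfolding x(2) unfolding x(1) by (rule stackf_glue[OF f g i])
 qed auto
 moreover have "{1/2..1} \<union> {0..1/2} = {0..1::real}" by auto
 ultimately show "continuous_on {0..1} (stackf f g i)" unfolding stackf_def by (simp only:)
 show "stackf f g i 1 = real i" using configD(2)[OF f i] by (simp add: stackf_def)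
 show "stackf f g i 0 \<in> real ` {1..n}" using configD(3)[OF g e] by (simp add: stackf_def)
 fix t :: real assume t: "t \<in> {0..1}"
 show "0 < stackf f g i t" "stackf f g i t < real n + 1"
  using configD(4,5)[OF g e, of "2 * t"] configD(4,5)[OF f i, of "2 * t - 1"] t by (auto simp: stackf_def)
next
 show "inj_on (%i. stackf f g i 0) {1..n}"
 proof (rule inj_onI)
  fix i j assume ij: "i \<in> {1..n}" "j \<in> {1..n}" "stackf f g i 0 = stackf f g j 0"
  hence "endp f i = endp f j"
   using config_bottom_inj[OF g endp(2)[OF f ij(1)] endp(2)[OF f ij(2)]] by (simp add: stackf_def)
  thus "i = j" by (rule endp_inj[OF f ij(1,2)])
 qed
next
 fix i j k and t :: real assume ijk: "i \<in> {1..n}" "j \<in> {1..n}" "k \<in> {1..n}" and t: "t \<in> {0..1}"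
  and eq: "stackf f g i t = stackf f g j t & stackf f g j t = stackf f g k t"
 note b = endp_inj[OF f]
 show "i = j \<or> j = k \<or> i = k"
 proof (cases "t < 1/2")
  case True
  hence "endp f i = endp f j \<or> endp f j = endp f k \<or> endp f i = endp f k"
   using config_two[OF g endp(2)[OF f ijk(1)] endp(2)[OF f ijk(2)] endp(2)[OF f ijk(3)], of "2 * t"] t eq
   by (simp add: stackf_def)
  thus ?thesis using b ijk by blast
 next
  case False
  thus ?thesis using config_two[OF f ijk, of "2 * t - 1"] t eq by (simp add: stackf_def)
 qed
next
 fix i j and t :: real assume ij: "i \<in> {1..n}" "j \<in> {1..n}" and t: "t \<in> {0<..<1}"
  and eq: "i ~= j & stackf f g i t = stackf f g j t"
 note b = endp_inj[OF f]
 note e = endp(2)[OF f ij(1)] endp(2)[OF f ij(2)]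
 have ne: "endp f i ~= endp f j" using b ij eq by blast
 consider "t < 1/2" | "t = 1/2" | "t > 1/2" by linarith
 thus "passes (stackf f g i) (stackf f g j) t"
 proof cases
  case 1
  hence "passes (g (endp f i)) (g (endp f j)) (2 * t - 0)"
   using config_passes[OF g e ne, of "2 * t"] eq t by (simp add: stackf_def)
  thus ?thesis by (rule passes_affine) (simp_all add: stackf_def)
 next
  case 2
  have "stackf f g m t = f m 0" for m unfolding 2 stackf_def by simp
  thus ?thesis using config_bottom_inj[OF f ij] eq by metis
 next
  case 3
  hence "passes (f i) (f j) (2 * t - 1)"
   using config_passes[OF f ij, of "2 * t - 1"] eq t by (simp add: stackf_def)
  thus ?thesis by (rule passes_affine) (simp_all add: stackf_def)
 qed
qed

lemma upper_curve: "upper ` curve f = (%t. (f (2 * t - 1), t)) ` {1/2..1}"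
proof (intro equalityI subsetI)
 fix p assume "p \<in> upper ` curve f"
 then obtain t where t: "t \<in> {0..1}" "p = (f t, (1 + t) / 2)" by (auto simp: curve_def upper_def)
 have h: "2 * ((1 + t) / 2) - 1 = t" by (simp add: field_simps)
 show "p \<in> (%t. (f (2 * t - 1), t)) ` {1/2..1}"
  by (rule image_eqI[of _ _ "(1 + t) / 2"]) (use t in \<open>simp_all only: h, auto\<close>)
next
 fix p assume "p \<in> (%t. (f (2 * t - 1), t)) ` {1/2..1}"
 then obtain t where "t \<in> {1/2..1}" "p = (f (2 * t - 1), t)" by blast
 thus "p \<in> upper ` curve f" unfolding curve_def
  by (intro image_eqI[of _ _ "(f (2 * t - 1), 2 * t - 1)"]) (auto simp: upper_def)
qed

lemma lower_curve: "lower ` curve f = (%t. (f (2 * t), t)) ` {0..1/2}"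
proof (intro equalityI subsetI)
 fix p assume "p \<in> lower ` curve f"
 then obtain t where "t \<in> {0..1}" "p = (f t, t / 2)" by (auto simp: curve_def lower_def)
 thus "p \<in> (%t. (f (2 * t), t)) ` {0..1/2}" by (intro image_eqI[of _ _ "t / 2"]) auto
next
 fix p assume "p \<in> (%t. (f (2 * t), t)) ` {0..1/2}"
 then obtain t where "t \<in> {0..1/2}" "p = (f (2 * t), t)" by blast
 thus "p \<in> lower ` curve f" unfolding curve_def
  by (intro image_eqI[of _ _ "(f (2 * t), 2 * t)"]) (auto simp: lower_def)
qed

lemma stack_curve:
 assumes f: "config n f" and g: "config n g" and i: "i \<in> {1..n}"
 shows "upper ` curve (f i) \<union> lower ` curve (g (endp f i)) = curve (stackf f g i)"
proof -
 have "curve (stackf f g i) = (%t. (stackf f g i t, t)) ` ({1/2..1} \<union> {0..1/2})"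
  unfolding curve_def by (rule arg_cong2[where f = image]) auto
 also have "... = (%t. (stackf f g i t, t)) ` {1/2..1} \<union> (%t. (stackf f g i t, t)) ` {0..1/2}"
  by (rule image_Un)
 also have "(%t. (stackf f g i t, t)) ` {1/2..1} = (%t. (f i (2 * t - 1), t)) ` {1/2..1}"
  by (rule image_cong) (auto simp: stackf_def)
 also have "(%t. (stackf f g i t, t)) ` {0..1/2} = (%t. (g (endp f i) (2 * t), t)) ` {0..1/2}"
 proof (rule image_cong)
  fix t :: real assume "t \<in> {0..1/2}"
  hence "t < 1/2 \<or> t = 1/2" by auto
  thus "(stackf f g i t, t) = (g (endp f i) (2 * t), t)"
  proof
   assume t: "t = 1/2"
   show ?thesis unfolding t using stackf_glue[OF f g i] by (simp add: stackf_def)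
  qed (simp add: stackf_def)
 qed simp
 finally show ?thesis unfolding upper_curve lower_curve by simp
qed

lemma upper_lower_meet:
 assumes f: "config n f" and g: "config n g" and i: "i \<in> {1..n}" and j: "j \<in> {1..n}"
 shows "upper ` curve (f i) \<inter> lower ` curve (g j) ~= {} \<longleftrightarrow> j = endp f i"
proof
 assume "upper ` curve (f i) \<inter> lower ` curve (g j) ~= {}"
 then obtain p where "p \<in> upper ` curve (f i)" "p \<in> lower ` curve (g j)" by blast
 then obtain t u where p: "p = (f i (2 * t - 1), t)" "t \<in> {1/2..1}" "p = (g j (2 * u), u)" "u \<in> {0..1/2}"
  unfolding upper_curve lower_curve by blast
 have tu: "t = 1/2" "u = 1/2" using p by auto
 have "f i 0 = g j 1" using p(1,3) unfolding tu by simp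
 thus "j = endp f i" using endp(1)[OF f i] configD(2)[OF g j] by simp
next
 assume j: "j = endp f i"
 have "(f i 0, 1/2) \<in> upper ` curve (f i)" unfolding upper_curve by (intro image_eqI[of _ _ "1/2"]) auto
 moreover have "(f i 0, 1/2) \<in> lower ` curve (g j)" unfolding lower_curve
  by (intro image_eqI[of _ _ "1/2"]) (use stackf_glue[OF f g i] j in auto)
 ultimately show "upper ` curve (f i) \<inter> lower ` curve (g j) ~= {}" by blast
qed

lemma meets_stack:
 assumes f: "config n f" and g: "config n g"
 shows "meets n (stackf f g) = upper ` meets n f \<union> lower ` meets n g"
proof (intro equalityI subsetI)
 fix p assume "p \<in> meets n (stackf f g)"
 then obtain i j t where ij: "i \<in> {1..n}" "j \<in> {1..n}" "i ~= j" and t: "t \<in> {0..1}" "p = (stackf f g i t, t)"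
  "stackf f g i t = stackf f g j t" unfolding meets_def by blast
 have ne: "endp f i ~= endp f j" using endp_inj[OF f ij(1,2)] ij(3) by blast
 show "p \<in> upper ` meets n f \<union> lower ` meets n g"
 proof (cases "t < 1/2")
  case True
  have "g (endp f i) (2 * t) = g (endp f j) (2 * t)" "2 * t \<in> {0..1}" using t True by (simp_all add: stackf_def)
  hence "(g (endp f i) (2 * t), 2 * t) \<in> meets n g"
   unfolding meets_def using endp(2)[OF f ij(1)] endp(2)[OF f ij(2)] ne by blast
  moreover have "p = lower (g (endp f i) (2 * t), 2 * t)" using t True by (simp add: stackf_def lower_def)
  ultimately show ?thesis by blast
 next
  case False
  have "f i (2 * t - 1) = f j (2 * t - 1)" "2 * t - 1 \<in> {0..1}" using t False by (simp_all add: stackf_def)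
  hence "(f i (2 * t - 1), 2 * t - 1) \<in> meets n f"
   unfolding meets_def using ij by blast
  moreover have "p = upper (f i (2 * t - 1), 2 * t - 1)" using t False by (simp add: stackf_def upper_def)
  ultimately show ?thesis by blast
 qed
next
 fix p assume "p \<in> upper ` meets n f \<union> lower ` meets n g"
 thus "p \<in> meets n (stackf f g)"
 proof
  assume "p \<in> upper ` meets n f"
  then obtain i j t where ij: "i \<in> {1..n}" "j \<in> {1..n}" "i ~= j" and t: "t \<in> {0..1}" "p = upper (f i t, t)"
   "f i t = f j t" unfolding meets_def by blast
  note e = stackf_upper[OF t(1)]
  have "p = (stackf f g i ((1 + t) / 2), (1 + t) / 2)" unfolding e using t(2) by (simp add: upper_def)
  moreover have "(1 + t) / 2 \<in> {0..1}" using t(1) by simp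
  moreover have "stackf f g i ((1 + t) / 2) = stackf f g j ((1 + t) / 2)" unfolding e by (rule t(3))
  ultimately show ?thesis unfolding meets_def using ij by blast
 next
  assume "p \<in> lower ` meets n g"
  then obtain i' j' t where ij': "i' \<in> {1..n}" "j' \<in> {1..n}" "i' ~= j'" and t: "t \<in> {0..1}" "p = lower (g i' t, t)"
   "g i' t = g j' t" unfolding meets_def by blast
  have e: "stackf f g m (t / 2) = g (endp f m) t" for m
   using config_meet_height[OF g ij' t(1,3)] by (intro stackf_lower) simp
  obtain i j where ij: "i \<in> {1..n}" "j \<in> {1..n}" "endp f i = i'" "endp f j = j'"
   using endp_bij[OF f] ij' unfolding bij_betw_def by (metis imageE)
  have "p = (stackf f g i (t / 2), t / 2)" unfolding e ij using t(2) by (simp add: lower_def)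
  moreover have "t / 2 \<in> {0..1}" using t(1) by simp
  moreover have "stackf f g i (t / 2) = stackf f g j (t / 2)" unfolding e ij by (rule t(3))
  moreover have "i ~= j" using ij ij'(3) by blast
  ultimately show ?thesis unfolding meets_def using ij by blast
 qed
qed

lemma upper_inj: "inj upper" and lower_inj: "inj lower"
 by (rule injI, simp add: upper_def prod_eq_iff, rule injI, simp add: lower_def prod_eq_iff)

lemma dg_heights:
 assumes d: "dg n b f"
 shows "p \<in> crossings b k ==> snd p \<in> {0<..<1}" "p \<in> bars b ==> snd p \<in> {0<..<1}"
  "p \<in> meets n f ==> snd p \<in> {0<..<1}"
proof -
 show 1: "snd p \<in> {0<..<1}" if "p \<in> meets n f" for p using dg_events(4)[OF d that] by auto
 show "snd p \<in> {0<..<1}" if "p \<in> crossings b k" for p using 1 dg_events(1)[OF d that] by blast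
 show "snd p \<in> {0<..<1}" if "p \<in> bars b" for p using dg_events(3)[OF d that] by auto
qed

lemma dg_stack:
 assumes b: "dg n b f" and c: "dg n c g"
 shows "dg n (stack b c) (stackf f g)"
proof -
 have f: "config n f" and g: "config n g" using b c by (simp_all add: dg_def)
 have sb: "strands b = (%i. curve (f i)) ` {1..n}" and sc: "strands c = (%i. curve (g i)) ` {1..n}"
  using b c by (simp_all add: dg_def)
 have sep: "upper p ~= lower q" if "snd p \<in> {0<..<1}" "snd q \<in> {0<..<1}" for p q
  using that by (auto simp: upper_def lower_def)
 have up: "upper q \<notin> meets n (stackf f g)" if "q \<in> bars b" for q
  unfolding meets_stack[OF f g] using inj_image_mem_iff[OF upper_inj, of q "meets n f"] dg_events(5)[OF b that]
   sep[OF dg_heights(2)[OF b that] dg_heights(3)[OF c]] by blast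
 have low: "lower q \<notin> meets n (stackf f g)" if "q \<in> bars c" for q
  unfolding meets_stack[OF f g] using inj_image_mem_iff[OF lower_inj, of q "meets n g"] dg_events(5)[OF c that]
   sep[OF dg_heights(3)[OF b] dg_heights(2)[OF c that]] by (metis Un_iff imageE)
 show ?thesis
  unfolding dg_def
 proof (intro conjI allI impI)
  show "config n (stackf f g)" by (rule config_stack[OF f g])
  show "strands (stack b c) = (%i. curve (stackf f g i)) ` {1..n}"
  proof (intro equalityI subsetI)
   fix a assume "a \<in> strands (stack b c)"
   then obtain i j where ij: "i \<in> {1..n}" "j \<in> {1..n}" and a: "a = upper ` curve (f i) \<union> lower ` curve (g j)"
    and m: "upper ` curve (f i) \<inter> lower ` curve (g j) ~= {}"
    unfolding stack_def diagram.select_convs sb sc by blast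
   have "j = endp f i" using upper_lower_meet[OF f g ij] m by blast
   thus "a \<in> (%i. curve (stackf f g i)) ` {1..n}" using stack_curve[OF f g ij(1)] a ij(1) by simp
  next
   fix a assume "a \<in> (%i. curve (stackf f g i)) ` {1..n}"
   then obtain i where i: "i \<in> {1..n}" "a = curve (stackf f g i)" by blast
   have "upper ` curve (f i) \<inter> lower ` curve (g (endp f i)) ~= {}"
    using upper_lower_meet[OF f g i(1) endp(2)[OF f i(1)]] by blast
   moreover have "curve (f i) \<in> strands b" "curve (g (endp f i)) \<in> strands c"
    unfolding sb sc using i(1) endp(2)[OF f i(1)] by blast+
   ultimately show "a \<in> strands (stack b c)" unfolding i(2) stack_curve[OF f g i(1), symmetric] stack_def by fastforce
  qed
  have "(\<Union>k. crossings (stack b c) k) = upper ` (\<Union>k. crossings b k) \<union> lower ` (\<Union>k. crossings c k)"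
   by (auto simp: stack_def)
  thus "(\<Union>k. crossings (stack b c) k) = meets n (stackf f g)"
   unfolding meets_stack[OF f g] using b c by (simp add: dg_def)
  show "finite (bars (stack b c))" using b c by (simp add: dg_def stack_def)
  fix k k' :: kind assume k: "k ~= k'"
  show "crossings (stack b c) k \<inter> crossings (stack b c) k' = {}"
  proof (rule equals0I)
   fix p assume "p \<in> crossings (stack b c) k \<inter> crossings (stack b c) k'"
   hence p: "p \<in> upper ` crossings b k \<union> lower ` crossings c k" "p \<in> upper ` crossings b k' \<union> lower ` crossings c k'"
    by (simp_all add: stack_def)
   have no: False if "q \<in> crossings b k1" "r \<in> crossings c k2" "upper q = lower r" for q r k1 k2
    using sep[OF dg_heights(1)[OF b that(1)] dg_heights(1)[OF c that(2)]] that(3) by blast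
   show False
    using p no dg_events(6)[OF b] dg_events(6)[OF c] injD[OF upper_inj] injD[OF lower_inj] k
    by (elim UnE imageE) metis+
  qed
 next
  show "bars (stack b c) \<subseteq> (\<Union>i\<in>{1..n}. curve (stackf f g i)) - meets n (stackf f g) - UNIV \<times> {0, 1}"
  proof
   fix p assume "p \<in> bars (stack b c)"
   then consider q where "q \<in> bars b" "p = upper q" | q where "q \<in> bars c" "p = lower q" by (auto simp: stack_def)
   thus "p \<in> (\<Union>i\<in>{1..n}. curve (stackf f g i)) - meets n (stackf f g) - UNIV \<times> {0, 1}"
   proof cases
    case (1 q)
    obtain i t where it: "i \<in> {1..n}" "t \<in> {0<..<1}" "q = (f i t, t)" using dg_events(3)[OF b 1(1)] by blast
    have "p \<in> curve (stackf f g i)" unfolding stack_curve[OF f g it(1), symmetric]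
     using 1(2) it by (auto simp: curve_def)
    moreover have "p \<notin> UNIV \<times> {0, 1}" using 1(2) it by (auto simp: upper_def)
    ultimately show ?thesis using it(1) up 1 by blast
   next
    case (2 q)
    obtain j t where jt: "j \<in> {1..n}" "t \<in> {0<..<1}" "q = (g j t, t)" using dg_events(3)[OF c 2(1)] by blast
    obtain i where i: "i \<in> {1..n}" "endp f i = j" using endp_bij[OF f] jt(1) unfolding bij_betw_def by (metis imageE)
    have "p \<in> curve (stackf f g i)" unfolding stack_curve[OF f g i(1), symmetric]
     using 2(2) jt i by (auto simp: curve_def)
    moreover have "p \<notin> UNIV \<times> {0, 1}" using 2(2) jt by (auto simp: lower_def)
    ultimately show ?thesis using i(1) low 2 by blast
   qed
  qed
 qed
qed

lemma lt_count_upper: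
 assumes "t \<in> {0..1}" shows "lt_count n (stackf f g) x ((1 + t) / 2) = lt_count n f x t"
 by (simp only: lt_count_def stackf_upper[OF assms])

lemma lt_count_lower:
 assumes f: "config n f" and t: "t \<in> {0..<1}" shows "lt_count n (stackf f g) x (t / 2) = lt_count n g x t"
proof -
 note e = stackf_lower[OF t]
 have "endp f ` {j \<in> {1..n}. g (endp f j) t < x} = {j \<in> {1..n}. g j t < x}"
 proof (intro equalityI subsetI)
  fix j assume j: "j \<in> {j \<in> {1..n}. g j t < x}"
  then obtain i where "i \<in> {1..n}" "endp f i = j" using endp_bij[OF f] unfolding bij_betw_def by (metis (no_types, lifting) imageE mem_Collect_eq)
  thus "j \<in> endp f ` {j \<in> {1..n}. g (endp f j) t < x}" using j by auto
 qed (use endp(2)[OF f] in auto)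
 moreover have "inj_on (endp f) {j \<in> {1..n}. g (endp f j) t < x}"
  by (rule inj_on_subset[OF endp_bij[OF f, unfolded bij_betw_def, THEN conjunct1]]) blast
 ultimately show ?thesis unfolding lt_count_def e using card_image by fastforce
qed

lemma rank_event:
 assumes d: "dg n b f" and t: "snd p \<in> {0..1}"
 shows "rank b p = lt_count n f (fst p) (snd p)"
 using rank_dg[OF d t, of "fst p"] by simp

lemma data_stack:
 assumes b: "dg n b f" and c: "dg n c g"
 shows "data (stack b c) = (%(l, t). (l, (1 + t) / 2)) ` data b \<union> (%(l, t). (l, t / 2)) ` data c"
proof -
 note d = dg_stack[OF b c]
 have f: "config n f" using b by (simp add: dg_def)
 have h: "snd p \<in> {0<..<1}" if "dg n d f" "(a, p) \<in> marks d" for d f a and p :: point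
  using mark_point[OF that] by auto
 have up: "rank (stack b c) (upper p) = rank b p" "snd (upper p) = (1 + snd p) / 2" if "(a, p) \<in> marks b" for a p
  using rank_event[OF d, of "upper p"] rank_event[OF b, of p] lt_count_upper[of "snd p" n f g "fst p"] h[OF b that]
  by (simp_all add: upper_def)
 have lo: "rank (stack b c) (lower p) = rank c p" "snd (lower p) = snd p / 2" if "(a, p) \<in> marks c" for a p
  using rank_event[OF d, of "lower p"] rank_event[OF c, of p] lt_count_lower[OF f, of "snd p" g "fst p"] h[OF c that]
  by (simp_all add: lower_def)
 show ?thesis
  unfolding data_marks marks_stack image_Un image_image
  by (intro arg_cong2[where f = "(\<union>)"] image_cong HOL.refl) (auto simp: up lo)
qed

fun letterf :: "letter => nat => real => real" where
 "letterf (Cr k i) j t = (if j = i then real i + 1 - t else if j = i + 1 then real i + t else real j)"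
| "letterf (Bar i) j t = real j"

lemma crossing_coincidence:
 assumes t: "t \<in> {0..1}" and e: "letterf (Cr k i) a t = letterf (Cr k i) b t" and ne: "a ~= b"
 shows "t = 1/2 & ((a = i & b = i + 1) \<or> (a = i + 1 & b = i))"
proof -
 have out: "letterf (Cr k i) z t <= real i - 1 \<or> letterf (Cr k i) z t >= real i + 2" if "z \<notin> {i, i + 1}" for z
 proof -
  have "z < i \<or> i + 1 < z" using that by auto
  thus ?thesis using that by auto
 qed
 have ins: "real i <= letterf (Cr k i) z t & letterf (Cr k i) z t <= real i + 1" if "z \<in> {i, i + 1}" for z
  using that t by auto
 consider "a \<in> {i, i + 1}" "b \<in> {i, i + 1}" | "a \<in> {i, i + 1}" "b \<notin> {i, i + 1}"
  | "a \<notin> {i, i + 1}" "b \<in> {i, i + 1}" | "a \<notin> {i, i + 1}" "b \<notin> {i, i + 1}" by blast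
 thus ?thesis
 proof cases
  case 1
  thus ?thesis using e ne by auto
 next
  case 2
  thus ?thesis using out[OF 2(2)] ins[OF 2(1)] e by linarith
 next
  case 3
  thus ?thesis using out[OF 3(1)] ins[OF 3(2)] e by linarith
 next
  case 4
  thus ?thesis using e ne by simp
 qed
qed

lemma config_crossing:
 assumes "1 <= i" "i + 1 <= n" shows "config n (letterf (Cr k i))" (is "config n ?f")
 unfolding config_def
proof (intro conjI ballI impI)
 fix j assume j: "j \<in> {1..n}"
 show "continuous_on {0..1} (?f j)"
 proof -
  have "?f j = (%t. if j = i then real i + 1 - t else if j = i + 1 then real i + t else real j)" by auto
  thus ?thesis by (cases "j = i"; cases "j = i + 1") (simp_all add: continuous_intros)
 qed
 show "?f j 1 = real j" by simp
 show "?f j 0 \<in> real ` {1..n}"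
 proof -
  have "?f j 0 = real (if j = i then i + 1 else if j = i + 1 then i else j)" by simp
  moreover have "(if j = i then i + 1 else if j = i + 1 then i else j) \<in> {1..n}" using j assms by auto
  ultimately show ?thesis by blast
 qed
 fix t :: real assume "t \<in> {0..1}"
 thus "0 < ?f j t" "?f j t < real n + 1" using j assms by auto
next
 show "inj_on (%j. ?f j 0) {1..n}" by (rule inj_onI) (auto split: if_splits)
next
 fix a b c and t :: real
 assume t: "t \<in> {0..1}" and e: "?f a t = ?f b t & ?f b t = ?f c t"
 show "a = b \<or> b = c \<or> a = c"
  using crossing_coincidence[OF t, of k i a b] crossing_coincidence[OF t, of k i b c] e by fastforce
next
 fix a b and t :: real assume t: "t \<in> {0<..<1}" and e: "a ~= b & ?f a t = ?f b t"
 have t2: "t = 1/2" and ab: "(a = i & b = i + 1) \<or> (a = i + 1 & b = i)"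
  using crossing_coincidence[of t k i a b] t e by auto
 show "passes (?f a) (?f b) t"
  unfolding passes_def
 proof (intro exI[of _ "1/2"] conjI allI impI)
  fix s :: real assume s: "0 < s & s < 1/2"
  show "(?f a (t - s) - ?f b (t - s)) * (?f a (t + s) - ?f b (t + s)) < 0"
   using ab s unfolding t2 by (auto simp: mult_less_0_iff)
 qed (simp_all add: t2)
qed

lemma config_bar: "config n (letterf (Bar i))"
 unfolding config_def by (auto intro!: inj_onI)

lemma vertical_strand_curve: "vertical_strand j = curve (%t. real j)"
 unfolding vertical_strand_def closed_segment_def curve_def by (auto simp: algebra_simps)

lemma meets_bar: "meets n (letterf (Bar i)) = {}"
 by (auto simp: meets_def)

lemma meets_crossing:
 assumes "1 <= i" "i + 1 <= n" shows "meets n (letterf (Cr k i)) = {(real i + 1/2, 1/2)}" (is "meets n ?f = _")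
proof (intro equalityI subsetI)
 fix p assume "p \<in> meets n ?f"
 then obtain a b t where ab: "a \<in> {1..n}" "b \<in> {1..n}" "a ~= b" and t: "t \<in> {0..1}" and p: "p = (?f a t, t)"
  and e: "?f a t = ?f b t" unfolding meets_def by blast
 have t2: "t = 1/2" and ab': "(a = i & b = i + 1) \<or> (a = i + 1 & b = i)"
  using crossing_coincidence[OF t e ab(3)] by auto
 from ab' have "?f a t = real i + 1/2" unfolding t2 by auto
 thus "p \<in> {(real i + 1/2, 1/2)}" using p unfolding t2 by simp
next
 fix p assume "p \<in> {(real i + 1/2, 1/2::real)}"
 thus "p \<in> meets n ?f" unfolding meets_def using assms
  by (intro CollectI exI[of _ i] exI[of _ "i + 1"] exI[of _ "1/2"]) auto
qed

lemma segment_curve: "closed_segment (x, 1) (y, 0) = curve (%t. y + t * (x - y))"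
proof -
 have "closed_segment (x, 1) (y, 0) = (%u. (x + u * (y - x), 1 - u)) ` {0..1::real}"
  unfolding closed_segment_def by (auto simp: algebra_simps)
 also have "... = (%u. (x + u * (y - x), 1 - u)) ` ((%t. 1 - t) ` {0..1})" by (simp add: image_diff_atLeastAtMost)
 also have "... = curve (%t. y + t * (x - y))"
  unfolding curve_def image_image by (rule image_cong) (simp_all add: algebra_simps)
 finally show ?thesis .
qed

lemma dg_crossing:
 assumes "1 <= i" "i + 1 <= n" shows "dg n (crossing_diagram n k i) (letterf (Cr k i))" (is "dg n ?b ?f")
 unfolding dg_def
proof (intro conjI allI impI)
 show "config n ?f" by (rule config_crossing[OF assms])
 let ?C = "%j. curve (?f j)"
 have 1: "closed_segment (real i, 1) (real i + 1, 0) = ?C i" "closed_segment (real i + 1, 1) (real i, 0) = ?C (i + 1)"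
  unfolding segment_curve by (auto simp: curve_def)
 have 3: "vertical_strand ` ({1..n} - {i, i + 1}) = ?C ` ({1..n} - {i, i + 1})"
  by (rule image_cong) (auto simp: vertical_strand_curve curve_def)
 have "{1..n} = ({1..n} - {i, i + 1}) \<union> {i, i + 1}" using assms by auto
 hence "?C ` {1..n} = ?C ` (({1..n} - {i, i + 1}) \<union> {i, i + 1})" by (rule arg_cong)
 also have "... = ?C ` ({1..n} - {i, i + 1}) \<union> {?C i, ?C (i + 1)}" by (simp only: image_Un image_insert image_empty)
 finally show "strands ?b = ?C ` {1..n}" unfolding crossing_diagram_def by (simp only: diagram.simps 1 3)
 show "(\<Union>k'. crossings ?b k') = meets n ?f"
  unfolding meets_crossing[OF assms] by (auto simp: crossing_diagram_def split: if_splits)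
 show "finite (bars ?b)" "bars ?b \<subseteq> (\<Union>j\<in>{1..n}. ?C j) - meets n ?f - UNIV \<times> {0, 1}"
  by (simp_all add: crossing_diagram_def)
 show "crossings ?b k1 \<inter> crossings ?b k2 = {}" if "k1 ~= k2" for k1 k2
  using that by (auto simp: crossing_diagram_def)
qed

lemma dg_bar:
 assumes "1 <= i" "i <= n" shows "dg n (bar_diagram n i) (letterf (Bar i))"
 unfolding dg_def
proof (intro conjI allI impI)
 show "config n (letterf (Bar i))" by (rule config_bar)
 show "strands (bar_diagram n i) = (%j. curve (letterf (Bar i) j)) ` {1..n}"
  by (simp add: bar_diagram_def id_diagram_def vertical_strand_curve curve_def)
 show "(\<Union>k'. crossings (bar_diagram n i) k') = meets n (letterf (Bar i))"
  unfolding meets_bar by (simp add: bar_diagram_def id_diagram_def)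
 have "(real i, 1/2) \<in> curve (letterf (Bar i) i)" by (simp add: mem_curve)
 thus "bars (bar_diagram n i) \<subseteq> (\<Union>j\<in>{1..n}. curve (letterf (Bar i) j)) - meets n (letterf (Bar i)) - UNIV \<times> {0, 1}"
  unfolding meets_bar using assms by (auto simp: bar_diagram_def id_diagram_def)
qed (simp_all add: bar_diagram_def id_diagram_def)

lemma dg_id: "dg n (id_diagram n) (letterf (Bar i))"
 unfolding dg_def
proof (intro conjI allI impI)
 show "config n (letterf (Bar i))" by (rule config_bar)
 show "strands (id_diagram n) = (%j. curve (letterf (Bar i) j)) ` {1..n}"
  by (simp add: id_diagram_def vertical_strand_curve curve_def)
 show "(\<Union>k'. crossings (id_diagram n) k') = meets n (letterf (Bar i))"
  unfolding meets_bar by (simp add: id_diagram_def)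
qed (simp_all add: id_diagram_def)

lemma dg_letter: "valid n l ==> dg n (letter_diagram n l) (letterf l)"
 by (cases l) (simp_all only: letter_diagram.simps valid.simps dg_crossing dg_bar)

lemma data_id: "data (id_diagram n) = {}"
 by (simp add: data_def id_diagram_def)

fun head :: "letter => nat => letter" where
 "head (Cr k i) = Cr k"
| "head (Bar i) = Bar"

fun center :: "letter => point" where
 "center (Cr k i) = (real i + 1/2, 1/2)"
| "center (Bar i) = (real i, 1/2)"

lemma marks_letter: "marks (letter_diagram n l) = {(head l, center l)}"
 by (cases l) (auto simp: marks_def crossing_diagram_def bar_diagram_def id_diagram_def split: if_splits)

lemma data_letter:
 assumes v: "valid n l" shows "data (letter_diagram n l) = {(l, 1/2)}"
proof -
 have "head l (Suc (lt_count n (letterf l) (fst (center l)) (1/2))) = l"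
 proof (cases l)
  case (Cr k i)
  hence "{j \<in> {1..n}. letterf l j (1/2) < fst (center l)} = {1..<i}" using v by auto
  thus ?thesis using v Cr by (simp add: lt_count_def)
 next
  case (Bar i)
  hence "{j \<in> {1..n}. letterf l j (1/2) < fst (center l)} = {1..<i}" using v by auto
  thus ?thesis using v Bar by (simp add: lt_count_def)
 qed
 moreover have h: "snd (center l) = 1/2" by (cases l) simp_all
 ultimately show ?thesis
  unfolding data_marks marks_letter using rank_event[OF dg_letter[OF v], of "center l"] by (simp add: h)
qed

fun wordf :: "letter list => nat => real => real" where
 "wordf [] = letterf (Bar 0)"
| "wordf (l # w) = stackf (letterf l) (wordf w)"

lemma word_diagram_Nil [simp]: "word_diagram n [] = id_diagram n"
 and word_diagram_Cons [simp]: "word_diagram n (l # w) = stack (letter_diagram n l) (word_diagram n w)"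
 by (simp_all add: word_diagram_def)

lemma dg_word: "\<forall>l\<in>set w. valid n l ==> dg n (word_diagram n w) (wordf w)"
proof (induction w)
 case Nil
 show ?case unfolding word_diagram_Nil wordf.simps by (rule dg_id)
next
 case (Cons l w)
 show ?case unfolding word_diagram_Cons wordf.simps
  by (rule dg_stack[OF dg_letter Cons.IH]) (use Cons.prems in simp_all)
qed

text \<open>The heights of the events of a word diagram: each further letter halves the space left at the bottom.\<close>

definition std_heights :: "nat => real list" where
 "std_heights m = map (%j. 3/4 * (1/2) ^ j) [0..<m]"

lemma std_heights_Suc: "std_heights (Suc m) = 3/4 # map (%t. t / 2) (std_heights m)"
 unfolding std_heights_def by (simp add: upt_rec[of 0] map_Suc_upt[symmetric] comp_def del: upt_Suc)

lemma length_std_heights [simp]: "length (std_heights m) = m"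
 by (simp add: std_heights_def)

lemma std_heights_sorted: "sorted_wrt (>) (std_heights m)"
 unfolding std_heights_def sorted_wrt_map
 by (rule sorted_wrt_mono_rel[OF _ sorted_wrt_upt]) (simp add: power_strict_decreasing)

lemma std_heights_range: "t \<in> set (std_heights m) ==> t \<in> {0<..<1}"
proof -
 assume "t \<in> set (std_heights m)"
 then obtain j where "t = 3/4 * (1/2) ^ j" by (auto simp: std_heights_def)
 moreover have "(1/2::real) ^ j <= 1" "0 < (1/2::real) ^ j" by (simp_all add: power_le_one)
 ultimately show ?thesis unfolding greaterThanLessThan_iff by linarith
qed

lemma data_word:
 "\<forall>l\<in>set w. valid n l ==> data (word_diagram n w) = set (zip w (std_heights (length w)))"
proof (induction w)
 case Nil
 thus ?case by (simp add: data_id)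
next
 case (Cons l w)
 have v: "valid n l" "\<forall>l\<in>set w. valid n l" using Cons.prems by simp_all
 have "data (word_diagram n (l # w)) = {(l, 3/4)} \<union> (%(l, t). (l, t / 2)) ` data (word_diagram n w)"
  unfolding word_diagram_Cons data_stack[OF dg_letter[OF v(1)] dg_word[OF v(2)]] data_letter[OF v(1)] by simp
 also have "(%(l, t). (l, t / 2)) ` data (word_diagram n w) = set (zip w (map (%t. t / 2) (std_heights (length w))))"
  unfolding Cons.IH[OF v(2)] by (simp add: zip_map2)
 finally show ?case by (simp add: std_heights_Suc)
qed

section \<open>Events along the strands of a word\<close>

lemma lcong_in: "(u, v) \<in> lcong n ==> u \<in> vwords n & v \<in> vwords n"
proof (induction rule: lcong.induct)
 case (local p q m l r d)
 have "map (shift d) l \<in> vwords n & map (shift d) r \<in> vwords n"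
  using local(3,4) by (cases rule: local_picture.cases) auto
 thus ?case using local by auto
qed auto

lemma lcong_context:
 assumes "(u, v) \<in> lcong n" "p \<in> vwords n" "q \<in> vwords n" shows "(p @ u @ q, p @ v @ q) \<in> lcong n"
 using assms
proof (induction rule: lcong.induct)
 case (far p' q' l1 l2)
 thus ?case using lcong.far[of "p @ p'" n "q' @ q" l1 l2] by simp
next
 case (local p' q' m l r d)
 thus ?case using lcong.local[of "p @ p'" n "q' @ q" m l r d] by simp
next
 case (lrefl w)
 hence "p @ w @ q \<in> vwords n" by simp
 thus ?case by (rule lcong.lrefl)
qed (blast intro: lcong.lsym lcong.ltrans)+

interpretation lc: word_congruence "vwords n" "lcong n" for n
proof (unfold_locales; (simp; fail)?)
 show "equiv (vwords n) (lcong n)"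
 proof (rule equivI)
  show "lcong n \<subseteq> vwords n \<times> vwords n" using lcong_in by auto
  show "refl_on (vwords n) (lcong n)" unfolding refl_on_def using lcong.lrefl by blast
  show "sym_on UNIV (lcong n)" by (rule symI) (rule lcong.lsym)
  show "trans_on UNIV (lcong n)" by (rule transI) (rule lcong.ltrans)
 qed
 show "(p @ u @ q, p @ v @ q) \<in> lcong n" if "(u, v) \<in> lcong n" "p \<in> vwords n" "q \<in> vwords n" for u v p q
  by (rule lcong_context[OF that])
qed

fun tag :: "letter => kind option" where
 "tag (Cr k i) = Some k"
| "tag (Bar i) = None"

fun lact :: "letter => nat => nat" where
 "lact (Cr k i) j = (if j = i then i + 1 else if j = i + 1 then i else j)"
| "lact (Bar i) j = j"

abbreviation relabel :: "letter => kind option \<times> nat set => kind option \<times> nat set" where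
 "relabel l \<equiv> apsnd ((`) (lact l))"

text \<open>The events of a word from top to bottom, each with its kind and the set of the labels of the strands involved. The first letter permutes
the strands, so the events below it have to be relabelled.\<close>

fun trace :: "letter list => (kind option \<times> nat set) list" where
 "trace [] = []"
| "trace (l # w) = (tag l, supp l) # map (relabel l) (trace w)"

lemma lact_lact [simp]: "lact l (lact l j) = j"
 by (cases l) auto

lemma relabel_relabel [simp]: "relabel l (relabel l e) = e"
 by (cases e) (simp add: image_image)

lemma lact_mem: "j \<in> lact l ` S \<longleftrightarrow> lact l j \<in> S"
 by (metis image_iff lact_lact)

lemma lact_supp [simp]: "lact l ` supp l = supp l"
 by (cases l) auto

lemma lact_outside: "j \<notin> supp l ==> lact l j = j"
 by (cases l) auto

lemma lact_image_disjoint: "S \<inter> supp l = {} ==> lact l ` S = S"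
proof -
 assume d: "S \<inter> supp l = {}"
 have "lact l j = j" if "j \<in> S" for j by (rule lact_outside) (use that d in blast)
 hence "lact l ` S = (%x. x) ` S" by (intro image_cong) simp_all
 thus ?thesis by simp
qed

lemma lact_commute:
 assumes "supp l1 \<inter> supp l2 = {}" shows "lact l1 (lact l2 j) = lact l2 (lact l1 j)"
proof -
 have s: "lact l1 j \<in> supp l1 \<longleftrightarrow> j \<in> supp l1" "lact l2 j \<in> supp l2 \<longleftrightarrow> j \<in> supp l2"
  using lact_supp lact_mem by metis+
 consider "j \<in> supp l1" | "j \<in> supp l2" | "j \<notin> supp l1" "j \<notin> supp l2" by blast
 thus ?thesis
 proof cases
  case 1
  hence "lact l1 j \<notin> supp l2" "j \<notin> supp l2" using s assms by blast+
  thus ?thesis by (simp add: lact_outside)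
 next
  case 2
  hence "lact l2 j \<notin> supp l1" "j \<notin> supp l1" using s assms by blast+
  thus ?thesis by (simp add: lact_outside)
 next
  case 3
  thus ?thesis by (simp add: lact_outside)
 qed
qed

lemma trace_swap:
 assumes d: "supp l1 \<inter> supp l2 = {}" and t: "trace (l1 # l2 # w) = e1 # e2 # R"
 shows "trace (l2 # l1 # w) = e2 # e1 # R"
proof -
 have 1: "lact l1 ` supp l2 = supp l2" "lact l2 ` supp l1 = supp l1"
  using d by (auto intro!: lact_image_disjoint simp: Int_commute)
 have 2: "relabel l1 (relabel l2 e) = relabel l2 (relabel l1 e)" for e
  by (cases e) (simp add: image_image lact_commute[OF d])
 have e: "e1 = (tag l1, supp l1)" "e2 = (tag l2, supp l2)" "R = map (%e. relabel l1 (relabel l2 e)) (trace w)"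
  using t 1 by auto
 have "R = map (%e. relabel l2 (relabel l1 e)) (trace w)" unfolding e(3) by (simp only: 2)
 thus ?thesis unfolding e(1,2) using 1 by simp
qed

lemma trace_disjoint:
 assumes t: "trace (l1 # l2 # w) = e1 # e2 # R" and d: "snd e1 \<inter> snd e2 = {}"
 shows "supp l1 \<inter> supp l2 = {}"
proof -
 have e: "snd e1 = lact l1 ` supp l1" "snd e2 = lact l1 ` supp l2" using t by auto
 have "lact l1 ` (supp l1 \<inter> supp l2) \<subseteq> snd e1 \<inter> snd e2" unfolding e by blast
 thus ?thesis using d by simp
qed

text \<open>An event that shares no strand with the events above it can be moved to the top by exchanges of letters. The
relabelling by the first letter changes the list of events, hence the induction on its length.\<close>

lemma pull_front:
 assumes "w \<in> vwords n" "trace w = X @ e # Y" "\<forall>x\<in>set X. snd x \<inter> snd e = {}"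
 shows "\<exists>l w'. (w, l # w') \<in> lcong n & trace (l # w') = e # X @ Y"
 using assms
proof (induction "length X" arbitrary: X w e Y)
 case 0
 then obtain l w' where w: "w = l # w'" by (cases w) auto
 have "(w, l # w') \<in> lcong n" unfolding w by (rule lcong.lrefl) (use 0 w in simp)
 moreover have "trace (l # w') = e # X @ Y" using 0 w by simp
 ultimately show ?case by blast
next
 case (Suc k Z)
 then obtain x X where Z: "Z = x # X" "k = length X" by (cases Z) auto
 note Cons = Suc.hyps(1) Suc.prems[unfolded Z]
 then obtain l0 w0 where w: "w = l0 # w0" by (cases w) auto
 have v: "valid n l0" "w0 \<in> vwords n" using Cons(2) w by auto
 have x: "x = (tag l0, supp l0)" and t0: "map (relabel l0) (trace w0) = X @ e # Y" using Cons(3) w by auto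
 have "trace w0 = map (relabel l0) (map (relabel l0) (trace w0))" by (simp add: comp_def)
 hence t: "trace w0 = map (relabel l0) X @ relabel l0 e # map (relabel l0) Y" unfolding t0 by simp
 have dj: "snd y \<inter> snd (relabel l0 e) = {}" if y: "y \<in> set (map (relabel l0) X)" for y
 proof -
  obtain z where z: "z \<in> set X" "y = relabel l0 z" using y by auto
  have "snd z \<inter> snd e = {}" using Cons(4) z(1) by simp
  hence "lact l0 ` (snd z \<inter> snd e) = {}" by simp
  moreover have "inj (lact l0)" by (metis injI lact_lact)
  ultimately show ?thesis unfolding z(2) snd_apsnd by (simp add: image_Int)
 qed
 have "\<exists>l w'. (w0, l # w') \<in> lcong n & trace (l # w') = relabel l0 e # map (relabel l0) X @ map (relabel l0) Y"
  by (rule Cons(1)[OF _ v(2) t]) (use Z(2) dj in \<open>simp_all del: set_map\<close>)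
 then obtain l w' where l: "(w0, l # w') \<in> lcong n" "trace (l # w') = relabel l0 e # map (relabel l0) X @ map (relabel l0) Y"
  by blast
 have vl: "valid n l" "w' \<in> vwords n" using lcong_in[OF l(1)] by auto
 have 1: "(w, l0 # l # w') \<in> lcong n" using lc.left[OF l(1), of "[l0]"] v(1) w by simp
 have t2: "trace (l0 # l # w') = x # e # X @ Y"
 proof -
  have "trace (l0 # l # w') = x # map (relabel l0) (trace (l # w'))" using x by simp
  thus ?thesis unfolding l(2) by (simp add: comp_def)
 qed
 have far: "supp l0 \<inter> supp l = {}" by (rule trace_disjoint[OF t2]) (use Cons(4) in simp)
 have "(l0 # l # w', l # l0 # w') \<in> lcong n" using lcong.far[of "[]" n w' l0 l] far v vl by simp
 hence "(w, l # l0 # w') \<in> lcong n" using 1 lcong.ltrans by blast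
 moreover have "trace (l # l0 # w') = e # (x # X) @ Y" using trace_swap[OF far t2] by simp
 ultimately show ?case unfolding Z by blast
qed

lemma event_letter: "tag l = tag l' ==> supp l = supp l' ==> l = l'"
 by (cases l; cases l') (auto simp: doubleton_eq_iff)

lemma trace_nonempty: "e \<in> set (trace w) ==> snd e ~= {}"
proof (induction w arbitrary: e)
 case (Cons l w)
 have "supp l ~= {}" by (cases l) auto
 thus ?case using Cons by auto
qed simp

lemma filter_relabel: "filter (%e. i \<in> snd e) (map (relabel l) T) = map (relabel l) (filter (%e. lact l i \<in> snd e) T)"
 by (simp add: filter_map comp_def lact_mem)

text \<open>The sequences of events along the single strands determine a word up to exchanges: the first event of \<open>w\<close> is
the first one on each of its strands, in \<open>w'\<close> as well, so it can be moved to the top of \<open>w'\<close> and cancelled.\<close>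

lemma lcong_if_same_strands:
 assumes "w \<in> vwords n" "w' \<in> vwords n"
  "\<And>i. filter (%e. i \<in> snd e) (trace w) = filter (%e. i \<in> snd e) (trace w')"
 shows "(w, w') \<in> lcong n"
 using assms
proof (induction w arbitrary: w')
 case Nil
 have "trace w' = []"
 proof (rule ccontr)
  assume "trace w' ~= []"
  then obtain e where e: "e \<in> set (trace w')" by (cases "trace w'") auto
  then obtain i where "i \<in> snd e" using trace_nonempty by blast
  hence "e \<in> set (filter (%e. i \<in> snd e) (trace w'))" using e by simp
  thus False unfolding Nil(3)[of i, symmetric] by simp
 qed
 hence "w' = []" by (cases w') auto
 thus ?case using Nil lcong.lrefl by blast
next
 case (Cons l u)
 let ?e = "(tag l, supp l)"
 have ne: "supp l ~= {}" by (cases l) auto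
 have hd: "\<exists>T. filter (%e. i \<in> snd e) (trace w') = ?e # T" if i: "i \<in> supp l" for i
  unfolding Cons.prems(3)[of i, symmetric] using i by simp
 obtain i where i: "i \<in> supp l" using ne by blast
 obtain T where "filter (%e. i \<in> snd e) (trace w') = ?e # T" using hd[OF i] by blast
 hence "?e \<in> set (filter (%e. i \<in> snd e) (trace w'))" by (simp del: set_filter)
 hence "?e \<in> set (trace w')" by simp
 hence "\<exists>x\<in>set (trace w'). snd x \<inter> supp l ~= {}" by (rule rev_bexI) (use ne in simp)
 then obtain X e' Y where s: "trace w' = X @ e' # Y" "snd e' \<inter> supp l ~= {}" "\<forall>y\<in>set X. \<not> snd y \<inter> supp l ~= {}"
  using split_list_first_prop[of "trace w'" "%x. snd x \<inter> supp l ~= {}"] by blast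
 obtain j where j: "j \<in> snd e'" "j \<in> supp l" using s(2) by blast
 have Xj: "filter (%e. k \<in> snd e) X = []" if "k \<in> supp l" for k
  using s(3) that by (auto simp: filter_empty_conv)
 have "filter (%e. j \<in> snd e) (trace w') = e' # filter (%e. j \<in> snd e) Y"
  unfolding s(1) using Xj[OF j(2)] j(1) by simp
 hence e': "e' = ?e" using hd[OF j(2)] by auto
 obtain l' w2 where l': "(w', l' # w2) \<in> lcong n" "trace (l' # w2) = ?e # X @ Y"
  using pull_front[OF Cons.prems(2) s(1)] s(3) e' by auto
 have "l' = l" by (rule event_letter) (use l'(2) in auto)
 hence l: "(w', l # w2) \<in> lcong n" "trace (l # w2) = ?e # X @ Y" using l' by simp_all
 have v: "valid n l" "u \<in> vwords n" "w2 \<in> vwords n" using Cons.prems(1) lcong_in[OF l(1)] by auto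
 have fil: "filter (%e. k \<in> snd e) (trace (l # u)) = filter (%e. k \<in> snd e) (trace (l # w2))" for k
 proof -
  have "filter (%e. k \<in> snd e) (X @ ?e # Y) = filter (%e. k \<in> snd e) (?e # X @ Y)"
   using Xj[of k] by (cases "k \<in> supp l") auto
  thus ?thesis using Cons.prems(3)[of k] unfolding l(2) s(1) e' by simp
 qed
 have "filter (%e. k \<in> snd e) (trace u) = filter (%e. k \<in> snd e) (trace w2)" for k
 proof -
  have "filter (%e. lact l k \<in> snd e) (map (relabel l) (trace u)) = filter (%e. lact l k \<in> snd e) (map (relabel l) (trace w2))"
   using fil[of "lact l k"] by (simp split: if_splits)
  hence "map (relabel l) (filter (%e. k \<in> snd e) (trace u)) = map (relabel l) (filter (%e. k \<in> snd e) (trace w2))"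
   unfolding filter_relabel lact_lact .
  moreover have "inj (relabel l)" by (metis injI relabel_relabel)
  ultimately show ?thesis by (simp add: inj_map_eq_map)
 qed
 hence "(u, w2) \<in> lcong n" by (rule Cons.IH[OF v(2,3)])
 hence "(l # u, l # w2) \<in> lcong n" using lc.left[of u w2 n "[l]"] v(1) by simp
 thus ?case using l(1) lcong.lsym lcong.ltrans by blast
qed

section \<open>An isotopy respects the strands\<close>

lemma finite_path_constant:
 fixes \<gamma> :: "real => point"
 assumes c: "continuous_on {0..1} \<gamma>" and F: "finite F" "\<And>s. s \<in> {0..1} ==> \<gamma> s \<in> F"
 shows "\<gamma> 1 = \<gamma> 0"
proof -
 have "connected (\<gamma> ` {0..1})" by (rule connected_continuous_image[OF c]) simp
 moreover have "finite (\<gamma> ` {0..1})" using F by (intro finite_subset[OF _ F(1)]) blast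
 ultimately have "\<gamma> ` {0..1} = {} \<or> (\<exists>x. \<gamma> ` {0..1} = {x})" using connected_finite_iff_sing by blast
 moreover have "\<gamma> 0 \<in> \<gamma> ` {0..1}" "\<gamma> 1 \<in> \<gamma> ` {0..1}" by auto
 ultimately show ?thesis by (metis empty_iff singletonD)
qed

text \<open>Along a strand the height of the image is continuous and injective with values onto \<open>[0, 1]\<close>, hence monotone.
An end point goes to an end point.\<close>

lemma strand_image:
 assumes b: "dg n b f" and b': "dg n (map_diagram \<phi> b) g" and cont: "continuous_on (E n) \<phi>"
  and inj: "inj_on \<phi> (E n)" and i: "i \<in> {1..n}"
 shows "\<exists>j\<in>{1..n}. \<phi> ` curve (f i) = curve (g j) &
   ((\<phi> (f i 1, 1) = (g j 1, 1) & (\<forall>t u. 0 <= t & t < u & u <= 1 --> snd (\<phi> (f i t, t)) < snd (\<phi> (f i u, u)))) \<or>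
   \<phi> (f i 1, 1) = (g j 0, 0))"
proof -
 have c: "config n f" and cg: "config n g" using b b' by (simp_all add: dg_def)
 have "strands (map_diagram \<phi> b) = (%a. \<phi> ` a) ` (%i. curve (f i)) ` {1..n}" using b by (simp add: dg_def map_diagram_def)
 hence "(%a. \<phi> ` a) ` (%i. curve (f i)) ` {1..n} = (%i. curve (g i)) ` {1..n}" using b' by (simp add: dg_def)
 hence "\<phi> ` curve (f i) \<in> (%i. curve (g i)) ` {1..n}" using i by blast
 then obtain j where j: "j \<in> {1..n}" "\<phi> ` curve (f i) = curve (g j)" by blast
 define m where "m = (%t. snd (\<phi> (f i t, t)))"
 have pt: "\<phi> (f i t, t) = (g j (m t), m t) & m t \<in> {0..1}" if "t \<in> {0..1}" for t
 proof -
  have "(f i t, t) \<in> curve (f i)" using that by (simp add: mem_curve)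
  hence "\<phi> (f i t, t) \<in> curve (g j)" using j(2) by blast
  thus ?thesis unfolding m_def by (auto simp: curve_def)
 qed
 have inE: "(f i t, t) \<in> E n" if "t \<in> {0..1}" for t
  using curve_sub_E[OF c i] that by (auto simp: curve_def)
 have mc: "continuous_on {0..1} m"
 proof -
  have "continuous_on {0..1} (%t. (f i t, t))" by (intro continuous_intros configD(1)[OF c i])
  hence "continuous_on {0..1} (%t. \<phi> (f i t, t))"
   by (rule continuous_on_compose2[OF cont]) (use inE in blast)
  thus ?thesis unfolding m_def by (rule continuous_on_snd)
 qed
 have minj: "inj_on m {0..1}"
 proof (rule inj_onI)
  fix t u assume tu: "t \<in> {0..1}" "u \<in> {0..1}" "m t = m u"
  hence "\<phi> (f i t, t) = \<phi> (f i u, u)" using pt by metis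
  thus "t = u" using inj_onD[OF inj _ inE[OF tu(1)] inE[OF tu(2)]] by blast
 qed
 have monto: "\<exists>t\<in>{0..1}. m t = v" if "v \<in> {0..1}" for v
 proof -
  have "(g j v, v) \<in> \<phi> ` curve (f i)" unfolding j(2) using that by (simp add: mem_curve)
  thus ?thesis unfolding m_def by (auto simp: curve_def) (metis atLeastAtMost_iff snd_conv)
 qed
 have btw: "(m a < m x & m x < m b) \<or> (m b < m x & m x < m a)" if "0 <= a" "a < x" "x < b" "b <= 1" for a x b
  by (rule continuous_inj_imp_mono[OF that(2,3)])
   (use that in \<open>auto intro: continuous_on_subset[OF mc] inj_on_subset[OF minj]\<close>)
 have m01: "m 0 ~= m 1" using inj_onD[OF minj, of 0 1] by auto
 have ends: "m 0 \<in> {0, 1} & m 1 \<in> {0, 1}"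
 proof -
  obtain t0 t1 where t: "t0 \<in> {0..1}" "m t0 = 0" "t1 \<in> {0..1}" "m t1 = 1" using monto[of 0] monto[of 1] by auto
  have bd: "0 <= m 0" "m 0 <= 1" "0 <= m 1" "m 1 <= 1" using pt[of 0] pt[of 1] by auto
  have a: "t0 = 0 \<or> t0 = 1"
  proof (rule ccontr)
   assume "\<not> ?thesis"
   thus False using btw[of 0 t0 1] t bd by auto
  qed
  have b: "t1 = 0 \<or> t1 = 1"
  proof (rule ccontr)
   assume "\<not> ?thesis"
   thus False using btw[of 0 t1 1] t bd by auto
  qed
  show ?thesis using a b t m01 by auto
 qed
 show ?thesis
 proof (intro bexI[OF _ j(1)] conjI j(2))
  show "(\<phi> (f i 1, 1) = (g j 1, 1) & (\<forall>t u. 0 <= t & t < u & u <= 1 --> snd (\<phi> (f i t, t)) < snd (\<phi> (f i u, u)))) \<or>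
   \<phi> (f i 1, 1) = (g j 0, 0)"
  proof (cases "m 1 = 1")
   case True
   hence z: "m 0 = 0" using ends m01 by auto
   have "m t < m u" if tu: "0 <= t" "t < u" "u <= 1" for t u
   proof -
    have lo: "m 0 < m u"
    proof -
     have "m u ~= m 0" using inj_onD[OF minj, of u 0] tu by auto
     moreover have "0 <= m u" using pt[of u] tu by auto
     ultimately show ?thesis using z by simp
    qed
    show ?thesis
    proof (cases "t = 0")
     case True thus ?thesis using lo by simp
    next
     case False
     have "m t ~= m 0" using inj_onD[OF minj, of t 0] tu False by auto
     moreover have "0 <= m t" using pt[of t] tu by auto
     ultimately show ?thesis using btw[of 0 t u] tu False z by auto
    qed
   qed
   thus ?thesis using pt[of 1] True unfolding m_def by auto
  next
   case False
   hence "m 1 = 0" using ends by auto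
   thus ?thesis using pt[of 1] by auto
  qed
 qed
qed

text \<open>During an isotopy a top end point moves continuously inside the finite set of end points, so it does
not move at all. This excludes that strands are permuted or turned upside down.\<close>

lemma isotopy_strands:
 assumes iso: "isotopic n b b'" and b: "dg n b f" and b': "dg n b' f'"
 shows "\<exists>\<phi>. b' = map_diagram \<phi> b & inj_on \<phi> (E n) & (\<forall>i\<in>{1..n}. \<phi> ` curve (f i) = curve (f' i) &
   (\<forall>t u. 0 <= t & t < u & u <= 1 --> snd (\<phi> (f i t, t)) < snd (\<phi> (f i u, u))))"
proof (rule isotopicE[OF iso])
 fix H :: "real => point => point"
 assume H: "continuous_on ({0..1} \<times> E n) (%q. H (fst q) (snd q))" "\<And>p. H 0 p = p" "b' = map_diagram (H 1) b"
  "\<And>s. s \<in> {0..1} ==> H s ` E n = E n" "\<And>s. s \<in> {0..1} ==> inj_on (H s) (E n)"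
  "\<And>s. s \<in> {0..1} ==> is_diagram n (map_diagram (H s) b)"
 have c: "config n f" and c': "config n f'" using b b' by (simp_all add: dg_def)
 have cs: "continuous_on (E n) (H s)" if s: "s \<in> {0..1}" for s
 proof -
  have "continuous_on (E n) (%p. (%q. H (fst q) (snd q)) (s, p))"
  proof (rule continuous_on_compose2[OF H(1)])
   show "(%p. (s, p)) ` E n \<subseteq> {0..1::real} \<times> E n" using s by (intro image_subsetI SigmaI)
  qed (intro continuous_intros)
  thus ?thesis by simp
 qed
 have top: "H 1 (f i 1, 1) = (real i, 1)" if i: "i \<in> {1..n}" for i
 proof -
  have iE: "(real i, 1) \<in> E n" using i by (auto simp: E_def)
  have fi: "f i 1 = real i" by (rule configD(2)[OF c i])
  have "H 1 (real i, 1) = H 0 (real i, 1)"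
  proof (rule finite_path_constant[where F = "real ` {1..n} \<times> {0, 1}"])
   have "continuous_on {0..1} (%s. (%q. H (fst q) (snd q)) (s, (real i, 1)))"
    by (rule continuous_on_compose2[OF H(1)]) (use iE in \<open>auto intro!: continuous_intros\<close>)
   thus "continuous_on {0..1} (%s. H s (real i, 1))" by simp
   fix s :: real assume s: "s \<in> {0..1}"
   obtain g where g: "dg n (map_diagram (H s) b) g" using is_diagram_dg[OF H(6)[OF s]] by blast
   have cg: "config n g" using g by (simp add: dg_def)
   obtain j where j: "j \<in> {1..n}" "H s (f i 1, 1) = (g j 1, 1) \<or> H s (f i 1, 1) = (g j 0, 0)"
    using strand_image[OF b g cs[OF s] H(5)[OF s] i] by blast
   thus "H s (real i, 1) \<in> real ` {1..n} \<times> {0, 1}"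
    using configD(2,3)[OF cg j(1)] unfolding fi by auto
  qed simp
  thus ?thesis unfolding fi using H(2) by simp
 qed
 have one: "(1::real) \<in> {0..1}" by simp
 have "H 1 ` curve (f i) = curve (f' i) &
   (\<forall>t u. 0 <= t & t < u & u <= 1 --> snd (H 1 (f i t, t)) < snd (H 1 (f i u, u)))" if i: "i \<in> {1..n}" for i
 proof -
  have g: "dg n (map_diagram (H 1) b) f'" using b' H(3) by simp
  obtain j where j: "j \<in> {1..n}" "H 1 ` curve (f i) = curve (f' j)"
   "(H 1 (f i 1, 1) = (f' j 1, 1) & (\<forall>t u. 0 <= t & t < u & u <= 1 --> snd (H 1 (f i t, t)) < snd (H 1 (f i u, u)))) \<or>
   H 1 (f i 1, 1) = (f' j 0, 0)"
   using strand_image[OF b g cs[OF one] H(5)[OF one] i] by blast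
  have m: "f' j 1 = real i" "\<forall>t u. 0 <= t & t < u & u <= 1 --> snd (H 1 (f i t, t)) < snd (H 1 (f i u, u))"
   using j(3) unfolding top[OF i] by auto
  have "j = i" using m(1) configD(2)[OF c' j(1)] by simp
  thus ?thesis using j(2) m(2) by blast
 qed
 thus ?thesis using H(3) H(5)[OF one] by blast
qed

section \<open>Isotopic word diagrams have congruent words\<close>

fun pts :: "nat => letter list => ((nat => letter) \<times> point) list" where
 "pts n [] = []"
| "pts n (l # w) = (head l, upper (center l)) # map (apsnd lower) (pts n w)"

definition lab :: "nat => (nat => real => real) => point => nat set" where
 "lab n f p = {i \<in> {1..n}. f i (snd p) = fst p}"

lemma marks_word: "marks (word_diagram n w) = set (pts n w)"
proof (induction w)
 case Nil
 thus ?case by (auto simp: marks_def id_diagram_def)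
next
 case (Cons l w)
 thus ?case by (simp add: marks_stack marks_letter)
qed

lemma pts_heights: "map (%m. snd (snd m)) (pts n w) = std_heights (length w)"
proof (induction w)
 case Nil
 thus ?case by (simp add: std_heights_def)
next
 case (Cons l w)
 have "snd (upper (center l)) = 3/4" by (cases l) (simp_all add: upper_def)
 moreover have "map (%m. snd (snd m)) (map (apsnd lower) (pts n w)) = map (%t. t / 2) (map (%m. snd (snd m)) (pts n w))"
  by (simp add: lower_def)
 ultimately show ?case unfolding pts.simps list.map(2) Cons.IH by (simp add: std_heights_Suc)
qed

lemma lact_range: "valid n l ==> i \<in> {1..n} ==> lact l i \<in> {1..n}"
 by (cases l) auto

lemma endp_letter: "endp (letterf l) i = lact l i"
proof (cases l)
 case (Cr k j)
 have "letterf l i 0 = real (lact l i)" using Cr by simp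
 thus ?thesis unfolding endp_def by simp
next
 case (Bar j)
 thus ?thesis by (simp add: endp_def)
qed

lemma lab_letter: "valid n l ==> lab n (letterf l) (center l) = supp l"
proof (cases l)
 case (Cr k i)
 assume v: "valid n l"
 have "j \<in> {i, i + 1}" if "letterf (Cr k i) j (1/2) = real i + 1/2" for j
 proof (rule ccontr)
  assume "j \<notin> {i, i + 1}"
  hence "real j = real i + 1/2" "j < i \<or> i + 1 < j" using that by auto
  thus False by auto
 qed
 thus ?thesis using v Cr by (auto simp: lab_def)
next
 case (Bar i)
 thus "valid n l ==> ?thesis" by (auto simp: lab_def)
qed

lemma lab_upper:
 assumes "snd p \<in> {0..1}" shows "lab n (stackf f g) (upper p) = lab n f p"
 by (simp only: lab_def upper_def fst_conv snd_conv stackf_upper[OF assms])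

lemma lab_lower:
 assumes v: "valid n l" and t: "snd p \<in> {0..<1}"
 shows "lab n (stackf (letterf l) g) (lower p) = lact l ` lab n g p"
proof -
 have e: "stackf (letterf l) g i (snd p / 2) = g (lact l i) (snd p)" for i
  unfolding stackf_lower[OF t] endp_letter ..
 show ?thesis
 proof (intro equalityI subsetI)
  fix i assume "i \<in> lab n (stackf (letterf l) g) (lower p)"
  hence "lact l i \<in> lab n g p" using lact_range[OF v] by (simp add: lab_def lower_def e)
  thus "i \<in> lact l ` lab n g p" by (simp add: lact_mem)
 next
  fix i assume "i \<in> lact l ` lab n g p"
  hence "lact l i \<in> lab n g p" by (simp add: lact_mem)
  hence "lact l i \<in> {1..n}" "g (lact l i) (snd p) = fst p" by (auto simp: lab_def)
  thus "i \<in> lab n (stackf (letterf l) g) (lower p)"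
   using lact_range[OF v, of "lact l i"] by (simp add: lab_def lower_def e)
 qed
qed

text \<open>The combinatorial trace of a word lists what happens in its diagram: the kinds of the events and the labels of the strands through them.\<close>

lemma trace_word:
 assumes "w \<in> vwords n"
 shows "map (%m. (tag (fst m 0), lab n (wordf w) (snd m))) (pts n w) = trace w"
 using assms
proof (induction w)
 case Nil
 thus ?case by simp
next
 case (Cons l w)
 have v: "valid n l" "w \<in> vwords n" using Cons.prems by auto
 have c: "snd (center l) \<in> {0..1}" by (cases l) auto
 have h: "tag (head l 0) = tag l" by (cases l) auto
 have r: "snd (snd m) \<in> {0..<1}" if "m \<in> set (pts n w)" for m
 proof -
  have "snd (snd m) \<in> set (map (%m. snd (snd m)) (pts n w))" using that by simp
  hence "snd (snd m) \<in> {0<..<1}" unfolding pts_heights by (rule std_heights_range)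
  thus ?thesis by simp
 qed
 have "map (%m. (tag (fst m 0), lab n (wordf (l # w)) (snd m))) (map (apsnd lower) (pts n w))
   = map (%m. relabel l (tag (fst m 0), lab n (wordf w) (snd m))) (pts n w)"
  unfolding list.map_comp by (rule map_cong[OF HOL.refl]) (use lab_lower[OF v(1) r] in simp)
 also have "... = map (relabel l) (trace w)" unfolding Cons.IH[OF v(2), symmetric] by simp
 finally have "map (%m. (tag (fst m 0), lab n (wordf (l # w)) (snd m))) (map (apsnd lower) (pts n w)) = map (relabel l) (trace w)" .
 moreover have "lab n (wordf (l # w)) (upper (center l)) = supp l"
  unfolding wordf.simps lab_upper[OF c] by (rule lab_letter[OF v(1)])
 ultimately show ?case unfolding pts.simps list.map(2) trace.simps by (simp add: h del: wordf.simps)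
qed

text \<open>The isotopy maps the events on the strand \<open>i\<close> of the first diagram bijectively, and in the same order, to those on the strand \<open>i\<close> of the second
one, preserving kinds and labels.\<close>

theorem lcong_if_isotopic:
 assumes w: "w \<in> vwords n" and w': "w' \<in> vwords n" and iso: "isotopic n (word_diagram n w) (word_diagram n w')"
 shows "(w, w') \<in> lcong n"
proof (rule lcong_if_same_strands[OF w w'])
 fix i
 let ?b = "word_diagram n w" and ?b' = "word_diagram n w'"
 have b: "dg n ?b (wordf w)" and b': "dg n ?b' (wordf w')" using dg_word w w' by (auto simp: vwords_def)
 have c: "config n (wordf w)" and c': "config n (wordf w')" using b b' by (simp_all add: dg_def)
 obtain \<phi> where \<phi>1: "?b' = map_diagram \<phi> ?b & inj_on \<phi> (E n) & (\<forall>i\<in>{1..n}. \<phi> ` curve (wordf w i) = curve (wordf w' i) &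
   (\<forall>t u. 0 <= t & t < u & u <= 1 --> snd (\<phi> (wordf w i t, t)) < snd (\<phi> (wordf w i u, u))))"
  using isotopy_strands[OF iso b b'] by (rule exE)
 have \<phi>: "?b' = map_diagram \<phi> ?b" "inj_on \<phi> (E n)"
  "\<And>i. i \<in> {1..n} ==> \<phi> ` curve (wordf w i) = curve (wordf w' i)"
  "\<And>i t u. i \<in> {1..n} ==> 0 <= t ==> t < u ==> u <= 1 ==> snd (\<phi> (wordf w i t, t)) < snd (\<phi> (wordf w i u, u))"
  using \<phi>1 by simp_all
 have on: "j \<in> lab n f p \<longleftrightarrow> p \<in> curve (f j)" if "j \<in> {1..n}" "snd p \<in> {0..1}" for j f p
  using that by (cases p) (auto simp: lab_def mem_curve)
 have mE: "snd m \<in> E n & snd (snd m) \<in> {0..1}" if d: "dg n d f" and m: "m \<in> marks d" for d f m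
 proof -
  obtain j t where j: "j \<in> {1..n}" "t \<in> {0<..<1}" "snd m = (f j t, t)" using mark_point[OF d, of "fst m" "snd m"] m by auto
  have cf: "config n f" using d by (simp add: dg_def)
  have "(f j t, t) \<in> curve (f j)" using j(2) by (simp add: mem_curve)
  hence "snd m \<in> E n" using curve_sub_E[OF cf j(1)] j(3) by auto
  thus ?thesis using j by simp
 qed
 have mm: "marks ?b' = apsnd \<phi> ` marks ?b" unfolding \<phi>(1) marks_map by (rule image_cong) auto
 have lab: "lab n (wordf w') (\<phi> p) = lab n (wordf w) p" if m: "(k, p) \<in> marks ?b" for k p
 proof -
  have pE: "p \<in> E n" "snd p \<in> {0..1}" using mE[OF b m] by simp_all
  have "(k, \<phi> p) \<in> marks ?b'" unfolding mm using m by force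
  hence p': "snd (\<phi> p) \<in> {0..1}" using mE[OF b'] by fastforce
  have "\<phi> p \<in> curve (wordf w' j) \<longleftrightarrow> p \<in> curve (wordf w j)" if j: "j \<in> {1..n}" for j
   unfolding \<phi>(3)[OF j, symmetric] using inj_on_image_mem_iff[OF \<phi>(2) pE(1) curve_sub_E[OF c j]] .
  hence "j \<in> lab n (wordf w') (\<phi> p) \<longleftrightarrow> j \<in> lab n (wordf w) p" if j: "j \<in> {1..n}" for j
   using on[OF j p', of "wordf w'"] on[OF j pE(2), of "wordf w"] j by blast
  thus ?thesis unfolding lab_def by blast
 qed
 let ?P = "%m. i \<in> lab n (wordf w) (snd m)" and ?P' = "%m. i \<in> lab n (wordf w') (snd m)"
 let ?L = "map (apsnd \<phi>) (filter ?P (pts n w))" and ?L' = "filter ?P' (pts n w')"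
 have dec: "sorted_wrt (%x y. snd (snd x) > snd (snd y)) (pts n w)" for w
 proof -
  have "sorted_wrt (>) (map (%m. snd (snd m)) (pts n w))" unfolding pts_heights by (rule std_heights_sorted)
  thus ?thesis by (simp add: sorted_wrt_map)
 qed
 have "?L = ?L'"
 proof (rule map_sorted_distinct_set_unique[where f = "%m. - snd (snd m)"])
  \<comment> \<open>Both lists are sorted by height, so it suffices to compare their sets.\<close>
  show seq: "set ?L = set ?L'"
  proof -
   have "set ?L' = {m \<in> apsnd \<phi> ` marks ?b. ?P' m}" by (simp add: marks_word[symmetric] mm[symmetric] del: set_filter)
    (auto simp: marks_word)
   also have "... = apsnd \<phi> ` {m \<in> marks ?b. ?P m}" using lab by auto
   finally show ?thesis by (simp add: marks_word)
  qed
  have inj: "inj_on (%m. - snd (snd m)) (set ?L')"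
  proof (rule inj_onI)
   fix x y assume x: "x \<in> set ?L'" and y: "y \<in> set ?L'" and e: "- snd (snd x) = - snd (snd y)"
   have "snd x = snd y" using x y e by (auto simp: lab_def prod_eq_iff)
   moreover have "x \<in> marks ?b'" "y \<in> marks ?b'" using x y by (auto simp: marks_word)
   ultimately show "x = y" using mark_unique[OF b', of "fst x" "snd x" "fst y"] by (metis prod.collapse)
  qed
  thus "inj_on (%m. - snd (snd m)) (set ?L \<union> set ?L')" unfolding seq by simp
  have s': "sorted_wrt (%x y. snd (snd x) > snd (snd y)) ?L'" by (rule sorted_wrt_filter[OF dec])
  have s: "sorted_wrt (%x y. snd (snd x) > snd (snd y)) ?L"
  proof -
   have "sorted_wrt (%x y. snd (snd x) > snd (snd y)) (filter ?P (pts n w))" by (rule sorted_wrt_filter[OF dec])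
   hence "sorted_wrt (%x y. snd (snd (apsnd \<phi> x)) > snd (snd (apsnd \<phi> y))) (filter ?P (pts n w))"
   proof (rule sorted_wrt_mono_rel[rotated])
    fix x y assume x: "x \<in> set (filter ?P (pts n w))" and y: "y \<in> set (filter ?P (pts n w))" and lt: "snd (snd x) > snd (snd y)"
    have xm: "snd (snd x) \<in> {0..1}" "snd (snd y) \<in> {0..1}" using mE[OF b] x y by (auto simp: marks_word)
    have i: "i \<in> {1..n}" using x by (auto simp: lab_def)
    have "snd x = (wordf w i (snd (snd x)), snd (snd x))" "snd y = (wordf w i (snd (snd y)), snd (snd y))"
     using x y by (auto simp: lab_def prod_eq_iff)
    hence "snd (\<phi> (snd y)) < snd (\<phi> (snd x))" using \<phi>(4)[OF i _ lt] xm by (metis atLeastAtMost_iff)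
    thus "snd (snd (apsnd \<phi> x)) > snd (snd (apsnd \<phi> y))" by simp
   qed
   thus ?thesis by (simp add: sorted_wrt_map)
  qed
  have gen: "sorted (map (%m. - snd (snd m)) L) & distinct (map (%m. - snd (snd m)) L)"
   if "sorted_wrt (%x y. snd (snd x) > snd (snd y)) L" for L :: "((nat => letter) \<times> point) list"
  proof -
   have "sorted_wrt (<) (map (%m. - snd (snd m)) L)" using that by (simp add: sorted_wrt_map)
   thus ?thesis by (simp only: strict_sorted_iff)
  qed
  show "sorted (map (%m. - snd (snd m)) ?L)" "distinct (map (%m. - snd (snd m)) ?L)"
   "sorted (map (%m. - snd (snd m)) ?L')" "distinct (map (%m. - snd (snd m)) ?L')"
   using gen[OF s] gen[OF s'] by blast+
 qed
 have "filter (%e. i \<in> snd e) (trace w') = map (%m. (tag (fst m 0), lab n (wordf w') (snd m))) ?L'"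
  unfolding trace_word[OF w', symmetric] by (simp add: filter_map comp_def)
 also have "... = map (%m. (tag (fst m 0), lab n (wordf w') (snd m))) ?L" unfolding \<open>?L = ?L'\<close> ..
 also have "... = map (%m. (tag (fst m 0), lab n (wordf w) (snd m))) (filter ?P (pts n w))"
  unfolding list.map_comp by (rule map_cong[OF HOL.refl]) (use lab in \<open>auto simp: marks_word\<close>)
 also have "... = filter (%e. i \<in> snd e) (trace w)"
  unfolding trace_word[OF w, symmetric] by (simp add: filter_map comp_def)
 finally show "filter (%e. i \<in> snd e) (trace w) = filter (%e. i \<in> snd e) (trace w')" by simp
qed

section \<open>Reading a diagram\<close>

text \<open>\<open>w\<close> lists the letters of the events of \<open>b\<close> by descending height, simultaneous events in any order.\<close>

definition reads :: "diagram => letter list => bool" where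
 "reads b w \<longleftrightarrow> (\<exists>ts. length ts = length w & sorted_wrt (>=) ts & distinct (zip w ts) & data b = set (zip w ts))"

definition ties :: "real list => nat set" where
 "ties ts = {j. Suc j < length ts & ts ! j = ts ! Suc j}"

lemma finite_ties: "finite (ties ts)"
 by (rule finite_subset[of _ "{..<length ts}"]) (auto simp: ties_def)

text \<open>Simultaneous events can be separated in the order in which \<open>w\<close> lists them: raise the first event of the topmost tie
by less than the distance to the next higher event.\<close>

lemma untie:
 assumes "is_diagram n b" "length ts = length w" "sorted_wrt (>=) ts" "distinct (zip w ts)" "data b = set (zip w ts)"
 shows "\<exists>b' ts'. isotopic n b b' & length ts' = length w & sorted_wrt (>) ts' & data b' = set (zip w ts')"
 using assms
proof (induction "card (ties ts)" arbitrary: b ts rule: less_induct)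
 case less
 show ?case
 proof (cases "ties ts = {}")
  case True
  have "ts ! i > ts ! Suc i" if "Suc i < length ts" for i
  proof -
   have "ts ! i ~= ts ! Suc i" using True that by (auto simp: ties_def)
   moreover have "ts ! i >= ts ! Suc i" by (rule sorted_wrt_nth_less[OF less.prems(3)]) (use that in auto)
   ultimately show ?thesis by simp
  qed
  hence "sorted_wrt (>) ts" by (subst sorted_wrt_iff_nth_Suc_transp) (auto simp: transp_def)
  thus ?thesis using isotopic_refl[OF less.prems(1)] less.prems by blast
 next
  case False
  define j where "j = Min (ties ts)"
  have j: "j \<in> ties ts" unfolding j_def by (rule Min_in[OF finite_ties False])
  have jmin: "j <= i" if "i \<in> ties ts" for i unfolding j_def by (rule Min_le[OF finite_ties that])
  have jl: "Suc j < length ts" "ts ! j = ts ! Suc j" "j < length ts" using j by (auto simp: ties_def)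
  define t where "t = ts ! j"
  define l where "l = w ! j"
  have zj: "zip w ts ! j = (l, t)" "j < length (zip w ts)" using jl less.prems(2) by (auto simp: l_def t_def)
  hence "(l, t) \<in> set (zip w ts)" by (metis nth_mem)
  hence "(l, t) \<in> data b" using less.prems(5) by simp
  then obtain c0 p0 where m: "(c0, p0) \<in> marks b" "l = c0 (Suc (rank b p0))" "t = snd p0"
   unfolding data_marks by auto
  obtain x0 where p0: "p0 = (x0, t)" using m(3) by (cases p0) auto
  obtain f where f: "dg n b f" using is_diagram_dg[OF less.prems(1)] by blast
  obtain \<delta> where \<delta>: "\<delta> > 0" "\<And>t'. \<bar>t' - t\<bar> < \<delta> ==> \<exists>b'. isotopic n b b' & data b' = insert (l, t') (data b - {(l, t)})"
   using shift_event[OF f m(1) p0] unfolding m(2)[symmetric] by blast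
  \<comment> \<open>Less than the gap above the tie, if there is one, and within the range of \<open>shift_event\<close>.\<close>
  define e where "e = (if j = 0 then \<delta> / 2 else min (\<delta> / 2) ((ts ! (j - 1) - t) / 2))"
  \<comment> \<open>As \<open>j\<close> is the topmost tie.\<close>
  have gap: "ts ! (j - 1) > t" if "j ~= 0"
  proof -
   have "j - 1 \<notin> ties ts" using jmin[of "j - 1"] that by auto
   hence "ts ! (j - 1) ~= ts ! j" using jl that by (auto simp: ties_def)
   moreover have "ts ! (j - 1) >= ts ! j" by (rule sorted_wrt_nth_less[OF less.prems(3)]) (use that jl in auto)
   ultimately show ?thesis unfolding t_def by simp
  qed
  have e: "0 < e" "e < \<delta>" "j ~= 0 ==> t + e < ts ! (j - 1)"
  proof -
   show "0 < e" "e < \<delta>" using \<delta>(1) gap by (auto simp: e_def min_def)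
   assume "j ~= 0"
   hence "e = min (\<delta> / 2) ((ts ! (j - 1) - t) / 2)" by (simp add: e_def)
   hence "e <= (ts ! (j - 1) - t) / 2" by linarith
   moreover have "ts ! (j - 1) > t" by (rule gap[OF \<open>j ~= 0\<close>])
   ultimately show "t + e < ts ! (j - 1)" by (simp add: field_simps)
  qed
  define t' where "t' = t + e"
  obtain b1 where b1: "isotopic n b b1" "data b1 = insert (l, t') (data b - {(l, t)})"
   using \<delta>(2)[of t'] e by (auto simp: t'_def)
  define ts1 where "ts1 = ts[j := t']"
  have hi: "t' < ts ! i" if "i < j" for i
  proof -
   have "ts ! (j - 1) <= ts ! i"
   proof (cases "i = j - 1")
    case False
    thus ?thesis using sorted_wrt_nth_less[OF less.prems(3), of i "j - 1"] that jl by simp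
   qed simp
   thus ?thesis using e(3) that by (auto simp: t'_def)
  qed
  have lo: "ts ! i <= t" if "j <= i" "i < length ts" for i
   using sorted_wrt_nth_less[OF less.prems(3), of j i] that by (cases "i = j") (auto simp: t_def)
  have new: "t' \<notin> set ts"
  proof
   assume "t' \<in> set ts"
   then obtain i where i: "i < length ts" "ts ! i = t'" by (auto simp: in_set_conv_nth)
   thus False using hi[of i] lo[of i] e(1) by (cases "i < j") (auto simp: t'_def)
  qed
  have z1: "zip w ts1 = (zip w ts)[j := (l, t')]"
   using zip_update[of w j l ts t'] unfolding ts1_def l_def by simp
  have d1: "data b1 = set (zip w ts1)"
   unfolding b1(2) z1 set_update_distinct[OF less.prems(4) zj(2)] zj(1) less.prems(5) ..
  have dist: "distinct (zip w ts1)" unfolding z1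
   by (rule distinct_list_update[OF less.prems(4)]) (use new in \<open>auto dest: set_zip_rightD\<close>)
  have nth1: "ts1 ! i = (if i = j then t' else ts ! i)" if "i < length ts" for i
   using that by (simp add: ts1_def nth_list_update)
  have srt: "sorted_wrt (>=) ts1"
   unfolding sorted_wrt_iff_nth_less
  proof (intro allI impI)
   fix a c assume ac: "a < c" "c < length ts1"
   have ac': "c < length ts" using ac by (simp add: ts1_def)
   have o: "ts ! c <= ts ! a" by (rule sorted_wrt_nth_less[OF less.prems(3) ac(1) ac'])
   consider "a = j" | "c = j" | "a ~= j" "c ~= j" by blast
   thus "ts1 ! a >= ts1 ! c"
   proof cases
    case 1
    thus ?thesis using nth1[of a] nth1[of c] ac ac' lo[of c] e(1) by (simp add: t'_def)
   next
    case 2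
    thus ?thesis using nth1[of a] nth1[of c] ac ac' hi[of a] by simp
   next
    case 3
    thus ?thesis using nth1[of a] nth1[of c] ac ac' o by simp
   qed
  qed
  have "ties ts1 \<subseteq> ties ts - {j}"
  proof
   fix i assume i: "i \<in> ties ts1"
   hence il: "Suc i < length ts" "ts1 ! i = ts1 ! Suc i" by (auto simp: ties_def ts1_def)
   have "i ~= j" using il jl e(1) nth1[of j] nth1[of "Suc j"] by (auto simp: t'_def t_def)
   moreover have "Suc i ~= j" using il hi[of i] nth1[of i] nth1[of "Suc i"] by auto
   ultimately show "i \<in> ties ts - {j}" using il nth1[of i] nth1[of "Suc i"] by (auto simp: ties_def)
  qed
  hence "ties ts1 \<subset> ties ts" using j by blast
  hence card: "card (ties ts1) < card (ties ts)" by (rule psubset_card_mono[OF finite_ties])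
  have len: "length ts1 = length w" using less.prems(2) by (simp add: ts1_def)
  obtain b' ts' where "isotopic n b1 b'" "length ts' = length w" "sorted_wrt (>) ts'" "data b' = set (zip w ts')"
   using less.hyps[OF card isotopic_diagrams(2)[OF b1(1)] len srt dist d1] by blast
  thus ?thesis using isotopic_trans[OF b1(1)] by blast
 qed
qed

lemma data_valid:
 assumes d: "dg n b f" and m: "(l, t) \<in> data b" shows "valid n l"
proof -
 obtain c p where cp: "(c, p) \<in> marks b" "l = c (Suc (rank b p))" "t = snd p" using m unfolding data_marks by auto
 consider k where "c = Cr k" "p \<in> crossings b k" | "c = Bar" "p \<in> bars b" using cp(1) unfolding marks_def by blast
 thus ?thesis
 proof cases
  case (1 k)
  obtain i j u where ij: "i \<in> {1..n}" "j \<in> {1..n}" "u \<in> {0<..<1}" "i ~= j" "p = (f i u, u)" "f i u = f j u"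
   using dg_events(4)[OF d dg_events(1)[OF d 1(2)]] by blast
  have "rank b p = lt_count n f (f i u) u" unfolding ij(5) by (rule rank_dg[OF d]) (use ij(3) in simp)
  also have "... <= card ({1..n} - {i, j})"
   unfolding lt_count_def by (rule card_mono) (use ij in auto)
  also have "... = n - 2" using ij by (simp add: card_Diff_subset)
  finally have "rank b p <= n - 2" .
  moreover have "2 <= n" using ij(1,2,4) by auto
  ultimately show ?thesis using 1 cp(2) by simp
 next
  case 2
  obtain i u where i: "i \<in> {1..n}" "u \<in> {0<..<1}" "p = (f i u, u)" using dg_events(3)[OF d 2(2)] by blast
  have "rank b p = lt_count n f (f i u) u" unfolding i(3) by (rule rank_dg[OF d]) (use i(2) in simp)
  also have "... <= card ({1..n} - {i})"
   unfolding lt_count_def by (rule card_mono) auto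
  also have "... = n - 1" using i by simp
  finally have "rank b p <= n - 1" .
  moreover have "1 <= n" using i(1) by simp
  ultimately show ?thesis using 2 cp(2) by simp
 qed
qed

lemma reads_valid:
 assumes "is_diagram n b" "reads b w" shows "w \<in> vwords n"
proof -
 obtain ts where ts: "length ts = length w" "data b = set (zip w ts)" using assms(2) by (auto simp: reads_def)
 obtain f where f: "dg n b f" using is_diagram_dg[OF assms(1)] by blast
 have "valid n l" if lw: "l \<in> set w" for l
 proof -
  obtain i where i: "i < length w" "w ! i = l" using lw by (auto simp: in_set_conv_nth)
  hence "(l, ts ! i) \<in> set (zip w ts)" using ts(1) by (auto simp: set_zip)
  thus ?thesis using data_valid[OF f] ts(2) by blast
 qed
 thus ?thesis by (simp add: vwords_def)
qed

text \<open>After separating simultaneous events and moving all heights to the standard ones, the data are those of the word diagram.\<close>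

theorem isotopic_word_diagram:
 assumes "is_diagram n b" "reads b w" shows "isotopic n b (word_diagram n w)"
proof -
 have v: "\<forall>l\<in>set w. valid n l" using reads_valid[OF assms] by (simp add: vwords_def)
 obtain ts where ts: "length ts = length w" "sorted_wrt (>=) ts" "distinct (zip w ts)" "data b = set (zip w ts)"
  using assms(2) unfolding reads_def by blast
 obtain b' us where b': "isotopic n b b'" "length us = length w" "sorted_wrt (>) us" "data b' = set (zip w us)"
  using untie[OF assms(1) ts] by blast
 obtain f where f: "dg n b' f" using is_diagram_dg[OF isotopic_diagrams(2)[OF b'(1)]] by blast
 have range: "t \<in> {0<..<1}" if t: "t \<in> set us" for t
 proof -
  obtain i where i: "i < length us" "us ! i = t" using t by (auto simp: in_set_conv_nth)
  hence "(w ! i, t) \<in> set (zip w us)" using b'(2) by (auto simp: set_zip)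
  thus ?thesis using data_height[OF f] b'(4) by blast
 qed
 have "\<exists>h. height_map h & (\<forall>j < length us. h (us ! j) = std_heights (length w) ! j)"
  by (rule interpolating_height_map[OF b'(3) range std_heights_sorted[of "length w"] std_heights_range]) (simp_all add: b'(2))
 then obtain h where h: "height_map h" "\<And>j. j < length us ==> h (us ! j) = std_heights (length w) ! j"
  by blast
 obtain b'' where b'': "isotopic n b' b''" "data b'' = (%(l, t). (l, h t)) ` data b'"
  using reparametrize_heights[OF f h(1)] by blast
 have "map h us = std_heights (length w)" by (rule nth_equalityI) (use h(2) b'(2) in auto)
 hence "data b'' = set (zip w (std_heights (length w)))"
  unfolding b''(2) b'(4) by (metis (no_types) image_set zip_map2)
 hence "data b'' = data (word_diagram n w)" using data_word[OF v] by simp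
 hence "isotopic n b'' (word_diagram n w)"
  by (rule isotopic_if_same_data[OF isotopic_diagrams(2)[OF b''(1)] dg_is_diagram[OF dg_word[OF v]]])
 thus ?thesis using isotopic_trans b'(1) b''(1) by blast
qed

definition enumerates :: "(letter \<times> real) list => (letter \<times> real) set => bool" where
 "enumerates xs S \<longleftrightarrow> set xs = S & distinct xs & sorted_wrt (%x y. snd x >= snd y) xs"

lemma enumerates_sort:
 assumes "distinct xs" shows "enumerates (sort_key (%x. - snd x) xs) (set xs)"
proof -
 have "sorted (map (%x. - snd x) (sort_key (%x. - snd x) xs))" by (rule sorted_sort_key)
 thus ?thesis using assms unfolding enumerates_def by (simp add: sorted_wrt_map)
qed

lemma ex_enumerates:
 assumes "finite S" shows "\<exists>xs. enumerates xs S"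
 using finite_distinct_list[OF assms] enumerates_sort by blast

lemma reads_enumeration: "enumerates xs (data b) ==> reads b (map fst xs)"
 unfolding reads_def enumerates_def
 by (intro exI[of _ "map snd xs"]) (simp add: zip_map_fst_snd sorted_wrt_map)

lemma reads_enumerates:
 assumes "reads b w" shows "\<exists>xs. enumerates xs (data b) & map fst xs = w"
proof -
 obtain ts where ts: "length ts = length w" "sorted_wrt (>=) ts" "distinct (zip w ts)" "data b = set (zip w ts)"
  using assms unfolding reads_def by blast
 have "sorted_wrt (%x y. x >= y) (map snd (zip w ts))" using ts by simp
 hence "sorted_wrt (%x y. snd x >= snd y) (zip w ts)" unfolding sorted_wrt_map .
 thus ?thesis using ts by (intro exI[of _ "zip w ts"]) (simp add: enumerates_def)
qed

lemma ex_reads: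
 assumes "is_diagram n b" shows "\<exists>w. reads b w"
proof -
 obtain f where "dg n b f" using is_diagram_dg[OF assms] by blast
 thus ?thesis using ex_enumerates[OF finite_data] reads_enumeration by blast
qed

lemma enumerates_append:
 assumes "enumerates xs S" "enumerates ys T" "\<And>x y. x \<in> S ==> y \<in> T ==> snd x > snd y"
 shows "enumerates (xs @ ys) (S \<union> T)"
 using assms unfolding enumerates_def by (auto simp: sorted_wrt_append less_imp_le)

lemma reads_stack:
 assumes b: "is_diagram n b" "reads b u" and c: "is_diagram n c" "reads c v"
 shows "reads (stack b c) (u @ v)"
proof -
 obtain f g where f: "dg n b f" and g: "dg n c g" using is_diagram_dg b(1) c(1) by metis
 obtain xs ys where x: "enumerates xs (data b)" "map fst xs = u" and y: "enumerates ys (data c)" "map fst ys = v"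
  using reads_enumerates[OF b(2)] reads_enumerates[OF c(2)] by blast
 let ?U = "%(l, t). (l::letter, (1 + t) / 2 :: real)" and ?L = "%(l, t). (l::letter, t / 2 :: real)"
 have "inj ?U" "inj ?L" by (auto intro!: injI)
 hence 1: "enumerates (map ?U xs) (?U ` data b)" "enumerates (map ?L ys) (?L ` data c)"
  using x(1) y(1) unfolding enumerates_def
  by (auto simp: distinct_map sorted_wrt_map case_prod_beta intro: inj_on_subset)
 have "enumerates (map ?U xs @ map ?L ys) (?U ` data b \<union> ?L ` data c)"
 proof (rule enumerates_append[OF 1])
  fix p q assume "p \<in> ?U ` data b" "q \<in> ?L ` data c"
  thus "snd p > snd q" using data_height[OF f] data_height[OF g] by fastforce
 qed
 hence "reads (stack b c) (map fst (map ?U xs @ map ?L ys))"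
  unfolding data_stack[OF f g, symmetric] by (rule reads_enumeration)
 moreover have "map fst (map ?U xs @ map ?L ys) = u @ v"
  unfolding x(2)[symmetric] y(2)[symmetric] by (simp add: case_prod_beta comp_def)
 ultimately show ?thesis by simp
qed

lemma reads_word:
 assumes "w \<in> vwords n" shows "reads (word_diagram n w) w"
 unfolding reads_def
proof (intro exI[of _ "std_heights (length w)"] conjI)
 have s: "sorted_wrt (>) (std_heights (length w))" by (rule std_heights_sorted)
 show "sorted_wrt (>=) (std_heights (length w))" by (rule sorted_wrt_mono_rel[OF _ s]) simp
 have "sorted_wrt (%x y. x ~= y) (std_heights (length w))" by (rule sorted_wrt_mono_rel[OF _ s]) simp
 hence "distinct (std_heights (length w))" by (simp add: distinct_conv_nth sorted_wrt_iff_nth_less) (metis linorder_neqE_nat)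
 thus "distinct (zip w (std_heights (length w)))" by (rule distinct_zipI2)
 show "data (word_diagram n w) = set (zip w (std_heights (length w)))" by (rule data_word) (use assms in \<open>simp add: vwords_def\<close>)
qed simp

lemma word_is_diagram: "w \<in> vwords n ==> is_diagram n (word_diagram n w)"
 by (rule dg_is_diagram[OF dg_word]) (simp add: vwords_def)

lemma lcong_if_isotopic_words:
 assumes "isotopic n b b'" "isotopic n b (word_diagram n w)" "isotopic n b' (word_diagram n w')"
  "w \<in> vwords n" "w' \<in> vwords n"
 shows "(w, w') \<in> lcong n"
 by (rule lcong_if_isotopic[OF assms(4,5)])
  (rule isotopic_trans[OF isotopic_sym[OF assms(2)] isotopic_trans[OF assms(1,3)]])

section \<open>The data of a diagram with a box\<close>

definition ext_count :: "diagram => real => real => nat" where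
 "ext_count e x t = card {a \<in> strands e. \<exists>y<x. (y, t) \<in> a}"

text \<open>The position of a point outside the box, computed from the exterior \<open>e\<close> of the box alone. At the heights of the box, the \<open>m\<close> strands in the box are
invisible in the exterior; they count for a point to the right of the box.\<close>

definition ext_rank :: "diagram => real => real => real => nat => point => nat" where
 "ext_rank e c d \<beta> m p = ext_count e (fst p) (snd p) + (if d <= snd p & snd p <= d + \<beta> & c < fst p then m else 0)"

definition ext_data :: "diagram => real => real => real => nat => (letter \<times> real) set" where
 "ext_data e c d \<beta> m = {(Cr k (Suc (ext_rank e c d \<beta> m p)), snd p) | k p. p \<in> crossings e k} \<union>
   {(Bar (Suc (ext_rank e c d \<beta> m p)), snd p) | p. p \<in> bars e}"

lemma box_iff:
 fixes c d \<alpha> \<beta> :: real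
 assumes ab: "\<alpha> > 0" "\<beta> > 0"
 shows "(x, t) \<in> (%p. (c + \<alpha> * fst p, d + \<beta> * snd p)) ` E m \<longleftrightarrow>
  c <= x & x <= c + \<alpha> * (real m + 1) & d <= t & t <= d + \<beta>" (is "_ \<in> ?D \<longleftrightarrow> ?R")
proof
 assume "(x, t) \<in> ?D"
 then obtain y u where "0 <= y" "y <= real m + 1" "0 <= u" "u <= 1" "x = c + \<alpha> * y" "t = d + \<beta> * u"
  unfolding E_def by auto
 thus ?R using ab mult_left_mono[of y "real m + 1" \<alpha>] mult_left_mono[of u 1 \<beta>] by simp
next
 assume ?R
 hence "((x - c) / \<alpha>, (t - d) / \<beta>) \<in> E m" using ab by (simp add: E_def divide_le_eq mult.commute)
 thus "(x, t) \<in> ?D" using ab by (intro image_eqI) simp_all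
qed

text \<open>The data of a diagram split into those of the picture in the box, shifted by the number \<open>k\<close> of strands to the left of the box, and data that depend only
on the exterior. Each of the \<open>m\<close> strands of the picture belongs to one strand of \<open>b\<close>, which at these
heights stays in the box; every other strand avoids the box, hence stays on one side of it. So events beside the box act on other positions.\<close>

lemma box_data:
 fixes c d \<alpha> \<beta> :: real
 assumes b: "dg n b f" and L: "dg m L g" and ab: "\<alpha> > 0" "\<beta> > 0"
  and D: "D = (%p. (c + \<alpha> * fst p, d + \<beta> * snd p)) ` E m" "D \<subseteq> E n"
  and res: "restrict_diagram D b = map_diagram (%p. (c + \<alpha> * fst p, d + \<beta> * snd p)) L"
 defines "e \<equiv> restrict_diagram (- D) b"
 defines "k \<equiv> ext_count e c (d + \<beta> / 2)"
 shows "data b = (%(l, t). (shift k l, d + \<beta> * t)) ` data L \<union> ext_data e c d \<beta> m"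
  and "k + m <= n"
  and "(l, t) \<in> ext_data e c d \<beta> m ==> d <= t ==> t <= d + \<beta> ==> supp l \<inter> {k + 1..k + m} = {}"
proof -
 let ?phi = "%p. (c + \<alpha> * fst p, d + \<beta> * snd p) :: point"
 define c' where "c' = c + \<alpha> * (real m + 1)"
 have cf: "config n f" and cg: "config m g" using b L by (simp_all add: dg_def)
 have Dmem: "(x, t) \<in> D \<longleftrightarrow> c <= x & x <= c' & d <= t & t <= d + \<beta>" for x t
  unfolding D(1) c'_def by (rule box_iff[OF ab])
 have cc: "c < c'" using ab by (simp add: c'_def)
 have "(c, d) \<in> D" "(c, d + \<beta>) \<in> D" using Dmem cc ab by auto
 hence "(c, d) \<in> E n" "(c, d + \<beta>) \<in> E n" using D(2) by blast+
 hence band: "0 <= d" "d + \<beta> <= 1" by (auto simp: E_def)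
 have b01: "t \<in> {0..1}" if "d <= t" "t <= d + \<beta>" for t using that band by auto
 have sD: "(%a. a \<inter> D) ` strands b - {{}} = (%a. ?phi ` a) ` strands L"
  using arg_cong[OF res, of strands] by (simp add: restrict_diagram_def map_diagram_def)
 have sb: "strands b = (%i. curve (f i)) ` {1..n}" and sL: "strands L = (%j. curve (g j)) ` {1..m}"
  using b L by (simp_all add: dg_def)
 have ex: "\<exists>i\<in>{1..n}. curve (f i) \<inter> D = ?phi ` curve (g j)" if j: "j \<in> {1..m}" for j
 proof -
  have "?phi ` curve (g j) \<in> (%a. a \<inter> D) ` strands b - {{}}" unfolding sD sL using j by blast
  then obtain a where a: "a \<in> strands b" "?phi ` curve (g j) = a \<inter> D" by - (erule DiffE, erule imageE, rule that, assumption+)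
  from a(1) obtain i where "i \<in> {1..n}" "a = curve (f i)" unfolding sb by - (erule imageE, rule that, assumption+)
  thus ?thesis using a(2) by blast
 qed
 have "\<exists>\<iota>. \<forall>j. j \<in> {1..m} --> \<iota> j \<in> {1..n} & curve (f (\<iota> j)) \<inter> D = ?phi ` curve (g j)"
 proof (rule choice, rule allI)
  fix j
  show "\<exists>i. j \<in> {1..m} --> i \<in> {1..n} & curve (f i) \<inter> D = ?phi ` curve (g j)"
  proof (cases "j \<in> {1..m}")
   case True
   obtain i where "i \<in> {1..n}" "curve (f i) \<inter> D = ?phi ` curve (g j)"
    using ex[OF True] by (rule bexE)
   thus ?thesis by (intro exI[of _ i] impI conjI)
  next
   case False
   thus ?thesis by (intro exI[of _ 0] impI) (rule notE)
  qed
 qed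
 then obtain \<iota> where \<iota>0: "\<forall>j. j \<in> {1..m} --> \<iota> j \<in> {1..n} & curve (f (\<iota> j)) \<inter> D = ?phi ` curve (g j)"
  by (rule exE)
 note \<iota> = \<iota>0[rule_format]
 have box: "f (\<iota> j) (d + \<beta> * u) = c + \<alpha> * g j u" if j: "j \<in> {1..m}" and u: "u \<in> {0..1}" for j u
 proof -
  have "(g j u, u) \<in> curve (g j)" using u by (simp add: mem_curve)
  hence "?phi (g j u, u) \<in> curve (f (\<iota> j)) \<inter> D" using \<iota>[OF j] by blast
  thus ?thesis by (simp add: mem_curve)
 qed
 have scaled: "\<exists>u\<in>{0..1}. t = d + \<beta> * u" if "d <= t" "t <= d + \<beta>" for t
 proof (intro bexI)
  show "(t - d) / \<beta> \<in> {0..1}" using that ab by (simp add: divide_le_eq)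
  show "t = d + \<beta> * ((t - d) / \<beta>)" using ab by simp
 qed
 define J where "J = \<iota> ` {1..m}"
 have Jn: "J \<subseteq> {1..n}" using \<iota> by (auto simp: J_def)
 have inD: "(f i t, t) \<in> D" if iJ: "i \<in> J" and t: "d <= t" "t <= d + \<beta>" for i t
 proof -
  obtain j where j: "j \<in> {1..m}" "i = \<iota> j" using iJ by (auto simp: J_def)
  obtain u where u: "u \<in> {0..1}" "t = d + \<beta> * u" using scaled[OF t] by blast
  have "(f i t, t) = ?phi (g j u, u)" using box[OF j(1) u(1)] j(2) u(2) by simp
  moreover have "(g j u, u) \<in> curve (g j)" using u(1) by (simp add: mem_curve)
  ultimately show ?thesis using \<iota>[OF j(1)] by blast
 qed
 have inj\<iota>: "inj_on \<iota> {1..m}"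
 proof (rule inj_onI)
  fix i j assume ij: "i \<in> {1..m}" "j \<in> {1..m}" "\<iota> i = \<iota> j"
  have "c + \<alpha> * g i 1 = c + \<alpha> * g j 1" using box[OF ij(1), of 1] box[OF ij(2), of 1] ij(3) by simp
  thus "i = j" using ab configD(2)[OF cg ij(1)] configD(2)[OF cg ij(2)] by simp
 qed
 \<comment> \<open>A strand that entered the box without belonging to the picture would run along a strand of the picture at these heights, but strands that meet pass to the other side of each other.\<close>
 have notD: "(f i t, t) \<notin> D" if i: "i \<in> {1..n}" "i \<notin> J" and t: "t \<in> {0..1}" for i t
 proof
  assume a: "(f i t, t) \<in> D"
  have "(f i t, t) \<in> curve (f i) \<inter> D" using a t by (simp add: mem_curve)
  hence "curve (f i) \<inter> D \<in> (%a. a \<inter> D) ` strands b - {{}}" unfolding sb using i(1) by blast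
  then obtain j where j: "j \<in> {1..m}" "curve (f i) \<inter> D = ?phi ` curve (g j)" unfolding sD sL by blast
  have ne: "i ~= \<iota> j" using i(2) j(1) by (auto simp: J_def)
  have same: "f i u = f (\<iota> j) u" if u: "d <= u" "u <= d + \<beta>" for u
  proof -
   have "(f (\<iota> j) u, u) \<in> curve (f (\<iota> j)) \<inter> D"
    using inD[of "\<iota> j" u] u b01[OF u] j(1) by (simp add: J_def mem_curve)
   hence "(f (\<iota> j) u, u) \<in> curve (f i)" using \<iota>[OF j(1)] j(2) by blast
   thus ?thesis by (simp add: mem_curve)
  qed
  define s0 where "s0 = d + \<beta> / 2"
  have s0: "s0 \<in> {0<..<1}" using band ab by (auto simp: s0_def)
  have "f i s0 = f (\<iota> j) s0" by (rule same) (use ab in \<open>auto simp: s0_def\<close>)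
  hence "passes (f i) (f (\<iota> j)) s0" using config_passes[OF cf i(1) _ ne s0] \<iota>[OF j(1)] by blast
  then obtain e where e: "e > 0" "\<And>s. 0 < s ==> s < e ==> (f i (s0 - s) - f (\<iota> j) (s0 - s)) * (f i (s0 + s) - f (\<iota> j) (s0 + s)) < 0"
   unfolding passes_def by blast
  define s where "s = min (e / 2) (\<beta> / 2)"
  have s: "0 < s" "s < e" "s <= \<beta> / 2" using e(1) ab by (auto simp: s_def)
  have "f i (s0 - s) = f (\<iota> j) (s0 - s)" by (rule same) (use s in \<open>auto simp: s0_def\<close>)
  thus False using e(2)[OF s(1,2)] by simp
 qed
 define s0 where "s0 = d + \<beta> / 2"
 have s0: "d <= s0" "s0 <= d + \<beta>" using ab by (auto simp: s0_def)
 \<comment> \<open>By the intermediate value theorem a change of sides would lead through the box.\<close>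
 have side: "f i t < c \<longleftrightarrow> f i s0 < c" if i: "i \<in> {1..n}" "i \<notin> J" and t: "d <= t" "t <= d + \<beta>" for i t
 proof (rule ccontr)
  assume ne: "\<not> ?thesis"
  have out: "f i u < c \<or> c' < f i u" if "d <= u" "u <= d + \<beta>" for u
   using notD[OF i b01[OF that]] Dmem[of "f i u" u] that by auto
  have "is_interval (f i ` {d..d + \<beta>})"
   unfolding is_interval_connected_1
   by (rule connected_continuous_image[OF continuous_on_subset[OF configD(1)[OF cf i(1)]]]) (use band in auto)
  moreover have "f i t \<in> f i ` {d..d + \<beta>}" "f i s0 \<in> f i ` {d..d + \<beta>}" using t s0 by auto
  moreover have "(f i t <= c & c <= f i s0) \<or> (f i s0 <= c & c <= f i t)" using ne by linarith
  ultimately have "c \<in> f i ` {d..d + \<beta>}" unfolding is_interval_1 by blast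
  then obtain u where "d <= u" "u <= d + \<beta>" "f i u = c" by auto
  thus False using out[of u] cc by auto
 qed
 define \<Lambda> where "\<Lambda> = {i \<in> {1..n} - J. f i s0 < c}"
 have LJ: "\<Lambda> \<inter> J = {}" "finite \<Lambda>" "finite J" "card J = m"
  using card_image[OF inj\<iota>] by (auto simp: \<Lambda>_def J_def)
 have se: "strands e = (%i. curve (f i) - D) ` {1..n} - {{}}"
  unfolding e_def restrict_diagram_def sb by (auto simp: image_image Diff_eq)
 have count: "ext_count e x t = card {i \<in> {1..n}. f i t < x & (f i t, t) \<notin> D}" if t: "t \<in> {0..1}" for x t
 proof -
  let ?I = "{i \<in> {1..n}. f i t < x & (f i t, t) \<notin> D}"
  have "{a \<in> strands e. \<exists>y<x. (y, t) \<in> a} = (%i. curve (f i) - D) ` ?I"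
  proof (intro equalityI subsetI)
   fix a assume "a \<in> {a \<in> strands e. \<exists>y<x. (y, t) \<in> a}"
   then obtain i y where "i \<in> {1..n}" "a = curve (f i) - D" "y < x" "(y, t) \<in> a" unfolding se by blast
   thus "a \<in> (%i. curve (f i) - D) ` ?I" by (auto simp: mem_curve)
  next
   fix a assume "a \<in> (%i. curve (f i) - D) ` ?I"
   then obtain i where i: "i \<in> {1..n}" "f i t < x" "(f i t, t) \<notin> D" "a = curve (f i) - D" by blast
   hence "(f i t, t) \<in> a" using t by (simp add: mem_curve)
   thus "a \<in> {a \<in> strands e. \<exists>y<x. (y, t) \<in> a}" unfolding se using i by blast
  qed
  moreover have "inj_on (%i. curve (f i) - D) ?I"
  proof (rule inj_onI)
   fix i j assume i: "i \<in> ?I" and j: "j \<in> ?I" and eq: "curve (f i) - D = curve (f j) - D"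
   have "\<exists>u\<in>{0, 1}. (f i u, u) \<notin> D"
   proof (cases "i \<in> J")
    case True
    hence "\<not> (d <= t & t <= d + \<beta>)" using inD[of i t] i by blast
    hence "\<not> (d <= 0 & 0 <= d + \<beta>) \<or> \<not> (d <= 1 & 1 <= d + \<beta>)" using t by auto
    thus ?thesis unfolding Dmem by blast
   next
    case False
    thus ?thesis using notD[of i 0] i by auto
   qed
   then obtain u where u: "u \<in> {0, 1}" "(f i u, u) \<notin> D" by blast
   hence "(f i u, u) \<in> curve (f j) - D" unfolding eq[symmetric] by (auto simp: mem_curve)
   hence "f i u = f j u" by (simp add: mem_curve)
   thus "i = j" using u(1) config_bottom_inj[OF cf, of i j] configD(2)[OF cf, of i] configD(2)[OF cf, of j] i j by auto
  qed
  ultimately show ?thesis unfolding ext_count_def by (simp add: card_image)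
 qed
 have k: "k = card \<Lambda>"
 proof -
  have "{i \<in> {1..n}. f i s0 < c & (f i s0, s0) \<notin> D} = \<Lambda>"
   unfolding \<Lambda>_def using Dmem inD[OF _ s0] notD[OF _ _ b01[OF s0]] by auto
  thus ?thesis unfolding k_def using count[OF b01[OF s0], of c] by (simp add: s0_def)
 qed
 have "card (\<Lambda> \<union> J) = k + m" using LJ k by (simp add: card_Un_disjoint)
 moreover have "card (\<Lambda> \<union> J) <= card {1..n}" by (rule card_mono) (use Jn in \<open>auto simp: \<Lambda>_def\<close>)
 ultimately show kn: "k + m <= n" by simp
 have outrank: "rank b (x, t) = ext_rank e c d \<beta> m (x, t)" if t: "t \<in> {0..1}" and p: "(x, t) \<notin> D" for x t
 proof -
  let ?O = "{i \<in> {1..n}. f i t < x & (f i t, t) \<notin> D}" and ?I = "{i \<in> {1..n}. f i t < x & (f i t, t) \<in> D}"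
  have "{i \<in> {1..n}. f i t < x} = ?O \<union> ?I" by blast
  hence r: "rank b (x, t) = card ?O + card ?I"
   unfolding rank_dg[OF b t] lt_count_def by (simp add: card_Un_disjoint disjoint_iff)
  have "card ?I = (if d <= t & t <= d + \<beta> & c < x then m else 0)"
  proof (cases "d <= t & t <= d + \<beta> & c < x")
   case True
   hence "c' < x" using p Dmem by auto
   hence "?I = J" using True inD[of _ t] notD[OF _ _ t] Jn Dmem by fastforce
   thus ?thesis using True LJ(4) by simp
  next
   case False
   hence "?I = {}" using Dmem by auto
   hence "card ?I = 0" by (simp only: card.empty)
   thus ?thesis unfolding if_not_P[OF False] .
  qed
  thus ?thesis using r unfolding ext_rank_def count[OF t] fst_conv snd_conv by simp
 qed
 have inrank: "rank b (?phi q) = k + rank L q" if q: "snd q \<in> {0..1}" "fst q \<in> {0..real m + 1}" for q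
 proof -
  obtain y u where yu: "q = (y, u)" by force
  have u: "u \<in> {0..1}" and y: "0 <= y" "y <= real m + 1" using q yu by auto
  define x t where "x = c + \<alpha> * y" and "t = d + \<beta> * u"
  have t: "d <= t" "t <= d + \<beta>" using u ab mult_left_mono[of u 1 \<beta>] by (auto simp: t_def)
  have x: "c <= x" "x <= c'" using y ab mult_left_mono[of y "real m + 1" \<alpha>] by (auto simp: x_def c'_def)
  have "{i \<in> {1..n}. f i t < x} = \<Lambda> \<union> \<iota> ` {j \<in> {1..m}. g j u < y}"
  proof (intro equalityI subsetI)
   fix i assume i: "i \<in> {i \<in> {1..n}. f i t < x}"
   show "i \<in> \<Lambda> \<union> \<iota> ` {j \<in> {1..m}. g j u < y}"
   proof (cases "i \<in> J")
    case True
    then obtain j where j: "j \<in> {1..m}" "i = \<iota> j" by (auto simp: J_def)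
    have "c + \<alpha> * g j u < c + \<alpha> * y" using i box[OF j(1) u] j(2) by (simp add: x_def t_def)
    hence "g j u < y" using ab by simp
    thus ?thesis using j by blast
   next
    case False
    hence "f i t < c" using notD[OF _ False b01[OF t]] i Dmem[of "f i t" t] t x by auto
    hence "f i s0 < c" using side[OF _ False t] i by blast
    thus ?thesis using i False by (auto simp: \<Lambda>_def)
   qed
  next
   fix i assume "i \<in> \<Lambda> \<union> \<iota> ` {j \<in> {1..m}. g j u < y}"
   thus "i \<in> {i \<in> {1..n}. f i t < x}"
   proof
    assume "i \<in> \<Lambda>"
    hence i: "i \<in> {1..n}" "i \<notin> J" "f i s0 < c" by (auto simp: \<Lambda>_def)
    hence "f i t < c" using side[OF i(1,2) t] by blast
    thus ?thesis using i x by auto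
   next
    assume "i \<in> \<iota> ` {j \<in> {1..m}. g j u < y}"
    then obtain j where j: "j \<in> {1..m}" "g j u < y" "i = \<iota> j" by blast
    hence "f i t < x" using box[OF j(1) u] ab by (simp add: x_def t_def)
    thus ?thesis using \<iota>[OF j(1)] j(3) by blast
   qed
  qed
  moreover have "card (\<Lambda> \<union> \<iota> ` {j \<in> {1..m}. g j u < y}) = k + card {j \<in> {1..m}. g j u < y}"
  proof -
   have "card (\<iota> ` {j \<in> {1..m}. g j u < y}) = card {j \<in> {1..m}. g j u < y}"
    by (rule card_image[OF inj_on_subset[OF inj\<iota>]]) blast
   moreover have "\<Lambda> \<inter> \<iota> ` {j \<in> {1..m}. g j u < y} = {}" using LJ(1) by (auto simp: J_def)
   ultimately show ?thesis using LJ(2) k by (simp add: card_Un_disjoint)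
  qed
  ultimately have "rank b (x, t) = k + rank L (y, u)"
   unfolding rank_dg[OF b b01[OF t]] rank_dg[OF L u] lt_count_def by simp
  thus ?thesis by (simp add: yu x_def t_def)
 qed
 have crD: "crossings b \<kappa> \<inter> D = ?phi ` crossings L \<kappa>" for \<kappa>
  using arg_cong[OF res, of crossings] by (simp add: restrict_diagram_def map_diagram_def fun_eq_iff)
 have brD: "bars b \<inter> D = ?phi ` bars L"
  using arg_cong[OF res, of bars] by (simp add: restrict_diagram_def map_diagram_def)
 have cre: "crossings e \<kappa> = crossings b \<kappa> - D" and bre: "bars e = bars b - D" for \<kappa>
  unfolding e_def restrict_diagram_def by auto
 have Lpt: "snd q \<in> {0..1} & fst q \<in> {0..real m + 1}" if aq: "(a, q) \<in> marks L" for a and q :: point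
 proof -
  obtain j u where "j \<in> {1..m}" "u \<in> {0<..<1}" "q = (g j u, u)" using mark_point[OF L aq] by blast
  thus ?thesis using configD(4,5)[OF cg, of j u] by auto
 qed
 have bpt: "snd q \<in> {0..1}" if "(a, q) \<in> marks b" for a q
  using mark_point[OF b that] by auto
 have mb: "marks b = (%(a, q). (a, ?phi q)) ` marks L \<union> marks e"
 proof -
  have "marks b = {(Cr \<kappa>, p) | \<kappa> p. p \<in> crossings b \<kappa> \<inter> D} \<union> {(Bar, p) | p. p \<in> bars b \<inter> D} \<union> marks e"
   unfolding marks_def cre bre by blast
  also have "{(Cr \<kappa>, p) | \<kappa> p. p \<in> crossings b \<kappa> \<inter> D} \<union> {(Bar, p) | p. p \<in> bars b \<inter> D} = (%(a, q). (a, ?phi q)) ` marks L"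
   unfolding crD brD marks_def image_Un by (intro arg_cong2[where f = "(\<union>)"]) force+
  finally show ?thesis .
 qed
 have ed: "ext_data e c d \<beta> m = (%(a, p). (a (Suc (ext_rank e c d \<beta> m p)), snd p)) ` marks e"
  unfolding ext_data_def marks_def image_Un by (intro arg_cong2[where f = "(\<union>)"]) force+
 have eD: "snd p \<in> {0..1} & p \<notin> D" if "(a, p) \<in> marks e" for a p
 proof -
  have "(a, p) \<in> marks b" using that mb by blast
  moreover have "p \<notin> D" using that unfolding marks_def cre bre by blast
  ultimately show ?thesis using bpt by blast
 qed
 have er: "rank b p = ext_rank e c d \<beta> m p" if "(a, p) \<in> marks e" for a p
  using outrank[of "snd p" "fst p"] eD[OF that] by simp
 have shc: "shift k (a (Suc (rank L q))) = a (Suc (k + rank L q))" if "(a, q) \<in> marks L" for a q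
  using that unfolding marks_def by (auto simp: add.commute)
 show "data b = (%(l, t). (shift k l, d + \<beta> * t)) ` data L \<union> ext_data e c d \<beta> m"
 proof -
  have "data b = (%(a, q). (a (Suc (rank b (?phi q))), d + \<beta> * snd q)) ` marks L \<union> (%(a, p). (a (Suc (rank b p)), snd p)) ` marks e"
   unfolding data_marks mb image_Un image_image by (intro arg_cong2[where f = "(\<union>)"] image_cong) auto
  also have "(%(a, q). (a (Suc (rank b (?phi q))), d + \<beta> * snd q)) ` marks L = (%(l, t). (shift k l, d + \<beta> * t)) ` data L"
   unfolding data_marks image_image
  proof (rule image_cong, simp, clarify)
   fix a y u assume q: "(a, (y, u)) \<in> marks L"
   show "a (Suc (rank b (?phi (y, u)))) = shift k (a (Suc (rank L (y, u)))) & d + \<beta> * snd (y, u) = d + \<beta> * snd (y, u)"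
    using inrank[of "(y, u)"] Lpt[OF q] shc[OF q] by simp
  qed
  also have "(%(a, p). (a (Suc (rank b p)), snd p)) ` marks e = ext_data e c d \<beta> m"
   unfolding ed by (rule image_cong) (use er in auto)
  finally show ?thesis .
 qed
 show "supp l \<inter> {k + 1..k + m} = {}" if X: "(l, t) \<in> ext_data e c d \<beta> m" and t: "d <= t" "t <= d + \<beta>"
 proof -
  obtain a p where ap: "(a, p) \<in> marks e" "l = a (Suc (ext_rank e c d \<beta> m p))" "t = snd p" using X unfolding ed by auto
  have amb: "(a, p) \<in> marks b" using ap(1) mb by blast
  obtain x where x: "p = (x, t)" using ap(3) by (cases p) auto
  have pD: "(x, t) \<notin> D" using eD[OF ap(1)] x by simp
  have l: "l = a (Suc (rank b p))" using ap(2) er[OF ap(1)] by simp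
  have rk: "rank b p = card {i \<in> {1..n}. f i t < x}" unfolding x rank_dg[OF b b01[OF t]] lt_count_def ..
  have notJ: "i \<notin> J" if "f i t = x" for i using inD[OF _ t, of i] that pD by auto
  show ?thesis
  proof (cases "x < c")
   case True
   have sub: "{i \<in> {1..n}. f i t < x} \<union> {i \<in> {1..n}. f i t = x} \<subseteq> \<Lambda>"
   proof
    fix i assume i: "i \<in> {i \<in> {1..n}. f i t < x} \<union> {i \<in> {1..n}. f i t = x}"
    hence lt: "i \<in> {1..n}" "f i t < c" using True by auto
    have "i \<notin> J" using inD[OF _ t, of i] lt(2) Dmem by auto
    thus "i \<in> \<Lambda>" using side[OF lt(1) _ t] lt by (auto simp: \<Lambda>_def)
   qed
   have "card {i \<in> {1..n}. f i t < x} + card {i \<in> {1..n}. f i t = x} = card ({i \<in> {1..n}. f i t < x} \<union> {i \<in> {1..n}. f i t = x})"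
    by (rule card_Un_disjoint[symmetric]) auto
   also have "... <= k" unfolding k by (rule card_mono[OF LJ(2) sub])
   finally have le: "rank b p + card {i \<in> {1..n}. f i t = x} <= k" unfolding rk .
   consider \<kappa> where "a = Cr \<kappa>" "p \<in> crossings b \<kappa>" | "a = Bar" "p \<in> bars b" using amb unfolding marks_def by blast
   thus ?thesis
   proof cases
    case (1 \<kappa>)
    obtain i j u where ij: "i \<in> {1..n}" "j \<in> {1..n}" "i ~= j" "p = (f i u, u)" "f i u = f j u"
     using dg_events(4)[OF b dg_events(1)[OF b 1(2)]] by blast
    have "{i, j} \<subseteq> {i \<in> {1..n}. f i t = x}" using ij x by auto
    hence "card {i, j} <= card {i \<in> {1..n}. f i t = x}" by (intro card_mono) auto
    hence "rank b p + 2 <= k" using le ij(3) by simp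
    thus ?thesis unfolding l 1(1) by auto
   next
    case 2
    obtain i u where i: "i \<in> {1..n}" "p = (f i u, u)" using dg_events(3)[OF b 2(2)] by blast
    have "{i} \<subseteq> {i \<in> {1..n}. f i t = x}" using i x by auto
    hence "card {i} <= card {i \<in> {1..n}. f i t = x}" by (intro card_mono) auto
    hence "rank b p + 1 <= k" using le by simp
    thus ?thesis unfolding l 2(1) by auto
   qed
  next
   case False
   hence x': "c' < x" using pD Dmem t by auto
   have "\<Lambda> \<union> J \<subseteq> {i \<in> {1..n}. f i t < x}"
   proof
    fix i assume i: "i \<in> \<Lambda> \<union> J"
    hence "i \<in> {1..n}" using Jn by (auto simp: \<Lambda>_def)
    moreover have "f i t < x"
    proof (cases "i \<in> J")
     case True
     thus ?thesis using inD[OF True t] Dmem x' by auto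
    next
     case False
     hence "f i t < c" using i side[OF _ False t] by (auto simp: \<Lambda>_def)
     thus ?thesis using cc x' by simp
    qed
    ultimately show "i \<in> {i \<in> {1..n}. f i t < x}" by blast
   qed
   hence "card (\<Lambda> \<union> J) <= rank b p" unfolding rk by (intro card_mono) auto
   hence "k + m <= rank b p" using LJ k by (simp add: card_Un_disjoint)
   moreover have "(\<exists>\<kappa>. a = Cr \<kappa>) \<or> a = Bar" using amb unfolding marks_def by blast
   ultimately show ?thesis unfolding l by auto
  qed
 qed
qed

section \<open>Equivalent diagrams read congruent words\<close>

lemma shift_valid: "valid m l ==> k + m <= n ==> valid n (shift k l)"
 by (cases l) auto

lemma shift_supp: "supp (shift k l) = (%i. i + k) ` supp l"
 by (cases l) auto

lemma shift_shift: "shift a (shift b l) = shift (b + a) l"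
 by (cases l) auto

lemma shift_words: "w \<in> vwords m ==> k + m <= n ==> map (shift k) w \<in> vwords n"
 using shift_valid[of m _ k n] by (auto simp: vwords_def)

lemma lcong_shift:
 assumes "(u, v) \<in> lcong m" "k + m <= n" shows "(map (shift k) u, map (shift k) v) \<in> lcong n"
 using assms
proof (induction rule: lcong.induct)
 case (lrefl w)
 thus ?case using shift_words by (blast intro: lcong.lrefl)
next
 case (lsym u v)
 thus ?case by (blast intro: lcong.lsym)
next
 case (ltrans u v w)
 thus ?case by (blast intro: lcong.ltrans)
next
 case (far p q l1 l2)
 have d: "supp (shift k l1) \<inter> supp (shift k l2) = {}" using far(5) unfolding shift_supp by auto
 have "(map (shift k) p @ [shift k l1, shift k l2] @ map (shift k) q, map (shift k) p @ [shift k l2, shift k l1] @ map (shift k) q) \<in> lcong n"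
  by (rule lcong.far[OF _ _ _ _ d]) (use far shift_valid shift_words in blast)+
 thus ?case by simp
next
 case (local p q m' l r d)
 have sh: "map (shift k) (map (shift d) w) = map (shift (d + k)) w" for w by (simp add: shift_shift)
 have "(map (shift k) p @ map (shift (d + k)) l @ map (shift k) q, map (shift k) p @ map (shift (d + k)) r @ map (shift k) q) \<in> lcong n"
  by (rule lcong.local[OF _ _ local(3)]) (use local shift_words in auto)
 thus ?case by (simp only: map_append sh)
qed

lemma lcong_move_past:
 assumes "l # F @ G \<in> vwords n" "\<forall>x\<in>set F. supp l \<inter> supp x = {}"
 shows "(l # F @ G, F @ l # G) \<in> lcong n"
 using assms
proof (induction F)
 case Nil
 thus ?case by (simp add: lcong.lrefl)
next
 case (Cons x F)
 have "(l # x # (F @ G), x # l # (F @ G)) \<in> lcong n"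
  using lcong.far[of "[]" n "F @ G" l x] Cons.prems by simp
 moreover have "(x # (l # F @ G), x # (F @ l # G)) \<in> lcong n"
  using lc.left[of "l # F @ G" "F @ l # G" n "[x]"] Cons by simp
 ultimately have "(l # x # (F @ G), x # (F @ l # G)) \<in> lcong n" by (rule lcong.ltrans)
 thus ?case by simp
qed

lemma lcong_partition:
 assumes "map fst xs \<in> vwords n" "\<And>x y. x \<in> set xs ==> y \<in> set xs ==> P x ==> \<not> P y ==> supp (fst x) \<inter> supp (fst y) = {}"
 shows "(map fst xs, map fst (filter P xs) @ map fst (filter (%x. \<not> P x) xs)) \<in> lcong n"
 using assms
proof (induction xs)
 case Nil
 thus ?case by (simp add: lcong.lrefl)
next
 case (Cons x xs)
 let ?F = "map fst (filter P xs)" and ?G = "map fst (filter (%x. \<not> P x) xs)"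
 have v: "valid n (fst x)" using Cons.prems(1) by simp
 have IH: "(map fst xs, ?F @ ?G) \<in> lcong n" by (rule Cons.IH) (use Cons.prems in auto)
 have 1: "(fst x # map fst xs, fst x # ?F @ ?G) \<in> lcong n" using lc.left[OF IH, of "[fst x]"] v by simp
 show ?case
 proof (cases "P x")
  case True
  thus ?thesis using 1 by simp
 next
  case False
  have "supp (fst x) \<inter> supp y = {}" if y: "y \<in> set ?F" for y
  proof -
   obtain z where "z \<in> set xs" "P z" "y = fst z" using y by auto
   thus ?thesis using Cons.prems(2)[of z x] False by auto
  qed
  hence "(fst x # ?F @ ?G, ?F @ fst x # ?G) \<in> lcong n"
   using lcong_in[OF 1] by (intro lcong_move_past) auto
  with 1 have "(fst x # map fst xs, ?F @ fst x # ?G) \<in> lcong n" by (rule lcong.ltrans)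
  thus ?thesis using False by simp
 qed
qed

text \<open>Two sets of events that act on disjoint positions may be listed one after the other instead of by height.\<close>

lemma merge_enumerations:
 assumes x: "enumerates xs S" and y: "enumerates ys T"
  and far: "\<And>x y. x \<in> S ==> y \<in> T ==> supp (fst x) \<inter> supp (fst y) = {}"
  and v: "\<And>x. x \<in> S \<union> T ==> valid n (fst x)"
 shows "\<exists>zs. enumerates zs (S \<union> T) & (map fst zs, map fst xs @ map fst ys) \<in> lcong n"
proof -
 have ne: "supp l ~= {}" for l by (cases l) auto
 have dj: "S \<inter> T = {}" using far ne by blast
 define zs where "zs = sort_key (%x. - snd x) (xs @ ys)"
 have sx: "set xs = S" "set ys = T" "distinct xs" "distinct ys" using x y by (auto simp: enumerates_def)
 have "distinct (xs @ ys)" using sx dj by simp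
 hence e: "enumerates zs (S \<union> T)" using enumerates_sort[of "xs @ ys"] sx by (simp add: zs_def)
 have id: "sort_key (%x. - snd x) L = L" if "enumerates L M" for L M
 proof -
  have "sorted_wrt (%x y. - snd x <= - snd y) L" using that by (simp add: enumerates_def)
  hence "sorted (map (%x. - snd x) L)" unfolding sorted_wrt_map .
  thus ?thesis by (rule sort_key_id_if_sorted)
 qed
 have f1: "filter (%z. z \<in> S) zs = xs"
 proof -
  have "filter (%z. z \<in> S) (xs @ ys) = xs" using sx dj by (auto simp: filter_id_conv filter_empty_conv)
  thus ?thesis unfolding zs_def filter_sort using id[OF x] by simp
 qed
 have f2: "filter (%z. z \<notin> S) zs = ys"
 proof -
  have "filter (%z. z \<notin> S) (xs @ ys) = ys" using sx dj by (auto simp: filter_id_conv filter_empty_conv)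
  thus ?thesis unfolding zs_def filter_sort using id[OF y] by simp
 qed
 have sz: "set zs = S \<union> T" using e by (simp add: enumerates_def)
 have "(map fst zs, map fst (filter (%z. z \<in> S) zs) @ map fst (filter (%z. z \<notin> S) zs)) \<in> lcong n"
  by (rule lcong_partition) (use sz v far in \<open>auto simp: vwords_def\<close>)
 thus ?thesis using e f1 f2 by auto
qed

text \<open>The word of a diagram with a box, up to exchanges: first the events above the box, then the picture in the box, then the
events beside it and those below.\<close>

lemma box_word:
 fixes k m n :: nat and d \<beta> :: real
 assumes b: "is_diagram n b" and L: "is_diagram m L" and beta: "\<beta> > 0"
  and data: "data b = (%(l, t). (shift k l, d + \<beta> * t)) ` data L \<union> X" and kn: "k + m <= n"
  and far: "\<And>l t. (l, t) \<in> X ==> d <= t ==> t <= d + \<beta> ==> supp l \<inter> {k + 1..k + m} = {}"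
  and A: "enumerates xa {q \<in> X. snd q > d + \<beta>}" and M: "enumerates xm {q \<in> X. d <= snd q & snd q <= d + \<beta>}"
  and C: "enumerates xc {q \<in> X. snd q < d}" and u: "reads L u"
 shows "\<exists>w. reads b w & (w, map fst xa @ map (shift k) u @ map fst xm @ map fst xc) \<in> lcong n"
proof -
 obtain f where f: "dg n b f" using is_diagram_dg[OF b] by blast
 obtain g where g: "dg m L g" using is_diagram_dg[OF L] by blast
 obtain ys where ys: "enumerates ys (data L)" "map fst ys = u" using reads_enumerates[OF u] by blast
 let ?s = "%(l, t). (shift k l, d + \<beta> * t)"
 let ?S = "?s ` data L" and ?M = "{q \<in> X. d <= snd q & snd q <= d + \<beta>}"
 let ?A = "{q \<in> X. snd q > d + \<beta>}" and ?C = "{q \<in> X. snd q < d}"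
 have "shift k l = shift k l' ==> l = l'" for l l' by (cases l; cases l') auto
 hence inj: "inj ?s" using beta by (auto intro!: injI)
 have S: "enumerates (map ?s ys) ?S"
  using ys(1) beta inj unfolding enumerates_def
  by (auto simp: distinct_map sorted_wrt_map case_prod_beta intro: inj_on_subset)
 have hS: "d < snd q & snd q < d + \<beta>" if qS: "q \<in> ?S" for q
 proof -
  obtain l t where "(l, t) \<in> data L" "q = (shift k l, d + \<beta> * t)" using qS by auto
  thus ?thesis using data_height[OF g, of l t] beta by simp
 qed
 have val: "valid n (fst q)" if "q \<in> ?S \<union> X" for q
  using data_valid[OF f, of "fst q" "snd q"] that data by auto
 obtain zs where zs: "enumerates zs (?S \<union> ?M)" "(map fst zs, map fst (map ?s ys) @ map fst xm) \<in> lcong n"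
 proof -
  have "\<exists>zs. enumerates zs (?S \<union> ?M) & (map fst zs, map fst (map ?s ys) @ map fst xm) \<in> lcong n"
  proof (rule merge_enumerations[OF S M])
   fix x y assume x: "x \<in> ?S" and y: "y \<in> ?M"
   obtain l t where l: "(l, t) \<in> data L" "x = (shift k l, d + \<beta> * t)" using x by auto
   have "valid m l" by (rule data_valid[OF g l(1)])
   hence "supp (fst x) \<subseteq> {k + 1..k + m}" unfolding l(2) by (cases l) auto
   moreover have "supp (fst y) \<inter> {k + 1..k + m} = {}" using far[of "fst y" "snd y"] y by simp
   ultimately show "supp (fst x) \<inter> supp (fst y) = {}" by blast
  qed (use val in blast)
  thus ?thesis using that by blast
 qed
 have "enumerates (zs @ xc) ((?S \<union> ?M) \<union> ?C)"
  proof (rule enumerates_append[OF zs(1) C])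
  fix x y assume x: "x \<in> ?S \<union> ?M" and y: "y \<in> ?C"
  have "d <= snd x"
  proof (cases "x \<in> ?S")
   case True
   thus ?thesis using hS[of x] by simp
  next
   case False
   thus ?thesis using x by auto
  qed
  thus "snd x > snd y" using y by auto
 qed
 hence "enumerates (xa @ zs @ xc) (?A \<union> ((?S \<union> ?M) \<union> ?C))"
 proof (rule enumerates_append[OF A])
  fix x y assume x: "x \<in> ?A" and y: "y \<in> (?S \<union> ?M) \<union> ?C"
  have "snd y <= d + \<beta>"
  proof (cases "y \<in> ?S")
   case True
   thus ?thesis using hS[of y] by simp
  next
   case False
   thus ?thesis using y beta by auto
  qed
  thus "snd x > snd y" using x by auto
 qed
 moreover have "?A \<union> ((?S \<union> ?M) \<union> ?C) = data b" unfolding data by auto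
 ultimately have "reads b (map fst (xa @ zs @ xc))" using reads_enumeration by metis
 moreover have "map fst (map ?s ys) = map (shift k) u" unfolding ys(2)[symmetric] by (simp add: case_prod_beta)
 hence "(map fst zs, map (shift k) u @ map fst xm) \<in> lcong n" using zs(2) by simp
 hence "(map fst xa @ map fst zs @ map fst xc, map fst xa @ (map (shift k) u @ map fst xm) @ map fst xc) \<in> lcong n"
 proof (rule lcong_context)
  show "map fst xa \<in> vwords n" "map fst xc \<in> vwords n" using A C val unfolding enumerates_def vwords_def by auto
 qed
 ultimately show ?thesis by auto
qed

lemma local_picture_valid:
 assumes "local_picture m l r" shows "l \<in> vwords m" "r \<in> vwords m"
 using assms by (cases rule: local_picture.cases; auto)+

text \<open>Both sides of a move have the same exterior events. Therefore their words differ only in the factor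
that comes from the box.\<close>

theorem reidemeister_words:
 assumes mv: "reidemeister_move n b b'"
 shows "\<exists>w w'. reads b w & reads b' w' & (w, w') \<in> lcong n"
proof -
 obtain m l r L R c d \<alpha> \<beta> where b: "is_diagram n b" "is_diagram n b'" and pic: "local_picture m l r"
  and L: "isotopic m (word_diagram m l) L" and R: "isotopic m (word_diagram m r) R" and ab: "\<alpha> > 0" "\<beta> > 0"
  and box: "let \<phi> = (%p. (c + \<alpha> * fst p, d + \<beta> * snd p)); D = \<phi> ` E m in
      D \<subseteq> E n & restrict_diagram D b = map_diagram \<phi> L & restrict_diagram D b' = map_diagram \<phi> R &
      restrict_diagram (- D) b = restrict_diagram (- D) b'"
  using mv unfolding reidemeister_move_def by blast
 define D where "D = (%p. (c + \<alpha> * fst p, d + \<beta> * snd p)) ` E m"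
 have D: "D \<subseteq> E n" "restrict_diagram D b = map_diagram (%p. (c + \<alpha> * fst p, d + \<beta> * snd p)) L"
  "restrict_diagram D b' = map_diagram (%p. (c + \<alpha> * fst p, d + \<beta> * snd p)) R"
  "restrict_diagram (- D) b = restrict_diagram (- D) b'"
  using box unfolding Let_def D_def by blast+
 have dL: "is_diagram m L" "is_diagram m R" using isotopic_diagrams L R by blast+
 obtain f f' g g' where dg: "dg n b f" "dg n b' f'" "dg m L g" "dg m R g'"
  using is_diagram_dg b dL by metis
 define e where "e = restrict_diagram (- D) b"
 define k where "k = ext_count e c (d + \<beta> / 2)"
 define X where "X = ext_data e c d \<beta> m"
 note 1 = box_data[OF dg(1,3) ab D_def D(1,2), folded e_def, folded k_def X_def]
 have e': "restrict_diagram (- D) b' = e" using D(4) by (simp add: e_def)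
 note 2 = box_data[OF dg(2,4) ab D_def D(1,3), unfolded e', folded k_def X_def]
 have finX: "finite X" by (rule finite_subset[OF _ finite_data[OF dg(1)]]) (use 1(1) in blast)
 have fin: "finite {q \<in> X. P q}" for P using finX by simp
 obtain xa where A: "enumerates xa {q \<in> X. snd q > d + \<beta>}" using ex_enumerates[OF fin[of "%q. snd q > d + \<beta>"]] by (rule exE)
 obtain xm where M: "enumerates xm {q \<in> X. d <= snd q & snd q <= d + \<beta>}" using ex_enumerates[OF fin[of "%q. d <= snd q & snd q <= d + \<beta>"]] by (rule exE)
 obtain xc where C: "enumerates xc {q \<in> X. snd q < d}" using ex_enumerates[OF fin[of "%q. snd q < d"]] by (rule exE)
 obtain u u' where u: "reads L u" "reads R u'" using ex_reads dL by metis
 have "\<exists>w. reads b w & (w, map fst xa @ map (shift k) u @ map fst xm @ map fst xc) \<in> lcong n"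
  by (rule box_word[OF b(1) dL(1) ab(2) 1(1,2) _ A M C u(1)]) (rule 1(3))
 then obtain w where w: "reads b w" "(w, map fst xa @ map (shift k) u @ map fst xm @ map fst xc) \<in> lcong n" by blast
 have "\<exists>w. reads b' w & (w, map fst xa @ map (shift k) u' @ map fst xm @ map fst xc) \<in> lcong n"
  by (rule box_word[OF b(2) dL(2) ab(2) 2(1,2) _ A M C u(2)]) (rule 2(3))
 then obtain w' where w': "reads b' w'" "(w', map fst xa @ map (shift k) u' @ map fst xm @ map fst xc) \<in> lcong n" by blast
 note v = local_picture_valid[OF pic]
 have vu: "u \<in> vwords m" "u' \<in> vwords m" using reads_valid dL u by blast+
 have ul: "(u, l) \<in> lcong m"
  by (rule lcong_if_isotopic[OF vu(1) v(1)])
   (rule isotopic_sym[OF isotopic_trans[OF L isotopic_word_diagram[OF dL(1) u(1)]]])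
 have ru: "(r, u') \<in> lcong m"
  by (rule lcong_if_isotopic[OF v(2) vu(2)])
   (rule isotopic_trans[OF R isotopic_word_diagram[OF dL(2) u(2)]])
 have sh0: "map (shift 0) w = w" for w
 proof -
  have "shift 0 l = l" for l by (cases l) auto
  thus ?thesis by (simp add: map_idI)
 qed
 have "([] @ map (shift 0) l @ [], [] @ map (shift 0) r @ []) \<in> lcong m"
  by (rule lcong.local[OF _ _ pic]) auto
 hence "(l, r) \<in> lcong m" by (simp add: sh0)
 hence "(u, u') \<in> lcong m" using ul ru lcong.ltrans by blast
 hence "(map (shift k) u, map (shift k) u') \<in> lcong n" by (rule lcong_shift[OF _ 1(2)])
 moreover have "map fst xa \<in> vwords n" "map fst xm @ map fst xc \<in> vwords n"
  using lcong_in[OF w(2)] by auto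
 ultimately have "(map fst xa @ map (shift k) u @ map fst xm @ map fst xc, map fst xa @ map (shift k) u' @ map fst xm @ map fst xc) \<in> lcong n"
  by (rule lcong_context)
 hence "(w, w') \<in> lcong n" using w(2) w'(2) lcong.lsym lcong.ltrans by blast
 thus ?thesis using w(1) w'(1) by blast
qed

lemma reads_unique:
 assumes "is_diagram n b" "reads b w" "reads b w'" shows "(w, w') \<in> lcong n"
 by (rule lcong_if_isotopic_words[OF isotopic_refl[OF assms(1)] isotopic_word_diagram isotopic_word_diagram reads_valid reads_valid])
  (use assms in auto)

lemma step_words:
 assumes "diagram_step n b b'" "reads b w" "reads b' w'" shows "(w, w') \<in> lcong n"
proof -
 have mv: "(w, w') \<in> lcong n" if m: "reidemeister_move n b b'" and r: "reads b w" "reads b' w'" for b b' w w'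
 proof -
  have d: "is_diagram n b" "is_diagram n b'" using m by (auto simp: reidemeister_move_def)
  obtain u u' where u: "reads b u" "reads b' u'" "(u, u') \<in> lcong n" using reidemeister_words[OF m] by blast
  show ?thesis
   using reads_unique[OF d(1) r(1) u(1)] reads_unique[OF d(2) u(2) r(2)] u(3) lcong.ltrans by blast
 qed
 consider "isotopic n b b'" | "reidemeister_move n b b'" | "reidemeister_move n b' b"
  using assms(1) unfolding diagram_step_def by blast
 thus ?thesis
 proof cases
  case 1
  note d = isotopic_diagrams[OF 1]
  show ?thesis
   by (rule lcong_if_isotopic_words[OF 1 isotopic_word_diagram[OF d(1) assms(2)] isotopic_word_diagram[OF d(2) assms(3)]
    reads_valid[OF d(1) assms(2)] reads_valid[OF d(2) assms(3)]])
 next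
  case 2
  thus ?thesis using mv assms by blast
 next
  case 3
  thus ?thesis using mv assms lcong.lsym by blast
 qed
qed

lemma step_diagram: "diagram_step n b b' ==> is_diagram n b & is_diagram n b'"
 unfolding diagram_step_def reidemeister_move_def using isotopic_diagrams by blast

text \<open>Each isotopy and each move preserves the class of the word, and so does the choice of an order for simultaneous events.\<close>

theorem equivalent_words:
 assumes "(b, b') \<in> diagram_equiv n" "reads b w" "reads b' w'" shows "(w, w') \<in> lcong n"
proof -
 have d: "is_diagram n b" and steps: "(diagram_step n)\<^sup>*\<^sup>* b b'" using assms(1) by (auto simp: diagram_equiv_def)
 have "\<forall>w'. reads b' w' --> (w, w') \<in> lcong n" using steps
 proof (induction rule: rtranclp_induct)
  case base
  thus ?case using reads_unique[OF d assms(2)] by blast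
 next
  case (step y z)
  obtain v where v: "reads y v" using ex_reads step_diagram[OF step(2)] by blast
  thus ?case using step(3) step_words[OF step(2) v] lcong.ltrans by blast
 qed
 thus ?thesis using assms(3) by blast
qed

lemma equiv_diagram_equiv: "equiv {b. is_diagram n b} (diagram_equiv n)"
proof (rule equivI)
 have sym: "diagram_step n b' b" if "diagram_step n b b'" for b b'
  using that isotopic_sym unfolding diagram_step_def by blast
 show "diagram_equiv n \<subseteq> {b. is_diagram n b} \<times> {b. is_diagram n b}" by (auto simp: diagram_equiv_def)
 show "refl_on {b. is_diagram n b} (diagram_equiv n)" by (auto simp: refl_on_def diagram_equiv_def)
 show "sym_on UNIV (diagram_equiv n)"
 proof (rule symI)
  fix b b' assume "(b, b') \<in> diagram_equiv n"
  hence d: "is_diagram n b" "is_diagram n b'" "(diagram_step n)\<^sup>*\<^sup>* b b'" by (auto simp: diagram_equiv_def)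
  from d(3) have "(diagram_step n)\<^sup>*\<^sup>* b' b"
   by (induction rule: rtranclp_induct) (use sym in \<open>auto intro: converse_rtranclp_into_rtranclp\<close>)
  thus "(b', b) \<in> diagram_equiv n" using d by (simp add: diagram_equiv_def)
 qed
 show "trans_on UNIV (diagram_equiv n)"
  by (rule transI) (auto simp: diagram_equiv_def intro: rtranclp_trans)
qed

lemma isotopic_equiv: "isotopic n b b' ==> (b, b') \<in> diagram_equiv n"
 using isotopic_diagrams[of n b b'] by (auto simp: diagram_equiv_def diagram_step_def)

lemma move_equiv: "reidemeister_move n b b' ==> (b, b') \<in> diagram_equiv n"
proof -
 assume m: "reidemeister_move n b b'"
 have "is_diagram n b" "is_diagram n b'" using m unfolding reidemeister_move_def by blast+
 moreover have "diagram_step n b b'" using m by (simp add: diagram_step_def)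
 ultimately show ?thesis by (simp add: diagram_equiv_def r_into_rtranclp)
qed

section \<open>Exchanging distant letters\<close>

lemma marks_alt: "crossings b k = {p. (Cr k, p) \<in> marks b}" "bars b = {p. (Bar, p) \<in> marks b}"
 by (auto simp: marks_iff Cr_fun_inj)

lemma is_diagram_stack: "is_diagram n b ==> is_diagram n c ==> is_diagram n (stack b c)"
 using is_diagram_dg dg_stack dg_is_diagram by metis

lemma letterf_low:
 assumes "supp l \<subseteq> {..c} \<or> supp l \<subseteq> {c<..}" "j <= c" "t \<in> {0..1}"
 shows "letterf l j t <= real c" "lact l j <= c"
 using assms by (cases l; auto)+

lemma letterf_high:
 assumes "supp l \<subseteq> {..c} \<or> supp l \<subseteq> {c<..}" "c < j" "t \<in> {0..1}"
 shows "real c + 1 <= letterf l j t" "c < lact l j"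
 using assms by (cases l; auto)+

lemma wordf_low:
 assumes "\<forall>l\<in>set w. supp l \<subseteq> {..c} \<or> supp l \<subseteq> {c<..}" "j <= c" "t \<in> {0..1}"
 shows "wordf w j t <= real c"
 using assms
proof (induction w arbitrary: j t)
 case (Cons l w)
 thus ?case
  using letterf_low[of l c j "2 * t - 1"] letterf_low(2)[of l c j 0] Cons.IH[of "lact l j" "2 * t"]
  by (auto simp: stackf_def endp_letter)
qed simp

lemma wordf_high:
 assumes "\<forall>l\<in>set w. supp l \<subseteq> {..c} \<or> supp l \<subseteq> {c<..}" "c < j" "t \<in> {0..1}"
 shows "real c + 1 <= wordf w j t"
 using assms
proof (induction w arbitrary: j t)
 case (Cons l w)
 thus ?case
  using letterf_high[of l c j "2 * t - 1"] letterf_high(2)[of l c j 0] Cons.IH[of "lact l j" "2 * t"]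
  by (auto simp: stackf_def endp_letter)
qed simp

text \<open>Starting from the diagram of \<open>[lA, lB]\<close>, the strands to the right of \<open>c\<close>, which never meet the others, are
moved upwards until both events have the same height.\<close>

lemma tie_diagram:
 assumes v: "valid n lA" "valid n lB" and s: "supp lA \<subseteq> {..c}" "supp lB \<subseteq> {c<..}"
 shows "\<exists>T. is_diagram n T & data T = {(lA, 3/4), (lB, 3/4)}"
proof -
 let ?w = "[lA, lB]"
 define Y where "Y = word_diagram n ?w"
 define F where "F = wordf ?w"
 have sep: "\<forall>l\<in>set ?w. supp l \<subseteq> {..c} \<or> supp l \<subseteq> {c<..}" using s by auto
 have b: "dg n Y F" unfolding Y_def F_def by (rule dg_word) (use v in simp)
 have low: "F i t <= real c" if "i <= c" "t \<in> {0..1}" for i t unfolding F_def by (rule wordf_low[OF sep that])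
 have high: "real c + 1 <= F i t" if "c < i" "t \<in> {0..1}" for i t unfolding F_def by (rule wordf_high[OF sep that])
 \<comment> \<open>The transition zone lies between the positions \<open>c\<close> and \<open>c + 1\<close>, where there are no strands.\<close>
 define l where "l = (%x. min 1 (max 0 (x - real c)))"
 have lam: "l (F i t) = (if c < i then 1 else 0)" if t: "t \<in> {0..1}" for i t
 proof (cases "c < i")
  case True
  thus ?thesis using high[OF True t] by (simp add: l_def)
 next
  case False
  thus ?thesis using low[OF _ t, of i] by (simp add: l_def)
 qed
 have "\<exists>h. height_map h & (\<forall>j<length [3/8 :: real]. h ([3/8] ! j) = [3/4] ! j)"
  by (rule interpolating_height_map) auto
 then obtain h where h: "height_map h" "h (3/8) = 3/4" by auto
 have h01: "h 0 = 0" "h 1 = 1" using h(1) by (simp_all add: height_map_def)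
 define A where "A = {i \<in> {1..n}. c < i}"
 define g where "g = (%i t. if i \<in> A then F i (hinv h t) else F i t)"
 have "\<exists>\<phi>. isotopic n Y (map_diagram \<phi> Y) & dg n (map_diagram \<phi> Y) g &
   (\<forall>i\<in>{1..n}. \<forall>t\<in>{0..1}. \<phi> (F i t, t) = (F i t, if i \<in> A then h t else t))"
  unfolding g_def
 proof (rule vertical_isotopy[OF b _ _ h(1), where l = l and ?t1.0 = 0 and ?t2.0 = 1])
  show "continuous_on {0..real n + 1} l" unfolding l_def by (intro continuous_intros)
  show "h t = t" if "t \<in> {0..1}" "t \<notin> {0<..<1}" for t
  proof -
   have "t = 0 \<or> t = 1" using that by auto
   thus ?thesis using h01 by auto
  qed
  show "l (F i t) = 0 \<or> l (F i t) = 1" if "t \<in> {0..1}" for i t using lam[OF that, of i] by simp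
  show "A = {i \<in> {1..n}. l (F i 0) = 1}" unfolding A_def using lam[of 0] by auto
 qed (auto simp: l_def)
 then obtain \<phi> where \<phi>: "isotopic n Y (map_diagram \<phi> Y)" "dg n (map_diagram \<phi> Y) g"
  "\<And>i t. i \<in> {1..n} ==> t \<in> {0..1} ==> \<phi> (F i t, t) = (F i t, if i \<in> A then h t else t)"
  by blast
 let ?T = "map_diagram \<phi> Y"
 have hr: "h t \<in> {0..1}" if "t \<in> {0..1}" for t using height_map_image[OF h(1)] that by blast
 have hi: "hinv h t \<in> {0..1}" if "t \<in> {0..1}" for t by (rule hinv(3)[OF h(1) that])
 have hh: "hinv h (h t) = t" if "t \<in> {0..1}" for t by (rule hinv(1)[OF h(1) that])
 have rk: "rank ?T (\<phi> p) = rank Y p" if i: "i \<in> {1..n}" "t \<in> {0..1}" "p = (F i t, t)" for p i t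
 proof (cases "i \<in> A")
  case True
  have cmp: "g j (h t) < F i t \<longleftrightarrow> F j t < F i t" if j: "j \<in> {1..n}" for j
  proof (cases "j \<in> A")
   case True
   thus ?thesis using hh[OF i(2)] by (simp add: g_def)
  next
   case False
   thus ?thesis using low[of j "h t"] low[of j t] high[of i t] \<open>i \<in> A\<close> j i hr by (simp add: g_def A_def)
  qed
  show ?thesis
   unfolding i(3) \<phi>(3)[OF i(1,2)] if_P[OF True] rank_dg[OF \<phi>(2) hr[OF i(2)]] rank_dg[OF b i(2)] lt_count_def
   by (rule arg_cong[where f = card]) (use cmp in blast)
 next
  case False
  have cmp: "g j t < F i t \<longleftrightarrow> F j t < F i t" if j: "j \<in> {1..n}" for j
  proof (cases "j \<in> A")
   case True
   thus ?thesis using high[of j "hinv h t"] high[of j t] low[of i t] \<open>i \<notin> A\<close> j i hi by (simp add: g_def A_def)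
  next
   case False
   thus ?thesis by (simp add: g_def)
  qed
  show ?thesis
   unfolding i(3) \<phi>(3)[OF i(1,2)] if_not_P[OF False] rank_dg[OF \<phi>(2) i(2)] rank_dg[OF b i(2)] lt_count_def
   by (rule arg_cong[where f = card]) (use cmp in blast)
 qed
 have db: "data Y = {(lA, 3/4), (lB, 3/8)}"
  using data_word[of ?w n] v unfolding Y_def by (simp add: std_heights_def)
 have Suc_supp: "Suc r \<in> supp (a (Suc r))" if "(a, p) \<in> marks Y" for a r and p :: point
  using that unfolding marks_iff by auto
 have bij: "bij_betw id {j \<in> {1..n}. j <= c} {1..c}"
  using v(2) s(2) by (cases lB) (auto simp: bij_betw_def)
 have cardc: "card {j \<in> {1..n}. j <= c} = c" using bij_betw_same_card[OF bij] by simp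
 have side: "i \<in> A \<longleftrightarrow> c <= rank Y p" if i: "i \<in> {1..n}" "t \<in> {0..1}" "p = (F i t, t)" for p i t
 proof (cases "i \<in> A")
  case True
  have "card {j \<in> {1..n}. j <= c} <= card {j \<in> {1..n}. F j t < F i t}"
  proof (rule card_mono)
   show "{j \<in> {1..n}. j <= c} \<subseteq> {j \<in> {1..n}. F j t < F i t}"
    using low[OF _ i(2)] high[of i t] True i(2) unfolding A_def by fastforce
  qed simp
  thus ?thesis using True unfolding i(3) rank_dg[OF b i(2)] lt_count_def cardc by simp
 next
  case False
  have "card {j \<in> {1..n}. F j t < F i t} < card {j \<in> {1..n}. j <= c}"
  proof (rule psubset_card_mono)
   have "i <= c" using False i(1) by (simp add: A_def)
   have "{j \<in> {1..n}. F j t < F i t} \<subseteq> {j \<in> {1..n}. j <= c}"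
   proof
    fix j assume j: "j \<in> {j \<in> {1..n}. F j t < F i t}"
    have "\<not> c < j" using high[of j t] low[OF \<open>i <= c\<close> i(2)] j i(2) by auto
    thus "j \<in> {j \<in> {1..n}. j <= c}" using j by simp
   qed
   thus "{j \<in> {1..n}. F j t < F i t} \<subset> {j \<in> {1..n}. j <= c}" using \<open>i <= c\<close> i(1) by blast
  qed simp
  thus ?thesis using False unfolding i(3) rank_dg[OF b i(2)] lt_count_def cardc by simp
 qed
 have ne: "supp lB ~= {}" by (cases lB) simp_all
 have "data ?T = (%(x, t). (x, if supp x \<subseteq> {..c} then t else h t)) ` data Y"
  unfolding data_marks marks_map image_image
 proof (rule image_cong[OF HOL.refl])
  fix m assume "m \<in> marks Y"
  then obtain a p where m: "m = (a, p)" "(a, p) \<in> marks Y" by (cases m) auto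
  obtain i t where i: "i \<in> {1..n}" "t \<in> {0<..<1}" "p = (F i t, t)" using mark_point[OF b m(2)] by blast
  have t: "t \<in> {0..1}" using i(2) by simp
  let ?x = "a (Suc (rank Y p))"
  have "(?x, t) \<in> data Y" unfolding data_marks using m(2) i(3) by (auto intro!: image_eqI[where x = "(a, p)"])
  hence x: "?x = lA \<or> ?x = lB" unfolding db by blast
  have "i \<in> A \<longleftrightarrow> \<not> supp ?x \<subseteq> {..c}"
  proof
   assume "i \<in> A"
   hence "Suc (rank Y p) \<notin> {..c}" using side[OF i(1) t i(3)] by simp
   thus "\<not> supp ?x \<subseteq> {..c}" using Suc_supp[OF m(2), of "rank Y p"] by blast
  next
   assume "\<not> supp ?x \<subseteq> {..c}"
   hence "?x = lB" using x s(1) by auto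
   hence "Suc (rank Y p) \<in> {c<..}" using Suc_supp[OF m(2), of "rank Y p"] s(2) by blast
   thus "i \<in> A" using side[OF i(1) t i(3)] by simp
  qed
  thus "(case (case m of (c, p) => (c, \<phi> p)) of (c, p) => (c (Suc (rank ?T p)), snd p)) =
   (case (case m of (c, p) => (c (Suc (rank Y p)), snd p)) of (x, t) => (x, if supp x \<subseteq> {..c} then t else h t))"
   using rk[OF i(1) t i(3)] \<phi>(3)[OF i(1) t] i(3) m(1) by simp
 qed
 also have "... = {(lA, 3/4), (lB, h (3/8))}"
 proof -
  have "\<not> supp lB \<subseteq> {..c}" using s(2) ne by fastforce
  thus ?thesis unfolding db using s(1) by simp
 qed
 also have "... = {(lA, 3/4), (lB, 3/4)}" unfolding h(2) ..
 finally show ?thesis using dg_is_diagram[OF \<phi>(2)] by blast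
qed

text \<open>A diagram with two simultaneous events reads both words.\<close>

lemma far_equiv_ordered:
 assumes v: "valid n l1" "valid n l2" and s: "supp l1 \<subseteq> {..c}" "supp l2 \<subseteq> {c<..}"
  and pq: "p \<in> vwords n" "q \<in> vwords n"
 shows "(word_diagram n (p @ [l1, l2] @ q), word_diagram n (p @ [l2, l1] @ q)) \<in> diagram_equiv n"
proof -
 obtain T where T: "is_diagram n T" "data T = {(l1, 3/4), (l2, 3/4)}" using tie_diagram[OF v s] by blast
 have ne: "l1 ~= l2" using s by (cases l1; cases l2) auto
 have "reads T (map fst [(l1, 3/4), (l2, 3/4 :: real)])" "reads T (map fst [(l2, 3/4), (l1, 3/4 :: real)])"
  by (rule reads_enumeration; use ne T(2) in \<open>auto simp: enumerates_def\<close>)+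
 hence r: "reads T [l1, l2]" "reads T [l2, l1]" by simp_all
 let ?Y = "stack (word_diagram n p) (stack T (word_diagram n q))"
 note d = word_is_diagram[OF pq(1)] word_is_diagram[OF pq(2)]
 have dT: "is_diagram n (stack T (word_diagram n q))" by (rule is_diagram_stack[OF T(1) d(2)])
 have dY: "is_diagram n ?Y" by (rule is_diagram_stack[OF d(1) dT])
 have "reads ?Y (p @ (u @ q))" if "reads T u" for u
  by (rule reads_stack[OF d(1) reads_word[OF pq(1)] dT reads_stack[OF T(1) that d(2) reads_word[OF pq(2)]]])
 hence "isotopic n ?Y (word_diagram n (p @ (u @ q)))" if "reads T u" for u
  using isotopic_word_diagram[OF dY] that by blast
 hence "isotopic n (word_diagram n (p @ [l1, l2] @ q)) (word_diagram n (p @ [l2, l1] @ q))"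
  using r isotopic_trans isotopic_sym by blast
 thus ?thesis by (rule isotopic_equiv)
qed

lemma far_equiv:
 assumes v: "valid n l1" "valid n l2" and s: "supp l1 \<inter> supp l2 = {}" and pq: "p \<in> vwords n" "q \<in> vwords n"
 shows "(word_diagram n (p @ [l1, l2] @ q), word_diagram n (p @ [l2, l1] @ q)) \<in> diagram_equiv n"
proof -
 have "(\<exists>c. supp l1 \<subseteq> {..c} & supp l2 \<subseteq> {c<..}) \<or> (\<exists>c. supp l2 \<subseteq> {..c} & supp l1 \<subseteq> {c<..})"
 proof -
  have "\<exists>c. supp l1 \<subseteq> {..c} & supp l2 \<subseteq> {c<..}" if "Max (supp l1) < Min (supp l2)" for l1 l2
   by (rule exI[of _ "Max (supp l1)"]) (use that in \<open>cases l1; cases l2; auto\<close>)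
  moreover have "Max (supp l1) < Min (supp l2) \<or> Max (supp l2) < Min (supp l1)"
   using s by (cases l1; cases l2) auto
  ultimately show ?thesis by blast
 qed
 thus ?thesis
  using far_equiv_ordered[OF v _ _ pq] far_equiv_ordered[OF v(2,1) _ _ pq]
   equiv_diagram_equiv[of n] by (meson equivE symD)
qed

text \<open>An increasing map applied at each height, the identity at the ends, does not change the order of the strands.\<close>

lemma horizontal_isotopy:
 assumes b: "dg n b f"
  and cont: "\<And>i. i \<in> {1..n} ==> continuous_on {0..1} (%t. \<psi> t (f i t))"
  and mono: "\<And>t x y. t \<in> {0..1} ==> x < y ==> \<psi> t x < \<psi> t y"
  and range: "\<And>t. t \<in> {0..1} ==> 0 <= \<psi> t 0 & \<psi> t (real n + 1) <= real n + 1"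
  and ends: "\<And>x. \<psi> 0 x = x" "\<And>x. \<psi> 1 x = x"
 shows "\<exists>b'. isotopic n b b' & dg n b' (%i t. \<psi> t (f i t)) & marks b' = (%(a, p). (a, (\<psi> (snd p) (fst p), snd p))) ` marks b"
proof -
 have c: "config n f" using b by (simp add: dg_def)
 have iff: "\<psi> t x < \<psi> t y \<longleftrightarrow> x < y" "\<psi> t x = \<psi> t y \<longleftrightarrow> x = y" if "t \<in> {0..1}" for t x y
  using mono[OF that, of x y] mono[OF that, of y x] by (metis linorder_neqE_linordered_idom order_less_asym order_less_irrefl)+
 have c': "config n (%i t. \<psi> t (f i t))"
  unfolding config_def
 proof (intro conjI ballI impI)
  fix i assume i: "i \<in> {1..n}"
  show "continuous_on {0..1} (%t. \<psi> t (f i t))" by (rule cont[OF i])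
  show "\<psi> 1 (f i 1) = real i" "\<psi> 0 (f i 0) \<in> real ` {1..n}" using configD(2,3)[OF c i] ends by simp_all
  fix t :: real assume t: "t \<in> {0..1}"
  show "0 < \<psi> t (f i t)" "\<psi> t (f i t) < real n + 1"
   using mono[OF t configD(4)[OF c i t]] mono[OF t configD(5)[OF c i t]] range[OF t] by auto
 next
  show "inj_on (%i. \<psi> 0 (f i 0)) {1..n}" using c by (simp add: ends config_def)
 next
  fix i j k and t :: real assume ijk: "i \<in> {1..n}" "j \<in> {1..n}" "k \<in> {1..n}" "t \<in> {0..1}"
   and e: "\<psi> t (f i t) = \<psi> t (f j t) & \<psi> t (f j t) = \<psi> t (f k t)"
  show "i = j \<or> j = k \<or> i = k" by (rule config_two[OF c ijk]) (use e iff(2)[OF ijk(4)] in simp_all)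
 next
  fix i j and t :: real assume ij: "i \<in> {1..n}" "j \<in> {1..n}" "t \<in> {0<..<1}" and e: "i ~= j & \<psi> t (f i t) = \<psi> t (f j t)"
  have "f i t = f j t" using e iff(2)[of t] ij(3) by simp
  hence "passes (f i) (f j) t" using config_passes[OF c ij(1,2) _ ij(3)] e by blast
  thus "passes (%t. \<psi> t (f i t)) (%t. \<psi> t (f j t)) t" by (rule passes_cong) (simp_all add: iff)
 qed
 obtain \<phi> where \<phi>: "isotopic n b (map_diagram \<phi> b)" "dg n (map_diagram \<phi> b) (%i t. \<psi> t (f i t))"
  "\<forall>i\<in>{1..n}. \<forall>t\<in>{0..1}. \<phi> (f i t, t) = (\<psi> t (f i t), t)"
  using isotopic_reorder[OF b c'] iff by (auto simp: same_order_def)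
 have "marks (map_diagram \<phi> b) = (%(a, p). (a, (\<psi> (snd p) (fst p), snd p))) ` marks b"
  unfolding marks_map
 proof (rule image_cong[OF HOL.refl])
  fix m assume "m \<in> marks b"
  then obtain a p where m: "m = (a, p)" "(a, p) \<in> marks b" by (cases m) auto
  obtain i t where i: "i \<in> {1..n}" "t \<in> {0<..<1}" "p = (f i t, t)" using mark_point[OF b m(2)] by blast
  hence "\<phi> p = (\<psi> (snd p) (fst p), snd p)" using \<phi>(3) by simp
  thus "(case m of (a, p) => (a, \<phi> p)) = (case m of (a, p) => (a, (\<psi> (snd p) (fst p), snd p)))"
   unfolding m(1) by simp
 qed
 thus ?thesis using \<phi> by blast
qed

section \<open>Realising local pictures by moves\<close>

lemma diagram_eqI: "strands b = strands c ==> marks b = marks c ==> b = (c :: diagram)"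
 by (rule diagram.equality) (auto simp: marks_alt)

lemma marks_restrict: "marks (restrict_diagram D b) = {m \<in> marks b. snd m \<in> D}"
 unfolding restrict_diagram_def marks_def by auto

lemma letterf_shift: "letterf (shift k l) (k + a) u = real k + letterf l a u"
 by (cases l) auto

lemma letterf_shift_outside: "valid m l ==> j \<notin> {k + 1..k + m} ==> letterf (shift k l) j u = real j"
 by (cases l) auto

lemma lact_shift: "lact (shift k l) (k + a) = k + lact l a"
 by (cases l) auto

lemma lact_shift_outside: "valid m l ==> j \<notin> {k + 1..k + m} ==> lact (shift k l) j = j"
 by (cases l) auto

lemma wordf_shift: "wordf (map (shift k) w) (k + a) u = real k + wordf w a u"
 by (induction w arbitrary: a u) (simp_all add: stackf_def endp_letter lact_shift letterf_shift)

lemma wordf_shift_outside: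
 "w \<in> vwords m ==> j \<notin> {k + 1..k + m} ==> wordf (map (shift k) w) j u = real j"
proof (induction w arbitrary: u)
 case (Cons l w)
 have "valid m l" "w \<in> vwords m" using Cons.prems(1) by simp_all
 thus ?case using lact_shift_outside[of m l j k] letterf_shift_outside[of m l j k] Cons.IH Cons.prems(2)
  by (simp add: stackf_def endp_letter)
qed simp

lemma wordf_range:
 assumes "w \<in> vwords m" "a \<in> {1..m}" "u \<in> {0..1}" shows "wordf w a u \<in> {1..real m}"
 using assms
proof (induction w arbitrary: a u)
 case (Cons l w)
 have l: "letterf l a t \<in> {1..real m}" if "t \<in> {0..1}" for t
  using Cons.prems(1,2) that by (cases l) auto
 show ?case
 proof (cases "u < 1/2")
  case True
  have "wordf w (lact l a) (2 * u) \<in> {1..real m}"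
   by (rule Cons.IH) (use Cons.prems True lact_range in auto)
  thus ?thesis using True by (simp add: stackf_def endp_letter)
 next
  case False
  hence "letterf l a (2 * u - 1) \<in> {1..real m}" using Cons.prems(3) by (intro l) auto
  thus ?thesis using False by (simp add: stackf_def)
 qed
qed auto

lemma endp_wordf: "endp (wordf []) i = i" "endp (wordf (l # w)) i = endp (wordf w) (lact l i)"
 by (simp_all add: endp_def stackf_def endp_letter[unfolded endp_def])

lemma local_picture_endp:
 assumes "local_picture m l r"
 shows "endp (wordf (map (shift k) l)) i = endp (wordf (map (shift k) r)) i"
 using assms by (cases rule: local_picture.cases) (auto simp: endp_wordf simp del: wordf.simps)

lemma pts_shift: "pts n (map (shift k) w) = map (%(h, p). (h, (real k + fst p, snd p))) (pts n w)"
proof (induction w)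
 case (Cons l w)
 have "head (shift k l) = head l" "center (shift k l) = (real k + fst (center l), snd (center l))"
  by (cases l; simp)+
 thus ?case using Cons by (simp add: upper_def lower_def case_prod_beta apsnd_def map_prod_def)
qed simp

lemma pts_degree: "pts n w = pts m w"
 by (induction w) simp_all

lemma marks_shift: "marks (word_diagram n (map (shift k) w)) = (%(h, p). (h, (real k + fst p, snd p))) ` marks (word_diagram m w)"
 unfolding marks_word pts_shift pts_degree[of n w m] by simp

text \<open>At the heights from \<open>1/4\<close> to \<open>1/2\<close> the interval \<open>[k + 1, k + m]\<close> is contracted by the factor \<open>1/2\<close> towards its midpoint and the points
outside follow it by translations. The bump function of \<open>t\<close> makes this the identity at the heights \<open>0\<close> and \<open>1\<close>.\<close>

definition squeeze :: "nat => nat => real => real => real" where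
 "squeeze k m t x = x - max 0 (min 1 (min (4 * t) (2 - 2 * t))) *
   (min (real k + real m) (max (real k + 1) x) - (real k + (real m + 1) / 2)) / 2"

lemma squeeze_mono:
 assumes "x < y" shows "squeeze k m t x < squeeze k m t y"
proof -
 define \<mu> where "\<mu> = max 0 (min 1 (min (4 * t) (2 - 2 * t)))"
 define C where "C = real k + (real m + 1) / 2"
 define cl where "cl = (%x. min (real k + real m) (max (real k + 1) x))"
 have mu: "0 <= \<mu>" "\<mu> <= 1" by (auto simp: \<mu>_def)
 have cl: "cl x <= cl y" "cl y - cl x <= y - x" using assms by (auto simp: cl_def min_def max_def)
 have "\<mu> * (cl y - cl x) <= 1 * (cl y - cl x)" using mu cl(1) by (intro mult_right_mono) auto
 hence "\<mu> * (cl y - cl x) / 2 < y - x" using cl assms by simp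
 moreover have "squeeze k m t z = z - \<mu> * (cl z - C) / 2" for z
  unfolding squeeze_def \<mu>_def cl_def C_def ..
 hence "squeeze k m t y - squeeze k m t x = (y - x) - \<mu> * (cl y - cl x) / 2"
  by (simp add: algebra_simps diff_divide_distrib)
 ultimately show ?thesis by simp
qed

lemma squeeze_ends: "squeeze k m 0 x = x" "squeeze k m 1 x = x"
 by (simp_all add: squeeze_def)

lemma squeeze_range:
 assumes "k + m <= n" "1 <= m"
 shows "0 <= squeeze k m t 0" "squeeze k m t (real n + 1) <= real n + 1"
proof -
 define \<mu> where "\<mu> = max 0 (min 1 (min (4 * t) (2 - 2 * t)))"
 have mu: "0 <= \<mu>" by (auto simp: \<mu>_def)
 have "real k + real m <= real n" using assms(1) by linarith
 hence cl: "min (real k + real m) (max (real k + 1) 0) = real k + 1"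
  "min (real k + real m) (max (real k + 1) (real n + 1)) = real k + real m"
  using assms(2) by (simp_all add: min_def max_def)
 have sq: "squeeze k m t z = z - \<mu> * (min (real k + real m) (max (real k + 1) z) - (real k + (real m + 1) / 2)) / 2" for z
  unfolding squeeze_def \<mu>_def ..
 have "\<mu> * (real k + 1 - (real k + (real m + 1) / 2)) <= 0" using mu assms by (intro mult_nonneg_nonpos) auto
 thus "0 <= squeeze k m t 0" unfolding sq cl by simp
 have "0 <= \<mu> * (real k + real m - (real k + (real m + 1) / 2))" using mu assms by (intro mult_nonneg_nonneg) auto
 thus "squeeze k m t (real n + 1) <= real n + 1" unfolding sq cl by simp
qed

lemma squeeze_band:
 assumes "t \<in> {1/4..1/2}" "1 <= m"
 shows "y \<in> {1..real m} ==> squeeze k m t (real k + y) = (real k + (real m + 1) / 4) + y / 2"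
  and "j <= k ==> squeeze k m t (real j) < real k + (real m + 1) / 4"
  and "k + m < j ==> real k + 3 * (real m + 1) / 4 < squeeze k m t (real j)"
proof -
 have mu: "max 0 (min 1 (min (4 * t) (2 - 2 * t))) = 1" using assms(1) by auto
 show "y \<in> {1..real m} ==> squeeze k m t (real k + y) = (real k + (real m + 1) / 4) + y / 2"
  unfolding squeeze_def mu by (simp add: min_def max_def field_simps)
 show "j <= k ==> squeeze k m t (real j) < real k + (real m + 1) / 4"
  unfolding squeeze_def mu using assms(2) by (simp add: min_def max_def field_simps)
 assume "k + m < j"
 hence "real k + real m + 1 <= real j" by linarith
 thus "real k + 3 * (real m + 1) / 4 < squeeze k m t (real j)"
  unfolding squeeze_def mu using assms(2) by (simp add: min_def max_def field_simps)
qed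

definition boxf :: "letter list => letter list => nat => nat => letter list => nat => real => real" where
 "boxf p q k m x = (%i t. squeeze k m t (stackf (wordf p) (stackf (wordf (map (shift k) x)) (wordf q)) i t))"

definition box_map :: "nat => nat => point => point" where
 "box_map k m = (%p. (real k + (real m + 1) / 4 + 1/2 * fst p, 1/4 + 1/4 * snd p))"

text \<open>The marks of the squeezed diagram outside the box.\<close>

definition box_exterior :: "nat => letter list => letter list => nat => nat => ((nat => letter) \<times> point) set" where
 "box_exterior n p q k m = (%(a, p). (a, (squeeze k m (snd p) (fst p), snd p))) `
   (apsnd upper ` marks (word_diagram n p) \<union> apsnd lower ` apsnd lower ` marks (word_diagram n q))"

text \<open>In a stack of \<open>p\<close>, the shifted word \<open>x\<close> and \<open>q\<close>, the middle part occupies the heights from \<open>1/4\<close> to \<open>1/2\<close>. After squeezing, the \<open>m\<close>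
strands in the positions \<open>k + 1, ..., k + m\<close> fill a box of half the width of \<open>E m\<close>, and the vertical strands to the left and to the right
of them, at distance at least one, are outside this box.\<close>

lemma squeezed_diagram:
 assumes pq: "p \<in> vwords n" "q \<in> vwords n" and x: "x \<in> vwords m" and km: "k + m <= n" "1 <= m"
 shows "\<exists>X. isotopic n (word_diagram n (p @ map (shift k) x @ q)) X & dg n X (boxf p q k m x) &
   restrict_diagram (box_map k m ` E m) X = map_diagram (box_map k m) (word_diagram m x) &
   marks (restrict_diagram (- box_map k m ` E m) X) = box_exterior n p q k m &
   (\<forall>i\<in>{1..n}. \<forall>t\<in>{1/4..1/2}. if endp (wordf p) i \<in> {k + 1..k + m} then (boxf p q k m x i t, t) \<in> box_map k m ` E m
    else boxf p q k m x i t = squeeze k m t (real (endp (wordf p) i)))"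
proof -
 define \<psi> where "\<psi> = squeeze k m"
 define P Q W where "P = word_diagram n p" and "Q = word_diagram n q" and "W = word_diagram n (map (shift k) x)"
 define G where "G = boxf p q k m x"
 define D where "D = box_map k m ` E m"
 define \<phi> where "\<phi> = box_map k m"
 have \<phi>_def': "\<phi> = (%p. (real k + (real m + 1) / 4 + 1/2 * fst p, 1/4 + 1/4 * snd p))" by (simp add: \<phi>_def box_map_def)
 have D_def': "D = (%p. (real k + (real m + 1) / 4 + 1/2 * fst p, 1/4 + 1/4 * snd p)) ` E m" by (simp add: D_def box_map_def)
 have w: "map (shift k) x \<in> vwords n" by (rule shift_words[OF x km(1)])
 have dP: "dg n P (wordf p)" and dQ: "dg n Q (wordf q)" and dW: "dg n W (wordf (map (shift k) x))"
  unfolding P_def Q_def W_def by (rule dg_word; use pq w in \<open>simp add: vwords_def\<close>)+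
 have dx: "dg m (word_diagram m x) (wordf x)" by (rule dg_word) (use x in \<open>simp add: vwords_def\<close>)
 define F where "F = stackf (wordf p) (stackf (wordf (map (shift k) x)) (wordf q))"
 define Y where "Y = stack P (stack W Q)"
 have dY: "dg n Y F" unfolding Y_def F_def by (rule dg_stack[OF dP dg_stack[OF dW dQ]])
 have cF: "config n F" using dY by (simp add: dg_def)
 have G: "G = (%i t. \<psi> t (F i t))" by (simp add: G_def boxf_def \<psi>_def F_def)
 have "\<exists>X. isotopic n Y X & dg n X (%i t. \<psi> t (F i t)) & marks X = (%(a, p). (a, (\<psi> (snd p) (fst p), snd p))) ` marks Y"
 proof (rule horizontal_isotopy[OF dY])
  show "continuous_on {0..1} (%t. \<psi> t (F i t))" if "i \<in> {1..n}" for i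
   unfolding \<psi>_def squeeze_def by (intro continuous_intros configD(1)[OF cF that]) auto
 qed (use squeeze_mono squeeze_ends squeeze_range[OF km] in \<open>simp_all add: \<psi>_def\<close>)
 then obtain X where X: "isotopic n Y X" "dg n X G" "marks X = (%(a, p). (a, (\<psi> (snd p) (fst p), snd p))) ` marks Y"
  unfolding G by blast
 have rY: "reads Y (p @ map (shift k) x @ q)" unfolding Y_def
  by (rule reads_stack[OF _ _ _ reads_stack])
   (use dg_is_diagram[OF dP] dg_is_diagram[OF dW] dg_is_diagram[OF dQ] dg_is_diagram[OF dg_stack[OF dW dQ]]
     reads_word pq w in \<open>simp_all add: P_def Q_def W_def\<close>)
 have isoX: "isotopic n (word_diagram n (p @ map (shift k) x @ q)) X"
  using isotopic_trans[OF isotopic_sym[OF isotopic_word_diagram[OF dg_is_diagram[OF dY] rY]] X(1)] .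
 have D: "(y, t) \<in> D \<longleftrightarrow> real k + (real m + 1) / 4 <= y & y <= real k + 3 * (real m + 1) / 4 & 1/4 <= t & t <= 1/2" for y t
 proof -
  have pos: "(0::real) < 1/2" "(0::real) < 1/4" by simp_all
  have e: "real k + (real m + 1) / 4 + 1/2 * (real m + 1) = real k + 3 * (real m + 1) / 4" "1/4 + 1/4 = (1/2::real)"
   by (simp_all add: field_simps)
  show ?thesis unfolding D_def' box_iff[OF pos] e ..
 qed
 have e: "endp (wordf p) i \<in> {1..n}" if "i \<in> {1..n}" for i
  using endp(2)[of n "wordf p" i] dP that by (simp add: dg_def)
 have Fband: "F i t = wordf (map (shift k) x) (endp (wordf p) i) (4 * t - 1)" if i: "i \<in> {1..n}" and t: "t \<in> {1/4..1/2}" for i t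
 proof (cases "t < 1/2")
  case True
  thus ?thesis using t unfolding F_def stackf_def by auto
 next
  case False
  hence t2: "t = 1/2" using t by simp
  have "F i t = wordf p i 0" unfolding F_def stackf_def t2 by simp
  also have "... = real (endp (wordf p) i)" using endp(1)[of n "wordf p" i] dP i by (simp add: dg_def)
  also have "... = wordf (map (shift k) x) (endp (wordf p) i) 1"
   using configD(2)[of n "wordf (map (shift k) x)" "endp (wordf p) i"] dW e[OF i] by (simp add: dg_def)
  finally show ?thesis unfolding t2 by simp
 qed
 have Gin: "(G i t, t) = \<phi> (wordf x a (4 * t - 1), 4 * t - 1) & (G i t, t) \<in> D"
  if i: "i \<in> {1..n}" "endp (wordf p) i = k + a" "a \<in> {1..m}" and t: "t \<in> {1/4..1/2}" for i a t
 proof -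
  have r: "wordf x a (4 * t - 1) \<in> {1..real m}" by (rule wordf_range[OF x i(3)]) (use t in auto)
  have "F i t = real k + wordf x a (4 * t - 1)" unfolding Fband[OF i(1) t] i(2) wordf_shift ..
  hence "G i t = real k + (real m + 1) / 4 + wordf x a (4 * t - 1) / 2"
   unfolding G \<psi>_def using squeeze_band(1)[OF t km(2) r] by simp
  hence "(G i t, t) = \<phi> (wordf x a (4 * t - 1), 4 * t - 1)" by (simp add: \<phi>_def' field_simps)
  moreover have "(wordf x a (4 * t - 1), 4 * t - 1) \<in> E m" using r t by (auto simp: E_def)
  ultimately show ?thesis unfolding D_def \<phi>_def by (metis (no_types, lifting) imageI)
 qed
 have Gout: "(G i t, t) \<notin> D" if i: "i \<in> {1..n}" "endp (wordf p) i \<notin> {k + 1..k + m}" and t: "t \<in> {1/4..1/2}" for i t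
 proof -
  have "F i t = real (endp (wordf p) i)" unfolding Fband[OF i(1) t] by (rule wordf_shift_outside[OF x i(2)])
  moreover have "endp (wordf p) i <= k \<or> k + m < endp (wordf p) i" using i(2) by auto
  ultimately show ?thesis unfolding G D \<psi>_def using squeeze_band(2,3)[OF t km(2)] by (metis linorder_not_le)
 qed
 have band: "t \<in> {1/4..1/2}" if "(y, t) \<in> D" for y t using that D by simp
 have curve_in: "curve (G i) \<inter> D = \<phi> ` curve (wordf x a)" if i: "i \<in> {1..n}" "endp (wordf p) i = k + a" "a \<in> {1..m}" for i a
 proof (intro equalityI subsetI)
  fix z assume z: "z \<in> curve (G i) \<inter> D"
  then obtain t where t: "z = (G i t, t)" unfolding curve_def by blast
  have tb: "t \<in> {1/4..1/2}" using band z t by blast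
  have "(wordf x a (4 * t - 1), 4 * t - 1) \<in> curve (wordf x a)" using tb by (simp add: mem_curve)
  thus "z \<in> \<phi> ` curve (wordf x a)" unfolding t using Gin[OF i tb] by (metis imageI)
 next
  fix z assume "z \<in> \<phi> ` curve (wordf x a)"
  then obtain u where u: "u \<in> {0..1}" "z = \<phi> (wordf x a u, u)" unfolding curve_def by blast
  define t where "t = (1 + u) / 4"
  have t: "t \<in> {1/4..1/2}" "4 * t - 1 = u" using u(1) by (auto simp: t_def field_simps)
  note g' = Gin[OF i t(1), unfolded t(2)]
  have g: "z = (G i t, t)" "(G i t, t) \<in> D"
   unfolding u(2) by (rule conjunct1[OF g', symmetric]) (rule conjunct2[OF g'])
  have "(G i t, t) \<in> curve (G i)" using t(1) by (simp add: mem_curve)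
  thus "z \<in> curve (G i) \<inter> D" unfolding g(1) using g(2) by (rule IntI)
 qed
 have curve_out: "curve (G i) \<inter> D = {}" if i: "i \<in> {1..n}" "endp (wordf p) i \<notin> {k + 1..k + m}" for i
  using Gout[OF i] band unfolding curve_def by blast
 have cp: "config n (wordf p)" using dP by (simp add: dg_def)
 have ex: "\<exists>i\<in>{1..n}. endp (wordf p) i = k + a" if a: "a \<in> {1..m}" for a
 proof -
  have "k + a \<in> {1..n}" using a km by auto
  hence "k + a \<in> endp (wordf p) ` {1..n}" using endp_bij[OF cp] by (simp add: bij_betw_def)
  thus ?thesis by (metis imageE)
 qed
 have st: "(%a. a \<inter> D) ` strands X - {{}} = (%a. \<phi> ` a) ` strands (word_diagram m x)"
 proof -
  have sX: "strands X = (%i. curve (G i)) ` {1..n}" using X(2) by (simp add: dg_def)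
  have sx: "strands (word_diagram m x) = (%a. curve (wordf x a)) ` {1..m}" using dx by (simp add: dg_def)
  show ?thesis
  proof (intro equalityI subsetI)
   fix s assume s: "s \<in> (%a. a \<inter> D) ` strands X - {{}}"
   then obtain i where i: "i \<in> {1..n}" "s = curve (G i) \<inter> D" unfolding sX by blast
   hence "endp (wordf p) i \<in> {k + 1..k + m}" using curve_out[OF i(1)] s by blast
   hence a: "endp (wordf p) i = k + (endp (wordf p) i - k)" "endp (wordf p) i - k \<in> {1..m}" by auto
   show "s \<in> (%a. \<phi> ` a) ` strands (word_diagram m x)" unfolding sx i(2) curve_in[OF i(1) a] using a(2) by blast
  next
   fix s assume "s \<in> (%a. \<phi> ` a) ` strands (word_diagram m x)"
   then obtain a where a: "a \<in> {1..m}" "s = \<phi> ` curve (wordf x a)" unfolding sx by blast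
   obtain i where i: "i \<in> {1..n}" "endp (wordf p) i = k + a" using ex[OF a(1)] by blast
   have "s = curve (G i) \<inter> D" unfolding a(2) by (rule curve_in[OF i a(1), symmetric])
   moreover have "s ~= {}" unfolding a(2) by (auto simp: curve_def)
   ultimately show "s \<in> (%a. a \<inter> D) ` strands X - {{}}" unfolding sX using i(1) by blast
  qed
 qed
 let ?\<Psi> = "%(a, p). (a :: nat => letter, (\<psi> (snd p) (fst p), snd p) :: point)"
 have mY: "marks Y = apsnd lower ` apsnd upper ` marks W \<union> (apsnd upper ` marks P \<union> apsnd lower ` apsnd lower ` marks Q)"
  unfolding Y_def marks_stack by (auto simp: image_Un)
 have hts: "snd z \<in> {0<..<1}" if "dg n' d f" "(a, z) \<in> marks d" for n' d f a and z :: point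
  using mark_point[OF that] by auto
 have outm: "snd (?\<Psi> z) \<notin> D" if z: "z \<in> apsnd upper ` marks P \<union> apsnd lower ` apsnd lower ` marks Q" for z
 proof -
  have "snd (snd z) > 1/2 \<or> snd (snd z) < 1/4"
  proof (cases "z \<in> apsnd upper ` marks P")
   case True
   then obtain a y where "(a, y) \<in> marks P" "z = (a, upper y)" by auto
   thus ?thesis using hts[OF dP] by (auto simp: upper_def)
  next
   case False
   then obtain a y where "(a, y) \<in> marks Q" "z = (a, lower (lower y))" using z by auto
   thus ?thesis using hts[OF dQ] by (auto simp: lower_def)
  qed
  moreover have "snd (?\<Psi> z) = (\<psi> (snd (snd z)) (fst (snd z)), snd (snd z))" by (cases z) simp
  ultimately show ?thesis by (auto simp: D)
 qed
 have inm: "?\<Psi> ` apsnd lower ` apsnd upper ` marks W = (%(a, p). (a, \<phi> p)) ` marks (word_diagram m x) &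
   (\<forall>z \<in> ?\<Psi> ` apsnd lower ` apsnd upper ` marks W. snd z \<in> D)"
 proof -
  have one: "?\<Psi> (apsnd lower (apsnd upper (a, (real k + fst y, snd y)))) = (a, \<phi> y) & \<phi> y \<in> D"
   if y: "(a, y) \<in> marks (word_diagram m x)" for a y
  proof -
   obtain j u where j: "j \<in> {1..m}" "u \<in> {0<..<1}" "y = (wordf x j u, u)" using mark_point[OF dx y] by blast
   have r: "wordf x j u \<in> {1..real m}" by (rule wordf_range[OF x j(1)]) (use j(2) in simp)
   have t: "(1 + u) / 2 / 2 \<in> {1/4..1/2}" using j(2) by auto
   have "?\<Psi> (apsnd lower (apsnd upper (a, (real k + fst y, snd y)))) = (a, (\<psi> ((1 + u) / 2 / 2) (real k + wordf x j u), (1 + u) / 2 / 2))"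
    by (simp add: j(3) upper_def lower_def)
   also have "... = (a, \<phi> y)" unfolding \<psi>_def squeeze_band(1)[OF t km(2) r] by (simp add: \<phi>_def' j(3) field_simps)
   finally have "?\<Psi> (apsnd lower (apsnd upper (a, (real k + fst y, snd y)))) = (a, \<phi> y)" .
   moreover have "y \<in> E m" using r j by (auto simp: E_def)
   ultimately show ?thesis unfolding D_def \<phi>_def by blast
  qed
  have "?\<Psi> ` apsnd lower ` apsnd upper ` marks W = (%(a, y). ?\<Psi> (apsnd lower (apsnd upper (a, (real k + fst y, snd y))))) ` marks (word_diagram m x)"
   unfolding W_def marks_shift[of n k x m] image_image by (rule image_cong[OF HOL.refl]) (simp add: case_prod_beta)
  also have "... = (%(a, p). (a, \<phi> p)) ` marks (word_diagram m x)"
  proof (rule image_cong[OF HOL.refl])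
   fix z assume z: "z \<in> marks (word_diagram m x)"
   obtain a y where zz: "z = (a, y)" by (cases z)
   show "(case z of (a, y) => ?\<Psi> (apsnd lower (apsnd upper (a, (real k + fst y, snd y))))) = (case z of (a, p) => (a, \<phi> p))"
    unfolding zz prod.case using one[of a y] z[unfolded zz] by blast
  qed
  finally have im: "?\<Psi> ` apsnd lower ` apsnd upper ` marks W = (%(a, p). (a, \<phi> p)) ` marks (word_diagram m x)" .
  moreover have "\<forall>z \<in> (%(a, p). (a, \<phi> p)) ` marks (word_diagram m x). snd z \<in> D" using one by auto
  ultimately show ?thesis by simp
 qed
 have mX: "marks X = ?\<Psi> ` apsnd lower ` apsnd upper ` marks W \<union> ?\<Psi> ` (apsnd upper ` marks P \<union> apsnd lower ` apsnd lower ` marks Q)"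
  unfolding X(3) mY image_Un ..
 have gen: "{m \<in> M \<union> N. snd m \<in> D} = M & {m \<in> M \<union> N. snd m \<in> - D} = N"
  if "\<forall>z\<in>M. snd z \<in> D" "\<forall>z\<in>N. snd z \<notin> D" for M N :: "((nat => letter) \<times> point) set"
  using that by blast
 have outm': "\<forall>z\<in>?\<Psi> ` (apsnd upper ` marks P \<union> apsnd lower ` apsnd lower ` marks Q). snd z \<notin> D"
  by (intro ballI, erule imageE) (use outm in simp)
 note mD = gen[OF conjunct2[OF inm] outm', folded mX]
 have "restrict_diagram D X = map_diagram \<phi> (word_diagram m x)"
 proof (rule diagram_eqI)
  show "strands (restrict_diagram D X) = strands (map_diagram \<phi> (word_diagram m x))"
   using st by (simp add: restrict_diagram_def map_diagram_def)
  show "marks (restrict_diagram D X) = marks (map_diagram \<phi> (word_diagram m x))"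
   unfolding marks_restrict marks_map conjunct1[OF mD] by (rule conjunct1[OF inm])
 qed
 moreover have "marks (restrict_diagram (- D) X) = box_exterior n p q k m"
  unfolding marks_restrict conjunct2[OF mD] box_exterior_def \<psi>_def P_def Q_def ..
 moreover have "\<forall>i\<in>{1..n}. \<forall>t\<in>{1/4..1/2}. if endp (wordf p) i \<in> {k + 1..k + m} then (G i t, t) \<in> D else G i t = \<psi> t (real (endp (wordf p) i))"
 proof (intro ballI)
  fix i t assume i: "i \<in> {1..n}" and t: "t \<in> {1/4..1/2 :: real}"
  show "if endp (wordf p) i \<in> {k + 1..k + m} then (G i t, t) \<in> D else G i t = \<psi> t (real (endp (wordf p) i))"
  proof (cases "endp (wordf p) i \<in> {k + 1..k + m}")
   case True
   hence a: "endp (wordf p) i = k + (endp (wordf p) i - k)" "endp (wordf p) i - k \<in> {1..m}" by auto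
   show ?thesis unfolding if_P[OF True] by (rule conjunct2[OF Gin[OF i a t]])
  next
   case False
   have "F i t = real (endp (wordf p) i)" unfolding Fband[OF i t] by (rule wordf_shift_outside[OF x False])
   thus ?thesis unfolding if_not_P[OF False] G by simp
  qed
 qed
 ultimately show ?thesis using isoX X(2) unfolding \<phi>_def D_def G_def \<psi>_def by blast
qed

text \<open>Both sides of a local picture connect the strands in the same way. So the two squeezed diagrams agree outside
the box, and they are related by a move.\<close>

lemma local_equiv:
 assumes pq: "p \<in> vwords n" "q \<in> vwords n" and pic: "local_picture m l r" and km: "k + m <= n"
 shows "(word_diagram n (p @ map (shift k) l @ q), word_diagram n (p @ map (shift k) r @ q)) \<in> diagram_equiv n"
proof -
 have m: "1 <= m" using pic by (cases rule: local_picture.cases) auto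
 note v = local_picture_valid[OF pic]
 define D where "D = box_map k m ` E m"
 define G where "G = boxf p q k m"
 note sq = squeezed_diagram[OF pq _ km m, folded D_def G_def]
 obtain X where X: "isotopic n (word_diagram n (p @ map (shift k) l @ q)) X" "dg n X (G l)"
  "restrict_diagram D X = map_diagram (box_map k m) (word_diagram m l)"
  "marks (restrict_diagram (- D) X) = box_exterior n p q k m"
  "\<forall>i\<in>{1..n}. \<forall>t\<in>{1/4..1/2}. if endp (wordf p) i \<in> {k + 1..k + m} then (G l i t, t) \<in> D else G l i t = squeeze k m t (real (endp (wordf p) i))"
  using sq[OF v(1)] by (elim exE conjE) (rule that)
 obtain X' where X': "isotopic n (word_diagram n (p @ map (shift k) r @ q)) X'" "dg n X' (G r)"
  "restrict_diagram D X' = map_diagram (box_map k m) (word_diagram m r)"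
  "marks (restrict_diagram (- D) X') = box_exterior n p q k m"
  "\<forall>i\<in>{1..n}. \<forall>t\<in>{1/4..1/2}. if endp (wordf p) i \<in> {k + 1..k + m} then (G r i t, t) \<in> D else G r i t = squeeze k m t (real (endp (wordf p) i))"
  using sq[OF v(2)] by (elim exE conjE) (rule that)
 have same: "G l i t = G r i t \<or> ((G l i t, t) \<in> D & (G r i t, t) \<in> D)" if i: "i \<in> {1..n}" for i t
 proof -
  consider "t < 1/4" | "1/2 < t" | "t \<in> {1/4..1/2}" by fastforce
  thus ?thesis
  proof cases
   case 1
   thus ?thesis unfolding G_def boxf_def using local_picture_endp[OF pic, of k "endp (wordf p) i"] by (simp add: stackf_def)
  next
   case 2
   thus ?thesis unfolding G_def boxf_def by (simp add: stackf_def)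
  next
   case 3
   thus ?thesis using bspec[OF bspec[OF X(5) i] 3] bspec[OF bspec[OF X'(5) i] 3]
    by (cases "endp (wordf p) i \<in> {k + 1..k + m}") (simp_all only: if_True if_False simp_thms)
  qed
 qed
 have ext: "restrict_diagram (- D) X = restrict_diagram (- D) X'"
 proof (rule diagram_eqI)
  show "marks (restrict_diagram (- D) X) = marks (restrict_diagram (- D) X')" unfolding X(4) X'(4) ..
  have sub: "curve g \<inter> - D \<subseteq> curve g' \<inter> - D" if h: "\<And>t. g t = g' t \<or> ((g t, t) \<in> D & (g' t, t) \<in> D)" for g g'
  proof
   fix z assume z: "z \<in> curve g \<inter> - D"
   then obtain t where t: "z = (g t, t)" "t \<in> {0..1}" unfolding curve_def by blast
   have "g t = g' t" using h[of t] z t(1) by blast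
   thus "z \<in> curve g' \<inter> - D" using z t by (simp add: mem_curve)
  qed
  have "curve (G l i) \<inter> - D = curve (G r i) \<inter> - D" if i: "i \<in> {1..n}" for i
   by (intro equalityI sub) (use same[OF i] in metis)+
  hence "(%i. curve (G l i) \<inter> - D) ` {1..n} = (%i. curve (G r i) \<inter> - D) ` {1..n}" by (rule image_cong[OF HOL.refl])
  moreover have "strands X = (%i. curve (G l i)) ` {1..n}" "strands X' = (%i. curve (G r i)) ` {1..n}"
   using X(2) X'(2) by (simp_all add: dg_def)
  ultimately show "strands (restrict_diagram (- D) X) = strands (restrict_diagram (- D) X')"
   by (simp add: restrict_diagram_def image_image)
 qed
 have DE: "D \<subseteq> E n"
 proof
  fix z assume "z \<in> D"
  then obtain y u where yu: "0 <= y" "y <= real m + 1" "0 <= u" "u <= 1" "z = (real k + (real m + 1) / 4 + y / 2, 1/4 + u / 4)"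
   unfolding D_def E_def box_map_def by auto
  have "real k + real m <= real n" using km by linarith
  thus "z \<in> E n" unfolding yu(5) E_def using yu(1-4) by (simp add: field_simps)
 qed
 have "reidemeister_move n X X'"
  unfolding reidemeister_move_def
 proof (intro conjI exI)
  show "is_diagram n X" "is_diagram n X'" using dg_is_diagram X(2) X'(2) by blast+
  show "local_picture m l r" by (rule pic)
  show "isotopic m (word_diagram m l) (word_diagram m l)" "isotopic m (word_diagram m r) (word_diagram m r)"
   by (rule isotopic_refl[OF word_is_diagram]; rule v)+
  show "let \<phi> = %p. (real k + (real m + 1) / 4 + 1/2 * fst p, 1/4 + 1/4 * snd p); D = \<phi> ` E m
   in D \<subseteq> E n & restrict_diagram D X = map_diagram \<phi> (word_diagram m l) &
     restrict_diagram D X' = map_diagram \<phi> (word_diagram m r) & restrict_diagram (- D) X = restrict_diagram (- D) X'"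
   unfolding Let_def box_map_def[symmetric] D_def[symmetric] using DE X(3) X'(3) ext by blast
 qed simp_all
 hence mv: "(X, X') \<in> diagram_equiv n" by (rule move_equiv)
 have tr: "trans (diagram_equiv n)" and sy: "sym (diagram_equiv n)" using equiv_diagram_equiv[of n] by (auto elim: equivE)
 show ?thesis by (rule transD[OF tr isotopic_equiv[OF X(1)] transD[OF tr mv symD[OF sy isotopic_equiv[OF X'(1)]]]])
qed

text \<open>The converse of \<open>equivalent_words\<close>: both kinds of generators of the congruence are realised by equivalences of diagrams.\<close>

theorem lcong_equiv:
 assumes "(u, v) \<in> lcong n" shows "(word_diagram n u, word_diagram n v) \<in> diagram_equiv n"
 using assms
proof (induction rule: lcong.induct)
 case (lrefl w)
 thus ?case by (intro isotopic_equiv isotopic_refl word_is_diagram)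
next
 case (lsym u v)
 thus ?case using equiv_diagram_equiv[of n] by (meson equivE symD)
next
 case (ltrans u v w)
 thus ?case using equiv_diagram_equiv[of n] by (meson equivE transD)
next
 case (far p q l1 l2)
 thus ?case by (intro far_equiv)
next
 case (local p q m l r d)
 thus ?case by (intro local_equiv)
qed

section \<open>Presented groups\<close>

lemma words_simps [simp]:
 "[] \<in> words X"
 "(x, e) # u \<in> words X \<longleftrightarrow> x \<in> X & u \<in> words X"
 "u @ v \<in> words X \<longleftrightarrow> u \<in> words X & v \<in> words X"
 by (auto simp: words_def)

lemma word_cong_in: "(u, v) \<in> word_cong X R ==> u \<in> words X & v \<in> words X"
 by (induction rule: word_cong.induct) auto

lemma word_cong_context:
 assumes "(u, v) \<in> word_cong X R" "p \<in> words X" "q \<in> words X" shows "(p @ u @ q, p @ v @ q) \<in> word_cong X R"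
 using assms
proof (induction rule: word_cong.induct)
 case (cancel p' q' x e)
 thus ?case using word_cong.cancel[of "p @ p'" X "q' @ q" x e R] by simp
next
 case (relation p' q' u v)
 thus ?case using word_cong.relation[of "p @ p'" X "q' @ q" u v R] by simp
next
 case (refl w)
 hence "p @ w @ q \<in> words X" by simp
 thus ?case by (rule word_cong.refl)
qed (blast intro: word_cong.sym word_cong.trans)+

interpretation pg: word_congruence "words X" "word_cong X R" for X R
proof (unfold_locales; (simp; fail)?)
 show "equiv (words X) (word_cong X R)"
 proof (rule equivI)
  show "word_cong X R \<subseteq> words X \<times> words X" using word_cong_in by auto
  show "refl_on (words X) (word_cong X R)" unfolding refl_on_def using word_cong.refl by blast
  show "sym_on UNIV (word_cong X R)" by (rule symI) (rule word_cong.sym)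
  show "trans_on UNIV (word_cong X R)" by (rule transI) (rule word_cong.trans)
 qed
 show "(p @ u @ q, p @ v @ q) \<in> word_cong X R" if "(u, v) \<in> word_cong X R" "p \<in> words X" "q \<in> words X" for u v p q
  by (rule word_cong_context[OF that])
qed

lemma presented_carrier: "carrier (presented_group X R) = pg.cls X R ` words X"
 unfolding presented_group_def pg.cls_def quotient_def by auto

lemma presented_mult:
 assumes u: "u \<in> words X" and v: "v \<in> words X"
 shows "pg.cls X R u \<otimes>\<^bsub>presented_group X R\<^esub> pg.cls X R v = pg.cls X R (u @ v)"
proof -
 have "pg.cls X R (u' @ v') = pg.cls X R (u @ v)" if "u' \<in> pg.cls X R u" "v' \<in> pg.cls X R v" for u' v'
 proof -
  have "(u @ v, u' @ v') \<in> word_cong X R" using that by (intro pg.append2) (simp_all add: pg.cls_def)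
  thus ?thesis using pg.cls_eq pg.in_lists by metis
 qed
 moreover have "u \<in> pg.cls X R u" "v \<in> pg.cls X R v" using u v by (simp_all add: pg.cls_def word_cong.refl)
 ultimately have "(\<Union>u'\<in>pg.cls X R u. \<Union>v'\<in>pg.cls X R v. pg.cls X R (u' @ v')) = pg.cls X R (u @ v)" by blast
 thus ?thesis by (simp add: presented_group_def pg.cls_def)
qed

lemma presented_one: "\<one>\<^bsub>presented_group X R\<^esub> = pg.cls X R []"
 by (simp add: presented_group_def pg.cls_def)

lemma word_left_inverse:
 "u \<in> words X ==> \<exists>v\<in>words X. (v @ u, []) \<in> word_cong X R"
proof (induction u)
 case Nil
 thus ?case by (intro bexI[of _ "[]"]) (simp_all add: word_cong.refl)
next
 case (Cons y u)
 obtain x e where y: "y = (x, e)" by (cases y)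
 have x: "x \<in> X" "u \<in> words X" using Cons.prems y by simp_all
 obtain v where v: "v \<in> words X" "(v @ u, []) \<in> word_cong X R" using Cons.IH[OF x(2)] by blast
 have "(v @ [(x, \<not> e), (x, \<not> \<not> e)] @ u, v @ u) \<in> word_cong X R" by (rule word_cong.cancel[OF v(1) x(2,1)])
 hence "((v @ [(x, \<not> e)]) @ y # u, []) \<in> word_cong X R" using v(2) word_cong.trans y by fastforce
 thus ?case using v(1) x(1) by (intro bexI[of _ "v @ [(x, \<not> e)]"]) simp_all
qed

lemma presented_group_group: "group (presented_group X R)"
proof (rule groupI)
 show "\<one>\<^bsub>presented_group X R\<^esub> \<in> carrier (presented_group X R)" by (simp add: presented_one presented_carrier)
next
 fix a b assume "a \<in> carrier (presented_group X R)" "b \<in> carrier (presented_group X R)"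
 then obtain u v where uv: "u \<in> words X" "a = pg.cls X R u" "v \<in> words X" "b = pg.cls X R v"
  unfolding presented_carrier by blast
 show "a \<otimes>\<^bsub>presented_group X R\<^esub> b \<in> carrier (presented_group X R)"
  unfolding uv(2,4) presented_mult[OF uv(1,3)] presented_carrier using uv by (intro imageI) simp
next
 fix a b c assume "a \<in> carrier (presented_group X R)" "b \<in> carrier (presented_group X R)" "c \<in> carrier (presented_group X R)"
 then obtain u v w where uv: "u \<in> words X" "a = pg.cls X R u" "v \<in> words X" "b = pg.cls X R v" "w \<in> words X" "c = pg.cls X R w"
  unfolding presented_carrier by blast
 show "a \<otimes>\<^bsub>presented_group X R\<^esub> b \<otimes>\<^bsub>presented_group X R\<^esub> c = a \<otimes>\<^bsub>presented_group X R\<^esub> (b \<otimes>\<^bsub>presented_group X R\<^esub> c)"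
  using uv by (simp add: presented_mult)
next
 fix a assume "a \<in> carrier (presented_group X R)"
 then obtain u where u: "u \<in> words X" "a = pg.cls X R u" unfolding presented_carrier by blast
 show "\<one>\<^bsub>presented_group X R\<^esub> \<otimes>\<^bsub>presented_group X R\<^esub> a = a"
  using u by (simp add: presented_mult presented_one)
 obtain v where v: "v \<in> words X" "(v @ u, []) \<in> word_cong X R" using word_left_inverse[OF u(1)] by blast
 have "pg.cls X R v \<otimes>\<^bsub>presented_group X R\<^esub> a = \<one>\<^bsub>presented_group X R\<^esub>"
  unfolding u(2) presented_mult[OF v(1) u(1)] presented_one using v u by (subst pg.cls_eq) simp_all
 thus "\<exists>b\<in>carrier (presented_group X R). b \<otimes>\<^bsub>presented_group X R\<^esub> a = \<one>\<^bsub>presented_group X R\<^esub>"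
  using v(1) presented_carrier by blast
qed

section \<open>The reduced presentation\<close>

fun letter_of :: "gen \<times> bool => letter" where
 "letter_of (Sigma1, e) = Cr (if e then Pos else Neg) 1"
| "letter_of (Gamma1, e) = Bar 1"
| "letter_of (V i, e) = Cr Virt i"

lemma generators_iff:
 "Gamma1 \<in> tvb_generators n" "Sigma1 \<in> tvb_generators n \<longleftrightarrow> 2 <= n" "V i \<in> tvb_generators n \<longleftrightarrow> 1 <= i & i < n"
 by (auto simp: tvb_generators_def)

lemma letter_of_words: "1 <= n ==> u \<in> words (tvb_generators n) ==> map letter_of u \<in> vwords n"
proof (induction u)
 case (Cons y u)
 obtain x e where y: "y = (x, e)" by (cases y)
 show ?case using Cons unfolding y by (cases x) (auto simp: generators_iff)
qed simp

abbreviation tc :: "nat => (gen word \<times> gen word) set" where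
 "tc n \<equiv> word_cong (tvb_generators n) (tvb_relations n)"

text \<open>A representation in a monoid of all the letters and of the relations between them.\<close>

locale letter_monoid =
 fixes n :: nat and A :: "letter => 'a::monoid_mult"
 assumes far: "valid n x ==> valid n y ==> supp x \<inter> supp y = {} ==> A x * A y = A y * A x"
  and local: "local_picture m l r ==> d + m <= n ==>
    prod_list (map A (map (shift d) l)) = prod_list (map A (map (shift d) r))"
begin

abbreviation "v i \<equiv> A (Cr Virt i)"
abbreviation "s i \<equiv> A (Cr Pos i)"
abbreviation "b i \<equiv> A (Bar i)"

lemma vv: "1 <= i ==> i < n ==> v i * v i = 1"
 using local[OF V2, of "i - 1"] by simp

lemma vvx: "1 <= i ==> i < n ==> v i * (v i * x) = x"
 by (simp only: mult.assoc[symmetric] vv mult_1_left)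

lemma bb: "1 <= i ==> i <= n ==> b i * b i = 1"
 using local[OF T2, of "i - 1"] by simp

lemma vbraid: "1 <= i ==> i + 1 < n ==> v i * v (i + 1) * v i = v (i + 1) * v i * v (i + 1)"
 using local[OF V3, of "i - 1"] by (simp add: mult.assoc)

lemma sbraid: "1 <= i ==> i + 1 < n ==> s i * s (i + 1) * s i = s (i + 1) * s i * s (i + 1)"
 using local[OF R3[of Pos Pos Pos], of "i - 1"] by (simp add: mult.assoc)

lemma inverse: "1 <= i ==> i < n ==> s i * A (Cr Neg i) = 1" "1 <= i ==> i < n ==> A (Cr Neg i) * s i = 1"
 using local[OF R2_pos_neg, of "i - 1"] local[OF R2_neg_pos, of "i - 1"] by simp_all

lemma next_crossing:
 assumes i: "1 <= i" "i + 1 < n"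
 shows "A (Cr k (i + 1)) = v i * v (i + 1) * A (Cr k i) * v (i + 1) * v i"
proof (cases "k = Virt")
 case True
 have "v i * v (i + 1) * v i * v (i + 1) * v i = v (i + 1) * v i * (v (i + 1) * v (i + 1)) * v i"
  unfolding vbraid[OF i] by (simp only: mult.assoc)
 also have "... = v (i + 1)" using vv[of "i + 1"] vv[of i] i by (simp add: mult.assoc)
 finally show ?thesis unfolding True by simp
next
 case False
 have "v i * v (i + 1) * A (Cr k i) = A (Cr k (i + 1)) * v i * v (i + 1)"
  using local[OF V4_strand1[OF False], of "i - 1"] i by (simp add: mult.assoc)
 hence "v i * v (i + 1) * A (Cr k i) * v (i + 1) * v i = A (Cr k (i + 1)) * v i * (v (i + 1) * v (i + 1)) * v i"
  by (simp only: mult.assoc)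
 also have "... = A (Cr k (i + 1))"
 proof -
  have one: "v (i + 1) * v (i + 1) = 1" "v i * v i = 1" using vv[of "i + 1"] vv[of i] i by auto
  show ?thesis by (simp only: one mult_1_right mult_1_left mult.assoc)
 qed
 finally show ?thesis by (rule HOL.sym)
qed

lemma conj_crossing:
 assumes i: "1 <= i" "i + 1 < n"
 shows "v i * s (i + 1) * v i = v (i + 1) * s i * v (i + 1)"
 using local[OF V4_strand2[of Pos], of "i - 1"] i by (simp add: mult.assoc)

lemma bar_slide:
 assumes i: "1 <= i" "i < n"
 shows "b i * v i = v i * b (i + 1)" "b (i + 1) * v i = v i * b i"
 using local[OF T1_left, of "i - 1"] local[OF T1_right, of "i - 1"] i by simp_all

lemma next_bar:
 assumes i: "1 <= i" "i < n" shows "b (i + 1) = v i * b i * v i"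
 using bar_slide[OF i] vvx[OF i] by (simp add: mult.assoc)

lemma bars_crossing:
 assumes i: "1 <= i" "i < n"
 shows "b (i + 1) * b i * s i * b i * b (i + 1) = v i * s i * v i"
 using local[OF T3[of Pos], of "i - 1"] i by (simp add: mult.assoc)

text \<open>The element \<open>v\<^sub>2 v\<^sub>3 v\<^sub>1 v\<^sub>2 s\<^sub>1 v\<^sub>2 v\<^sub>1 v\<^sub>3 v\<^sub>2\<close> is \<open>s\<^sub>3\<close>, \<open>v\<^sub>1 v\<^sub>2 s\<^sub>1 v\<^sub>2 v\<^sub>1\<close> is \<open>s\<^sub>2\<close>, and \<open>v\<^sub>1 b\<^sub>1 v\<^sub>1\<close> is \<open>b\<^sub>2\<close>. So these relations
exchange distant letters. The long braid relation is the one for \<open>s\<^sub>1\<close> and \<open>s\<^sub>2\<close>, conjugated by \<open>v\<^sub>1\<close>, since \<open>v\<^sub>2 s\<^sub>1 v\<^sub>2 = v\<^sub>1 s\<^sub>2 v\<^sub>1\<close>. The last relation is the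
move T3.\<close>

lemma reduced_relation:
 assumes R: "(u, w) \<in> tvb_relations n" and n: "1 <= n"
 shows "prod_list (map A (map letter_of u)) = prod_list (map A (map letter_of w))"
proof -
 have W: "u \<in> words (tvb_generators n)" "w \<in> words (tvb_generators n)" and all: "(u, w) \<in> all_relations"
  using R by (auto simp: tvb_relations_def)
 note gi = generators_iff
 from all[unfolded all_relations_def] show ?thesis
 proof (elim UnE, goal_cases)
  case 1
  then obtain i where 1: "u = [\<nu> i, \<nu> i]" "w = []" by blast
  show ?thesis using W 1 vv[of i] by (simp add: gi)
 next
  case 2
  then obtain i j where 2: "u = [\<nu> i, \<nu> j]" "w = [\<nu> j, \<nu> i]" "\<bar>int i - int j\<bar> > 1" by blast
  have "supp (Cr Virt i) \<inter> supp (Cr Virt j) = {}" using 2 by auto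
  thus ?thesis using W 2 far[of "Cr Virt i" "Cr Virt j"] by (simp add: gi)
 next
  case 3
  then obtain i where 3: "u = [\<nu> i, \<nu> (i + 1), \<nu> i]" "w = [\<nu> (i + 1), \<nu> i, \<nu> (i + 1)]" by blast
  show ?thesis using W 3 vbraid[of i] by (simp add: gi mult.assoc)
 next
  case 4
  hence 4: "u = [\<sigma>1, \<nu> 2, \<nu> 3, \<nu> 1, \<nu> 2, \<sigma>1, \<nu> 2, \<nu> 1, \<nu> 3, \<nu> 2]" "w = [\<nu> 2, \<nu> 3, \<nu> 1, \<nu> 2, \<sigma>1, \<nu> 2, \<nu> 1, \<nu> 3, \<nu> 2, \<sigma>1]" by simp_all
  have n: "3 < n" using W 4 by (simp add: gi)
  have S2: "s 2 = v 1 * v 2 * s 1 * v 2 * v 1" using next_crossing[of 1 Pos] n by (simp add: numeral_2_eq_2)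
  have S3: "s 3 = v 2 * v 3 * s 2 * v 3 * v 2" using next_crossing[of 2 Pos] n by simp
  have "s 1 * s 3 = s 3 * s 1" by (rule far) (use n in auto)
  thus ?thesis unfolding 4 S3 S2 by (simp add: mult.assoc)
 next
  case 5
  hence 5: "u = [\<nu> 1, \<sigma>1, \<nu> 1, \<nu> 2, \<sigma>1, \<nu> 2, \<nu> 1, \<sigma>1, \<nu> 1]" "w = [\<nu> 2, \<sigma>1, \<nu> 2, \<nu> 1, \<sigma>1, \<nu> 1, \<nu> 2, \<sigma>1, \<nu> 2]" by simp_all
  have n: "2 < n" using W 5 by (simp add: gi)
  have c: "v 2 * s 1 * v 2 = v 1 * s 2 * v 1" using conj_crossing[of 1] n by (simp add: numeral_2_eq_2)
  have B: "s 1 * s 2 * s 1 = s 2 * s 1 * s 2" using sbraid[of 1] n by (simp add: numeral_2_eq_2)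
  have x: "v 1 * (v 1 * y) = y" for y using vvx[of 1 y] n by simp
  have "(v 1 * s 1 * v 1) * (v 2 * s 1 * v 2) * (v 1 * s 1 * v 1) = v 1 * (s 1 * s 2 * s 1) * v 1"
   unfolding c by (simp only: mult.assoc x)
  also have "... = (v 2 * s 1 * v 2) * (v 1 * s 1 * v 1) * (v 2 * s 1 * v 2)"
   unfolding c B by (simp only: mult.assoc x)
  finally show ?thesis unfolding 5 by (simp add: mult.assoc)
 next
  case 6
  then obtain j where 6: "u = [\<sigma>1, \<nu> j]" "w = [\<nu> j, \<sigma>1]" "j >= 3" by blast
  show ?thesis using W 6 far[of "Cr Pos 1" "Cr Virt j"] by (simp add: gi)
 next
  case 7
  hence 7: "u = [\<gamma>1, \<gamma>1]" "w = []" by simp_all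
  show ?thesis using 7 bb[of 1] n by simp
 next
  case 8
  then obtain j where 8: "u = [\<gamma>1, \<nu> j]" "w = [\<nu> j, \<gamma>1]" "j >= 2" by blast
  show ?thesis using W 8 far[of "Bar 1" "Cr Virt j"] by (simp add: gi)
 next
  case 9
  hence 9: "u = [\<gamma>1, \<nu> 1, \<gamma>1, \<nu> 1]" "w = [\<nu> 1, \<gamma>1, \<nu> 1, \<gamma>1]" by simp_all
  have n: "1 < n" using W 9 by (simp add: gi)
  have "b 2 = v 1 * b 1 * v 1" using next_bar[of 1] n by (simp add: numeral_2_eq_2)
  moreover have "b 1 * b 2 = b 2 * b 1" by (rule far) (use n in auto)
  ultimately show ?thesis unfolding 9 by (simp add: mult.assoc)
 next
  case 10
  hence 10: "u = [\<gamma>1, \<nu> 1, \<nu> 2, \<sigma>1, \<nu> 2, \<nu> 1]" "w = [\<nu> 1, \<nu> 2, \<sigma>1, \<nu> 2, \<nu> 1, \<gamma>1]" by simp_all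
  have n: "2 < n" using W 10 by (simp add: gi)
  have S2: "s 2 = v 1 * v 2 * s 1 * v 2 * v 1" using next_crossing[of 1 Pos] n by (simp add: numeral_2_eq_2)
  have "b 1 * s 2 = s 2 * b 1" by (rule far) (use n in auto)
  thus ?thesis unfolding 10 S2 by (simp add: mult.assoc)
 next
  case 11
  hence 11: "u = [\<gamma>1, \<nu> 1, \<gamma>1, \<sigma>1, \<gamma>1, \<nu> 1, \<gamma>1]" "w = [\<sigma>1]" by simp_all
  have n: "1 < n" using W 11 by (simp add: gi)
  have x: "v 1 * (v 1 * y) = y" for y using vvx[of 1 y] n by simp
  have sl: "b 1 * v 1 = v 1 * b 2" "v 1 * b 1 = b 2 * v 1" using bar_slide[of 1] n by (simp_all add: numeral_2_eq_2)
  have bs: "b 2 * b 1 * s 1 * b 1 * b 2 = v 1 * s 1 * v 1" using bars_crossing[of 1] n by (simp add: numeral_2_eq_2)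
  have "b 1 * v 1 * b 1 * s 1 * b 1 * (v 1 * b 1) = v 1 * (b 2 * b 1 * s 1 * b 1 * b 2) * v 1"
   unfolding sl by (simp only: mult.assoc)
  also have "... = s 1" unfolding bs using vv[of 1] n by (simp only: mult.assoc x mult_1_right)
  finally show ?thesis unfolding 11 by (simp add: mult.assoc)
 qed
qed

end

abbreviation lact1 :: "nat => letter => (letter list set) endo" where
 "lact1 n x \<equiv> lc.act n [x]"

lemma local_words:
 assumes "local_picture m l r" "d + m <= n" shows "map (shift d) l \<in> vwords n" "map (shift d) r \<in> vwords n"
 using lcong_in[OF lcong.local[of "[]" n "[]" m l r d]] assms by simp_all

interpretation lm: letter_monoid n "lact1 n" for n
proof
 show "lact1 n x * lact1 n y = lact1 n y * lact1 n x" if v: "valid n x" "valid n y" and s: "supp x \<inter> supp y = {}" for x y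
 proof -
  have "([x, y], [y, x]) \<in> lcong n" using lcong.far[of "[]" n "[]" x y] v s by simp
  hence "lc.act n ([x] @ [y]) = lc.act n ([y] @ [x])" by (subst lc.act_eq_iff) (use v in simp_all)
  thus ?thesis using v by (simp add: lc.act_append del: append.simps)
 qed
 show "prod_list (map (lact1 n) (map (shift d) l)) = prod_list (map (lact1 n) (map (shift d) r))"
  if p: "local_picture m l r" and d: "d + m <= n" for m l r d
 proof -
  note w = local_words[OF p d]
  have "(map (shift d) l, map (shift d) r) \<in> lcong n" using lcong.local[of "[]" n "[]" m l r d] p d by simp
  hence "lc.act n (map (shift d) l) = lc.act n (map (shift d) r)" by (subst lc.act_eq_iff) (use w in simp_all)
  thus ?thesis unfolding lc.act_prod[OF w(1)] lc.act_prod[OF w(2)] .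
 qed
qed

lemma lcong_if_presented:
 assumes "(u, w) \<in> tc n" and n: "1 <= n" shows "(map letter_of u, map letter_of w) \<in> lcong n"
 using assms(1)
proof (induction rule: word_cong.induct)
 case (refl w)
 thus ?case by (intro lcong.lrefl letter_of_words[OF n])
next
 case (sym u v)
 thus ?case by (blast intro: lcong.lsym)
next
 case (trans u v w)
 thus ?case by (blast intro: lcong.ltrans)
next
 case (cancel p q x e)
 have "([letter_of (x, e), letter_of (x, \<not> e)], []) \<in> lcong n"
 proof -
  have w: "map letter_of [(x, e), (x, \<not> e)] \<in> vwords n" by (rule letter_of_words[OF n]) (use cancel in simp)
  have "lact1 n (letter_of (x, e)) * lact1 n (letter_of (x, \<not> e)) = 1"
   using cancel(3) lm.vv[of _ n] lm.bb[of 1 n] lm.inverse[of 1 n] n by (cases x) (auto simp: generators_iff)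
  hence "lc.act n [letter_of (x, e), letter_of (x, \<not> e)] = lc.act n []"
   using w by (simp add: lc.act_prod[of "[_, _]"] lc.act_Nil)
  thus ?thesis using w by (subst (asm) lc.act_eq_iff) simp_all
 qed
 from lcong_context[OF this letter_of_words[OF n cancel(1)] letter_of_words[OF n cancel(2)]]
 show ?case by simp
next
 case (relation p q u v)
 have "lc.act n (map letter_of u) = lc.act n (map letter_of v)"
  unfolding lc.act_prod[OF letter_of_words[OF n relation(3)]] lc.act_prod[OF letter_of_words[OF n relation(4)]]
  by (rule lm.reduced_relation[OF relation(5) n])
 hence "(map letter_of u, map letter_of v) \<in> lcong n"
  using lc.act_eq_iff[OF letter_of_words[OF n relation(3)] letter_of_words[OF n relation(4)]] by simp
 from lcong_context[OF this letter_of_words[OF n relation(1)] letter_of_words[OF n relation(2)]]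
 show ?case by simp
qed

abbreviation pact :: "nat => gen word => (gen word set) endo" where
 "pact n \<equiv> pg.act (tvb_generators n) (tvb_relations n)"

lemma pact_relation:
 assumes "(u, w) \<in> all_relations" "u \<in> words (tvb_generators n)" "w \<in> words (tvb_generators n)"
 shows "prod_list (map (%x. pact n [x]) u) = prod_list (map (%x. pact n [x]) w)"
proof -
 have "(u, w) \<in> tc n"
  using word_cong.relation[of "[]" "tvb_generators n" "[]" u w "tvb_relations n"] assms by (simp add: tvb_relations_def)
 hence "pact n u = pact n w" using pg.act_eq_iff[OF assms(2,3)] by blast
 thus ?thesis unfolding pg.act_prod[OF assms(2)] pg.act_prod[OF assms(3)] .
qed

lemma pact_cancel:
 assumes "x \<in> tvb_generators n" shows "pact n [(x, e)] * pact n [(x, \<not> e)] = 1"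
proof -
 have "([(x, e), (x, \<not> e)], []) \<in> tc n"
  using word_cong.cancel[of "[]" "tvb_generators n" "[]" x e "tvb_relations n"] assms by simp
 hence "pact n [(x, e), (x, \<not> e)] = pact n []" by (subst pg.act_eq_iff) (use assms in simp_all)
 thus ?thesis using assms by (simp add: pg.act_prod[of "[_, _]"] pg.act_Nil)
qed

lemma presented_reduced_relations:
 "reduced_relations n (%i. pact n [\<nu> i]) (pact n [\<sigma>1]) (pact n [(Sigma1, False)]) (pact n [\<gamma>1])"
proof (unfold_locales, goal_cases)
 case (1 i) thus ?case
  using pact_relation[of "[\<nu> i, \<nu> i]" "[]" n] by (simp add: generators_iff all_relations_def)
next
 case (2 i j) thus ?case
  using pact_relation[of "[\<nu> i, \<nu> j]" "[\<nu> j, \<nu> i]" n] by (simp add: generators_iff all_relations_def)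
next
 case (3 i) thus ?case
  using pact_relation[of "[\<nu> i, \<nu> (i + 1), \<nu> i]" "[\<nu> (i + 1), \<nu> i, \<nu> (i + 1)]" n]
  by (simp add: generators_iff all_relations_def mult.assoc)
next
 case 4 thus ?case using pact_cancel[of Sigma1 n True] by (simp add: generators_iff)
next
 case 5 thus ?case using pact_cancel[of Sigma1 n False] by (simp add: generators_iff)
next
 case 6 thus ?case
  using pact_relation[of "[\<sigma>1] @ [\<nu> 2, \<nu> 3, \<nu> 1, \<nu> 2, \<sigma>1, \<nu> 2, \<nu> 1, \<nu> 3, \<nu> 2]" "[\<nu> 2, \<nu> 3, \<nu> 1, \<nu> 2, \<sigma>1, \<nu> 2, \<nu> 1, \<nu> 3, \<nu> 2] @ [\<sigma>1]" n]
  by (simp add: generators_iff all_relations_def mult.assoc)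
next
 case 7 thus ?case
  using pact_relation[of "[\<nu> 1, \<sigma>1, \<nu> 1] @ [\<nu> 2, \<sigma>1, \<nu> 2] @ [\<nu> 1, \<sigma>1, \<nu> 1]" "[\<nu> 2, \<sigma>1, \<nu> 2] @ [\<nu> 1, \<sigma>1, \<nu> 1] @ [\<nu> 2, \<sigma>1, \<nu> 2]" n]
  by (simp add: generators_iff all_relations_def mult.assoc)
next
 case (8 j) thus ?case
  using pact_relation[of "[\<sigma>1, \<nu> j]" "[\<nu> j, \<sigma>1]" n] by (simp add: generators_iff all_relations_def)
next
 case 9 thus ?case
  using pact_relation[of "[\<gamma>1, \<gamma>1]" "[]" n] by (simp add: generators_iff all_relations_def)
next
 case (10 j) thus ?case
  using pact_relation[of "[\<gamma>1, \<nu> j]" "[\<nu> j, \<gamma>1]" n] by (simp add: generators_iff all_relations_def)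
next
 case 11 thus ?case
  using pact_relation[of "[\<gamma>1, \<nu> 1, \<gamma>1, \<nu> 1]" "[\<nu> 1, \<gamma>1, \<nu> 1, \<gamma>1]" n]
  by (simp add: generators_iff all_relations_def mult.assoc)
next
 case 12 thus ?case
  using pact_relation[of "[\<gamma>1, \<nu> 1, \<nu> 2, \<sigma>1, \<nu> 2, \<nu> 1]" "[\<nu> 1, \<nu> 2, \<sigma>1, \<nu> 2, \<nu> 1, \<gamma>1]" n]
  by (simp add: generators_iff all_relations_def mult.assoc)
next
 case 13 thus ?case
  using pact_relation[of "[\<gamma>1, \<nu> 1, \<gamma>1, \<sigma>1, \<gamma>1, \<nu> 1, \<gamma>1]" "[\<sigma>1]" n]
  by (simp add: generators_iff all_relations_def mult.assoc)
qed

text \<open>The presented group satisfies the reduced relations. Hence it satisfies the relations among all letters when these are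
evaluated in it, and evaluation of the letters of a word in the generators gives back the word.\<close>

lemma presented_if_lcong:
 assumes uw: "u \<in> words (tvb_generators n)" "w \<in> words (tvb_generators n)"
  and l: "(map letter_of u, map letter_of w) \<in> lcong n"
 shows "(u, w) \<in> tc n"
proof -
 interpret r: reduced_relations n "%i. pact n [\<nu> i]" "pact n [\<sigma>1]" "pact n [(Sigma1, False)]" "pact n [\<gamma>1]"
  by (rule presented_reduced_relations)
 have inv: "pact n [(x, False)] = pact n [(x, True)]" if "x \<in> tvb_generators n" "pact n [(x, True)] * pact n [(x, True)] = 1" for x
  by (rule inverse_unique'[of "pact n [(x, True)]"]) (use pact_cancel[OF that(1), of True] that(2) in simp_all)
 have letter: "r.ev (letter_of y) = pact n [y]" if y: "[y] \<in> words (tvb_generators n)" for y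
 proof -
  obtain x e where xe: "y = (x, e)" by (cases y)
  have x: "x \<in> tvb_generators n" using y xe by simp
  show ?thesis
  proof (cases x)
   case Sigma1
   thus ?thesis unfolding xe by (cases e) simp_all
  next
   case Gamma1
   thus ?thesis unfolding xe using inv[OF x] r.gg by (cases e) simp_all
  next
   case (V i)
   hence "1 <= i" "i < n" using x by (simp_all add: generators_iff)
   thus ?thesis unfolding xe V using inv[OF x] r.vv[of i] V by (cases e) simp_all
  qed
 qed
 have word: "r.evs (map letter_of u) = pact n u" if "u \<in> words (tvb_generators n)" for u
  using that
 proof (induction u)
  case Nil
  thus ?case by (simp add: r.evs_def pg.act_Nil)
 next
  case (Cons y u)
  have y: "[y] \<in> words (tvb_generators n)" "u \<in> words (tvb_generators n)"
   using Cons.prems pg.append_in[of "[y]" u] by simp_all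
  have "pact n (y # u) = pact n [y] * pact n u" using pg.act_append[OF y] by simp
  thus ?case using Cons.IH[OF y(2)] letter[OF y(1)] by (simp add: r.evs_def del: r.ev.simps)
 qed
 have "pact n u = pact n w" using r.evs_lcong[OF l] word uw by simp
 thus ?thesis using pg.act_eq_iff[OF uw] by blast
qed

lemma letter_word_reduced:
 assumes n: "1 <= n" and x: "valid n x"
 shows "\<exists>u\<in>words (tvb_generators n). lc.act n (map letter_of u) = lact1 n x"
proof -
 let ?W = "words (tvb_generators n)"
 have app: "lc.act n (map letter_of (u @ w)) = lc.act n (map letter_of u) * lc.act n (map letter_of w)" if "u \<in> ?W" "w \<in> ?W" for u w
  using lc.act_append[OF letter_of_words[OF n that(1)] letter_of_words[OF n that(2)]] by simp
 have cr: "1 <= i ==> i < n ==> \<exists>u\<in>?W. lc.act n (map letter_of u) = lact1 n (Cr k i)" for k i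
 proof (induction i rule: nat_induct_at_least)
  case base
  have "map letter_of [if k = Virt then \<nu> 1 else (Sigma1, k = Pos)] = [Cr k 1]" by (cases k) simp_all
  thus ?case using base
   by (intro bexI[of _ "[if k = Virt then \<nu> 1 else (Sigma1, k = Pos)]"]) (simp_all add: generators_iff)
 next
  case (Suc i)
  obtain u where u: "u \<in> ?W" "lc.act n (map letter_of u) = lact1 n (Cr k i)" using Suc by auto
  have i: "1 <= i" "i + 1 < n" using Suc by simp_all
  have V: "[\<nu> i] \<in> ?W" "[\<nu> (i + 1)] \<in> ?W" using i by (simp_all add: generators_iff)
  have "lc.act n (map letter_of ([\<nu> i] @ [\<nu> (i + 1)] @ u @ [\<nu> (i + 1)] @ [\<nu> i])) = lact1 n (Cr k (i + 1))"
   unfolding lm.next_crossing[OF i, of k] using u V by (simp add: app mult.assoc del: append.simps map_append)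
  thus ?case using u V by (intro bexI[of _ "[\<nu> i] @ [\<nu> (i + 1)] @ u @ [\<nu> (i + 1)] @ [\<nu> i]"]) simp_all
 qed
 have br: "1 <= i ==> i <= n ==> \<exists>u\<in>?W. lc.act n (map letter_of u) = lact1 n (Bar i)" for i
 proof (induction i rule: nat_induct_at_least)
  case base
  thus ?case by (intro bexI[of _ "[\<gamma>1]"]) (simp_all add: generators_iff)
 next
  case (Suc i)
  obtain u where u: "u \<in> ?W" "lc.act n (map letter_of u) = lact1 n (Bar i)" using Suc by auto
  have i: "1 <= i" "i < n" using Suc by simp_all
  have V: "[\<nu> i] \<in> ?W" using i by (simp add: generators_iff)
  have "lc.act n (map letter_of ([\<nu> i] @ u @ [\<nu> i])) = lact1 n (Bar (i + 1))"
   unfolding lm.next_bar[OF i] using u V by (simp add: app mult.assoc del: append.simps map_append)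
  thus ?case using u V by (intro bexI[of _ "[\<nu> i] @ u @ [\<nu> i]"]) simp_all
 qed
 show ?thesis using x cr br by (cases x) auto
qed

text \<open>Every letter is congruent to a word in the reduced generators, by induction on its position.\<close>

lemma lcong_reduced:
 assumes n: "1 <= n" and w: "w \<in> vwords n"
 shows "\<exists>u\<in>words (tvb_generators n). (w, map letter_of u) \<in> lcong n"
 using w
proof (induction w)
 case Nil
 thus ?case by (intro bexI[of _ "[]"]) (simp_all add: lcong.lrefl)
next
 case (Cons x w)
 obtain u where u: "u \<in> words (tvb_generators n)" "(w, map letter_of u) \<in> lcong n" using Cons by auto
 have x: "valid n x" using Cons.prems by simp
 obtain y where y: "y \<in> words (tvb_generators n)" "lc.act n (map letter_of y) = lact1 n x"
  using letter_word_reduced[OF n x] by blast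
 have "([x], map letter_of y) \<in> lcong n"
  using lc.act_eq_iff[of "[x]" n "map letter_of y"] x letter_of_words[OF n y(1)] y(2) by simp
 hence "([x] @ w, map letter_of y @ map letter_of u) \<in> lcong n" by (rule lc.append2[OF _ u(2)])
 thus ?case using y(1) u(1) by (intro bexI[of _ "y @ u"]) simp_all
qed

section \<open>The isomorphism\<close>

abbreviation dclass :: "nat => diagram => diagram set" where
 "dclass n b \<equiv> diagram_equiv n `` {b}"

lemma dclass_eq_iff:
 assumes "is_diagram n b" "is_diagram n b'" shows "dclass n b = dclass n b' \<longleftrightarrow> (b, b') \<in> diagram_equiv n"
 using eq_equiv_class_iff[OF equiv_diagram_equiv] assms by blast

lemma dclass_word:
 assumes "is_diagram n b" "reads b w" shows "dclass n b = dclass n (word_diagram n w)"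
 using dclass_eq_iff[OF assms(1) word_is_diagram[OF reads_valid[OF assms]]] isotopic_equiv[OF isotopic_word_diagram[OF assms]] by blast

lemma dclass_word_iff:
 assumes "u \<in> vwords n" "w \<in> vwords n"
 shows "dclass n (word_diagram n u) = dclass n (word_diagram n w) \<longleftrightarrow> (u, w) \<in> lcong n"
 unfolding dclass_eq_iff[OF word_is_diagram[OF assms(1)] word_is_diagram[OF assms(2)]]
 using equivalent_words[OF _ reads_word[OF assms(1)] reads_word[OF assms(2)]] lcong_equiv by blast

lemma TVB_carrier: "carrier (TVB n) = (%w. dclass n (word_diagram n w)) ` vwords n"
proof -
 have "carrier (TVB n) = dclass n ` {b. is_diagram n b}" by (auto simp: TVB_def quotient_def)
 also have "... = (%w. dclass n (word_diagram n w)) ` vwords n"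
 proof (intro equalityI subsetI)
  fix A assume "A \<in> dclass n ` {b. is_diagram n b}"
  then obtain b where b: "is_diagram n b" "A = dclass n b" by blast
  obtain w where w: "reads b w" using ex_reads[OF b(1)] by blast
  show "A \<in> (%w. dclass n (word_diagram n w)) ` vwords n"
   unfolding b(2) dclass_word[OF b(1) w] by (rule imageI[OF reads_valid[OF b(1) w]])
 next
  fix A assume "A \<in> (%w. dclass n (word_diagram n w)) ` vwords n"
  thus "A \<in> dclass n ` {b. is_diagram n b}" using word_is_diagram by blast
 qed
 finally show ?thesis .
qed

lemma TVB_mult:
 assumes u: "u \<in> vwords n" and v: "v \<in> vwords n"
 shows "dclass n (word_diagram n u) \<otimes>\<^bsub>TVB n\<^esub> dclass n (word_diagram n v) = dclass n (word_diagram n (u @ v))"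
proof -
 have same: "dclass n (stack b c) = dclass n (word_diagram n (u @ v))"
  if b: "b \<in> dclass n (word_diagram n u)" and c: "c \<in> dclass n (word_diagram n v)" for b c
 proof -
  have e: "(word_diagram n u, b) \<in> diagram_equiv n" "(word_diagram n v, c) \<in> diagram_equiv n" using b c by simp_all
  hence d: "is_diagram n b" "is_diagram n c" by (simp_all add: diagram_equiv_def)
  obtain u' v' where r: "reads b u'" "reads c v'" using ex_reads d by metis
  have "(u, u') \<in> lcong n" "(v, v') \<in> lcong n"
   using equivalent_words[OF e(1) reads_word[OF u] r(1)] equivalent_words[OF e(2) reads_word[OF v] r(2)] by blast+
  hence l: "(u @ v, u' @ v') \<in> lcong n" by (rule lc.append2)
  have "dclass n (stack b c) = dclass n (word_diagram n (u' @ v'))"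
   by (rule dclass_word[OF is_diagram_stack[OF d] reads_stack[OF d(1) r(1) d(2) r(2)]])
  thus ?thesis using l dclass_word_iff lcong_in[OF l] by blast
 qed
 have "word_diagram n u \<in> dclass n (word_diagram n u)" "word_diagram n v \<in> dclass n (word_diagram n v)"
  using equiv_class_self[OF equiv_diagram_equiv] word_is_diagram u v by blast+
 hence "(\<Union>b\<in>dclass n (word_diagram n u). \<Union>c\<in>dclass n (word_diagram n v). dclass n (stack b c)) = dclass n (word_diagram n (u @ v))"
  using same by blast
 thus ?thesis by (simp add: TVB_def)
qed

lemma TVB_one: "\<one>\<^bsub>TVB n\<^esub> = dclass n (word_diagram n [])"
 by (simp add: TVB_def)

lemma gen_class_word:
 assumes "1 <= n" "x \<in> tvb_generators n" shows "gen_class n x = dclass n (word_diagram n [letter_of (x, True)])"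
proof -
 have v: "valid n (letter_of (x, True))" using letter_of_words[OF assms(1), of "[(x, True)]"] assms(2) by simp
 have g: "gen_diagram n x = letter_diagram n (letter_of (x, True))" by (cases x) simp_all
 have "reads (letter_diagram n (letter_of (x, True))) [letter_of (x, True)]"
  unfolding reads_def data_letter[OF v] by (intro exI[of _ "[1/2]"]) simp
 thus ?thesis unfolding gen_class_def g by (rule dclass_word[OF dg_is_diagram[OF dg_letter[OF v]]])
qed

theorem theorem6p1:
 fixes n :: nat
 assumes "n \<ge> 1"
 shows "has_presentation (TVB n) (tvb_generators n) (tvb_relations n) (gen_class n)"
proof -
 let ?X = "tvb_generators n" and ?R = "tvb_relations n"
 let ?P = "presented_group ?X ?R" and ?T = "TVB n"
 let ?c = "pg.cls ?X ?R" and ?d = "%u. dclass n (word_diagram n (map letter_of u))"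
 note vw = letter_of_words[OF assms]
 \<comment> \<open>All words in a class have the same value under \<open>?d\<close>, so the union is this value.\<close>
 define h where "h = (%A. \<Union>u\<in>A. ?d u)"
 have iff: "?d u = ?d w \<longleftrightarrow> ?c u = ?c w" if "u \<in> words ?X" "w \<in> words ?X" for u w
  using dclass_word_iff[OF vw[OF that(1)] vw[OF that(2)]] pg.cls_eq[OF that]
   presented_if_lcong[OF that] lcong_if_presented[OF _ assms, of u w] by blast
 have h: "h (?c u) = ?d u" if u: "u \<in> words ?X" for u
 proof -
  have "?d u' = ?d u" if "u' \<in> ?c u" for u'
  proof -
   have e: "(u, u') \<in> tc n" using that by (simp add: pg.cls_def)
   thus ?thesis using iff pg.cls_eq word_cong_in[OF e] by metis
  qed
  moreover have "u \<in> ?c u" using u by (simp add: pg.cls_def word_cong.refl)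
  ultimately show ?thesis unfolding h_def by blast
 qed
 have hom: "h \<in> hom ?P ?T"
 proof (rule homI)
  fix A assume "A \<in> carrier ?P"
  then obtain u where u: "u \<in> words ?X" "A = ?c u" unfolding presented_carrier by blast
  show "h A \<in> carrier ?T" unfolding u(2) h[OF u(1)] TVB_carrier by (rule imageI[OF vw[OF u(1)]])
 next
  fix A B assume "A \<in> carrier ?P" "B \<in> carrier ?P"
  then obtain u w where u: "u \<in> words ?X" "A = ?c u" and w: "w \<in> words ?X" "B = ?c w" unfolding presented_carrier by blast
  have uw: "u @ w \<in> words ?X" using u w by simp
  show "h (A \<otimes>\<^bsub>?P\<^esub> B) = h A \<otimes>\<^bsub>?T\<^esub> h B"
   unfolding u(2) w(2) presented_mult[OF u(1) w(1)] h[OF uw] h[OF u(1)] h[OF w(1)] TVB_mult[OF vw[OF u(1)] vw[OF w(1)]]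
   by simp
 qed
 have inj: "inj_on h (carrier ?P)"
 proof (rule inj_onI)
  fix A B assume "A \<in> carrier ?P" "B \<in> carrier ?P" and e: "h A = h B"
  then obtain u w where u: "u \<in> words ?X" "A = ?c u" and w: "w \<in> words ?X" "B = ?c w" unfolding presented_carrier by blast
  show "A = B" using e iff[OF u(1) w(1)] unfolding u(2) w(2) h[OF u(1)] h[OF w(1)] by blast
 qed
 have img: "h ` carrier ?P = carrier ?T"
 proof (intro equalityI subsetI)
  fix A assume "A \<in> h ` carrier ?P"
  thus "A \<in> carrier ?T" using hom by (auto simp: hom_def)
 next
  fix A assume "A \<in> carrier ?T"
  then obtain w where w: "w \<in> vwords n" "A = dclass n (word_diagram n w)" unfolding TVB_carrier by blast
  obtain u where u: "u \<in> words ?X" "(w, map letter_of u) \<in> lcong n" using lcong_reduced[OF assms w(1)] by blast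
  have "A = h (?c u)" unfolding w(2) h[OF u(1)] using dclass_word_iff[OF w(1) vw[OF u(1)]] u(2) by blast
  moreover have "?c u \<in> carrier ?P" unfolding presented_carrier by (rule imageI[OF u(1)])
  ultimately show "A \<in> h ` carrier ?P" by blast
 qed
 have one: "h \<one>\<^bsub>?P\<^esub> = \<one>\<^bsub>?T\<^esub>" unfolding presented_one TVB_one using h[of "[]"] by simp
 \<comment> \<open>The group axioms for \<open>TVB n\<close> come from the presented group, of which it is a homomorphic image.\<close>
 have "group (?T \<lparr>carrier := h ` carrier ?P, one := h \<one>\<^bsub>?P\<^esub>\<rparr>)"
  by (rule group.hom_imp_img_group[OF presented_group_group hom])
 hence "group ?T" unfolding img one by simp
 moreover have "gen_class n ` ?X \<subseteq> carrier ?T"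
 proof (rule image_subsetI)
  fix x assume x: "x \<in> ?X"
  have "map letter_of [(x, True)] \<in> vwords n" by (rule vw) (use x in simp)
  thus "gen_class n x \<in> carrier ?T" unfolding gen_class_word[OF assms x] TVB_carrier by (intro imageI) simp
 qed
 moreover have "h \<in> iso ?P ?T" using hom inj img by (simp add: iso_def bij_betw_def)
 moreover have "h (word_cong ?X ?R `` {[(x, True)]}) = gen_class n x" if x: "x \<in> ?X" for x
  using h[of "[(x, True)]"] x by (simp add: pg.cls_def gen_class_word[OF assms x])
 ultimately show ?thesis unfolding has_presentation_def by blast
qed

end
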